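(* Let $M$ be an almost-CR manifold, let $\Omega\subset M$ be open and assume that the distribution $\mathcal{V}_2$ (defined in the context) has constant rank in $\Omega$. If $f\in\mathcal{O}_M(\Omega)$ and $|f|$ attains a maximum at a point $p_0$ of $\Omega$, then $f$ is constant on the leaf of $\mathcal{V}_2$ through $p_0$ in $\Omega$.
   Context: An almost-CR manifold is a smooth real manifold $M$ with a smooth complex subbundle $T^{0,1}M\subset\mathbb{C}TM$ of constant rank $n$ such that $T^{0,1}M\cap\overline{T^{0,1}M}=0$; no formal integrability is required. Let $\mathcal{Z}$ be the sheaf of smooth sections of $T^{0,1}M$, $H_pM=\{\mathrm{Re}\,Z\mid Z\in T^{0,1}_pM\}$, and $\pi_M:TM\to TM/HM$ the projection. $\mathcal{O}_M(\Omega)$ is the space of smooth complex valued functions $f$ on $\Omega$ that are CR, i.e. $Zf=0$ for all $Z\in\mathcal{Z}$. $H^{1,1}_pM$ is the convex hull of $\{Z_p\otimes\bar Z_p\mid Z_p\in T^{0,1}_pM\}$. The vector valued Levi form is the linear extension $\mathcal{L}:H^{1,1}M\to TM/HM$ of $Z_p\otimes\bar Z_p\mapsto-\pi_M(i[Z,\bar Z]_p)$, $Z\in\mathcal{Z}$. Put $[\ker\mathcal{L}]_p=\{\tau\in H^{1,1}_pM\mid\tau\ne0,\ \mathcal{L}(\tau)=0\}$. For $U$ open, $[\ker\mathcal{L}](U)$ is the set of sections $\tau$ over $U$, with $\tau_p\in[\ker\mathcal{L}]_p$ for all $p\in U$, which can be locally written as finite sums $\tau=\sum_{j=1}^rZ_j\otimes\bar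 Z_j$ with $Z_j\in\mathcal{Z}$; then $\sum_{j=1}^r[Z_j,\bar Z_j]=\bar L_0-L_0$ for some $L_0\in\mathcal{Z}$. For a family $S$ of real vector fields, $\mathfrak{L}(S)$ is the formally integrable distribution ($C^\infty$-module closed under brackets) generated by $S$ and its iterated commutators. For a local section $\tau$ of $[\ker\mathcal{L}]$, written locally as $\tau=\sum_{j=1}^rZ_j\otimes\bar Z_j$ with $Z_1,\dots,Z_r\in\mathcal{Z}$, and with $L_0\in\mathcal{Z}$ such that $\sum_{j=1}^r[Z_j,\bar Z_j]=\bar L_0-L_0$, put $\mathcal{V}_2(\tau)=\mathfrak{L}(\mathrm{Re}\,Z_1,\dots,\mathrm{Re}\,Z_r,\mathrm{Im}\,Z_1,\dots,\mathrm{Im}\,Z_r,\mathrm{Re}\,L_0)$ (it depends only on $\tau$ and $\mathcal{Z}$), and $\mathcal{V}_2=\mathfrak{L}\big(\bigcup_{\tau\in[\ker\mathcal{L}]}\mathcal{V}_2(\tau)\big)$ (union over all local sections $\tau$). The leaf of $\mathcal{V}_2$ through $p_0$ in $\Omega$ is the maximal connected integral manifold of $\mathcal{V}_2$ in $\Omega$ containing $p_0$. *)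

theory Defs
  imports "HOL-Analysis.Analysis" "HOL-Library.Function_Algebras"
begin

section \<open>Vector spaces of functions\<close>

instantiation "fun" :: (type, real_vector) real_vector
begin

definition scaleR_fun :: "real \<Rightarrow> ('a \<Rightarrow> 'b) \<Rightarrow> 'a \<Rightarrow> 'b" where
  "scaleR_fun c f = (\<lambda>x. c *\<^sub>R f x)"

instance
  by standard (auto simp: scaleR_fun_def fun_eq_iff algebra_simps)

end

definition scaleC_fun :: "complex \<Rightarrow> ('a \<Rightarrow> complex) \<Rightarrow> 'a \<Rightarrow> complex"  (infixr "*\<^sub>C" 75) where
  "c *\<^sub>C f = (\<lambda>x. c * f x)"

interpretation cvec: vector_space "scaleC_fun :: complex \<Rightarrow> ('a \<Rightarrow> complex) \<Rightarrow> 'a \<Rightarrow> complex"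
  by standard (auto simp: scaleC_fun_def fun_eq_iff algebra_simps)


section \<open>Smooth manifolds\<close>

primrec Ck_on :: "nat \<Rightarrow> 'e::euclidean_space set \<Rightarrow> ('e \<Rightarrow> 'f::real_normed_vector) \<Rightarrow> bool" where
  "Ck_on 0 S f \<longleftrightarrow> continuous_on S f"
| "Ck_on (Suc k) S f \<longleftrightarrow>
     (\<forall>x\<in>S. f differentiable at x) \<and> (\<forall>v. Ck_on k S (\<lambda>x. frechet_derivative f (at x) v))"

definition smooth_on :: "'e::euclidean_space set \<Rightarrow> ('e \<Rightarrow> 'f::real_normed_vector) \<Rightarrow> bool" where
  "smooth_on S f \<longleftrightarrow> open S \<and> (\<forall>k. Ck_on k S f)"

text \<open>A chart is a pair of its domain and its coordinate map. The manifold is the whole type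
  \<open>'m\<close>; the predicate \<open>almost_CR_manifold\<close> below requires its topology to be Hausdorff and
  second countable through the sort of \<open>'m\<close>.\<close>

type_synonym ('m, 'e) chart = "'m set \<times> ('m \<Rightarrow> 'e)"

definition smooth_atlas ::
    "('m::topological_space, 'e::euclidean_space) chart set \<Rightarrow> bool" where
  "smooth_atlas A \<longleftrightarrow>
     (\<Union>(U, \<phi>)\<in>A. U) = UNIV \<and>
     (\<forall>(U, \<phi>)\<in>A. open U \<and> open (\<phi> ` U) \<and> inj_on \<phi> U \<and>
        homeomorphism U (\<phi> ` U) \<phi> (inv_into U \<phi>)) \<and>
     (\<forall>(U, \<phi>)\<in>A. \<forall>(V, \<psi>)\<in>A. smooth_on (\<phi> ` (U \<inter> V)) (\<psi> \<circ> inv_into U \<phi>))"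

definition smooth_fun :: "('m::topological_space, 'e::euclidean_space) chart set \<Rightarrow>
    'm set \<Rightarrow> ('m \<Rightarrow> 'b::real_normed_vector) \<Rightarrow> bool" where
  "smooth_fun A W f \<longleftrightarrow>
     open W \<and> (\<forall>(U, \<phi>)\<in>A. smooth_on (\<phi> ` (W \<inter> U)) (f \<circ> inv_into U \<phi>))"

definition smooth_near :: "('m::topological_space, 'e::euclidean_space) chart set \<Rightarrow>
    'm \<Rightarrow> ('m \<Rightarrow> complex) \<Rightarrow> bool" where
  "smooth_near A p f \<longleftrightarrow> (\<exists>W. p \<in> W \<and> smooth_fun A W f)"


section \<open>Complex tangent vectors and vector fields\<close>

text \<open>An element of the complexified tangent space \<open>\<complex>T\<^sub>pM\<close> is a complex linear
  derivation at \<open>p\<close> on complex functions smooth near \<open>p\<close>. The Leibniz rule forces it to depend on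
  the germ at \<open>p\<close> only (multiply by the indicator function of a neighbourhood of \<open>p\<close>). The value
  \<open>0\<close> at all other functions is a convention that makes equality of derivations extensional.\<close>

type_synonym 'm cvec = "('m \<Rightarrow> complex) \<Rightarrow> complex"
type_synonym 'm cfield = "'m \<Rightarrow> 'm cvec"

definition ctangent ::
    "('m::topological_space, 'e::euclidean_space) chart set \<Rightarrow> 'm \<Rightarrow> 'm cvec set" where
  "ctangent A p = {X.
     (\<forall>f g. smooth_near A p f \<longrightarrow> smooth_near A p g \<longrightarrow>
        X (\<lambda>x. f x + g x) = X f + X g \<and>
        X (\<lambda>x. f x * g x) = f p * X g + g p * X f) \<and>
     (\<forall>c f. smooth_near A p f \<longrightarrow> X (\<lambda>x. c * f x) = c * X f) \<and>
     (\<forall>f. \<not> smooth_near A p f \<longrightarrow> X f = 0)}"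

text \<open>Real tangent vectors are the complex ones that are fixed by \<open>conj_vec\<close>.\<close>

definition conj_vec :: "'m cvec \<Rightarrow> 'm cvec" where
  "conj_vec X = (\<lambda>f. cnj (X (\<lambda>x. cnj (f x))))"

definition Re_vec :: "'m cvec \<Rightarrow> 'm cvec" where
  "Re_vec X = (1/2) *\<^sub>C (X + conj_vec X)"

definition Im_vec :: "'m cvec \<Rightarrow> 'm cvec" where
  "Im_vec X = (1/(2*\<i>)) *\<^sub>C (X - conj_vec X)"

definition smooth_cfield :: "('m::topological_space, 'e::euclidean_space) chart set \<Rightarrow>
    'm set \<Rightarrow> 'm cfield \<Rightarrow> bool" where
  "smooth_cfield A U X \<longleftrightarrow> open U \<and> (\<forall>p\<in>U. X p \<in> ctangent A p) \<and>
     (\<forall>W f. W \<subseteq> U \<longrightarrow> smooth_fun A W f \<longrightarrow> smooth_fun A W (\<lambda>p. X p f))"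

definition lie_bracket :: "('m::topological_space, 'e::euclidean_space) chart set \<Rightarrow>
    'm cfield \<Rightarrow> 'm cfield \<Rightarrow> 'm cfield" where
  "lie_bracket A X Y = (\<lambda>p f.
     if smooth_near A p f then X p (\<lambda>q. Y q f) - Y p (\<lambda>q. X q f) else 0)"


section \<open>Almost-CR manifolds\<close>

text \<open>\<open>T p\<close> is the fibre \<open>T\<^sup>0\<^sup>,\<^sup>1\<^sub>pM\<close>.\<close>

definition almost_CR_manifold ::
    "('m::{t2_space, second_countable_topology}, 'e::euclidean_space) chart set \<Rightarrow>
      nat \<Rightarrow> ('m \<Rightarrow> 'm cvec set) \<Rightarrow> bool" where
  "almost_CR_manifold A n T \<longleftrightarrow> smooth_atlas A \<and>
     (\<forall>p. cvec.subspace (T p) \<and> T p \<subseteq> ctangent A p \<and> cvec.dim (T p) = n) \<and>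
     (\<forall>p. \<exists>U Z. p \<in> U \<and> (\<forall>j<n. smooth_cfield A U (Z j)) \<and> open U \<and>
        (\<forall>q\<in>U. T q = cvec.span ((\<lambda>j. Z j q) ` {..<n}))) \<and>
     (\<forall>p. T p \<inter> conj_vec ` T p = {0})"

definition CR_sections :: "('m::topological_space, 'e::euclidean_space) chart set \<Rightarrow>
    ('m \<Rightarrow> 'm cvec set) \<Rightarrow> 'm set \<Rightarrow> 'm cfield set" where
  "CR_sections A T U = {Z. smooth_cfield A U Z \<and> (\<forall>p\<in>U. Z p \<in> T p)}"

definition CR_functions :: "('m::topological_space, 'e::euclidean_space) chart set \<Rightarrow>
    ('m \<Rightarrow> 'm cvec set) \<Rightarrow> 'm set \<Rightarrow> ('m \<Rightarrow> complex) set" where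
  "CR_functions A T \<Omega> = {f. smooth_fun A \<Omega> f \<and>
     (\<forall>U Z. U \<subseteq> \<Omega> \<longrightarrow> Z \<in> CR_sections A T U \<longrightarrow> (\<forall>p\<in>U. Z p f = 0))}"

definition H_space :: "('m \<Rightarrow> 'm cvec set) \<Rightarrow> 'm \<Rightarrow> 'm cvec set" where
  "H_space T p = Re_vec ` T p"

text \<open>The class in \<open>T\<^sub>pM / H\<^sub>pM\<close> is represented as a coset.\<close>

definition normal_class :: "('m \<Rightarrow> 'm cvec set) \<Rightarrow> 'm \<Rightarrow> 'm cvec \<Rightarrow> 'm cvec set" where
  "normal_class T p X = {X + h |h. h \<in> H_space T p}"


section \<open>The Levi form and its kernel\<close>

text \<open>The tensor product of two spaces of functionals is realised in the space of functions
  of two arguments.\<close>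

type_synonym 'm ctensor = "('m \<Rightarrow> complex) \<Rightarrow> ('m \<Rightarrow> complex) \<Rightarrow> complex"

definition tensor :: "'m cvec \<Rightarrow> 'm cvec \<Rightarrow> 'm ctensor"  (infixl "\<otimes>\<^sub>v" 70) where
  "X \<otimes>\<^sub>v Y = (\<lambda>f g. X f * Y g)"

definition H11 :: "('m \<Rightarrow> 'm cvec set) \<Rightarrow> 'm \<Rightarrow> 'm ctensor set" where
  "H11 T p = convex hull {Z \<otimes>\<^sub>v conj_vec Z |Z. Z \<in> T p}"

text \<open>The value at \<open>\<tau> = \<Sum>\<^sub>j t\<^sub>j (Z\<^sub>j \<otimes> conj Z\<^sub>j)(p)\<close> of the real
  linear extension of \<open>Z\<^sub>p \<otimes> conj Z\<^sub>p \<mapsto> -\<pi>(\<i>[Z, conj Z]\<^sub>p)\<close>, where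
  \<open>\<pi>\<close> is the (linear) projection to \<open>T\<^sub>pM / H\<^sub>pM\<close>. This does not depend on
  the representation of \<open>\<tau>\<close>, because \<open>(Z, W) \<mapsto> \<i>[Z, conj W]\<close> is tensorial modulo
  \<open>T p + conj (T p)\<close>.\<close>

definition levi_form :: "('m::topological_space, 'e::euclidean_space) chart set \<Rightarrow>
    ('m \<Rightarrow> 'm cvec set) \<Rightarrow> 'm \<Rightarrow> 'm ctensor \<Rightarrow> 'm cvec set" where
  "levi_form A T p \<tau> = (THE c. \<exists>(r::nat) t Z U.
     p \<in> U \<and> (\<forall>j<r. Z j \<in> CR_sections A T U) \<and> open U \<and>
     \<tau> = (\<Sum>j<r. t j *\<^sub>R (Z j p \<otimes>\<^sub>v conj_vec (Z j p))) \<and>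
     c = normal_class T p
       (\<Sum>j<r. t j *\<^sub>R (- (\<i> *\<^sub>C lie_bracket A (Z j) (\<lambda>q. conj_vec (Z j q)) p))))"

definition ker_levi :: "('m::topological_space, 'e::euclidean_space) chart set \<Rightarrow>
    ('m \<Rightarrow> 'm cvec set) \<Rightarrow> 'm \<Rightarrow> 'm ctensor set" where
  "ker_levi A T p = {\<tau> \<in> H11 T p. \<tau> \<noteq> 0 \<and> levi_form A T p \<tau> = normal_class T p 0}"

definition represents :: "('m::topological_space, 'e::euclidean_space) chart set \<Rightarrow>
    ('m \<Rightarrow> 'm cvec set) \<Rightarrow> 'm set \<Rightarrow> nat \<Rightarrow> (nat \<Rightarrow> 'm cfield) \<Rightarrow>
    ('m \<Rightarrow> 'm ctensor) \<Rightarrow> bool" where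
  "represents A T V r Z \<tau> \<longleftrightarrow> open V \<and> (\<forall>j<r. Z j \<in> CR_sections A T V) \<and>
     (\<forall>q\<in>V. \<tau> q = (\<Sum>j<r. Z j q \<otimes>\<^sub>v conj_vec (Z j q)))"

definition ker_levi_sections :: "('m::topological_space, 'e::euclidean_space) chart set \<Rightarrow>
    ('m \<Rightarrow> 'm cvec set) \<Rightarrow> 'm set \<Rightarrow> ('m \<Rightarrow> 'm ctensor) set" where
  "ker_levi_sections A T U = {\<tau>. open U \<and> (\<forall>p\<in>U. \<tau> p \<in> ker_levi A T p) \<and>
     (\<forall>p\<in>U. \<exists>V r Z. p \<in> V \<and> V \<subseteq> U \<and> represents A T V r Z \<tau>)}"


section \<open>Distributions\<close>

text \<open>A family of local vector fields is a set of pairs \<open>(U, X)\<close> of an open domain and a field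
  on it; the values of \<open>X\<close> off \<open>U\<close> are irrelevant. The rule \<open>local\<close> covers restriction,
  gluing and independence of the values off the domain.\<close>

inductive_set lie_distribution ::
    "('m::topological_space, 'e::euclidean_space) chart set \<Rightarrow> ('m set \<times> 'm cfield) set \<Rightarrow>
      ('m set \<times> 'm cfield) set"
  for A :: "('m::topological_space, 'e::euclidean_space) chart set"
    and S :: "('m set \<times> 'm cfield) set" where
  gen: "(U, X) \<in> S \<Longrightarrow> (U, X) \<in> lie_distribution A S"
| zero: "open U \<Longrightarrow> (U, \<lambda>p. 0) \<in> lie_distribution A S"
| add: "(U, X) \<in> lie_distribution A S \<Longrightarrow> (U, Y) \<in> lie_distribution A S \<Longrightarrow>
    (U, \<lambda>p. X p + Y p) \<in> lie_distribution A S"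
| scale: "(U, X) \<in> lie_distribution A S \<Longrightarrow> smooth_fun A U (g :: 'm \<Rightarrow> real) \<Longrightarrow>
    (U, \<lambda>p. g p *\<^sub>R X p) \<in> lie_distribution A S"
| bracket: "(U, X) \<in> lie_distribution A S \<Longrightarrow> (U, Y) \<in> lie_distribution A S \<Longrightarrow>
    (U, lie_bracket A X Y) \<in> lie_distribution A S"
| local: "open U \<Longrightarrow>
    \<forall>p\<in>U. \<exists>V X'. p \<in> V \<and> (V, X') \<in> lie_distribution A S \<and> (\<forall>q\<in>U \<inter> V. X q = X' q) \<Longrightarrow>
    (U, X) \<in> lie_distribution A S"

text \<open>The generators range over all local representations of \<open>\<tau>\<close>.\<close>

definition V2_of :: "('m::topological_space, 'e::euclidean_space) chart set \<Rightarrow>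
    ('m \<Rightarrow> 'm cvec set) \<Rightarrow> 'm set \<Rightarrow> ('m \<Rightarrow> 'm ctensor) \<Rightarrow> ('m set \<times> 'm cfield) set" where
  "V2_of A T U \<tau> = lie_distribution A {(V, Y). \<exists>r Z L0.
     V \<subseteq> U \<and> represents A T V r Z \<tau> \<and> L0 \<in> CR_sections A T V \<and>
     (\<forall>q\<in>V. (\<Sum>j<r. lie_bracket A (Z j) (\<lambda>x. conj_vec (Z j x)) q) = conj_vec (L0 q) - L0 q) \<and>
     ((\<exists>j<r. Y = (\<lambda>q. Re_vec (Z j q))) \<or> (\<exists>j<r. Y = (\<lambda>q. Im_vec (Z j q))) \<or>
      Y = (\<lambda>q. Re_vec (L0 q)))}"

definition V2 :: "('m::topological_space, 'e::euclidean_space) chart set \<Rightarrow>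
    ('m \<Rightarrow> 'm cvec set) \<Rightarrow> ('m set \<times> 'm cfield) set" where
  "V2 A T = lie_distribution A (\<Union>U. \<Union>\<tau>\<in>ker_levi_sections A T U. V2_of A T U \<tau>)"

definition fibre :: "('m set \<times> 'm cfield) set \<Rightarrow> 'm \<Rightarrow> 'm cvec set" where
  "fibre D p = {X p |U X. (U, X) \<in> D \<and> p \<in> U}"

definition constant_rank_on :: "('m set \<times> 'm cfield) set \<Rightarrow> 'm set \<Rightarrow> bool" where
  "constant_rank_on D \<Omega> \<longleftrightarrow> (\<exists>d. \<forall>p\<in>\<Omega>. dim (fibre D p) = d)"


section \<open>Integral manifolds and leaves\<close>

definition smooth_map_into :: "('m::topological_space, 'e::euclidean_space) chart set \<Rightarrow>
    'e set \<Rightarrow> ('e \<Rightarrow> 'm) \<Rightarrow> bool" where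
  "smooth_map_into A G \<psi> \<longleftrightarrow> open G \<and> continuous_on G \<psi> \<and>
     (\<forall>(U, \<phi>)\<in>A. smooth_on (G \<inter> \<psi> -` U) (\<phi> \<circ> \<psi>))"

text \<open>The differential of \<open>\<psi>\<close> at \<open>x\<close>, applied to \<open>v\<close>.\<close>

definition pushforward :: "('m::topological_space, 'e::euclidean_space) chart set \<Rightarrow>
    ('e \<Rightarrow> 'm) \<Rightarrow> 'e \<Rightarrow> 'e \<Rightarrow> 'm cvec" where
  "pushforward A \<psi> x v = (\<lambda>f. if smooth_near A (\<psi> x) f
     then vector_derivative (\<lambda>t::real. f (\<psi> (x + t *\<^sub>R v))) (at 0) else 0)"

text \<open>A connected integral manifold \<open>N\<close> of \<open>D\<close>: an immersed submanifold, that is, a set with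
  its own topology \<open>\<T>\<close> (in general finer than the one induced by \<open>M\<close>) and local
  parametrisations that are immersions, whose tangent spaces are the fibres of \<open>D\<close>.
  The parameter domains are open subsets \<open>G \<inter> E\<close> of linear subspaces \<open>E\<close> of the model space,
  since the dimension of \<open>N\<close> is not a type; a smooth map on \<open>G \<inter> E\<close> extends smoothly to an open
  set of the model space by composition with the orthogonal projection. Two such parametrisations
  are automatically smoothly compatible, because they are immersions into \<open>M\<close> and homeomorphisms
  onto \<open>\<T>\<close>-open sets.\<close>

definition connected_integral_manifold ::
    "('m::topological_space, 'e::euclidean_space) chart set \<Rightarrow>
      ('m set \<times> 'm cfield) set \<Rightarrow> 'm set \<Rightarrow> bool" where
  "connected_integral_manifold A D N \<longleftrightarrow> (\<exists>\<T>. topspace \<T> = N \<and>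
     Hausdorff_space \<T> \<and> second_countable \<T> \<and> connected_space \<T> \<and>
     (\<forall>p\<in>N. \<exists>E G \<psi>. subspace E \<and> smooth_map_into A G \<psi> \<and> p \<in> \<psi> ` (G \<inter> E) \<and>
        openin \<T> (\<psi> ` (G \<inter> E)) \<and>
        homeomorphic_map (top_of_set (G \<inter> E)) (subtopology \<T> (\<psi> ` (G \<inter> E))) \<psi> \<and>
        (\<forall>x\<in>G \<inter> E. inj_on (pushforward A \<psi> x) E \<and>
           pushforward A \<psi> x ` E = fibre D (\<psi> x))))"

definition is_leaf :: "('m::topological_space, 'e::euclidean_space) chart set \<Rightarrow>
    ('m set \<times> 'm cfield) set \<Rightarrow> 'm set \<Rightarrow> 'm \<Rightarrow> 'm set \<Rightarrow> bool" where
  "is_leaf A D \<Omega> p L \<longleftrightarrow>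
     connected_integral_manifold A D L \<and> L \<subseteq> \<Omega> \<and> p \<in> L \<and>
     (\<forall>N. connected_integral_manifold A D N \<and> N \<subseteq> \<Omega> \<and> L \<subseteq> N \<longrightarrow> N = L)"

end

theory Submission
  imports Defs
begin

text \<open>
  The parametrisation of a leaf is extended to an open set of the model space, constantly in the
  directions transversal to the leaf, and the fields \<open>X\<^sub>j = Re Z\<^sub>j\<close>, \<open>Y\<^sub>j = Im Z\<^sub>j\<close>, \<open>X\<^sub>0 = Re L\<^sub>0\<close> are lifted to
  it. With \<open>f\<close> normalised to \<open>f p\<^sub>0 = 1\<close> and \<open>|f| \<le> 1\<close>, the lifted function satisfies \<open>(X\<^sub>j + \<i> Y\<^sub>j) f = 0\<close> and
  \<open>\<Sum>\<^sub>j (X\<^sub>j\<^sup>2 + Y\<^sub>j\<^sup>2) f = X\<^sub>0 f\<close>, and the lifted fields, together with the transversal constant fields,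
  generate all directions under brackets.

  Let \<open>S = {f = 1}\<close>. As \<open>Re f - 1\<close> solves a degenerate elliptic equation, Hopf's lemma shows that
  \<open>X\<^sub>j\<close> and \<open>Y\<^sub>j\<close> are orthogonal to the exterior normals of \<open>S\<close>, and a doubling of variables shows that
  \<open>- X\<^sub>0\<close> does not point outwards, so that the flows of \<open>\<plusminus> X\<^sub>j\<close>, \<open>\<plusminus> Y\<^sub>j\<close>, \<open>- X\<^sub>0\<close> preserve \<open>S\<close>. If
  \<open>(X + \<i> Y) f = 0\<close>, then \<open>X\<close> annihilates the indicator function of \<open>S\<close> weakly, hence is tangent
  to the complement \<open>C\<close> of the interior of \<open>S\<close>; this applies to \<open>X\<^sub>j\<close>, \<open>Y\<^sub>j\<close> and also to \<open>X\<^sub>0\<close>, because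
  \<open>X\<^sub>0 + \<i> \<Sum>\<^sub>j [X\<^sub>j, Y\<^sub>j]\<close> annihilates \<open>f\<close>. If \<open>S \<inter> C\<close> were not empty, it would be a set without
  interior points that is invariant under the semiflows of bracket generating fields, contradicting
  Krener's theorem. Thus \<open>S\<close> is open, and its trace on the leaf is open and closed.
\<close>

section \<open>Smooth maps and vector fields\<close>

text \<open>Why two sets are needed. A sum of squares with drift propagates a maximum along the
  drift in one time direction only, as for the heat equation. Thus \<open>S\<close> is invariant
  under semiflows, and the orbit theorem, which uses flows in both directions, is out of reach.
  Krener's theorem works with positive times, but applied to \<open>S\<close> it would only give
  interior points, not openness. Intersecting with \<open>C\<close> removes these points, so that a
  contradiction arises once \<open>C\<close> is invariant in the same time direction. That second
  invariance is no maximum principle: it rests on f being complex valued, so that every field in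
  question has a conjugate field. The drift also resists Hopf's barrier. Although the
  \<open>X\<^sub>j\<close> and \<open>Y\<^sub>j\<close> are tangent to \<open>S\<close>, their
  squares applied to the barrier need not vanish at the contact point and may outweigh the drift.
  The map \<open>theta\<close> carries the barrier along these fields and thereby removes the second
  order terms. Extending the parametrisation transversally lets all analysis take place in open sets
  of a single Euclidean space; the constant transversal fields annihilate the lifted function and
  supply the directions that the leaf lacks.\<close>

abbreviation fder where "fder f x \<equiv> frechet_derivative f (at x)"

lemma fder_works: "f differentiable at x \<Longrightarrow> (f has_derivative fder f x) (at x)"
  by (simp add: frechet_derivative_works)

lemma fder_eq: "(f has_derivative f') (at x) \<Longrightarrow> fder f x = f'"
  using frechet_derivative_at by metis

lemma fder_cong:
  assumes "open S" "x \<in> S" "\<And>y. y \<in> S \<Longrightarrow> f y = g y"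
  shows "fder f x = fder g x"
proof -
  have "(f has_derivative f') (at x) \<longleftrightarrow> (g has_derivative f') (at x)" for f'
    using assms has_derivative_transform_within_open[of f f' x UNIV S g]
      has_derivative_transform_within_open[of g f' x UNIV S f] by auto
  then show ?thesis unfolding frechet_derivative_def by simp
qed

lemma differentiable_cong_open:
  assumes "open S" "x \<in> S" "\<And>y. y \<in> S \<Longrightarrow> f y = g y" "f differentiable at x"
  shows "g differentiable at x"
  using assms has_derivative_transform_within_open[of f _ x UNIV S g]
  unfolding differentiable_def by blast

section \<open>Calculus of functions of class C^k through iterated directional derivatives\<close>

lemma Ck_on_imp_continuous_on: "Ck_on k S f \<Longrightarrow> continuous_on S f"
  by (cases k) (auto intro!: continuous_at_imp_continuous_on differentiable_imp_continuous_within)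

lemma Ck_on_Suc_imp: "Ck_on (Suc k) S f \<Longrightarrow> Ck_on k S f"
proof (induction k arbitrary: f)
  case 0
  then show ?case using Ck_on_imp_continuous_on by fastforce
qed auto

lemma Ck_on_cong:
  assumes "open S" "\<And>x. x \<in> S \<Longrightarrow> f x = g x" "Ck_on k S f"
  shows "Ck_on k S g"
  using assms(2,3)
proof (induction k arbitrary: f g)
  case 0
  then show ?case using continuous_on_cong by fastforce
next
  case (Suc k)
  have "fder f x = fder g x" if "x \<in> S" for x
    using fder_cong[OF assms(1) that] Suc.prems(1) by blast
  then have "Ck_on k S (\<lambda>x. fder g x v)" for v
    using Suc.IH[of "\<lambda>x. fder f x v" "\<lambda>x. fder g x v"] Suc.prems by auto
  moreover have "g differentiable at x" if "x \<in> S" for x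
    using differentiable_cong_open[OF assms(1) that] Suc.prems that by (metis Ck_on.simps(2))
  ultimately show ?case by auto
qed

lemma Ck_on_subset: "Ck_on k S f \<Longrightarrow> T \<subseteq> S \<Longrightarrow> Ck_on k T f"
  by (induction k arbitrary: f) (auto intro: continuous_on_subset)

lemma Ck_on_local:
  assumes "\<And>x. x \<in> S \<Longrightarrow> \<exists>N. open N \<and> x \<in> N \<and> Ck_on k N f"
  shows "Ck_on k S f"
  using assms
proof (induction k arbitrary: f)
  case 0
  then have "isCont f x" if "x \<in> S" for x
    using that by (metis Ck_on.simps(1) continuous_on_eq_continuous_at)
  then show ?case by (simp add: continuous_at_imp_continuous_on)
next
  case (Suc k)
  then have "f differentiable at x" if "x \<in> S" for x using that by (metis Ck_on.simps(2))
  moreover have "Ck_on k S (\<lambda>x. fder f x v)" for v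
    using Suc.prems by (intro Suc.IH) (metis Ck_on.simps(2))
  ultimately show ?case by auto
qed

lemma Ck_on_const [simp]: "Ck_on k S (\<lambda>x. c)"
  by (induction k arbitrary: c) auto

lemma Ck_on_linear:
  assumes "bounded_linear h" "open S" "Ck_on k S f"
  shows "Ck_on k S (\<lambda>x. h (f x))"
  using assms(3)
proof (induction k arbitrary: f)
  case 0
  then show ?case using bounded_linear.continuous_on[OF assms(1)] by auto
next
  case (Suc k)
  have d: "((\<lambda>x. h (f x)) has_derivative (\<lambda>v. h (fder f x v))) (at x)" if "x \<in> S" for x
    using bounded_linear.has_derivative[OF assms(1) fder_works[of f x]] Suc.prems that by auto
  have "Ck_on k S (\<lambda>x. fder (\<lambda>x. h (f x)) x v)" for v
    by (rule Ck_on_cong[OF assms(2) _ Suc.IH[of "\<lambda>x. fder f x v"]]) (use Suc.prems fder_eq[OF d] in auto)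
  then show ?case using differentiableI[OF d] by simp
qed

lemma Ck_on_add:
  assumes "open S" "Ck_on k S f" "Ck_on k S g"
  shows "Ck_on k S (\<lambda>x. f x + g x)"
  using assms(2,3)
proof (induction k arbitrary: f g)
  case (Suc k)
  have d: "((\<lambda>x. f x + g x) has_derivative (\<lambda>v. fder f x v + fder g x v)) (at x)" if "x \<in> S" for x
    using has_derivative_add[OF fder_works[of f x] fder_works[of g x]] Suc.prems that by auto
  have "Ck_on k S (\<lambda>x. fder (\<lambda>x. f x + g x) x v)" for v
    by (rule Ck_on_cong[OF assms(1) _ Suc.IH[of "\<lambda>x. fder f x v" "\<lambda>x. fder g x v"]])
      (use Suc.prems fder_eq[OF d] in auto)
  then show ?case using differentiableI[OF d] by simp
qed (auto intro: continuous_intros)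

lemma Ck_on_bilinear:
  assumes "bounded_bilinear h" "open S" "Ck_on k S f" "Ck_on k S g"
  shows "Ck_on k S (\<lambda>x. h (f x) (g x))"
  using assms(3,4)
proof (induction k arbitrary: f g)
  case 0
  then show ?case using bounded_bilinear.continuous_on[OF assms(1)] by auto
next
  case (Suc k)
  have d: "((\<lambda>x. h (f x) (g x)) has_derivative (\<lambda>v. h (f x) (fder g x v) + h (fder f x v) (g x))) (at x)"
    if "x \<in> S" for x
    using bounded_bilinear.FDERIV[OF assms(1) fder_works[of f x] fder_works[of g x]] Suc.prems that by auto
  have "Ck_on k S (\<lambda>x. h (f x) (fder g x v) + h (fder f x v) (g x))" for v
    using Suc.prems Ck_on_Suc_imp[OF Suc.prems(1)] Ck_on_Suc_imp[OF Suc.prems(2)]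
    by (intro Ck_on_add[OF assms(2)] Suc.IH) auto
  then have "Ck_on k S (\<lambda>x. fder (\<lambda>x. h (f x) (g x)) x v)" for v
    by (rule Ck_on_cong[OF assms(2), rotated]) (use fder_eq[OF d] in auto)
  then show ?case using differentiableI[OF d] by simp
qed

lemma Ck_on_sum:
  assumes "open S" "\<And>i. i \<in> I \<Longrightarrow> Ck_on k S (f i)"
  shows "Ck_on k S (\<lambda>x. \<Sum>i\<in>I. f i x)"
  using assms(2) by (induction I rule: infinite_finite_induct) (auto intro: Ck_on_add[OF assms(1)])

lemma Ck_on_id: "Ck_on k S (\<lambda>x. x)"
proof (cases k)
  case (Suc l)
  have "fder (\<lambda>x::'a. x) x v = v" for x v by (simp add: fder_eq)
  then show ?thesis using Suc by auto
qed auto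

lemma linear_euclidean_expand:
  fixes h :: "'e::euclidean_space \<Rightarrow> 'b::real_vector"
  assumes "linear h"
  shows "h v = (\<Sum>b\<in>Basis. (v \<bullet> b) *\<^sub>R h b)"
  by (metis (no_types, lifting) assms euclidean_representation linear_scale linear_sum sum.cong)

lemma fder_expand:
  fixes f :: "'e::euclidean_space \<Rightarrow> 'b::real_normed_vector"
  assumes "f differentiable at x"
  shows "fder f x v = (\<Sum>b\<in>Basis. (v \<bullet> b) *\<^sub>R fder f x b)"
  using linear_euclidean_expand linear_frechet_derivative[OF assms] by blast

text \<open>\<open>Ck_on\<close> only speaks of derivatives in fixed directions, whereas the chain
  rule differentiates \<open>f\<close> in the variable direction \<open>fder g x v\<close>.
  Expanding that direction in the basis leaves scalar coefficients times derivatives of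
  \<open>f\<close> in fixed directions, to which the induction hypothesis applies.\<close>

lemma Ck_on_compose:
  fixes f :: "'e::euclidean_space \<Rightarrow> 'b::real_normed_vector" and g :: "'d::euclidean_space \<Rightarrow> 'e"
  assumes "open S" "open T" "Ck_on k T f" "Ck_on k S g" "g ` S \<subseteq> T"
  shows "Ck_on k S (\<lambda>x. f (g x))"
  using assms(3,4)
proof (induction k arbitrary: f)
  case 0
  then show ?case using continuous_on_compose2 assms(5) by auto
next
  case (Suc k)
  have d: "((\<lambda>x. f (g x)) has_derivative (\<lambda>v. fder f (g x) (fder g x v))) (at x)" if "x \<in> S" for x
    using has_derivative_compose[OF fder_works[of g x] fder_works[of f "g x"]] Suc.prems that assms(5) by auto
  have "Ck_on k S (\<lambda>x. \<Sum>b\<in>Basis. (fder g x v \<bullet> b) *\<^sub>R fder f (g x) b)" for v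
    using Suc.prems Ck_on_Suc_imp[OF Suc.prems(2)]
    by (intro Ck_on_sum[OF assms(1)] Ck_on_bilinear[OF bounded_bilinear_scaleR assms(1)] Suc.IH
        Ck_on_linear[OF bounded_linear_inner_left assms(1)]) auto
  then have "Ck_on k S (\<lambda>x. fder (\<lambda>x. f (g x)) x v)" for v
  proof (rule Ck_on_cong[OF assms(1), rotated])
    fix x assume x: "x \<in> S"
    then have "f differentiable at (g x)" using Suc.prems assms(5) by auto
    then show "(\<Sum>b\<in>Basis. (fder g x v \<bullet> b) *\<^sub>R fder f (g x) b) = fder (\<lambda>x. f (g x)) x v"
      using fder_eq[OF d[OF x]] fder_expand by metis
  qed
  then show ?case using differentiableI[OF d] by simp
qed

lemma smooth_onD:
  assumes "smooth_on S f"
  shows "open S" "Ck_on k S f" "continuous_on S f" "x \<in> S \<Longrightarrow> f differentiable at x"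
    "x \<in> S \<Longrightarrow> (f has_derivative fder f x) (at x)"
proof -
  have o: "open S" and k: "\<forall>k. Ck_on k S f" using assms unfolding smooth_on_def by blast+
  show "open S" "Ck_on k S f" using o k by blast+
  show "continuous_on S f" using spec[OF k, of 0] by simp
  show d: "x \<in> S \<Longrightarrow> f differentiable at x" using spec[OF k, of 1] by simp
  then show "x \<in> S \<Longrightarrow> (f has_derivative fder f x) (at x)" using fder_works by blast
qed

lemma smooth_on_cong: "smooth_on S f \<Longrightarrow> (\<And>x. x \<in> S \<Longrightarrow> f x = g x) \<Longrightarrow> smooth_on S g"
  unfolding smooth_on_def using Ck_on_cong by blast

lemma smooth_on_subset: "smooth_on S f \<Longrightarrow> open T \<Longrightarrow> T \<subseteq> S \<Longrightarrow> smooth_on T f"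
  unfolding smooth_on_def using Ck_on_subset by blast

lemma smooth_on_local:
  assumes "open S" "\<And>x. x \<in> S \<Longrightarrow> \<exists>N. x \<in> N \<and> smooth_on N f"
  shows "smooth_on S f"
proof -
  have "Ck_on k S f" for k
  proof (rule Ck_on_local)
    fix x assume "x \<in> S"
    then obtain N where "x \<in> N" "smooth_on N f" using assms(2) by meson
    then show "\<exists>N. open N \<and> x \<in> N \<and> Ck_on k N f"
      using smooth_onD(1)[of N f] smooth_onD(2)[of N f k] by (intro exI[of _ N]) simp
  qed
  then show ?thesis using assms(1) by (simp add: smooth_on_def)
qed

lemma smooth_on_const: "open S \<Longrightarrow> smooth_on S (\<lambda>x. c)"
  by (simp add: smooth_on_def)

lemma smooth_on_id: "open S \<Longrightarrow> smooth_on S (\<lambda>x. x)"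
  by (simp add: smooth_on_def Ck_on_id)

lemma smooth_on_add: "smooth_on S f \<Longrightarrow> smooth_on S g \<Longrightarrow> smooth_on S (\<lambda>x. f x + g x)"
  by (simp add: smooth_on_def Ck_on_add)

lemma smooth_on_linear: "bounded_linear h \<Longrightarrow> smooth_on S f \<Longrightarrow> smooth_on S (\<lambda>x. h (f x))"
  by (simp add: smooth_on_def Ck_on_linear)

lemma smooth_on_minus: "smooth_on S f \<Longrightarrow> smooth_on S (\<lambda>x. - f x)"
  by (rule smooth_on_linear[OF bounded_linear_minus[OF bounded_linear_ident]])

lemma smooth_on_diff: "smooth_on S f \<Longrightarrow> smooth_on S g \<Longrightarrow> smooth_on S (\<lambda>x. f x - g x)"
  using smooth_on_add[OF _ smooth_on_minus] by fastforce

lemma smooth_on_bilinear: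
  "bounded_bilinear h \<Longrightarrow> smooth_on S f \<Longrightarrow> smooth_on S g \<Longrightarrow> smooth_on S (\<lambda>x. h (f x) (g x))"
  by (simp add: smooth_on_def Ck_on_bilinear)

lemmas smooth_on_scaleR = smooth_on_bilinear[OF bounded_bilinear_scaleR]
  and smooth_on_mult = smooth_on_bilinear[OF bounded_bilinear_mult]
  and smooth_on_inner = smooth_on_bilinear[OF bounded_bilinear_inner]

lemma smooth_on_sum:
  "open S \<Longrightarrow> (\<And>i. i \<in> I \<Longrightarrow> smooth_on S (f i)) \<Longrightarrow> smooth_on S (\<lambda>x. \<Sum>i\<in>I. f i x)"
  by (simp add: smooth_on_def Ck_on_sum)

lemma smooth_on_compose:
  fixes f :: "'e::euclidean_space \<Rightarrow> 'b::real_normed_vector" and g :: "'d::euclidean_space \<Rightarrow> 'e"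
  assumes "smooth_on T f" "smooth_on S g" "g ` S \<subseteq> T"
  shows "smooth_on S (\<lambda>x. f (g x))"
  using assms Ck_on_compose[of S T _ f g] unfolding smooth_on_def by simp

lemma smooth_on_fder:
  assumes "smooth_on S f"
  shows "smooth_on S (\<lambda>x. fder f x v)"
proof -
  have "Ck_on k S (\<lambda>x. fder f x v)" for k
    using smooth_onD(2)[OF assms, of "Suc k"] by simp
  then show ?thesis using smooth_onD(1)[OF assms] by (simp add: smooth_on_def)
qed

lemma smooth_on_fder_field:
  fixes f :: "'e::euclidean_space \<Rightarrow> 'b::real_normed_vector"
  assumes "smooth_on S f" "smooth_on S Y"
  shows "smooth_on S (\<lambda>x. fder f x (Y x))"
proof -
  have "smooth_on S (\<lambda>x. \<Sum>b\<in>Basis. (Y x \<bullet> b) *\<^sub>R fder f x b)"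
    using assms smooth_onD(1)[OF assms(1)]
    by (intro smooth_on_sum smooth_on_scaleR smooth_on_fder smooth_on_linear[OF bounded_linear_inner_left])
  then show ?thesis
    by (rule smooth_on_cong) (metis assms(1) fder_expand smooth_onD(4))
qed

lemma smooth_on_componentwise:
  fixes f :: "'d::euclidean_space \<Rightarrow> 'e::euclidean_space"
  assumes "open S" "\<And>b. b \<in> Basis \<Longrightarrow> smooth_on S (\<lambda>x. f x \<bullet> b)"
  shows "smooth_on S f"
proof -
  have "smooth_on S (\<lambda>x. \<Sum>b\<in>Basis. (f x \<bullet> b) *\<^sub>R b)"
    using assms by (intro smooth_on_sum smooth_on_scaleR smooth_on_const)
  then show ?thesis by (rule smooth_on_cong) (simp add: euclidean_representation)
qed

section \<open>Symmetry of the second derivative\<close>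

lemma line_derivative:
  assumes "f differentiable at (p + s *\<^sub>R v)"
  shows "((\<lambda>s. f (p + s *\<^sub>R v)) has_vector_derivative fder f (p + s *\<^sub>R v) v) (at s within T)"
proof -
  have "((\<lambda>s. p + s *\<^sub>R v) has_vector_derivative v) (at s within T)"
    by (auto intro!: derivative_eq_intros)
  from vector_derivative_diff_chain_within[OF this, of f "fder f (p + s *\<^sub>R v)"]
  show ?thesis using fder_works[OF assms] by (simp add: has_derivative_at_withinI o_def)
qed

text \<open>Both mixed derivatives are limits of the second difference of \<open>f\<close> over a parallelogram.\<close>

lemma fder_commute_real:
  fixes f :: "'e::euclidean_space \<Rightarrow> real"
  assumes f: "smooth_on S f" and x: "x \<in> S"
  shows "fder (\<lambda>y. fder f y v) x w = fder (\<lambda>y. fder f y w) x v"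
proof (rule ccontr)
  assume ne: "\<not> ?thesis"
  define A where "A u1 u2 y = fder (\<lambda>y. fder f y u1) y u2" for u1 u2 y
  have cont: "isCont (A u1 u2) x" for u1 u2
    using smooth_onD(3)[OF smooth_on_fder[OF smooth_on_fder[OF f]]] smooth_onD(1)[OF f] x
    unfolding A_def by (simp add: continuous_on_eq_continuous_at)
  define e where "e = \<bar>A v w x - A w v x\<bar> / 2"
  have "e > 0" using ne by (auto simp: e_def A_def)
  obtain r1 where r1: "r1 > 0" "\<And>y. dist y x < r1 \<Longrightarrow> dist (A v w y) (A v w x) < e"
    using cont[of v w] \<open>e > 0\<close> unfolding continuous_at_eps_delta by blast
  obtain r2 where r2: "r2 > 0" "\<And>y. dist y x < r2 \<Longrightarrow> dist (A w v y) (A w v x) < e"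
    using cont[of w v] \<open>e > 0\<close> unfolding continuous_at_eps_delta by blast
  obtain r3 where r3: "r3 > 0" "ball x r3 \<subseteq> S"
    using smooth_onD(1)[OF f] x open_contains_ball by blast
  define r where "r = min r1 (min r2 r3)"
  have r: "r > 0" using r1 r2 r3 by (auto simp: r_def)
  define c where "c = norm v + norm w + 1"
  \<comment> \<open>With this step size the whole parallelogram stays within distance
    \<open>r / 2\<close> of \<open>x\<close>.\<close>
  define h where "h = r / (2 * c)"
  have pos: "0 < c" unfolding c_def by (smt (verit) norm_ge_zero)
  have h: "h > 0" using r pos by (simp add: h_def)
  have near: "dist (x + s *\<^sub>R u1 + t *\<^sub>R u2) x < r"
    if "0 \<le> s" "s \<le> h" "0 \<le> t" "t \<le> h" "{u1,u2} = {v,w}" for s t u1 u2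
  proof -
    have n: "norm u1 + norm u2 < c"
      using that(5) by (auto simp: doubleton_eq_iff c_def)
    have "dist (x + s *\<^sub>R u1 + t *\<^sub>R u2) x \<le> s * norm u1 + t * norm u2"
      using norm_triangle_ineq[of "s *\<^sub>R u1" "t *\<^sub>R u2"] that by (simp add: dist_norm add.assoc)
    also have "\<dots> \<le> h * norm u1 + h * norm u2"
      using that by (intro add_mono mult_right_mono) auto
    also have "\<dots> = h * (norm u1 + norm u2)" by (simp add: algebra_simps)
    also have "\<dots> \<le> h * c" using n h by simp
    also have "\<dots> = r / 2" using pos by (simp add: h_def)
    finally show ?thesis using r by simp
  qed
  have diff: "f differentiable at y" "(\<lambda>y. fder f y u) differentiable at y" if "dist y x < r" for y u
    using that r3 smooth_onD(4)[OF f] smooth_onD(4)[OF smooth_on_fder[OF f]]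
    by (auto simp: r_def dist_commute subset_iff)
  \<comment> \<open>The mean value theorem is used twice, for \<open>g\<close> in direction
    \<open>u1\<close> and then for \<open>k\<close> in direction \<open>u2\<close>. The second
    difference is symmetric in \<open>u1\<close> and \<open>u2\<close>, so both orders of
    differentiation are compared with the same number.\<close>
  have key: "\<exists>y. dist y x < r \<and> f (x + h *\<^sub>R u1 + h *\<^sub>R u2) - f (x + h *\<^sub>R u1) - f (x + h *\<^sub>R u2) + f x = h * h * A u1 u2 y"
    if u: "{u1,u2} = {v,w}" for u1 u2
  proof -
    define g where "g s = f (x + h *\<^sub>R u2 + s *\<^sub>R u1) - f (x + s *\<^sub>R u1)" for s
    have dg: "(g has_real_derivative fder f (x + h *\<^sub>R u2 + s *\<^sub>R u1) u1 - fder f (x + s *\<^sub>R u1) u1) (at s)"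
      if "0 \<le> s" "s \<le> h" for s
    proof -
      have 1: "dist (x + h *\<^sub>R u2 + s *\<^sub>R u1) x < r"
        using near[of s h u1 u2] that u h by (simp add: algebra_simps)
      have 2: "dist (x + s *\<^sub>R u1) x < r" using near[of s 0 u1 u2] that u h by simp
      show ?thesis unfolding g_def has_real_derivative_iff_has_vector_derivative
        by (intro has_vector_derivative_diff line_derivative diff(1) 1 2)
    qed
    obtain s where s: "0 < s" "s < h" "g h - g 0 = (h - 0) * (fder f (x + h *\<^sub>R u2 + s *\<^sub>R u1) u1 - fder f (x + s *\<^sub>R u1) u1)"
      using MVT2[OF h, of g "\<lambda>s. fder f (x + h *\<^sub>R u2 + s *\<^sub>R u1) u1 - fder f (x + s *\<^sub>R u1) u1"] dg by metis
    define k where "k t = fder f (x + s *\<^sub>R u1 + t *\<^sub>R u2) u1" for t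
    have dk: "(k has_real_derivative A u1 u2 (x + s *\<^sub>R u1 + t *\<^sub>R u2)) (at t)" if "0 \<le> t" "t \<le> h" for t
      using line_derivative[of "\<lambda>y. fder f y u1" "x + s *\<^sub>R u1" t u2 UNIV]
        diff(2)[OF near[of s t u1 u2]] that s u
      unfolding has_real_derivative_iff_has_vector_derivative k_def A_def by simp
    obtain t where t: "0 < t" "t < h" "k h - k 0 = (h - 0) * A u1 u2 (x + s *\<^sub>R u1 + t *\<^sub>R u2)"
      using MVT2[OF h, of k "\<lambda>t. A u1 u2 (x + s *\<^sub>R u1 + t *\<^sub>R u2)"] dk by metis
    have "k h = fder f (x + h *\<^sub>R u2 + s *\<^sub>R u1) u1" "k 0 = fder f (x + s *\<^sub>R u1) u1"
      by (simp_all add: k_def algebra_simps)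
    then have "g h - g 0 = h * h * A u1 u2 (x + s *\<^sub>R u1 + t *\<^sub>R u2)" using s t by simp
    moreover have "g h - g 0 = f (x + h *\<^sub>R u1 + h *\<^sub>R u2) - f (x + h *\<^sub>R u1) - f (x + h *\<^sub>R u2) + f x"
      by (simp add: g_def algebra_simps)
    ultimately show ?thesis using near[of s t u1 u2] s t u by auto
  qed
  obtain y z where "dist y x < r" "dist z x < r" "h * h * A v w y = h * h * A w v z"
    using key[of v w] key[of w v] by (auto simp: insert_commute algebra_simps)
  then have "A v w y = A w v z" "dist (A v w y) (A v w x) < e" "dist (A w v z) (A w v x) < e"
    using h r1(2)[of y] r2(2)[of z] by (auto simp: r_def)
  then show False unfolding dist_real_def e_def by (smt (verit) field_sum_of_halves)
qed

lemma fder_linear: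
  assumes "bounded_linear h" "f differentiable at x"
  shows "fder (\<lambda>y. h (f y)) x v = h (fder f x v)"
  using fder_eq[OF bounded_linear.has_derivative[OF assms(1) fder_works[OF assms(2)]]] by simp

lemma fder_commute:
  fixes f :: "'e::euclidean_space \<Rightarrow> 'b::euclidean_space"
  assumes f: "smooth_on S f" and x: "x \<in> S"
  shows "fder (\<lambda>y. fder f y v) x w = fder (\<lambda>y. fder f y w) x v"
proof (rule euclidean_eqI)
  fix b :: 'b assume "b \<in> Basis"
  let ?f = "\<lambda>y. f y \<bullet> b"
  have s: "smooth_on S ?f" by (rule smooth_on_linear[OF bounded_linear_inner_left f])
  have "fder (\<lambda>y. fder f y v) x w \<bullet> b = fder (\<lambda>y. fder ?f y v) x w" for v w
  proof -
    have "fder (\<lambda>y. fder ?f y v) x = fder (\<lambda>y. fder f y v \<bullet> b) x"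
      by (rule fder_cong[OF smooth_onD(1)[OF f] x])
        (simp add: fder_linear[OF bounded_linear_inner_left] smooth_onD(4)[OF f])
    then show ?thesis
      by (simp add: fder_linear[OF bounded_linear_inner_left] smooth_onD(4)[OF smooth_on_fder[OF f] x])
  qed
  then show "fder (\<lambda>y. fder f y v) x w \<bullet> b = fder (\<lambda>y. fder f y w) x v \<bullet> b"
    using fder_commute_real[OF s x] by simp
qed

section \<open>Iterated derivatives along vector fields and the Lie bracket\<close>

lemma fder_add: "f differentiable at x \<Longrightarrow> g differentiable at x \<Longrightarrow>
    fder (\<lambda>y. f y + g y) x v = fder f x v + fder g x v"
  using fder_eq[OF has_derivative_add[OF fder_works[of f] fder_works[of g]]] by simp

lemma fder_diff: "f differentiable at x \<Longrightarrow> g differentiable at x \<Longrightarrow>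
    fder (\<lambda>y. f y - g y) x v = fder f x v - fder g x v"
  using fder_eq[OF has_derivative_diff[OF fder_works[of f] fder_works[of g]]] by simp

lemma fder_sum: "(\<And>i. i \<in> I \<Longrightarrow> f i differentiable at x) \<Longrightarrow>
    fder (\<lambda>y. \<Sum>i\<in>I. f i y) x v = (\<Sum>i\<in>I. fder (f i) x v)"
  by (rule fun_cong[OF fder_eq[OF has_derivative_sum]]) (rule fder_works)

lemma fder_bilinear:
  assumes "bounded_bilinear h" "f differentiable at x" "g differentiable at x"
  shows "fder (\<lambda>y. h (f y) (g y)) x v = h (f x) (fder g x v) + h (fder f x v) (g x)"
  using fder_eq[OF bounded_bilinear.FDERIV[OF assms(1) fder_works[OF assms(2)] fder_works[OF assms(3)]]] by simp

lemmas fder_scaleR = fder_bilinear[OF bounded_bilinear_scaleR]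
  and fder_mult = fder_bilinear[OF bounded_bilinear_mult]

lemma fder_linear_arg:
  assumes "f differentiable at x"
  shows "fder f x (u + v) = fder f x u + fder f x v" "fder f x (c *\<^sub>R u) = c *\<^sub>R fder f x u"
    "fder f x (- u) = - fder f x u" "fder f x (u - v) = fder f x u - fder f x v" "fder f x 0 = 0"
  using linear_frechet_derivative[OF assms]
  by (simp_all add: linear_add linear_scale linear_neg linear_diff linear_0)

lemma fder_sum_arg:
  assumes "f differentiable at x"
  shows "fder f x (\<Sum>i\<in>I. u i) = (\<Sum>i\<in>I. fder f x (u i))"
  using linear_frechet_derivative[OF assms] by (rule linear_sum)

lemma fder_fder_field:
  fixes f :: "'e::euclidean_space \<Rightarrow> 'b::euclidean_space"
  assumes f: "smooth_on S f" and Y: "smooth_on S Y" and x: "x \<in> S"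
  shows "fder (\<lambda>y. fder f y (Y y)) x w = fder (\<lambda>y. fder f y (Y x)) x w + fder f x (fder Y x w)"
proof -
  have dY: "Y differentiable at x" using smooth_onD(4)[OF Y x] .
  have dY': "(\<lambda>y. Y y \<bullet> b) differentiable at x" for b
    using smooth_onD(4)[OF smooth_on_linear[OF bounded_linear_inner_left Y] x] .
  have df: "f differentiable at y" "(\<lambda>y. fder f y b) differentiable at y" if "y \<in> S" for y b
    using smooth_onD(4)[OF f that] smooth_onD(4)[OF smooth_on_fder[OF f] that] .
  have "fder (\<lambda>y. fder f y (Y y)) x = fder (\<lambda>y. \<Sum>b\<in>Basis. (Y y \<bullet> b) *\<^sub>R fder f y b) x"
    by (rule fder_cong[OF smooth_onD(1)[OF f] x]) (rule fder_expand[OF df(1)])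
  then have "fder (\<lambda>y. fder f y (Y y)) x w = fder (\<lambda>y. \<Sum>b\<in>Basis. (Y y \<bullet> b) *\<^sub>R fder f y b) x w"
    by simp
  also have "\<dots> = (\<Sum>b\<in>Basis. (Y x \<bullet> b) *\<^sub>R fder (\<lambda>y. fder f y b) x w + (fder Y x w \<bullet> b) *\<^sub>R fder f x b)"
    using dY' df(2)[OF x] dY
    by (subst fder_sum) (auto simp: fder_scaleR fder_linear[OF bounded_linear_inner_left])
  also have "\<dots> = (\<Sum>b\<in>Basis. (Y x \<bullet> b) *\<^sub>R fder (\<lambda>y. fder f y b) x w) + fder f x (fder Y x w)"
    using fder_expand[OF df(1)[OF x], of "fder Y x w"] by (simp add: sum.distrib)
  also have "(\<Sum>b\<in>Basis. (Y x \<bullet> b) *\<^sub>R fder (\<lambda>y. fder f y b) x w)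
      = fder (\<lambda>y. \<Sum>b\<in>Basis. (Y x \<bullet> b) *\<^sub>R fder f y b) x w"
    using df(2)[OF x] by (subst fder_sum) (auto simp: fder_scaleR)
  also have "fder (\<lambda>y. \<Sum>b\<in>Basis. (Y x \<bullet> b) *\<^sub>R fder f y b) x = fder (\<lambda>y. fder f y (Y x)) x"
    by (rule fder_cong[OF smooth_onD(1)[OF f] x]) (rule fder_expand[OF df(1), symmetric])
  finally show ?thesis .
qed

text \<open>The sign makes \<open>brk X Y\<close> act on functions as the commutator X Y - Y X, in
  agreement with \<open>lie_bracket\<close>.\<close>

definition brk :: "('e::euclidean_space \<Rightarrow> 'e) \<Rightarrow> ('e \<Rightarrow> 'e) \<Rightarrow> 'e \<Rightarrow> 'e" where
  "brk X Y = (\<lambda>x. fder Y x (X x) - fder X x (Y x))"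

lemma smooth_on_brk: "smooth_on S X \<Longrightarrow> smooth_on S Y \<Longrightarrow> smooth_on S (brk X Y)"
  unfolding brk_def by (intro smooth_on_diff smooth_on_fder_field)

lemma fder_brk:
  fixes f :: "'e::euclidean_space \<Rightarrow> 'b::euclidean_space"
  assumes f: "smooth_on S f" and X: "smooth_on S X" and Y: "smooth_on S Y" and x: "x \<in> S"
  shows "fder f x (brk X Y x) = fder (\<lambda>y. fder f y (Y y)) x (X x) - fder (\<lambda>y. fder f y (X y)) x (Y x)"
  using fder_fder_field[OF f Y x] fder_fder_field[OF f X x] fder_commute[OF f x]
  by (simp add: brk_def fder_linear_arg[OF smooth_onD(4)[OF f x]])

lemma brk_cong:
  assumes "open S" "x \<in> S" "\<And>y. y \<in> S \<Longrightarrow> X y = X' y" "\<And>y. y \<in> S \<Longrightarrow> Y y = Y' y"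
  shows "brk X Y x = brk X' Y' x"
  using fder_cong[OF assms(1,2), of X X'] fder_cong[OF assms(1,2), of Y Y'] assms by (simp add: brk_def)

lemma brk_jacobi:
  fixes X Y Z :: "'e::euclidean_space \<Rightarrow> 'e"
  assumes X: "smooth_on S X" and Y: "smooth_on S Y" and Z: "smooth_on S Z" and x: "x \<in> S"
  shows "brk (brk X Y) Z x = brk X (brk Y Z) x - brk Y (brk X Z) x"
proof (rule euclidean_eqI)
  fix b :: 'e assume "b \<in> Basis"
  \<comment> \<open>A vector is determined by its action on the coordinate functions; tested on
    these, the Jacobi identity becomes the algebraic identity for commutators of the operators
    \<open>L X\<close>.\<close>
  define f where "f = (\<lambda>y::'e. y \<bullet> b)"
  have S: "open S" using smooth_onD(1)[OF X] .
  have f: "smooth_on S f" unfolding f_def by (rule smooth_on_linear[OF bounded_linear_inner_left smooth_on_id[OF S]])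
  have fd: "fder f y v = v \<bullet> b" for y v
    unfolding f_def by (simp add: fder_linear[OF bounded_linear_inner_left] fder_eq)
  define L where "L = (\<lambda>X (g::'e \<Rightarrow> real) y. fder g y (X y))"
  have L_at: "L X g y = fder g y (X y)" for X g y by (simp add: L_def)
  have sL: "smooth_on S (L X g)" if "smooth_on S X" "smooth_on S g" for X g
    unfolding L_def by (rule smooth_on_fder_field[OF that(2,1)])
  have Lb: "L (brk X Y) g y = L X (L Y g) y - L Y (L X g) y"
    if "smooth_on S X" "smooth_on S Y" "smooth_on S g" "y \<in> S" for X Y g y
    using fder_brk[OF that(3,1,2,4)] by (simp add: L_def)
  have Ld: "L X (L (brk Y Z) f) x = L X (L Y (L Z f)) x - L X (L Z (L Y f)) x"
    if "smooth_on S X" "smooth_on S Y" "smooth_on S Z" for X Y Z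
  proof -
    have "fder (L (brk Y Z) f) x = fder (\<lambda>y. L Y (L Z f) y - L Z (L Y f) y) x"
      by (rule fder_cong[OF S x]) (rule Lb[OF that(2,3) f])
    then show ?thesis
      unfolding L_at[of X] by (simp add: fder_diff smooth_onD(4)[OF _ x] sL f that)
  qed
  have "L (brk (brk X Y) Z) f x = L X (L (brk Y Z) f) x - L (brk Y Z) (L X f) x
      - (L Y (L (brk X Z) f) x - L (brk X Z) (L Y f) x)"
    using X Y Z f x sL by (simp add: Lb smooth_on_brk Ld)
  also have "\<dots> = L (brk X (brk Y Z)) f x - L (brk Y (brk X Z)) f x"
    using X Y Z f x by (simp add: Lb smooth_on_brk)
  finally show "brk (brk X Y) Z x \<bullet> b = (brk X (brk Y Z) x - brk Y (brk X Z) x) \<bullet> b"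
    by (simp add: L_def fd inner_diff_left)
qed

text \<open>As \<open>g\<close> vanishes at \<open>x\<close>, it is of order |y - x| there, and the
  oscillation of \<open>k\<close> contributes only a smaller order. It serves to differentiate the
  solution of a linear system at a stage where only its continuity is known.\<close>

lemma has_derivative_continuous_times_vanishing:
  fixes k :: "'e::euclidean_space \<Rightarrow> real" and g :: "'e \<Rightarrow> 'b::real_normed_vector"
  assumes k: "isCont k x" and g: "(g has_derivative g') (at x)" and g0: "g x = 0"
  shows "((\<lambda>y. k y *\<^sub>R g y) has_derivative (\<lambda>v. k x *\<^sub>R g' v)) (at x)"
proof -
  obtain K where K: "\<And>v. norm (g' v) \<le> norm v * K" "K > 0"
    using bounded_linear.pos_bounded[OF has_derivative_bounded_linear[OF g]] by blast
  have "((\<lambda>y. (k y - k x) *\<^sub>R g y) has_derivative (\<lambda>v. 0)) (at x)"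
    unfolding has_derivative_at_alt
  proof (intro conjI allI impI)
    fix e :: real assume e: "e > 0"
    obtain d1 where d1: "d1 > 0" "\<And>y. norm (y - x) < d1 \<Longrightarrow> norm (g y - g x - g' (y - x)) \<le> 1 * norm (y - x)"
      using g unfolding has_derivative_at_alt using zero_less_one by blast
    have eK: "e / (K + 1) > 0" using e K by (simp add: add_pos_pos)
    obtain d2 where d2: "d2 > 0" "\<And>y. dist y x < d2 \<Longrightarrow> dist (k y) (k x) < e / (K + 1)"
      using k eK unfolding continuous_at_eps_delta by blast
    show "\<exists>d>0. \<forall>y. norm (y - x) < d \<longrightarrow> norm ((k y - k x) *\<^sub>R g y - (k x - k x) *\<^sub>R g x - 0) \<le> e * norm (y - x)"
    proof (intro exI[of _ "min d1 d2"] conjI allI impI)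
      fix y assume y: "norm (y - x) < min d1 d2"
      have "norm (g y) \<le> norm (g y - g x - g' (y - x)) + norm (g' (y - x))"
        using norm_triangle_ineq[of "g y - g x - g' (y - x)" "g' (y - x)"] g0 by simp
      also have "\<dots> \<le> (K + 1) * norm (y - x)"
        using d1(2)[of y] y K(1)[of "y - x"] by (simp add: algebra_simps)
      finally have "norm (g y) \<le> (K + 1) * norm (y - x)" .
      moreover have "\<bar>k y - k x\<bar> \<le> e / (K + 1)" using d2(2)[of y] y by (simp add: dist_norm)
      ultimately have "\<bar>k y - k x\<bar> * norm (g y) \<le> e / (K + 1) * ((K + 1) * norm (y - x))"
        using eK by (intro mult_mono) auto
      then show "norm ((k y - k x) *\<^sub>R g y - (k x - k x) *\<^sub>R g x - 0) \<le> e * norm (y - x)"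
        using K by simp
    qed (use d1 d2 in auto)
  qed simp
  from has_derivative_add[OF has_derivative_scaleR_right[OF g, of "k x"] this]
  show ?thesis by (simp add: algebra_simps)
qed

section \<open>Smooth dependence of the solution of an injective linear system\<close>

lemma injective_linear_lower_bound:
  fixes h :: "'e::euclidean_space \<Rightarrow> 'd::euclidean_space"
  assumes "linear h" "inj h"
  shows "\<exists>m>0. \<forall>v. m * norm v \<le> norm (h v)"
  using linear_inj_bounded_below_pos[OF assms] by (metis mult.commute)

context
  fixes B :: "'e::euclidean_space \<Rightarrow> 'd::euclidean_space \<Rightarrow> 'c::euclidean_space" and S :: "'e set"
  assumes S: "open S" and B: "\<And>b. smooth_on S (\<lambda>x. B x b)"
    and lin: "\<And>x. x \<in> S \<Longrightarrow> linear (B x)" and inj: "\<And>x. x \<in> S \<Longrightarrow> inj (B x)"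
begin

text \<open>The lower bound \<open>m\<close> of the injective map \<open>B x\<close> persists as
  \<open>m / 2\<close> at nearby points, which bounds \<open>a y - a x\<close> by the variation of
  \<open>c\<close> and of \<open>B\<close>.\<close>

lemma isCont_linear_solve:
  fixes a :: "'e \<Rightarrow> 'd" and c :: "'e \<Rightarrow> 'c"
  assumes x: "x \<in> S" and cc: "isCont c x" and eqc: "\<And>x. x \<in> S \<Longrightarrow> B x (a x) = c x"
  shows "isCont a x"
proof -
    obtain m where m: "m > 0" "\<And>v. m * norm v \<le> norm (B x v)"
      using injective_linear_lower_bound[OF lin[OF x] inj[OF x]] by blast
    define \<beta> where "\<beta> y = (\<Sum>b\<in>Basis. norm (B y b - B x b))" for y
    have Bd: "norm (B y v - B x v) \<le> \<beta> y * norm v" if "y \<in> S" for y v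
    proof -
      have "B y v - B x v = (\<Sum>b\<in>Basis. (v \<bullet> b) *\<^sub>R (B y b - B x b))"
        using linear_euclidean_expand[OF lin[OF that], of v] linear_euclidean_expand[OF lin[OF x], of v]
        by (simp add: sum_subtractf scaleR_diff_right)
      also have "norm \<dots> \<le> (\<Sum>b\<in>Basis. norm v * norm (B y b - B x b))"
        by (intro sum_norm_le) (auto intro!: mult_right_mono Basis_le_norm)
      finally show ?thesis by (simp add: \<beta>_def sum_distrib_left mult.commute)
    qed
    have Bcont: "isCont (\<lambda>y. B y b) x" for b
      using smooth_onD(3)[OF B] S x by (simp add: continuous_on_eq_continuous_at)
    have "isCont \<beta> x" unfolding \<beta>_def using Bcont by (intro continuous_intros) auto
    moreover have "\<beta> x = 0" by (simp add: \<beta>_def)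
    ultimately have b0: "\<beta> \<midarrow>x\<rightarrow> 0" by (simp add: isCont_def)
    have c0: "c \<midarrow>x\<rightarrow> c x" using cc by (simp add: isCont_def)
    have "((\<lambda>y. (norm (c y - c x) + \<beta> y * norm (a x)) / (m/2)) \<longlongrightarrow> (norm (c x - c x) + 0 * norm (a x)) / (m/2)) (at x)"
      by (intro tendsto_intros b0 c0) (use m in auto)
    moreover have "\<forall>\<^sub>F y in at x. y \<in> S" using S x eventually_at_in_open' by blast
    moreover have "\<forall>\<^sub>F y in at x. \<beta> y < m/2" using order_tendstoD(2)[OF b0, of "m/2"] m by simp
    ultimately have "((\<lambda>y. a y - a x) \<longlongrightarrow> 0) (at x)"
    proof (intro Lim_null_comparison[of "\<lambda>y. a y - a x"])
      assume e: "\<forall>\<^sub>F y in at x. y \<in> S" "\<forall>\<^sub>F y in at x. \<beta> y < m / 2"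
      show "\<forall>\<^sub>F y in at x. norm (a y - a x) \<le> (norm (c y - c x) + \<beta> y * norm (a x)) / (m / 2)"
        using e
      proof eventually_elim
        case (elim y)
        let ?d = "a y - a x"
        have "B y ?d = c y - c x - (B y (a x) - B x (a x))"
          using eqc[OF x] eqc[OF elim(1)] linear_diff[OF lin[OF elim(1)]] by simp
        then have "norm (B y ?d) \<le> norm (c y - c x) + \<beta> y * norm (a x)"
          using norm_triangle_ineq4[of "c y - c x" "B y (a x) - B x (a x)"] Bd[OF elim(1), of "a x"] by simp
        moreover have "norm (B y ?d) \<ge> norm (B x ?d) - norm (B y ?d - B x ?d)"
          by (metis norm_minus_commute norm_triangle_sub diff_le_eq add.commute)
        moreover have "norm (B x ?d) \<ge> m * norm ?d" using m by blast
        moreover have "norm (B y ?d - B x ?d) \<le> (m/2) * norm ?d"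
          using Bd[OF elim(1), of ?d] elim(2) mult_right_mono[OF less_imp_le[OF elim(2)] norm_ge_zero[of ?d]] by linarith
        ultimately have "(m/2) * norm ?d \<le> norm (c y - c x) + \<beta> y * norm (a x)"
          by (simp add: field_simps)
        then show ?case using m by (simp add: field_simps)
      qed
    qed simp
    then show ?thesis by (simp add: isCont_def LIM_zero_iff)
  qed

text \<open>The coefficient is frozen at \<open>x\<close>: \<open>B x (a y)\<close> equals
  \<open>c y\<close> minus the coordinates of \<open>a y\<close> times the differences
  \<open>B y b - B x b\<close>. These vanish at \<open>x\<close>, so continuity of \<open>a\<close>
  allows differentiation, and a linear left inverse of \<open>B x\<close> transfers the derivative
  to \<open>a\<close>.\<close>

lemma fder_linear_solve:
  fixes a :: "'e \<Rightarrow> 'd" and c :: "'e \<Rightarrow> 'c"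
  assumes x: "x \<in> S" and c: "c differentiable at x" and eq: "\<And>x. x \<in> S \<Longrightarrow> B x (a x) = c x"
  shows "a differentiable at x \<and> (\<forall>v. B x (fder a x v) = fder c x v - (\<Sum>b\<in>Basis. (a x \<bullet> b) *\<^sub>R fder (\<lambda>y. B y b) x v))"
proof -
    define D where "D v = fder c x v - (\<Sum>b\<in>Basis. (a x \<bullet> b) *\<^sub>R fder (\<lambda>y. B y b) x v)" for v
    have ca: "isCont a x"
      using isCont_linear_solve[OF x differentiable_imp_continuous_within[OF c] eq] .
    have "((\<lambda>y. c y - (\<Sum>b\<in>Basis. (a y \<bullet> b) *\<^sub>R (B y b - B x b))) has_derivative D) (at x)"
      unfolding D_def
    proof (intro has_derivative_diff has_derivative_sum has_derivative_continuous_times_vanishing)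
      show "(c has_derivative fder c x) (at x)" using fder_works[OF c] .
      show "isCont (\<lambda>y. a y \<bullet> b) x" for b using ca by (intro continuous_intros)
      show "((\<lambda>y. B y b - B x b) has_derivative fder (\<lambda>y. B y b) x) (at x)" for b
        using has_derivative_diff[OF smooth_onD(5)[OF B[of b] x] has_derivative_const[of "B x b"]] by simp
    qed simp
    then have D: "((\<lambda>y. B x (a y)) has_derivative D) (at x)"
    proof (rule has_derivative_transform_within_open[OF _ S x])
      fix y assume y: "y \<in> S"
      have "(\<Sum>b\<in>Basis. (a y \<bullet> b) *\<^sub>R (B y b - B x b)) = B y (a y) - B x (a y)"
        using linear_euclidean_expand[OF lin[OF y], of "a y"] linear_euclidean_expand[OF lin[OF x], of "a y"]
        by (simp add: sum_subtractf scaleR_diff_right)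
      then show "c y - (\<Sum>b\<in>Basis. (a y \<bullet> b) *\<^sub>R (B y b - B x b)) = B x (a y)" using eq[OF y] by simp
    qed
    obtain g where g: "linear g" "g \<circ> B x = id"
      using linear_injective_left_inverse[OF lin[OF x] inj[OF x]] by blast
    have da: "(a has_derivative (\<lambda>v. g (D v))) (at x)"
      using bounded_linear.has_derivative[OF linear_conv_bounded_linear[THEN iffD1, OF g(1)] D] g(2)
      by (simp add: fun_eq_iff)
    have "((\<lambda>y. B x (a y)) has_derivative (\<lambda>v. B x (fder a x v))) (at x)"
      using bounded_linear.has_derivative[OF linear_conv_bounded_linear[THEN iffD1, OF lin[OF x]] da]
        fder_eq[OF da] by simp
    then have "D = (\<lambda>v. B x (fder a x v))" using has_derivative_unique[OF D] by blast
    then show ?thesis using differentiableI[OF da] by (metis D_def)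
  qed

text \<open>Bootstrapping: each directional derivative of \<open>a\<close> solves the same linear
  system, with a right hand side built from \<open>a\<close> and from derivatives of
  \<open>B\<close> and \<open>c\<close>, hence of class C^k as soon as \<open>a\<close> is.\<close>

lemma Ck_on_linear_solve:
  fixes a :: "'e \<Rightarrow> 'd" and c :: "'e \<Rightarrow> 'c"
  assumes "Ck_on k S c" "\<And>x. x \<in> S \<Longrightarrow> B x (a x) = c x"
  shows "Ck_on k S a"
  using assms
proof (induction k arbitrary: a c)
  case 0
  then show ?case
    using isCont_linear_solve S by (auto simp: continuous_on_eq_continuous_at)
next
  case (Suc k)
  have d: "a differentiable at x \<and> (\<forall>v. B x (fder a x v) = fder c x v - (\<Sum>b\<in>Basis. (a x \<bullet> b) *\<^sub>R fder (\<lambda>y. B y b) x v))"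
    if "x \<in> S" for x
    using fder_linear_solve[OF that _ Suc.prems(2)] Suc.prems(1) that by auto
  have ck: "Ck_on k S c" "Ck_on k S (\<lambda>x. fder c x v)" for v using Suc.prems(1) Ck_on_Suc_imp by auto
  have cka: "Ck_on k S a" using Suc.IH[OF ck(1) Suc.prems(2)] .
  have "Ck_on k S (\<lambda>x. fder a x v)" for v
  proof (rule Suc.IH)
    have "Ck_on k S (\<lambda>x. fder c x v + - (\<Sum>b\<in>Basis. (a x \<bullet> b) *\<^sub>R fder (\<lambda>y. B y b) x v))"
      by (intro Ck_on_add[OF S] ck(2) Ck_on_linear[OF bounded_linear_minus[OF bounded_linear_ident] S]
          Ck_on_sum[OF S] Ck_on_bilinear[OF bounded_bilinear_scaleR S] Ck_on_linear[OF bounded_linear_inner_left S]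
          cka smooth_onD(2)[OF smooth_on_fder[OF B]])
    then show "Ck_on k S (\<lambda>x. fder c x v - (\<Sum>b\<in>Basis. (a x \<bullet> b) *\<^sub>R fder (\<lambda>y. B y b) x v))" by simp
  qed (use d in blast)
  then show ?case using d by simp
qed

lemma smooth_on_linear_solve:
  fixes a :: "'e \<Rightarrow> 'd" and c :: "'e \<Rightarrow> 'c"
  assumes "smooth_on S c" "\<And>x. x \<in> S \<Longrightarrow> B x (a x) = c x"
  shows "smooth_on S a"
  unfolding smooth_on_def using S Ck_on_linear_solve[OF smooth_onD(2)[OF assms(1)] assms(2)] by simp

end

section \<open>Flows\<close>

lemma smooth_on_lipschitz:
  fixes g :: "'e::euclidean_space \<Rightarrow> 'b::real_normed_vector"
  assumes g: "smooth_on V g" and V: "cball q r \<subseteq> V"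
  obtains K where "K \<ge> 0" "\<And>x. x \<in> cball q r \<Longrightarrow> norm (g x) \<le> K"
    "\<And>x v. x \<in> cball q r \<Longrightarrow> norm (fder g x v) \<le> K * norm v"
    "\<And>x y. x \<in> cball q r \<Longrightarrow> y \<in> cball q r \<Longrightarrow> norm (g x - g y) \<le> K * norm (x - y)"
proof -
  have bdd: "\<exists>B\<ge>0. \<forall>x\<in>cball q r. norm (h x) \<le> B" if "smooth_on V h" for h :: "'e \<Rightarrow> 'b"
  proof -
    have "compact (h ` cball q r)"
      using continuous_on_subset[OF smooth_onD(3)[OF that] V] by (intro compact_continuous_image) auto
    from bounded_pos[THEN iffD1, OF compact_imp_bounded[OF this]] show ?thesis
      by (auto intro: less_imp_le)
  qed
  obtain B0 where B0: "B0 \<ge> 0" "\<And>x. x \<in> cball q r \<Longrightarrow> norm (g x) \<le> B0" using bdd[OF g] by blast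
  obtain B where B: "\<And>b. B b \<ge> 0" "\<And>x b. x \<in> cball q r \<Longrightarrow> norm (fder g x b) \<le> B b"
    using bdd[OF smooth_on_fder[OF g]] by metis
  define L where "L = (\<Sum>b\<in>Basis. B b)"
  have L: "L \<ge> 0" unfolding L_def using B(1) by (intro sum_nonneg) auto
  have gd: "norm (fder g x v) \<le> L * norm v" if "x \<in> cball q r" for x v
  proof -
    have "fder g x v = (\<Sum>b\<in>Basis. (v \<bullet> b) *\<^sub>R fder g x b)"
      using fder_expand smooth_onD(4)[OF g] V that by blast
    also have "norm \<dots> \<le> (\<Sum>b\<in>Basis. norm v * B b)"
    proof (rule sum_norm_le)
      fix b :: 'e assume "b \<in> Basis"
      then show "norm ((v \<bullet> b) *\<^sub>R fder g x b) \<le> norm v * B b"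
        using B(2)[OF that] Basis_le_norm[of b v] by (auto intro!: mult_mono)
    qed
    finally show ?thesis by (simp add: L_def sum_distrib_left mult.commute)
  qed
  have lip: "norm (g x - g y) \<le> L * norm (x - y)" if "x \<in> cball q r" "y \<in> cball q r" for x y
  proof (rule differentiable_bound[OF convex_cball _ _ that])
    fix x assume x: "x \<in> cball q r"
    show "(g has_derivative fder g x) (at x within cball q r)"
      using smooth_onD(5)[OF g] V x has_derivative_at_withinI by blast
    show "onorm (fder g x) \<le> L"
      by (rule onorm_le) (rule gd[OF x])
  qed
  show ?thesis
  proof (rule that[of "max B0 L"])
    show "norm (g x) \<le> max B0 L" if "x \<in> cball q r" for x using B0(2)[OF that] by simp
    show "norm (fder g x v) \<le> max B0 L * norm v" if "x \<in> cball q r" for x v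
      using gd[OF that, of v] mult_right_mono[of L "max B0 L" "norm v"] by simp
    show "norm (g x - g y) \<le> max B0 L * norm (x - y)" if "x \<in> cball q r" "y \<in> cball q r" for x y
      using lip[OF that] mult_right_mono[of L "max B0 L" "norm (x - y)"] by simp
  qed (use L in simp)
qed

lemma smooth_on_taylor:
  fixes g :: "'e::euclidean_space \<Rightarrow> 'b::real_normed_vector"
  assumes g: "smooth_on V g" and V: "cball q r \<subseteq> V"
  obtains C where "C \<ge> 0"
    "\<And>x y. x \<in> cball q r \<Longrightarrow> y \<in> cball q r \<Longrightarrow> norm (g y - g x - fder g x (y - x)) \<le> C * (norm (y - x))\<^sup>2"
proof -
  have "\<exists>K\<ge>0. \<forall>x\<in>cball q r. \<forall>y\<in>cball q r. norm (fder g x b - fder g y b) \<le> K * norm (x - y)" for b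
    using smooth_on_lipschitz[OF smooth_on_fder[OF g, of b] V] by metis
  then obtain K where K: "\<And>b. K b \<ge> 0"
    "\<And>b x y. x \<in> cball q r \<Longrightarrow> y \<in> cball q r \<Longrightarrow> norm (fder g x b - fder g y b) \<le> K b * norm (x - y)"
    by metis
  define L where "L = (\<Sum>b\<in>Basis. K b)"
  have L: "L \<ge> 0" unfolding L_def using K(1) by (intro sum_nonneg) auto
  have gd: "norm (fder g x v - fder g y v) \<le> L * norm (x - y) * norm v"
    if "x \<in> cball q r" "y \<in> cball q r" for x y v
  proof -
    have "fder g x v - fder g y v = (\<Sum>b\<in>Basis. (v \<bullet> b) *\<^sub>R (fder g x b - fder g y b))"
      using fder_expand[of g x v] fder_expand[of g y v] smooth_onD(4)[OF g] V that
      by (auto simp: sum_subtractf scaleR_diff_right subset_iff)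
    also have "norm \<dots> \<le> (\<Sum>b\<in>Basis. norm v * (K b * norm (x - y)))"
    proof (rule sum_norm_le)
      fix b :: 'e assume "b \<in> Basis"
      then show "norm ((v \<bullet> b) *\<^sub>R (fder g x b - fder g y b)) \<le> norm v * (K b * norm (x - y))"
        using K(2)[OF that] Basis_le_norm[of b v] by (auto intro!: mult_mono)
    qed
    also have "\<dots> = L * norm (x - y) * norm v"
      by (simp add: L_def sum_distrib_left sum_distrib_right mult_ac)
    finally show ?thesis .
  qed
  show ?thesis
  proof (rule that[OF L])
    fix x y assume xy: "x \<in> cball q r" "y \<in> cball q r"
    have S: "closed_segment x y \<subseteq> cball q r" using xy by (simp add: closed_segment_subset)
    have "norm (g y - g x - fder g x (y - x)) \<le> norm (y - x) * (L * norm (y - x))"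
    proof (rule differentiable_bound_linearization[of x y "closed_segment x y"])
      show "x + t *\<^sub>R (y - x) \<in> closed_segment x y" if "t \<in> {0..1}" for t
        using that by (auto simp: closed_segment_def algebra_simps intro!: exI[of _ t])
      fix z assume z: "z \<in> closed_segment x y"
      show "(g has_derivative fder g z) (at z within closed_segment x y)"
        using smooth_onD(5)[OF g] V z S has_derivative_at_withinI by blast
      show "onorm (fder g z - fder g x) \<le> L * norm (y - x)"
      proof (rule onorm_le)
        fix v :: 'e
        have "norm (z - x) \<le> norm (y - x)" using z segment_bound1 by (metis norm_minus_commute)
        then have "L * norm (z - x) * norm v \<le> L * norm (y - x) * norm v"
          using L by (intro mult_right_mono mult_left_mono) auto
        then show "norm ((fder g z - fder g x) v) \<le> L * norm (y - x) * norm v"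
          using gd[of z x v] z S xy by auto
      qed
    qed auto
    then show "norm (g y - g x - fder g x (y - x)) \<le> L * (norm (y - x))\<^sup>2"
      by (simp add: power2_eq_square mult_ac)
  qed
qed

section \<open>Differential inequalities, Picard's theorem and local flows\<close>

lemma vector_derivative_bound:
  fixes d :: "real \<Rightarrow> 'b::real_normed_vector"
  assumes "\<And>t. t \<in> {-\<delta>..\<delta>} \<Longrightarrow> (d has_vector_derivative d' t) (at t within {-\<delta>..\<delta>})"
    and "\<And>t. t \<in> {-\<delta>..\<delta>} \<Longrightarrow> norm (d' t) \<le> B" and "s \<in> {-\<delta>..\<delta>}" "t \<in> {-\<delta>..\<delta>}"
  shows "norm (d t - d s) \<le> B * \<bar>t - s\<bar>"
proof -
  have "norm (d t - d s) \<le> B * norm (t - s)"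
  proof (rule differentiable_bound[of "{-\<delta>..\<delta>}" d "\<lambda>t h. h *\<^sub>R d' t"])
    fix t assume t: "t \<in> {-\<delta>..\<delta>}"
    show "(d has_derivative (\<lambda>h. h *\<^sub>R d' t)) (at t within {-\<delta>..\<delta>})"
      using assms(1)[OF t] by (simp add: has_vector_derivative_def)
    show "onorm (\<lambda>h. h *\<^sub>R d' t) \<le> B"
    proof (rule onorm_le)
      show "norm (h *\<^sub>R d' t) \<le> B * norm h" for h
        using mult_right_mono[OF assms(2)[OF t] abs_ge_zero[of h]] by (simp add: mult.commute)
    qed
  qed (use assms in auto)
  then show ?thesis by simp
qed

text \<open>Over a time interval that is short compared with the Lipschitz constant this replaces
  Gronwall's inequality.\<close>

lemma short_time_gronwall:
  fixes d :: "real \<Rightarrow> 'b::real_normed_vector"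
  assumes d: "\<And>t. t \<in> {-\<delta>..\<delta>} \<Longrightarrow> (d has_vector_derivative d' t) (at t within {-\<delta>..\<delta>})"
    and b: "\<And>t. t \<in> {-\<delta>..\<delta>} \<Longrightarrow> norm (d' t) \<le> K * norm (d t) + e"
    and "0 < \<delta>" "K \<ge> 0" "K * \<delta> \<le> 1/4" "e \<ge> 0" "t \<in> {-\<delta>..\<delta>}"
  shows "norm (d t) \<le> 2 * (norm (d 0) + e * \<delta>)"
proof -
  have "continuous_on {-\<delta>..\<delta>} d"
    using d has_vector_derivative_continuous unfolding continuous_on_eq_continuous_within by blast
  then have "continuous_on {-\<delta>..\<delta>} (\<lambda>t. norm (d t))" by (intro continuous_intros)
  from continuous_attains_sup[OF compact_Icc _ this]
  \<comment> \<open>At a maximum of the norm the estimate closes up: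
    \<open>K * \<delta> \<le> 1/4\<close> moves a quarter of the maximum to the left hand
    side.\<close>
  obtain t0 where t0: "t0 \<in> {-\<delta>..\<delta>}" "\<And>t. t \<in> {-\<delta>..\<delta>} \<Longrightarrow> norm (d t) \<le> norm (d t0)"
    using \<open>0 < \<delta>\<close> by fastforce
  let ?n = "norm (d t0)"
  have "norm (d' t) \<le> K * ?n + e" if "t \<in> {-\<delta>..\<delta>}" for t
    using b[OF that] mult_left_mono[OF t0(2)[OF that] \<open>K \<ge> 0\<close>] by linarith
  from vector_derivative_bound[OF d this, of 0 t0] t0 \<open>0 < \<delta>\<close>
  have "norm (d t0 - d 0) \<le> (K * ?n + e) * \<bar>t0\<bar>" by simp
  also have "\<dots> \<le> (K * ?n + e) * \<delta>" using t0 assms by (intro mult_left_mono) auto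
  also have "\<dots> \<le> 1/4 * ?n + e * \<delta>"
    using mult_right_mono[OF \<open>K * \<delta> \<le> 1/4\<close>, of ?n] by (simp add: algebra_simps)
  finally have "norm (d t0 - d 0) \<le> 1/4 * ?n + e * \<delta>" .
  moreover have "?n \<le> norm (d t0 - d 0) + norm (d 0)" by (metis norm_triangle_sub add.commute)
  ultimately have "3/4 * ?n \<le> norm (d 0) + e * \<delta>" by linarith
  moreover have "z \<le> 2 * y" if "3/4 * n \<le> y" "0 \<le> n" "z \<le> n" for n y z :: real using that by linarith
  ultimately show ?thesis using t0(2)[OF \<open>t \<in> {-\<delta>..\<delta>}\<close>] norm_ge_zero by blast
qed

text \<open>Stated in a Banach space because it is used twice: for the integral curves, and for the
  linearised equation, whose unknown is an operator.\<close>

lemma picard: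
  fixes F :: "real \<Rightarrow> 'b::banach \<Rightarrow> 'b"
  assumes \<delta>: "0 < \<delta>" and F: "continuous_on ({-\<delta>..\<delta>} \<times> UNIV) (\<lambda>(s,y). F s y)"
    and lip: "\<And>s y z. s \<in> {-\<delta>..\<delta>} \<Longrightarrow> norm (F s y - F s z) \<le> K * norm (y - z)"
    and K: "K \<ge> 0" "K * \<delta> \<le> 1/4"
  obtains w where "w 0 = x" "\<And>t. t \<in> {-\<delta>..\<delta>} \<Longrightarrow> (w has_vector_derivative F t (w t)) (at t within {-\<delta>..\<delta>})"
proof -
  define I where "I = {-\<delta>..\<delta>}"
  \<comment> \<open>The primitive starts at the left end point and is normalised to vanish at time
    0, so that one formula covers both time directions.\<close>
  define J where "J g t = integral {-\<delta>..t} g - integral {-\<delta>..0} g" for g :: "real \<Rightarrow> 'b" and t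
  have J: "(J g has_vector_derivative g t) (at t within I)" if "continuous_on I g" "t \<in> I" for g t
  proof -
    have "((\<lambda>t. integral {-\<delta>..t} g - integral {-\<delta>..0} g) has_vector_derivative g t - 0) (at t within I)"
      unfolding I_def
      by (intro has_vector_derivative_diff has_vector_derivative_const integral_has_vector_derivative)
        (use that in \<open>auto simp: I_def\<close>)
    then show ?thesis by (simp add: J_def[abs_def])
  qed
  \<comment> \<open>Clamping time turns functions on the interval into bounded continuous functions
    on the whole line, which form a complete metric space that is a type.\<close>
  define c where "c t = max (-\<delta>) (min \<delta> t)" for t
  have c: "c t \<in> I" "t \<in> I \<Longrightarrow> c t = t" for t using \<delta> by (auto simp: c_def I_def)
  have cc: "continuous_on UNIV c" unfolding c_def by (intro continuous_intros)
  define P where "P u t = x + J (\<lambda>s. F s (apply_bcontfun u s)) (c t)" for u t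
  have Fu: "continuous_on I (\<lambda>s. F s (apply_bcontfun u s))" for u
  proof -
    have "continuous_on I (\<lambda>s. (s, apply_bcontfun u s))"
      by (intro continuous_on_Pair continuous_on_id continuous_on_apply_bcontfun)
    from continuous_on_compose2[OF F this] show ?thesis by (auto simp: I_def)
  qed
  have Pd: "(J (\<lambda>s. F s (apply_bcontfun u s)) has_vector_derivative F t (apply_bcontfun u t)) (at t within I)"
    if "t \<in> I" for u t
    using J[OF Fu that] .
  have Pc: "P u \<in> bcontfun" for u
  proof -
    let ?h = "\<lambda>t. x + J (\<lambda>s. F s (apply_bcontfun u s)) t"
    have "continuous_on I (J (\<lambda>s. F s (apply_bcontfun u s)))"
      using Pd has_vector_derivative_continuous unfolding continuous_on_eq_continuous_within by blast
    then have h: "continuous_on I ?h" by (intro continuous_intros)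
    have "bounded (?h ` I)"
      using compact_imp_bounded[OF compact_continuous_image[OF h]] by (simp add: I_def)
    moreover have "range (P u) \<subseteq> ?h ` I" unfolding P_def using c(1) by auto
    ultimately have "bounded (range (P u))" by (rule bounded_subset)
    moreover have "continuous_on UNIV (P u)"
      unfolding P_def using continuous_on_compose2[OF h cc] c(1) by auto
    ultimately show ?thesis by (simp add: bcontfun_def)
  qed
  define T where "T u = Bcontfun (P u)" for u
  have T: "apply_bcontfun (T u) = P u" for u unfolding T_def using Pc Bcontfun_inverse by blast
  have contr: "dist (T u) (T v) \<le> 1/4 * dist u v" for u v
  proof (rule dist_bound)
    fix t
    let ?U = "\<lambda>s. F s (apply_bcontfun u s)" and ?V = "\<lambda>s. F s (apply_bcontfun v s)"
    let ?d = "\<lambda>t. J ?U t - J ?V t"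
    have 1: "(?d has_vector_derivative (?U t - ?V t)) (at t within {-\<delta>..\<delta>})" if "t \<in> {-\<delta>..\<delta>}" for t
      using that Pd unfolding I_def by (intro has_vector_derivative_diff) auto
    have 2: "norm (?U t - ?V t) \<le> K * dist u v" if "t \<in> {-\<delta>..\<delta>}" for t
    proof -
      have "norm (?U t - ?V t) \<le> K * norm (apply_bcontfun u t - apply_bcontfun v t)" using lip[OF that] .
      also have "\<dots> \<le> K * dist u v"
        using dist_bounded[of u t v] K(1) by (intro mult_left_mono) (auto simp: dist_norm)
      finally show ?thesis .
    qed
    have "dist (T u t) (T v t) = norm (?d (c t) - ?d 0)"
      by (simp add: T P_def dist_norm J_def)
    also have "\<dots> \<le> K * dist u v * \<bar>c t - 0\<bar>"
      using vector_derivative_bound[OF 1 2, of 0 "c t"] c(1)[of t] \<delta> by (simp add: I_def)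
    also have "\<dots> \<le> K * dist u v * \<delta>"
      using c(1)[of t] K(1) by (intro mult_left_mono) (auto simp: I_def)
    also have "\<dots> \<le> 1/4 * dist u v"
      using mult_right_mono[OF K(2), of "dist u v"] by (simp add: mult_ac)
    finally show "dist (T u t) (T v t) \<le> 1/4 * dist u v" .
  qed
  obtain u where u: "T u = u" using banach_fix_type[of "1/4" T] contr by auto
  have uP: "apply_bcontfun u t = x + J (\<lambda>s. F s (apply_bcontfun u s)) (c t)" for t
    using T[of u] unfolding u by (metis P_def)
  show ?thesis
  proof (rule that[of "apply_bcontfun u"])
    show "apply_bcontfun u 0 = x" using c(2)[of 0] \<delta> by (subst uP) (simp add: J_def I_def)
    fix t assume t: "t \<in> {-\<delta>..\<delta>}"
    have "((\<lambda>t. x + J (\<lambda>s. F s (apply_bcontfun u s)) t) has_vector_derivative 0 + F t (apply_bcontfun u t)) (at t within I)"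
      using t by (intro has_vector_derivative_add has_vector_derivative_const Pd) (simp add: I_def)
    then have "((\<lambda>t. x + J (\<lambda>s. F s (apply_bcontfun u s)) t) has_vector_derivative F t (apply_bcontfun u t)) (at t within I)"
      by simp
    then show "(apply_bcontfun u has_vector_derivative F t (apply_bcontfun u t)) (at t within {-\<delta>..\<delta>})"
      unfolding I_def[symmetric]
    proof (rule has_vector_derivative_transform[rotated 2])
      show "t \<in> I" using t by (simp add: I_def)
      fix s assume "s \<in> I"
      then show "apply_bcontfun u s = x + J (\<lambda>s. F s (apply_bcontfun u s)) s"
        using c(2)[of s] by (subst uP) simp
    qed
  qed
qed

text \<open>\<open>A t\<close> is the differential of the time \<open>t\<close> map at the centre
  \<open>q\<close> alone, a solution of the linearised equation along the orbit of \<open>q\<close>.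
  The bound with \<open>2 * \<delta>\<close> keeps \<open>A t\<close> within 1/2 of the identity and
  so injective; the last clause says that the flow carries \<open>X\<close> to itself.\<close>

definition local_flow :: "'e::euclidean_space set \<Rightarrow> ('e \<Rightarrow> 'e) \<Rightarrow> 'e \<Rightarrow> real \<Rightarrow> real \<Rightarrow>
    ('e \<Rightarrow> real \<Rightarrow> 'e) \<Rightarrow> (real \<Rightarrow> 'e \<Rightarrow>\<^sub>L 'e) \<Rightarrow> bool" where
  "local_flow V X q R \<delta> \<phi> A \<longleftrightarrow> R > 0 \<and> \<delta> > 0 \<and> cball q (2 * R) \<subseteq> V \<and>
    (\<forall>x\<in>cball q R. \<phi> x 0 = x) \<and>
    (\<forall>x\<in>cball q R. \<forall>t\<in>{-\<delta>..\<delta>}. \<phi> x t \<in> cball q (2 * R)) \<and>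
    (\<forall>x\<in>cball q R. \<forall>t\<in>{-\<delta>..\<delta>}. (\<phi> x has_vector_derivative X (\<phi> x t)) (at t within {-\<delta>..\<delta>})) \<and>
    (\<forall>x\<in>cball q R. \<forall>y\<in>cball q R. \<forall>t\<in>{-\<delta>..\<delta>}. norm (\<phi> x t - \<phi> y t) \<le> 2 * norm (x - y)) \<and>
    (\<forall>t\<in>{-\<delta>..\<delta>}. ((\<lambda>x. \<phi> x t) has_derivative blinfun_apply (A t)) (at q)) \<and>
    A 0 = id_blinfun \<and>
    (\<forall>v. ((\<lambda>t. A t v) has_vector_derivative fder X q v) (at 0 within {-\<delta>..\<delta>})) \<and>
    (\<forall>t\<in>{-\<delta>..\<delta>}. \<forall>v. norm (A t v - v) \<le> \<bar>t\<bar> / (2 * \<delta>) * norm v) \<and>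
    (\<forall>t\<in>{-\<delta>..\<delta>}. A t (X q) = X (\<phi> q t))"

lemma local_flowD:
  assumes "local_flow V X q R \<delta> \<phi> A"
  shows "R > 0" "\<delta> > 0" "cball q (2 * R) \<subseteq> V"
    "\<And>x. x \<in> cball q R \<Longrightarrow> \<phi> x 0 = x"
    "\<And>x t. x \<in> cball q R \<Longrightarrow> t \<in> {-\<delta>..\<delta>} \<Longrightarrow> \<phi> x t \<in> cball q (2 * R)"
    "\<And>x t. x \<in> cball q R \<Longrightarrow> t \<in> {-\<delta>..\<delta>} \<Longrightarrow> (\<phi> x has_vector_derivative X (\<phi> x t)) (at t within {-\<delta>..\<delta>})"
    "\<And>x y t. x \<in> cball q R \<Longrightarrow> y \<in> cball q R \<Longrightarrow> t \<in> {-\<delta>..\<delta>} \<Longrightarrow> norm (\<phi> x t - \<phi> y t) \<le> 2 * norm (x - y)"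
    "\<And>t. t \<in> {-\<delta>..\<delta>} \<Longrightarrow> ((\<lambda>x. \<phi> x t) has_derivative blinfun_apply (A t)) (at q)"
    "A 0 = id_blinfun"
    "\<And>v. ((\<lambda>t. A t v) has_vector_derivative fder X q v) (at 0 within {-\<delta>..\<delta>})"
    "\<And>t v. t \<in> {-\<delta>..\<delta>} \<Longrightarrow> norm (A t v - v) \<le> \<bar>t\<bar> / (2 * \<delta>) * norm v"
    "\<And>t. t \<in> {-\<delta>..\<delta>} \<Longrightarrow> A t (X q) = X (\<phi> q t)"
  using assms unfolding local_flow_def by blast+

lemma local_flow_exists:
  fixes X :: "'e::euclidean_space \<Rightarrow> 'e"
  assumes X: "smooth_on V X" and q: "q \<in> V" and \<rho>: "\<rho> > 0"
  obtains R \<delta> \<phi> A where "R \<le> \<rho>" "local_flow V X q R \<delta> \<phi> A"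
proof -
  obtain r where r: "r > 0" "cball q r \<subseteq> V"
    using smooth_onD(1)[OF X] q open_contains_cball by blast
  define R where "R = min \<rho> (r / 2)"
  have R: "R > 0" "R \<le> \<rho>" "cball q (2 * R) \<subseteq> V" using r \<rho> by (auto simp: R_def)
  let ?B = "cball q (2 * R)"
  obtain K where K: "K \<ge> 0" "\<And>x. x \<in> ?B \<Longrightarrow> norm (X x) \<le> K"
    "\<And>x v. x \<in> ?B \<Longrightarrow> norm (fder X x v) \<le> K * norm v"
    "\<And>x y. x \<in> ?B \<Longrightarrow> y \<in> ?B \<Longrightarrow> norm (X x - X y) \<le> K * norm (x - y)"
    using smooth_on_lipschitz[OF X R(3)] by metis
  obtain C where C: "C \<ge> 0"
    "\<And>x y. x \<in> ?B \<Longrightarrow> y \<in> ?B \<Longrightarrow> norm (X y - X x - fder X x (y - x)) \<le> C * (norm (y - x))\<^sup>2"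
    using smooth_on_taylor[OF X R(3)] by metis
  \<comment> \<open>The 1 in the minimum gives the contraction condition
    \<open>K * \<delta> \<le> 1/4\<close>; the \<open>R\<close> keeps orbits that start in the ball
    of radius \<open>R\<close> inside the ball of radius \<open>2 * R\<close>.\<close>
  define \<delta> where "\<delta> = min 1 R / (4 * (K + 1))"
  have \<delta>: "\<delta> > 0" using R(1) K(1) by (simp add: \<delta>_def add_nonneg_pos)
  have K4: "(K + 1) * \<delta> = min 1 R / 4" using K(1) by (simp add: \<delta>_def field_simps)
  have KD: "K * \<delta> \<le> 1/4" "K * \<delta> \<le> R" using K4 \<delta> R(1) by (auto simp: algebra_simps min_def split: if_splits)
  \<comment> \<open>Composition with the nearest point map makes the field globally Lipschitz, as
    \<open>picard\<close> requires. The orbits concerned never leave the ball, where nothing has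
    changed.\<close>
  define pr where "pr = closest_point ?B"
  have B: "closed ?B" "?B \<noteq> {}" "convex ?B" using R(1) by auto
  have pr: "pr x \<in> ?B" "x \<in> ?B \<Longrightarrow> pr x = x" "dist (pr x) (pr y) \<le> dist x y" for x y
    using closest_point_in_set[OF B(1,2)] closest_point_self closest_point_lipschitz[OF B(3,1,2)]
    unfolding pr_def by metis+
  define F where "F x = X (pr x)" for x
  have Flip: "norm (F x - F y) \<le> K * norm (x - y)" for x y
  proof -
    have "norm (F x - F y) \<le> K * norm (pr x - pr y)" unfolding F_def using K(4) pr(1) by blast
    also have "\<dots> \<le> K * norm (x - y)" using pr(3) K(1) by (intro mult_left_mono) (auto simp: dist_norm)
    finally show ?thesis .
  qed
  have Fcont: "continuous_on UNIV F"
    unfolding F_def pr_def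
    by (rule continuous_on_compose2[OF continuous_on_subset[OF smooth_onD(3)[OF X] R(3)]])
      (use continuous_on_closest_point[OF B(3,1,2)] closest_point_in_set[OF B(1,2)] in auto)
  have "\<exists>w. w 0 = x \<and> (\<forall>t\<in>{-\<delta>..\<delta>}. (w has_vector_derivative F (w t)) (at t within {-\<delta>..\<delta>}))" for x
  proof (rule picard[of \<delta> "\<lambda>s. F" K x])
    show "continuous_on ({-\<delta>..\<delta>} \<times> UNIV) (\<lambda>(s, y). F y)"
      unfolding split_beta by (rule continuous_on_compose2[OF Fcont]) (auto intro!: continuous_intros)
  qed (use \<delta> Flip K KD in auto)
  then obtain \<phi> where \<phi>0: "\<And>x. \<phi> x 0 = x"
    and \<phi>F: "\<And>x t. t \<in> {-\<delta>..\<delta>} \<Longrightarrow> (\<phi> x has_vector_derivative F (\<phi> x t)) (at t within {-\<delta>..\<delta>})"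
    by metis
  have \<phi>B: "\<phi> x t \<in> ?B" if "x \<in> cball q R" "t \<in> {-\<delta>..\<delta>}" for x t
  proof -
    have "norm (\<phi> x t - \<phi> x 0) \<le> K * \<bar>t - 0\<bar>"
      by (rule vector_derivative_bound[OF \<phi>F]) (use that \<delta> K(2) pr(1) in \<open>auto simp: F_def\<close>)
    also have "\<dots> \<le> K * \<delta>" using that K(1) by (intro mult_left_mono) auto
    also have "\<dots> \<le> R" using KD by simp
    finally have "dist x (\<phi> x t) \<le> R" by (simp add: \<phi>0 dist_norm norm_minus_commute)
    then show ?thesis using that dist_triangle[of q "\<phi> x t" x] by simp
  qed
  have \<phi>X: "(\<phi> x has_vector_derivative X (\<phi> x t)) (at t within {-\<delta>..\<delta>})"
    if "x \<in> cball q R" "t \<in> {-\<delta>..\<delta>}" for x t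
    using \<phi>F[OF that(2), of x] pr(2)[OF \<phi>B[OF that]] by (simp add: F_def)
  have lip2: "norm (\<phi> x t - \<phi> y t) \<le> 2 * norm (x - y)" if "t \<in> {-\<delta>..\<delta>}" for x y t
  proof -
    have "norm (\<phi> x t - \<phi> y t) \<le> 2 * (norm (\<phi> x 0 - \<phi> y 0) + 0 * \<delta>)"
      by (rule short_time_gronwall[of \<delta> _ "\<lambda>t. F (\<phi> x t) - F (\<phi> y t)" K])
        (use \<phi>F that \<delta> K KD Flip in \<open>auto intro!: has_vector_derivative_diff\<close>)
    then show ?thesis by (simp add: \<phi>0)
  qed
  have qR: "q \<in> cball q R" using R(1) by simp
  define D where "D t = Blinfun (fder X (\<phi> q t))" for t
  have \<phi>V: "\<phi> q t \<in> V" if "t \<in> {-\<delta>..\<delta>}" for t using \<phi>B[OF qR that] R(3) by blast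
  have Dv: "blinfun_apply (D t) = fder X (\<phi> q t)" if "t \<in> {-\<delta>..\<delta>}" for t
    unfolding D_def
    by (rule bounded_linear_Blinfun_apply)
      (use smooth_onD(5)[OF X \<phi>V[OF that]] has_derivative_bounded_linear in blast)
  have \<phi>c: "continuous_on {-\<delta>..\<delta>} (\<phi> q)"
    using \<phi>F has_vector_derivative_continuous unfolding continuous_on_eq_continuous_within by blast
  have Dc: "continuous_on {-\<delta>..\<delta>} D"
  proof (rule continuous_on_blinfun_componentwise)
    fix b :: 'e
    have "continuous_on {-\<delta>..\<delta>} (\<lambda>t. fder X (\<phi> q t) b)"
      by (rule continuous_on_compose2[OF smooth_onD(3)[OF smooth_on_fder[OF X, of b]] \<phi>c]) (use \<phi>V in auto)
    then show "continuous_on {-\<delta>..\<delta>} (\<lambda>t. D t b)"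
      by (rule continuous_on_eq) (use Dv in auto)
  qed
  have Dn: "norm (D t) \<le> K" if "t \<in> {-\<delta>..\<delta>}" for t
    by (rule norm_blinfun_bound[OF K(1)]) (use Dv[OF that] K(3)[OF \<phi>B[OF qR that]] in auto)
  \<comment> \<open>The linearised equation along the orbit of \<open>q\<close>, solved in the space
    of operators.\<close>
  obtain A :: "real \<Rightarrow> 'e \<Rightarrow>\<^sub>L 'e" where A0: "A 0 = id_blinfun"
    and Ad: "\<And>t. t \<in> {-\<delta>..\<delta>} \<Longrightarrow> (A has_vector_derivative D t o\<^sub>L A t) (at t within {-\<delta>..\<delta>})"
  proof (rule picard[of \<delta> "\<lambda>t A. D t o\<^sub>L A" K id_blinfun])
    show "continuous_on ({-\<delta>..\<delta>} \<times> UNIV) (\<lambda>(s, y). D s o\<^sub>L y)"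
      unfolding split_beta
      by (intro bounded_bilinear.continuous_on[OF bounded_bilinear_blinfun_compose]
          continuous_on_compose2[OF Dc] continuous_intros) auto
    show "norm ((D s o\<^sub>L y) - (D s o\<^sub>L z)) \<le> K * norm (y - z)" if "s \<in> {-\<delta>..\<delta>}" for s and y z :: "'e \<Rightarrow>\<^sub>L 'e"
    proof -
      have "(D s o\<^sub>L y) - (D s o\<^sub>L z) = D s o\<^sub>L (y - z)"
        by (simp add: bounded_bilinear.diff_right[OF bounded_bilinear_blinfun_compose])
      also have "norm \<dots> \<le> norm (D s) * norm (y - z)" by (rule norm_blinfun_compose)
      also have "\<dots> \<le> K * norm (y - z)" using Dn[OF that] by (intro mult_right_mono) auto
      finally show ?thesis .
    qed
  qed (use \<delta> K KD in auto)
  have Av: "((\<lambda>t. A t v) has_vector_derivative fder X (\<phi> q t) (A t v)) (at t within {-\<delta>..\<delta>})"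
    if "t \<in> {-\<delta>..\<delta>}" for t v
    using bounded_linear.has_vector_derivative[OF blinfun.bounded_linear_left Ad[OF that], of v]
    by (simp add: Dv[OF that])
  have Avn: "norm (A t v) \<le> 2 * norm v" if "t \<in> {-\<delta>..\<delta>}" for t v
  proof -
    have "norm (A t v) \<le> 2 * (norm (A 0 v) + 0 * \<delta>)"
      by (rule short_time_gronwall[OF Av]) (use that \<delta> K KD \<phi>B[OF qR] in auto)
    then show ?thesis by (simp add: A0)
  qed
  have Aid: "norm (A t v - v) \<le> \<bar>t\<bar> / (2 * \<delta>) * norm v" if t: "t \<in> {-\<delta>..\<delta>}" for t v
  proof -
    have "norm (A t v - A 0 v) \<le> K * (2 * norm v) * \<bar>t - 0\<bar>"
    proof (rule vector_derivative_bound[OF Av])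
      fix s assume s: "s \<in> {-\<delta>..\<delta>}"
      show "norm (fder X (\<phi> q s) (A s v)) \<le> K * (2 * norm v)"
        using K(3)[OF \<phi>B[OF qR s], of "A s v"] mult_left_mono[OF Avn[OF s, of v] K(1)] by linarith
    qed (use t \<delta> in auto)
    also have "\<dots> = K * (2 * norm v * \<bar>t\<bar>)" by simp
    also have "\<dots> \<le> 1 / (4 * \<delta>) * (2 * norm v * \<bar>t\<bar>)"
      using KD(1) \<delta> by (intro mult_right_mono) (auto simp: field_simps)
    also have "\<dots> = \<bar>t\<bar> / (2 * \<delta>) * norm v" using \<delta> by simp
    finally show ?thesis by (simp add: A0)
  qed
  \<comment> \<open>Both sides solve the linearised equation and agree at time 0, so Gronwall's
    estimate without error term makes their difference vanish.\<close>
  have AX: "A t (X q) = X (\<phi> q t)" if t: "t \<in> {-\<delta>..\<delta>}" for t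
  proof -
    let ?d = "\<lambda>t. A t (X q) - X (\<phi> q t)"
    have "norm (?d t) \<le> 2 * (norm (?d 0) + 0 * \<delta>)"
    proof (rule short_time_gronwall[of \<delta> _ "\<lambda>t. fder X (\<phi> q t) (?d t)" K])
      fix s assume s: "s \<in> {-\<delta>..\<delta>}"
      have "((X \<circ> \<phi> q) has_vector_derivative fder X (\<phi> q s) (X (\<phi> q s))) (at s within {-\<delta>..\<delta>})"
        using vector_derivative_diff_chain_within[OF \<phi>X[OF qR s] has_derivative_at_withinI[OF smooth_onD(5)[OF X \<phi>V[OF s]]]] .
      from has_vector_derivative_diff[OF Av[OF s] this]
      show "(?d has_vector_derivative fder X (\<phi> q s) (?d s)) (at s within {-\<delta>..\<delta>})"
        by (simp add: o_def fder_linear_arg[OF smooth_onD(4)[OF X \<phi>V[OF s]]])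
      show "norm (fder X (\<phi> q s) (?d s)) \<le> K * norm (?d s) + 0" using K(3)[OF \<phi>B[OF qR s]] by simp
    qed (use t \<delta> K KD in auto)
    then show ?thesis by (simp add: A0 \<phi>0)
  qed
  have Ader: "((\<lambda>x. \<phi> x t) has_derivative blinfun_apply (A t)) (at q)" if t: "t \<in> {-\<delta>..\<delta>}" for t
  proof -
    \<comment> \<open>The difference between the true and the linearised displacement satisfies a
      linear inequality whose forcing term is the Taylor remainder of \<open>X\<close>, quadratic in
      \<open>x - q\<close>.\<close>
    have est: "norm (\<phi> x t - \<phi> q t - A t (x - q)) \<le> (8 * C * \<delta> * norm (x - q)) * norm (x - q)" if x: "x \<in> cball q R" for x
    proof -
      let ?d = "\<lambda>t. \<phi> x t - \<phi> q t - A t (x - q)"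
      let ?e = "C * (2 * norm (x - q))\<^sup>2"
      have "norm (?d t) \<le> 2 * (norm (?d 0) + ?e * \<delta>)"
      proof (rule short_time_gronwall[of \<delta> _ "\<lambda>s. X (\<phi> x s) - X (\<phi> q s) - fder X (\<phi> q s) (A s (x - q))" K])
        fix s assume s: "s \<in> {-\<delta>..\<delta>}"
        show "(?d has_vector_derivative X (\<phi> x s) - X (\<phi> q s) - fder X (\<phi> q s) (A s (x - q))) (at s within {-\<delta>..\<delta>})"
          by (intro has_vector_derivative_diff \<phi>X x qR s Av)
        let ?r = "X (\<phi> x s) - X (\<phi> q s) - fder X (\<phi> q s) (\<phi> x s - \<phi> q s)"
        have eq: "X (\<phi> x s) - X (\<phi> q s) - fder X (\<phi> q s) (A s (x - q)) = ?r + fder X (\<phi> q s) (?d s)"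
          by (simp add: fder_linear_arg[OF smooth_onD(4)[OF X \<phi>V[OF s]]])
        have "norm ?r \<le> C * (norm (\<phi> x s - \<phi> q s))\<^sup>2" using C(2)[OF \<phi>B[OF qR s] \<phi>B[OF x s]] .
        moreover have "C * (norm (\<phi> x s - \<phi> q s))\<^sup>2 \<le> ?e"
          using lip2[OF s, of x q] C(1) by (intro mult_left_mono power_mono) auto
        moreover have "norm (fder X (\<phi> q s) (?d s)) \<le> K * norm (?d s)" using K(3)[OF \<phi>B[OF qR s]] .
        ultimately show "norm (X (\<phi> x s) - X (\<phi> q s) - fder X (\<phi> q s) (A s (x - q))) \<le> K * norm (?d s) + ?e"
          unfolding eq using norm_triangle_ineq[of ?r "fder X (\<phi> q s) (?d s)"] by linarith
      qed (use t \<delta> K KD C in auto)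
      then show ?thesis by (simp add: A0 \<phi>0 power2_eq_square mult_ac)
    qed
    show ?thesis unfolding has_derivative_at_alt
    proof (intro conjI allI impI)
      fix e :: real assume e: "e > 0"
      have pos: "8 * C * \<delta> + 1 > 0" using C(1) \<delta> by (simp add: add_nonneg_pos)
      show "\<exists>d>0. \<forall>y. norm (y - q) < d \<longrightarrow> norm (\<phi> y t - \<phi> q t - A t (y - q)) \<le> e * norm (y - q)"
      proof (intro exI[of _ "min R (e / (8 * C * \<delta> + 1))"] conjI allI impI)
        fix y assume y: "norm (y - q) < min R (e / (8 * C * \<delta> + 1))"
        have "(8 * C * \<delta> + 1) * norm (y - q) \<le> e" using y pos by (simp add: pos_less_divide_eq mult.commute)
        then have "8 * C * \<delta> * norm (y - q) \<le> e" using norm_ge_zero[of "y - q"] unfolding distrib_right by linarith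
        moreover have "y \<in> cball q R" using y by (simp add: dist_norm norm_minus_commute)
        ultimately show "norm (\<phi> y t - \<phi> q t - A t (y - q)) \<le> e * norm (y - q)"
          using est[of y] mult_right_mono[of "8 * C * \<delta> * norm (y - q)" e "norm (y - q)"]
          by (meson norm_ge_zero order_trans)
      qed (use R(1) e pos in auto)
    qed (simp add: blinfun.bounded_linear_right)
  qed
  have A0d: "((\<lambda>t. A t v) has_vector_derivative fder X q v) (at 0 within {-\<delta>..\<delta>})" for v
    using Av[of 0 v] \<delta> by (simp add: \<phi>0 A0)
  show ?thesis
    by (rule that[of R \<delta> \<phi> A, OF R(2)], unfold local_flow_def)
      (intro conjI ballI allI R(1) \<delta> R(3) \<phi>0 \<phi>B \<phi>X lip2 Ader A0 A0d Aid AX)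
qed

section \<open>Exterior normals and invariant sets\<close>

definition exterior_normal :: "'e::euclidean_space set \<Rightarrow> 'e \<Rightarrow> 'e \<Rightarrow> bool" where
  "exterior_normal S p \<nu> \<longleftrightarrow> p \<in> S \<and> ball (p + \<nu>) (norm \<nu>) \<inter> S = {}"

text \<open>The squared distance from \<open>x\<close> to the centre of the ball is expanded,
  whereupon the squared radius cancels.\<close>

lemma exterior_normal_iff:
  "exterior_normal S p \<nu> \<longleftrightarrow> p \<in> S \<and> (\<forall>x\<in>S. 2 * (\<nu> \<bullet> (x - p)) \<le> (norm (x - p))\<^sup>2)"
proof -
  have "x \<notin> ball (p + \<nu>) (norm \<nu>) \<longleftrightarrow> 2 * (\<nu> \<bullet> (x - p)) \<le> (norm (x - p))\<^sup>2" for x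
  proof -
    have "x \<notin> ball (p + \<nu>) (norm \<nu>) \<longleftrightarrow> norm \<nu> \<le> norm ((x - p) - \<nu>)"
      by (simp add: dist_norm norm_minus_commute algebra_simps not_less)
    also have "\<dots> \<longleftrightarrow> (norm \<nu>)\<^sup>2 \<le> (norm ((x - p) - \<nu>))\<^sup>2" by (simp add: power2_le_iff_abs_le)
    also have "\<dots> \<longleftrightarrow> 2 * (\<nu> \<bullet> (x - p)) \<le> (norm (x - p))\<^sup>2"
      unfolding power2_norm_eq_inner by (auto simp: inner_diff inner_commute algebra_simps)
    finally show ?thesis .
  qed
  then show ?thesis unfolding exterior_normal_def disjoint_iff by blast
qed

lemma exterior_normal_scaleR:
  assumes "exterior_normal S p \<nu>" "0 \<le> c" "c \<le> 1"
  shows "exterior_normal S p (c *\<^sub>R \<nu>)"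
proof -
  have "2 * ((c *\<^sub>R \<nu>) \<bullet> (x - p)) \<le> (norm (x - p))\<^sup>2" if "x \<in> S" for x
  proof -
    have "2 * ((c *\<^sub>R \<nu>) \<bullet> (x - p)) = c * (2 * (\<nu> \<bullet> (x - p)))" by simp
    also have "\<dots> \<le> c * (norm (x - p))\<^sup>2"
      using assms that by (intro mult_left_mono) (auto simp: exterior_normal_iff)
    also have "\<dots> \<le> 1 * (norm (x - p))\<^sup>2" using assms by (intro mult_right_mono) auto
    finally show ?thesis by simp
  qed
  then show ?thesis using assms by (simp add: exterior_normal_iff)
qed

lemma decreases_right:
  assumes "(f has_real_derivative l) (at t within {a..b})" "l < 0" "t \<in> {a..<b}" "f t \<le> 0"
  shows "\<exists>e>0. \<forall>s. t < s \<and> s < t + e \<and> s \<le> b \<longrightarrow> f s < 0"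
proof -
  obtain d where d: "0 < d" "\<And>h. 0 < h \<Longrightarrow> t + h \<in> {a..b} \<Longrightarrow> h < d \<Longrightarrow> f (t + h) < f t"
    using has_real_derivative_neg_dec_right[OF assms(1,2)] by blast
  show ?thesis
  proof (intro exI[of _ d] conjI allI impI)
    fix s assume "t < s \<and> s < t + d \<and> s \<le> b"
    then show "f s < 0" using d(2)[of "s - t"] assms by auto
  qed (use d in auto)
qed

text \<open>Nagumo's theorem with an error term. At the first exit time \<open>t\<^sub>0\<close> from the region where the
  distance to \<open>S\<close> is below a slightly larger bound, the distance is compared with the distance to
  a fixed nearest point.\<close>

lemma approximate_invariance:
  fixes S :: "'e::euclidean_space set"
  assumes S: "closed (S \<inter> cball q R)" and R: "0 < R"
    and lip: "\<And>x y. x \<in> cball q R \<Longrightarrow> y \<in> cball q R \<Longrightarrow> norm (V x - V y) \<le> K * norm (x - y)"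
    and K: "0 \<le> K" "K * T \<le> 1/4" and T: "0 < T"
    and nrm: "\<And>p \<nu>. p \<in> ball q R \<Longrightarrow> exterior_normal S p \<nu> \<Longrightarrow> V p \<bullet> \<nu> \<le> 0"
    and \<beta>: "\<And>t. t \<in> {0..T} \<Longrightarrow> (\<beta> has_vector_derivative \<beta>' t) (at t within {0..T})"
    and e: "\<And>t. t \<in> {0..T} \<Longrightarrow> norm (\<beta>' t - V (\<beta> t)) \<le> e"
    and in_ball: "\<And>t. t \<in> {0..T} \<Longrightarrow> \<beta> t \<in> cball q (R / 4)" and start: "\<beta> 0 \<in> S" and t: "t \<in> {0..T}"
  shows "infdist (\<beta> t) (S \<inter> cball q R) \<le> 3 * T * e"
proof -
  define C where "C = S \<inter> cball q R"
  have C: "closed C" "C \<noteq> {}" "\<beta> 0 \<in> C"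
    using S in_ball[of 0] start T R by (auto simp: C_def)
  have e0: "e \<ge> 0" using e[of 0] T by (smt (verit) atLeastAtMost_iff norm_ge_zero)
  define D where "D t = infdist (\<beta> t) C" for t
  have \<beta>c: "continuous_on {0..T} \<beta>"
    using \<beta> has_vector_derivative_continuous unfolding continuous_on_eq_continuous_within by blast
  have Dc: "continuous_on {0..T} D" unfolding D_def using \<beta>c by (intro continuous_intros)
  have main: "D t \<le> (e + \<epsilon>) * (2 * t + T)" if \<epsilon>: "\<epsilon> > 0" and t: "t \<in> {0..T}" for \<epsilon> t
  proof (rule ccontr)
    assume "\<not> ?thesis"
    then have neg: "D t > (e + \<epsilon>) * (2 * t + T)" by simp
    \<comment> \<open>This bound is positive already at time 0 and has slope
      \<open>2 * (e + \<epsilon>)\<close>. It stays below \<open>3 * T * (e + \<epsilon>)\<close>,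
      so by \<open>K * T \<le> 1/4\<close> the distance can grow at the exit time at most at the
      rate e + 3/4 * (e + \<epsilon>), which is strictly less than the slope.\<close>
    define b where "b t = (e + \<epsilon>) * (2 * t + T)" for t
    define Z where "Z = {s \<in> {0..t}. D s \<le> b s}"
    have bc: "continuous_on {0..T} b" unfolding b_def by (intro continuous_intros)
    have Zc: "compact Z"
    proof -
      have "continuous_on {0..t} (\<lambda>s. D s - b s)"
        using t by (intro continuous_on_diff continuous_on_subset[OF Dc] continuous_on_subset[OF bc]) auto
      from continuous_closed_preimage[OF this closed_atLeastAtMost, of "{..0}"]
      have "closed ({0..t} \<inter> (\<lambda>s. D s - b s) -` {..0})" by simp
      moreover have "Z = {0..t} \<inter> (\<lambda>s. D s - b s) -` {..0}" by (auto simp: Z_def)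
      moreover have "bounded Z" by (rule bounded_subset[OF bounded_closed_interval[of 0 t]]) (auto simp: Z_def)
      ultimately show ?thesis by (simp add: compact_eq_bounded_closed)
    qed
    have "0 \<in> Z" using C(3) e0 \<epsilon> T t by (auto simp: Z_def D_def b_def)
    then obtain t0 where t0: "t0 \<in> Z" "\<And>s. s \<in> Z \<Longrightarrow> s \<le> t0"
      using compact_attains_sup[OF Zc] by auto
    have t0t: "0 \<le> t0" "t0 < t" "t0 \<in> {0..<T}" "t0 \<in> {0..T}"
      using t0(1) neg t by (auto simp: Z_def b_def less_le)
    have out: "D s > b s" if "t0 < s" "s \<le> t" for s
      using t0(2)[of s] that t0t by (fastforce simp: Z_def)
    have b0: "b t0 > 0" using e0 \<epsilon> T t0t by (simp add: b_def add_nonneg_pos)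
    obtain p where p: "p \<in> C" "D t0 = dist (\<beta> t0) p"
      unfolding D_def using infdist_attains_inf[OF C(1,2)] by metis
    \<comment> \<open>The distance to the set need not be differentiable. The distance to the
      nearest point \<open>p\<close>, held fixed, dominates it with equality at \<open>t0\<close>,
      and its square is differentiable.\<close>
    define n where "n s = (\<beta> s - p) \<bullet> (\<beta> s - p) - b s * b s" for s
    have n_eq: "n s = (norm (\<beta> s - p))\<^sup>2 - (b s)\<^sup>2" for s
      by (simp only: n_def power2_norm_eq_inner power2_eq_square[of "b s"])
    have "n t0 \<le> 0"
      using p(2) t0(1) b0 by (auto simp: n_eq Z_def dist_norm intro!: power_mono)
    define \<nu> where "\<nu> = \<beta> t0 - p"
    have \<nu>D: "norm \<nu> = D t0" using p by (simp add: \<nu>_def dist_norm)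
    have D_le: "D t0 \<le> b t0" "0 \<le> D t0" using t0(1) by (auto simp: Z_def D_def infdist_nonneg)
    have "D t0 \<le> dist (\<beta> t0) (\<beta> 0)" unfolding D_def using C(3) by (rule infdist_le)
    also have "\<dots> \<le> dist (\<beta> t0) q + dist q (\<beta> 0)" by (rule dist_triangle)
    also have "\<dots> \<le> R/2" using in_ball[OF t0t(4)] in_ball[of 0] T by (auto simp: dist_commute)
    finally have DR: "D t0 \<le> R/2" .
    have pq: "dist q p < R"
      using dist_triangle[of q p "\<beta> t0"] DR p(2) in_ball[OF t0t(4)] R by auto
    \<comment> \<open>The ball about \<open>\<beta> t0\<close> has radius at most \<open>R/2\<close>
      and lies in \<open>cball q R\<close>, so it misses all of \<open>S\<close> and not just the
      part that defines \<open>D\<close>.\<close>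
    have ext: "exterior_normal S p \<nu>" unfolding exterior_normal_def
    proof
      show "p \<in> S" using p by (simp add: C_def)
      show "ball (p + \<nu>) (norm \<nu>) \<inter> S = {}"
      proof (rule ccontr)
        assume "ball (p + \<nu>) (norm \<nu>) \<inter> S \<noteq> {}"
        then obtain x where x: "x \<in> S" "dist (\<beta> t0) x < D t0" by (auto simp: \<nu>_def \<nu>D[unfolded \<nu>_def])
        then have "dist q x \<le> R"
          using dist_triangle[of q x "\<beta> t0"] DR in_ball[OF t0t(4)] R by auto
        then have "D t0 \<le> dist (\<beta> t0) x" unfolding D_def using x by (intro infdist_le) (simp add: C_def)
        then show False using x by simp
      qed
    qed
    have "V p \<bullet> \<nu> \<le> 0" using nrm[OF _ ext] pq by simp
    moreover have "(V (\<beta> t0) - V p) \<bullet> \<nu> \<le> K * (norm \<nu> * norm \<nu>)"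
    proof -
      have "(V (\<beta> t0) - V p) \<bullet> \<nu> \<le> norm (V (\<beta> t0) - V p) * norm \<nu>" by (rule norm_cauchy_schwarz)
      also have "\<dots> \<le> K * norm \<nu> * norm \<nu>"
        unfolding \<nu>_def using lip[of "\<beta> t0" p] in_ball[OF t0t(4)] pq R by (intro mult_right_mono) auto
      finally show ?thesis by (simp add: mult_ac)
    qed
    moreover have "(\<beta>' t0 - V (\<beta> t0)) \<bullet> \<nu> \<le> e * norm \<nu>"
      using norm_cauchy_schwarz[of "\<beta>' t0 - V (\<beta> t0)" \<nu>] mult_right_mono[OF e[OF t0t(4)], of "norm \<nu>"] by simp
    ultimately have "\<beta>' t0 \<bullet> \<nu> \<le> e * norm \<nu> + K * (norm \<nu> * norm \<nu>)" by (simp add: inner_diff_left)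
    also have "\<dots> \<le> e * b t0 + K * (b t0 * b t0)"
      using D_le \<nu>D e0 K b0 by (intro add_mono mult_left_mono mult_mono) auto
    also have "\<dots> = b t0 * (e + K * b t0)" by (simp add: algebra_simps)
    also have "\<dots> < b t0 * (2 * (e + \<epsilon>))"
    proof (rule mult_strict_left_mono[OF _ b0])
      have "K * b t0 = (e + \<epsilon>) * (2 * (K * t0) + K * T)" by (simp add: b_def algebra_simps)
      also have "\<dots> \<le> (e + \<epsilon>) * (3/4)"
        using K mult_left_mono[of t0 T K] t0t e0 \<epsilon> by (intro mult_left_mono) auto
      finally show "e + K * b t0 < 2 * (e + \<epsilon>)" using \<epsilon> e0 by (simp add: algebra_simps)
    qed
    finally have lt: "2 * (\<beta>' t0 \<bullet> \<nu>) - 2 * b t0 * (2 * (e + \<epsilon>)) < 0" by simp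
    have "((\<lambda>s. (\<beta> s - p) \<bullet> (\<beta> s - p) - b s * b s) has_vector_derivative
        (\<beta> t0 - p) \<bullet> \<beta>' t0 + \<beta>' t0 \<bullet> (\<beta> t0 - p) - (b t0 * (2 * (e + \<epsilon>)) + (2 * (e + \<epsilon>)) * b t0)) (at t0 within {0..T})"
    proof (intro has_vector_derivative_diff bounded_bilinear.has_vector_derivative[OF bounded_bilinear_inner]
        bounded_bilinear.has_vector_derivative[OF bounded_bilinear_mult])
      show 1: "((\<lambda>s. \<beta> s - p) has_vector_derivative \<beta>' t0) (at t0 within {0..T})"
        using has_vector_derivative_diff[OF \<beta>[OF t0t(4)] has_vector_derivative_const[of p]] by simp
      then show "((\<lambda>s. \<beta> s - p) has_vector_derivative \<beta>' t0) (at t0 within {0..T})" .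
      show 2: "(b has_vector_derivative 2 * (e + \<epsilon>)) (at t0 within {0..T})"
        unfolding b_def by (auto intro!: derivative_eq_intros simp: has_real_derivative_iff_has_vector_derivative[symmetric])
      then show "(b has_vector_derivative 2 * (e + \<epsilon>)) (at t0 within {0..T})" .
    qed
    then have "(n has_real_derivative 2 * (\<beta>' t0 \<bullet> \<nu>) - 2 * b t0 * (2 * (e + \<epsilon>))) (at t0 within {0..T})"
      unfolding n_def has_real_derivative_iff_has_vector_derivative \<nu>_def
      by (rule has_vector_derivative_eq_rhs) (simp add: inner_commute algebra_simps)
    from decreases_right[OF this lt t0t(3) \<open>n t0 \<le> 0\<close>]
    obtain d where d: "d > 0" "\<And>s. t0 < s \<Longrightarrow> s < t0 + d \<Longrightarrow> s \<le> T \<Longrightarrow> n s < 0" by blast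
    define s where "s = min t (t0 + d/2)"
    have s: "t0 < s" "s \<le> t" "s < t0 + d" "s \<le> T" using d t0t t by (auto simp: s_def)
    have "(norm (\<beta> s - p))\<^sup>2 < (b s)\<^sup>2" using d(2)[OF s(1,3,4)] by (simp add: n_eq)
    moreover have "b s \<ge> 0" using s t0t e0 \<epsilon> T by (simp add: b_def)
    ultimately have "norm (\<beta> s - p) < b s" by (rule power2_less_imp_less)
    moreover have "D s \<le> dist (\<beta> s) p" unfolding D_def using p(1) by (rule infdist_le)
    ultimately show False using out[OF s(1,2)] by (simp add: dist_norm)
  qed
  have "D t \<le> 3 * T * e + \<epsilon>" if \<epsilon>: "\<epsilon> > 0" for \<epsilon>
  proof -
    have "D t \<le> (e + \<epsilon> / (3 * T)) * (2 * t + T)" using main[of "\<epsilon> / (3 * T)"] \<epsilon> T t by simp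
    also have "\<dots> \<le> (e + \<epsilon> / (3 * T)) * (3 * T)" using t T e0 \<epsilon> by (intro mult_left_mono) auto
    also have "\<dots> = 3 * T * e + \<epsilon>" using T by (simp add: field_simps)
    finally show ?thesis .
  qed
  then show ?thesis unfolding D_def C_def[symmetric] by (rule field_le_epsilon)
qed

lemma invariance:
  fixes S :: "'e::euclidean_space set"
  assumes "closed (S \<inter> cball q R)" "0 < R"
    and "\<And>x y. x \<in> cball q R \<Longrightarrow> y \<in> cball q R \<Longrightarrow> norm (V x - V y) \<le> K * norm (x - y)"
    and "0 \<le> K" "K * T \<le> 1/4" "0 < T"
    and "\<And>p \<nu>. p \<in> ball q R \<Longrightarrow> exterior_normal S p \<nu> \<Longrightarrow> V p \<bullet> \<nu> \<le> 0"
    and "\<And>t. t \<in> {0..T} \<Longrightarrow> (\<beta> has_vector_derivative V (\<beta> t)) (at t within {0..T})"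
    and "\<And>t. t \<in> {0..T} \<Longrightarrow> \<beta> t \<in> cball q (R / 4)" "\<beta> 0 \<in> S" "t \<in> {0..T}"
  shows "\<beta> t \<in> S"
proof -
  have "infdist (\<beta> t) (S \<inter> cball q R) \<le> 3 * T * 0"
    by (rule approximate_invariance[OF assms(1-8) _ assms(9-11)]) auto
  then have "infdist (\<beta> t) (S \<inter> cball q R) = 0" using infdist_nonneg[of "\<beta> t" "S \<inter> cball q R"] by linarith
  moreover have "S \<inter> cball q R \<noteq> {}" using assms(9)[of 0] assms(2,6,10) by auto
  ultimately show ?thesis using in_closed_iff_infdist_zero[OF assms(1)] by blast
qed

section \<open>Hopf's lemma for degenerate elliptic operators\<close>

text \<open>A small multiple of \<open>H\<close> pushes the maximum off \<open>B\<close>: on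
  \<open>B\<close> either \<open>U\<close> has a strict gap or \<open>H\<close> itself is negative,
  while the value at \<open>z0\<close> remains 0. It is applied to a ball with its sphere and to the
  product of a ball with a parameter box.\<close>

lemma contact_point:
  fixes U H :: "'z::topological_space \<Rightarrow> real"
  assumes K: "compact K" and B: "compact B" "B \<subseteq> K"
    and cont: "continuous_on K U" "continuous_on K H"
    and z0: "z0 \<in> K" "U z0 = 0" "H z0 = 0" and U: "\<And>z. z \<in> B \<Longrightarrow> U z \<le> 0"
    and neg: "\<And>z. z \<in> B \<Longrightarrow> 0 \<le> H z \<Longrightarrow> U z < 0"
  obtains \<epsilon> z where "\<epsilon> > 0" "z \<in> K - B" "\<And>w. w \<in> K \<Longrightarrow> U w + \<epsilon> * H w \<le> U z + \<epsilon> * H z"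
proof -
  obtain zM where zM: "zM \<in> K" "\<And>z. z \<in> K \<Longrightarrow> H z \<le> H zM"
    using continuous_attains_sup[OF K _ cont(2)] z0 by blast
  define M where "M = H zM + 1"
  have M: "M > 0" "\<And>z. z \<in> K \<Longrightarrow> H z < M"
    using zM z0 by (force simp: M_def)+
  have cU: "continuous_on B U" and cH: "continuous_on B H"
    using cont B continuous_on_subset by blast+
  have "\<exists>\<epsilon>>0. \<forall>z\<in>B. U z + \<epsilon> * H z < 0"
  proof (cases "B = {}")
    case False
    text \<open>On \<open>B\<close> either \<open>U\<close> or \<open>H\<close> is negative; a uniform gap exists by compactness.\<close>
    have "continuous_on B (\<lambda>z. min (- U z) 1 + max (- H z) 0)"
      using cU cH by (intro continuous_intros)
    from continuous_attains_inf[OF B(1) False this] obtain b where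
      b: "b \<in> B" "\<And>z. z \<in> B \<Longrightarrow> min (- U b) 1 + max (- H b) 0 \<le> min (- U z) 1 + max (- H z) 0" by auto
    define g where "g = min (- U b) 1 + max (- H b) 0"
    have g: "g > 0" using neg[OF b(1)] U[OF b(1)] by (cases "0 \<le> H b") (auto simp: g_def)
    define \<epsilon> where "\<epsilon> = g / (2 * M + 2 * g + 1) "
    have e: "\<epsilon> > 0" "\<epsilon> * M < g / 2" "\<epsilon> < 1/2"
      using g M(1) by (auto simp: \<epsilon>_def field_simps add_pos_pos)
    have "U z + \<epsilon> * H z < 0" if z: "z \<in> B" for z
    proof (cases "0 \<le> H z")
      case True
      have "g \<le> - U z" using b(2)[OF z] True by (simp add: g_def)
      moreover have "\<epsilon> * H z \<le> \<epsilon> * M" using M(2)[of z] B z e by (intro mult_left_mono) auto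
      ultimately show ?thesis using e g by linarith
    next
      case False
      then have "\<epsilon> * H z < 0" using e by (simp add: mult_pos_neg)
      then show ?thesis using U[OF z] by linarith
    qed
    then show ?thesis using e by blast
  qed (use zero_less_one in blast)
  then obtain \<epsilon> where e: "\<epsilon> > 0" "\<And>z. z \<in> B \<Longrightarrow> U z + \<epsilon> * H z < 0" by blast
  have "continuous_on K (\<lambda>z. U z + \<epsilon> * H z)" using cont by (intro continuous_intros)
  from continuous_attains_sup[OF K _ this] obtain z where
    z: "z \<in> K" "\<And>w. w \<in> K \<Longrightarrow> U w + \<epsilon> * H w \<le> U z + \<epsilon> * H z" using z0 by blast
  have "z \<notin> B" using e(2)[of z] z(2)[OF z0(1)] z0 by force
  then show ?thesis using that e z by blast
qed

lemma second_derivative_test: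
  fixes g :: "real \<Rightarrow> real"
  assumes \<delta>: "0 < \<delta>" and g: "\<And>s. s \<in> {-\<delta>..\<delta>} \<Longrightarrow> (g has_real_derivative g' s) (at s within {-\<delta>..\<delta>})"
    and g2: "(g' has_real_derivative g2) (at 0 within {-\<delta>..\<delta>})"
    and max: "\<And>s. s \<in> {-\<delta>..\<delta>} \<Longrightarrow> g s \<le> g 0"
  shows "g' 0 = 0" "g2 \<le> 0"
proof -
  have int: "at s within {-\<delta>..\<delta>} = at s" if "-\<delta> < s" "s < \<delta>" for s
    using that by (intro at_within_interior) (simp add: interior_atLeastAtMost_real)
  have d: "(g has_real_derivative g' s) (at s)" if "-\<delta> < s" "s < \<delta>" for s
    using g[of s] int[OF that] that by simp
  show g0: "g' 0 = 0"
  proof (rule DERIV_local_max[OF d[of 0] \<delta>])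
    show "\<forall>y. \<bar>0 - y\<bar> < \<delta> \<longrightarrow> g y \<le> g 0" by (intro allI impI max) auto
  qed (use \<delta> in auto)
  show "g2 \<le> 0"
  proof (rule ccontr)
    assume "\<not> g2 \<le> 0"
    then have "(g' has_real_derivative g2) (at 0)" "0 < g2" using g2 int[of 0] \<delta> by auto
    from DERIV_pos_inc_right[OF this] g0 obtain d where
      e: "d > 0" "\<And>h. 0 < h \<Longrightarrow> h < d \<Longrightarrow> 0 < g' h" by auto
    define h where "h = min (d/2) (\<delta>/2)"
    have h: "0 < h" "h < d" "h < \<delta>" using e \<delta> by (auto simp: h_def)
    obtain z where z: "0 < z" "z < h" "g h - g 0 = (h - 0) * g' z"
      using MVT2[OF h(1), of g g'] d h \<delta> by force
    have "0 < h * g' z" using e(2)[of z] z h by simp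
    then show False using z max[of h] h \<delta> by simp
  qed
qed

lemma integral_curve:
  fixes X :: "'e::euclidean_space \<Rightarrow> 'e"
  assumes X: "smooth_on V X" and x: "x \<in> V" and \<rho>: "\<rho> > 0"
  obtains \<delta> \<gamma> where "\<delta> > 0" "\<gamma> 0 = x" "\<And>t. t \<in> {-\<delta>..\<delta>} \<Longrightarrow> \<gamma> t \<in> V \<and> \<gamma> t \<in> cball x \<rho>"
    "\<And>t. t \<in> {-\<delta>..\<delta>} \<Longrightarrow> (\<gamma> has_vector_derivative X (\<gamma> t)) (at t within {-\<delta>..\<delta>})"
proof -
  obtain R \<delta> \<phi> A where R: "R \<le> \<rho>/2" "local_flow V X x R \<delta> \<phi> A"
    using local_flow_exists[OF X x half_gt_zero[OF \<rho>]] .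
  note f = local_flowD[OF R(2)]
  have xR: "x \<in> cball x R" using f(1) by simp
  show ?thesis
  proof (rule that[OF f(2) f(4)[OF xR] _ f(6)[OF xR]])
    fix t assume "t \<in> {-\<delta>..\<delta>}"
    from f(5)[OF xR this] R(1) f(3) show "\<phi> x t \<in> V \<and> \<phi> x t \<in> cball x \<rho>" by auto
  qed
qed

lemma derivative_along_curve:
  assumes "smooth_on V u" "\<gamma> t \<in> V" "(\<gamma> has_vector_derivative v) (at t within T)"
  shows "((\<lambda>t. u (\<gamma> t)) has_vector_derivative fder u (\<gamma> t) v) (at t within T)"
  using vector_derivative_diff_chain_within[OF assms(3) has_derivative_at_withinI[OF smooth_onD(5)[OF assms(1,2)]]]
  by (simp add: o_def)

text \<open>Along an integral curve of \<open>X\<close> the first two derivatives of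
  \<open>w\<close> are exactly X w and X (X w), with all lower order terms included, so the test in
  one variable applies and no Hessian is written out.\<close>

lemma interior_max_derivatives:
  fixes w :: "'e::euclidean_space \<Rightarrow> real"
  assumes w: "smooth_on V w" and X: "smooth_on V X" and x: "x \<in> V" and r: "r > 0"
    and max: "\<And>y. y \<in> cball x r \<Longrightarrow> w y \<le> w x"
  shows "fder w x (X x) = 0" "fder (\<lambda>y. fder w y (X y)) x (X x) \<le> 0"
proof -
  obtain \<delta> \<gamma> where g: "\<delta> > 0" "\<gamma> 0 = x" "\<And>t. t \<in> {-\<delta>..\<delta>} \<Longrightarrow> \<gamma> t \<in> V \<and> \<gamma> t \<in> cball x r"
    "\<And>t. t \<in> {-\<delta>..\<delta>} \<Longrightarrow> (\<gamma> has_vector_derivative X (\<gamma> t)) (at t within {-\<delta>..\<delta>})"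
    using integral_curve[OF X x r] by metis
  have 0: "0 \<in> {-\<delta>..\<delta>}" using g(1) by simp
  have 1: "((\<lambda>t. w (\<gamma> t)) has_real_derivative fder w (\<gamma> s) (X (\<gamma> s))) (at s within {-\<delta>..\<delta>})"
    if "s \<in> {-\<delta>..\<delta>}" for s
    using derivative_along_curve[where \<gamma>=\<gamma>, OF w _ g(4)[OF that]] g(3)[OF that]
    by (simp add: has_real_derivative_iff_has_vector_derivative)
  have 2: "((\<lambda>t. fder w (\<gamma> t) (X (\<gamma> t))) has_real_derivative fder (\<lambda>y. fder w y (X y)) (\<gamma> 0) (X (\<gamma> 0))) (at 0 within {-\<delta>..\<delta>})"
    using derivative_along_curve[where \<gamma>=\<gamma>, OF smooth_on_fder_field[OF w X] _ g(4)[OF 0]] g(3)[OF 0]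
    by (simp add: has_real_derivative_iff_has_vector_derivative)
  have 3: "w (\<gamma> s) \<le> w (\<gamma> 0)" if "s \<in> {-\<delta>..\<delta>}" for s using max g(3)[OF that] g(2) by simp
  from second_derivative_test[OF g(1) 1 2 3] show "fder w x (X x) = 0" "fder (\<lambda>y. fder w y (X y)) x (X x) \<le> 0"
    by (simp_all add: g(2))
qed

text \<open>The drift stands on the same side as the squares: in the application \<open>u\<close> is
  Re f - 1, \<open>F\<close> lists the fields \<open>X j\<close> and \<open>Y j\<close>, and
  \<open>F0\<close> is \<open>- X0\<close>.\<close>

locale degenerate_elliptic =
  fixes V :: "'e::euclidean_space set" and u :: "'e \<Rightarrow> real" and m :: nat
    and F :: "nat \<Rightarrow> 'e \<Rightarrow> 'e" and F0 :: "'e \<Rightarrow> 'e"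
  assumes smooth_u: "smooth_on V u" and smooth_F: "\<And>j. j < m \<Longrightarrow> smooth_on V (F j)"
    and smooth_F0: "smooth_on V F0" and nonpos: "\<And>x. x \<in> V \<Longrightarrow> u x \<le> 0"
    and equation: "\<And>x. x \<in> V \<Longrightarrow> (\<Sum>j<m. fder (\<lambda>y. fder u y (F j y)) x (F j x)) + fder u x (F0 x) = 0"
begin

definition max_set where "max_set = {x \<in> V. u x = 0}"

text \<open>Positive exactly on the open ball with diameter from \<open>p\<close> to
  \<open>p + \<nu>\<close>. This ball lies inside the exterior ball and touches its boundary only at
  \<open>p\<close>; the gradient at \<open>p\<close> is \<open>\<nu>\<close>.\<close>

definition bump :: "'e \<Rightarrow> 'e \<Rightarrow> 'e \<Rightarrow> real" where
  "bump p \<nu> x = \<nu> \<bullet> (x - p) - (x - p) \<bullet> (x - p)"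

lemma smooth_bump: "open W \<Longrightarrow> smooth_on W (bump p \<nu>)"
  unfolding bump_def by (intro smooth_on_diff smooth_on_inner smooth_on_const smooth_on_id)

lemma fder_bump: "fder (bump p \<nu>) x v = (\<nu> - 2 *\<^sub>R (x - p)) \<bullet> v"
proof -
  have "(bump p \<nu> has_derivative (\<lambda>v. (\<nu> - 2 *\<^sub>R (x - p)) \<bullet> v)) (at x)"
    unfolding bump_def
    by (auto intro!: derivative_eq_intros simp: fun_eq_iff inner_diff_left inner_diff_right inner_commute algebra_simps)
  from fder_eq[OF this] show ?thesis by simp
qed

lemma bump_max_set:
  assumes "exterior_normal max_set p \<nu>" "x \<in> max_set"
  shows "bump p \<nu> x \<le> - (1/2) * (norm (x - p))\<^sup>2"
proof -
  have "2 * (\<nu> \<bullet> (x - p)) \<le> (norm (x - p))\<^sup>2" using assms by (simp add: exterior_normal_iff)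
  then show ?thesis by (simp add: bump_def power2_norm_eq_inner)
qed

text \<open>For small \<open>\<epsilon>\<close> the function \<open>u + \<epsilon> b\<close> has a
  maximum inside the ball. There every square is nonpositive and the drift vanishes, although the
  operator applied to this function equals \<open>\<epsilon>\<close> times a positive
  number.\<close>

lemma no_strict_barrier:
  fixes b :: "'e \<Rightarrow> real"
  assumes b: "smooth_on V b" and p: "p \<in> max_set" "b p = 0"
    and r: "r > 0" "cball p r \<subseteq> V" and sep: "\<And>x. x \<in> max_set \<Longrightarrow> x \<in> sphere p r \<Longrightarrow> b x < 0"
    and pos: "\<And>x. x \<in> cball p r \<Longrightarrow> 0 < (\<Sum>j<m. fder (\<lambda>y. fder b y (F j y)) x (F j x)) + fder b x (F0 x)"
  shows False
proof -
  have V: "open V" using smooth_onD(1)[OF smooth_u] .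
  obtain \<epsilon> x where e: "\<epsilon> > 0" and x: "x \<in> cball p r - sphere p r"
    and max: "\<And>y. y \<in> cball p r \<Longrightarrow> u y + \<epsilon> * b y \<le> u x + \<epsilon> * b x"
  proof (rule contact_point[of "cball p r" "sphere p r" u b p])
    show "continuous_on (cball p r) u" "continuous_on (cball p r) b"
      using smooth_onD(3)[OF smooth_u] smooth_onD(3)[OF b] r continuous_on_subset by blast+
    fix z assume z: "z \<in> sphere p r"
    then have zV: "z \<in> V" using r by auto
    then show "u z \<le> 0" using nonpos by blast
    assume "0 \<le> b z"
    then show "u z < 0" using sep[OF _ z] zV nonpos[OF zV] by (force simp: max_set_def)
  qed (use p r in \<open>auto simp: max_set_def\<close>)
  define w where "w y = u y + \<epsilon> * b y" for y
  have sb: "smooth_on V (\<lambda>y. \<epsilon> * b y)" using smooth_on_mult[OF smooth_on_const[OF V] b] .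
  have sw: "smooth_on V w" unfolding w_def by (intro smooth_on_add smooth_u sb)
  have xV: "x \<in> V" using x r by auto
  have rr: "r - dist p x > 0" using x by auto
  have wmax: "w y \<le> w x" if "y \<in> cball x (r - dist p x)" for y
    unfolding w_def using that dist_triangle[of p y x] by (intro max) auto
  have wd: "fder w y v = fder u y v + \<epsilon> * fder b y v" if "y \<in> V" for y v
    unfolding w_def
    using fder_add[OF smooth_onD(4)[OF smooth_u that] smooth_onD(4)[OF sb that]]
      fder_linear[OF bounded_linear_mult_right[of \<epsilon>] smooth_onD(4)[OF b that]] by simp
  have wd2: "fder (\<lambda>y. fder w y (X y)) x (X x) = fder (\<lambda>y. fder u y (X y)) x (X x) + \<epsilon> * fder (\<lambda>y. fder b y (X y)) x (X x)"
    if X: "smooth_on V X" for X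
  proof -
    have "fder (\<lambda>y. fder w y (X y)) x = fder (\<lambda>y. fder u y (X y) + \<epsilon> * fder b y (X y)) x"
      by (rule fder_cong[OF V xV]) (rule wd)
    then show ?thesis
      using smooth_onD(4)[OF smooth_on_fder_field[OF smooth_u X] xV] smooth_onD(4)[OF smooth_on_fder_field[OF b X] xV]
      by (simp add: fder_add fder_linear[OF bounded_linear_mult_right])
  qed
  have "(\<Sum>j<m. fder (\<lambda>y. fder w y (F j y)) x (F j x)) + fder w x (F0 x)
     = ((\<Sum>j<m. fder (\<lambda>y. fder u y (F j y)) x (F j x)) + fder u x (F0 x))
     + \<epsilon> * ((\<Sum>j<m. fder (\<lambda>y. fder b y (F j y)) x (F j x)) + fder b x (F0 x))"
    by (simp add: wd2 smooth_F wd[OF xV] sum.distrib sum_distrib_left distrib_left)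
  then have "(\<Sum>j<m. fder (\<lambda>y. fder w y (F j y)) x (F j x)) + fder w x (F0 x) > 0"
    using equation[OF xV] pos[of x] x e by simp
  moreover have "(\<Sum>j<m. fder (\<lambda>y. fder w y (F j y)) x (F j x)) \<le> 0"
    by (intro sum_nonpos interior_max_derivatives(2)[OF sw _ xV rr wmax] smooth_F) auto
  moreover have "fder w x (F0 x) = 0" by (rule interior_max_derivatives(1)[OF sw smooth_F0 xV rr wmax])
  ultimately show False by simp
qed

text \<open>Hopf's lemma: the barrier \<open>h + \<beta> h\<^sup>2\<close> with \<open>h = bump p \<nu>\<close> and \<open>\<beta>\<close> large.\<close>

lemma tangent_to_max_set:
  assumes ext: "exterior_normal max_set p \<nu>" and j: "j < m"
  shows "F j p \<bullet> \<nu> = 0"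
proof (rule ccontr)
  assume ne: "F j p \<bullet> \<nu> \<noteq> 0"
  have V: "open V" using smooth_onD(1)[OF smooth_u] .
  have p: "p \<in> max_set" "p \<in> V" using ext by (auto simp: exterior_normal_iff max_set_def)
  let ?h = "bump p \<nu>"
  define Q where "Q = (\<Sum>j<m. (F j p \<bullet> \<nu>)\<^sup>2)"
  have Q: "Q > 0" unfolding Q_def using j ne by (intro sum_pos2[of _ j]) auto
  define c where "c = (\<Sum>j<m. fder (\<lambda>y. fder ?h y (F j y)) p (F j p)) + fder ?h p (F0 p)"
  \<comment> \<open>As \<open>?h\<close> vanishes at \<open>p\<close>, its square contributes
    \<open>2 * \<beta> * (F j p \<bullet> \<nu>)\<^sup>2\<close> through each field and nothing
    through the drift. This choice lets the sum outweigh \<open>c\<close>, whatever its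
    sign.\<close>
  define \<beta> where "\<beta> = (\<bar>c\<bar> + 1) / Q"
  define b where "b x = ?h x + \<beta> * (?h x * ?h x)" for x
  have sh: "smooth_on V ?h" by (rule smooth_bump[OF V])
  have sb: "smooth_on V b" unfolding b_def by (intro smooth_on_add smooth_on_mult smooth_on_const V sh)
  have dh: "?h differentiable at y" if "y \<in> V" for y using smooth_onD(4)[OF sh that] .
  have bd: "fder b y v = fder ?h y v + \<beta> * (2 * (?h y * fder ?h y v))" if "y \<in> V" for y v
    unfolding b_def by (simp add: fder_add fder_mult dh[OF that] fder_linear[OF bounded_linear_mult_right])
  define Pb where "Pb x = (\<Sum>j<m. fder (\<lambda>y. fder b y (F j y)) x (F j x)) + fder b x (F0 x)" for x
  have h0: "?h p = 0" by (simp add: bump_def)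
  have bd2: "fder (\<lambda>y. fder b y (X y)) p (X p) = fder (\<lambda>y. fder ?h y (X y)) p (X p) + 2 * \<beta> * (X p \<bullet> \<nu>)\<^sup>2"
    if X: "smooth_on V X" for X
  proof -
    have dhX: "(\<lambda>y. fder ?h y (X y)) differentiable at p" using smooth_onD(4)[OF smooth_on_fder_field[OF sh X] p(2)] .
    have "fder (\<lambda>y. fder b y (X y)) p = fder (\<lambda>y. fder ?h y (X y) + \<beta> * (2 * (?h y * fder ?h y (X y)))) p"
      by (rule fder_cong[OF V p(2)]) (rule bd)
    then have "fder (\<lambda>y. fder b y (X y)) p (X p) = fder (\<lambda>y. fder ?h y (X y) + \<beta> * (2 * (?h y * fder ?h y (X y)))) p (X p)"
      by simp
    also have "\<dots> = fder (\<lambda>y. fder ?h y (X y)) p (X p)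
        + \<beta> * (2 * (?h p * fder (\<lambda>y. fder ?h y (X y)) p (X p) + fder ?h p (X p) * fder ?h p (X p)))"
      using dhX dh[OF p(2)] by (simp add: fder_add fder_mult fder_linear[OF bounded_linear_mult_right])
    also have "fder ?h p (X p) = X p \<bullet> \<nu>" by (simp add: fder_bump inner_commute)
    finally show ?thesis using h0 by (simp add: power2_eq_square)
  qed
  have "Pb p = c + 2 * \<beta> * Q"
    unfolding Pb_def c_def Q_def
    by (simp add: bd2 smooth_F bd[OF p(2)] h0 sum.distrib sum_distrib_left)
  also have "\<dots> > 0" using Q by (simp add: \<beta>_def)
  finally have Pbp: "Pb p > 0" .
  have "smooth_on V Pb"
    unfolding Pb_def by (intro smooth_on_add smooth_on_sum smooth_on_fder_field sb smooth_F smooth_F0 V) auto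
  have nh: "(g \<longlongrightarrow> g p) (nhds p)" if "isCont g p" for g :: "'e \<Rightarrow> real"
    using that by (simp add: isCont_def tendsto_at_iff_tendsto_nhds)
  from smooth_onD(3)[OF \<open>smooth_on V Pb\<close>] have "isCont Pb p" using V p by (simp add: continuous_on_eq_continuous_at)
  then have "\<forall>\<^sub>F x in nhds p. Pb x > 0" 
    using order_tendstoD(1)[OF nh[of Pb]] Pbp by blast
  moreover have "isCont (\<lambda>x. \<bar>\<beta> * ?h x\<bar>) p"
    using smooth_onD(3)[OF sh] V p by (auto simp: continuous_on_eq_continuous_at intro!: continuous_intros)
  \<comment> \<open>Where this holds, \<open>b\<close>, which is \<open>?h\<close> times 1 + \<beta>
    \<open>?h\<close>, has the sign of \<open>?h\<close> and inherits its negativity on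
    \<open>max_set\<close> away from \<open>p\<close>.\<close>
  then have "\<forall>\<^sub>F x in nhds p. \<bar>\<beta> * ?h x\<bar> < 1"
    by (intro order_tendstoD(2)[OF nh[of "\<lambda>x. \<bar>\<beta> * ?h x\<bar>"]]) (simp_all add: h0)
  moreover have "\<forall>\<^sub>F x in nhds p. x \<in> V" using V p eventually_nhds_in_open by blast
  ultimately have "\<forall>\<^sub>F x in nhds p. Pb x > 0 \<and> \<bar>\<beta> * ?h x\<bar> < 1 \<and> x \<in> V" by eventually_elim auto
  then obtain d where d: "d > 0" "\<And>x. dist x p < d \<Longrightarrow> Pb x > 0 \<and> \<bar>\<beta> * ?h x\<bar> < 1 \<and> x \<in> V"
    unfolding eventually_nhds_metric by blast
  show False
  proof (rule no_strict_barrier[OF sb p(1), of "d/2"])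
    show "b p = 0" by (simp add: b_def h0)
    show "cball p (d/2) \<subseteq> V" using d by (auto simp: dist_commute)
    fix x assume x: "x \<in> max_set" "x \<in> sphere p (d/2)"
    have "0 < (norm (x - p))\<^sup>2" using x(2) d(1) by auto
    then have "?h x < 0" using bump_max_set[OF ext x(1)] by linarith
    moreover have "1 + \<beta> * ?h x > 0" using d(2)[of x] x(2) d(1) by (auto simp: dist_commute)
    ultimately have "?h x * (1 + \<beta> * ?h x) < 0" by (rule mult_neg_pos)
    then show "b x < 0" by (simp add: b_def algebra_simps)
  next
    fix x assume "x \<in> cball p (d/2)"
    then show "0 < (\<Sum>j<m. fder (\<lambda>y. fder b y (F j y)) x (F j x)) + fder b x (F0 x)"
      using d by (auto simp: Pb_def[symmetric] dist_commute)
  qed (use d in auto)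
qed

end

section \<open>The drift at exterior normals\<close>

lemma common_bound:
  fixes P :: "nat \<Rightarrow> real \<Rightarrow> bool"
  assumes "\<And>i. i < m \<Longrightarrow> \<exists>K. P i K" "\<And>i K K'. P i K \<Longrightarrow> K \<le> K' \<Longrightarrow> P i K'"
  shows "\<exists>K. \<forall>i<m. P i K"
  using assms(1)
proof (induction m)
  case (Suc m)
  then obtain K K' where "\<forall>i<m. P i K" "P m K'" by (metis less_Suc_eq)
  then have "\<forall>i<Suc m. P i (max K K')" using assms(2) by (metis less_Suc_eq max.cobounded1 max.cobounded2)
  then show ?case by blast
qed simp

lemma norm_weighted_sum_le:
  fixes a :: "nat \<Rightarrow> 'b::real_normed_vector"
  assumes "\<And>i. i < m \<Longrightarrow> norm (a i) \<le> K"
  shows "norm (\<Sum>i<m. y i *\<^sub>R a i) \<le> (\<Sum>i<m. \<bar>y i\<bar>) * K"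
  unfolding sum_distrib_right
  by (rule sum_norm_le) (use assms in \<open>auto intro!: mult_left_mono\<close>)

lemma norm_weighted_double_sum_le:
  fixes a :: "nat \<Rightarrow> nat \<Rightarrow> 'b::real_normed_vector"
  assumes "\<And>i k. i < m \<Longrightarrow> k < m \<Longrightarrow> norm (a i k) \<le> K"
  shows "norm (\<Sum>i<m. \<Sum>k<m. (y i * y k) *\<^sub>R a i k) \<le> (\<Sum>i<m. \<bar>y i\<bar>)\<^sup>2 * K"
proof -
  have "norm (\<Sum>i<m. y i *\<^sub>R (\<Sum>k<m. y k *\<^sub>R a i k)) \<le> (\<Sum>i<m. \<bar>y i\<bar>) * ((\<Sum>k<m. \<bar>y k\<bar>) * K)"
    by (intro norm_weighted_sum_le assms)
  then show ?thesis by (simp add: scaleR_sum_right power2_eq_square mult.assoc)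
qed

text \<open>The number \<open>m\<close> of parameters is not a type, so parameter vectors are
  sequences that vanish from index \<open>m\<close> on. Their box is a product of compact intervals
  and single points, compact in the product topology.\<close>

lemma compact_coordinate_box:
  "compact {y :: nat \<Rightarrow> real. (\<forall>i<m. \<bar>y i\<bar> \<le> \<sigma>) \<and> (\<forall>i\<ge>m. y i = 0)}"
proof -
  let ?S = "\<lambda>i. if i < m then {-\<sigma>..\<sigma>} else {0::real}"
  have "compactin (product_topology (\<lambda>i. euclidean) UNIV) (PiE UNIV ?S)"
    unfolding compactin_PiE by auto
  moreover have "PiE UNIV ?S = {y. (\<forall>i<m. \<bar>y i\<bar> \<le> \<sigma>) \<and> (\<forall>i\<ge>m. y i = 0)}"
  proof (rule set_eqI)
    fix y :: "nat \<Rightarrow> real"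
    have "y \<in> PiE UNIV ?S \<longleftrightarrow> (\<forall>i. y i \<in> ?S i)" by (simp add: PiE_UNIV_domain Pi_iff)
    also have "\<dots> \<longleftrightarrow> (\<forall>i. (i < m \<longrightarrow> \<bar>y i\<bar> \<le> \<sigma>) \<and> (i \<ge> m \<longrightarrow> y i = 0))"
    proof -
      have "y i \<in> ?S i \<longleftrightarrow> (i < m \<longrightarrow> \<bar>y i\<bar> \<le> \<sigma>) \<and> (i \<ge> m \<longrightarrow> y i = 0)" for i
        by (cases "i < m") (auto simp: abs_le_iff)
      then show ?thesis by blast
    qed
    also have "\<dots> \<longleftrightarrow> (\<forall>i<m. \<bar>y i\<bar> \<le> \<sigma>) \<and> (\<forall>i\<ge>m. y i = 0)" by blast
    finally show "y \<in> PiE UNIV ?S \<longleftrightarrow> y \<in> {y. (\<forall>i<m. \<bar>y i\<bar> \<le> \<sigma>) \<and> (\<forall>i\<ge>m. y i = 0)}" by simp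
  qed
  ultimately show ?thesis by (simp add: euclidean_product_topology)
qed

lemma eventually_small:
  fixes c d :: real
  assumes "d > 0"
  shows "\<forall>\<^sub>F s in at_right 0. c * s \<le> d"
proof -
  have "((\<lambda>s. c * s) \<longlongrightarrow> c * 0) (at_right 0)" by (intro tendsto_intros)
  from order_tendstoD(2)[OF this, of d] assms show ?thesis by (auto elim: eventually_mono)
qed

context degenerate_elliptic
begin

text \<open>\<open>theta y\<close> is, to second order in \<open>y\<close>, the time one map of the flow of \<open>- \<Sum>\<^sub>i y\<^sub>i F\<^sub>i\<close>.\<close>

definition FF where "FF i k = (\<lambda>x. fder (F i) x (F k x))"
definition FFF where "FFF i k j = (\<lambda>x. fder (FF i k) x (F j x))"
definition FFFF where "FFFF i k j = (\<lambda>x. fder (FFF i k j) x (F j x))"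

definition theta :: "(nat \<Rightarrow> real) \<Rightarrow> 'e \<Rightarrow> 'e" where
  "theta y x = x - (\<Sum>i<m. y i *\<^sub>R F i x) + (1/2) *\<^sub>R (\<Sum>i<m. \<Sum>k<m. (y i * y k) *\<^sub>R FF i k x)"

text \<open>First derivative of \<open>theta\<close> along the curve on which \<open>x\<close>
  follows \<open>F j\<close> and the entry \<open>y j\<close> grows with unit speed. The terms
  \<open>F j\<close> cancel, and every remaining term contains an entry of \<open>y\<close>.\<close>

definition theta1 :: "nat \<Rightarrow> (nat \<Rightarrow> real) \<Rightarrow> 'e \<Rightarrow> 'e" where
  "theta1 j y x = (1/2) *\<^sub>R (\<Sum>i<m. y i *\<^sub>R (FF j i x - FF i j x))
     + (1/2) *\<^sub>R (\<Sum>i<m. \<Sum>k<m. (y i * y k) *\<^sub>R FFF i k j x)"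

text \<open>Second derivative along the same curve. The terms \<open>FF j j\<close>, which carry no
  entry of \<open>y\<close>, cancel as well; this is what the quadratic part of \<open>theta\<close>
  is for.\<close>

definition theta2 :: "nat \<Rightarrow> (nat \<Rightarrow> real) \<Rightarrow> 'e \<Rightarrow> 'e" where
  "theta2 j y x = (1/2) *\<^sub>R (\<Sum>i<m. y i *\<^sub>R (FFF j i j x - FFF i j j x))
     + (1/2) *\<^sub>R ((\<Sum>i<m. \<Sum>k<m. (y i * y k) *\<^sub>R FFFF i k j x) + (\<Sum>i<m. y i *\<^sub>R (FFF j i j x + FFF i j j x)))"

definition ysum :: "(nat \<Rightarrow> real) \<Rightarrow> real" where "ysum y = (\<Sum>i<m. \<bar>y i\<bar>)"

lemma smooth_FF: "i < m \<Longrightarrow> k < m \<Longrightarrow> smooth_on V (FF i k)"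
  unfolding FF_def by (intro smooth_on_fder_field smooth_F)

lemma smooth_FFF: "i < m \<Longrightarrow> k < m \<Longrightarrow> j < m \<Longrightarrow> smooth_on V (FFF i k j)"
  unfolding FFF_def by (intro smooth_on_fder_field smooth_FF smooth_F)

lemma smooth_FFFF: "i < m \<Longrightarrow> k < m \<Longrightarrow> j < m \<Longrightarrow> smooth_on V (FFFF i k j)"
  unfolding FFFF_def by (intro smooth_on_fder_field smooth_FFF smooth_F)

lemma
  fixes y :: "nat \<Rightarrow> real"
  assumes j: "j < m" and \<gamma>: "(\<gamma> has_vector_derivative F j (\<gamma> s)) (at s within T)" and V: "\<gamma> s \<in> V"
  defines "Y \<equiv> \<lambda>s. y(j := y j + s)"
  shows theta_along_curve:
      "((\<lambda>s. theta (Y s) (\<gamma> s)) has_vector_derivative theta1 j (Y s) (\<gamma> s)) (at s within T)"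
    and theta1_along_curve:
      "((\<lambda>s. theta1 j (Y s) (\<gamma> s)) has_vector_derivative theta2 j (Y s) (\<gamma> s)) (at s within T)"
proof -
  have Yd: "((\<lambda>s. Y s i) has_real_derivative (if i = j then 1 else 0)) (at s within T)" for i
    unfolding Y_def by (auto intro!: derivative_eq_intros)
  have YYd: "((\<lambda>s. Y s i * Y s k) has_real_derivative (if i = j then Y s k else 0) + (if k = j then Y s i else 0)) (at s within T)" for i k
    using DERIV_mult[OF Yd[of i] Yd[of k]] by (auto simp: if_distrib cong: if_cong)
  have dF: "((\<lambda>s. F i (\<gamma> s)) has_vector_derivative FF i j (\<gamma> s)) (at s within T)" if "i < m" for i
    using derivative_along_curve[OF smooth_F[OF that] V \<gamma>] by (simp add: FF_def)
  have dFF: "((\<lambda>s. FF i k (\<gamma> s)) has_vector_derivative FFF i k j (\<gamma> s)) (at s within T)" if "i < m" "k < m" for i k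
    using derivative_along_curve[OF smooth_FF[OF that] V \<gamma>] by (simp add: FFF_def)
  have dFFF: "((\<lambda>s. FFF i k j (\<gamma> s)) has_vector_derivative FFFF i k j (\<gamma> s)) (at s within T)" if "i < m" "k < m" for i k
    using derivative_along_curve[OF smooth_FFF[OF that j] V \<gamma>] by (simp add: FFFF_def)
  have s1: "((\<lambda>s. \<Sum>i<m. Y s i *\<^sub>R G i (\<gamma> s)) has_vector_derivative (\<Sum>i<m. Y s i *\<^sub>R G' i) + G j (\<gamma> s)) (at s within T)"
    if "\<And>i. i < m \<Longrightarrow> ((\<lambda>s. G i (\<gamma> s)) has_vector_derivative G' i) (at s within T)" for G :: "nat \<Rightarrow> 'e \<Rightarrow> 'e" and G'
  proof -
    have "((\<lambda>s. \<Sum>i<m. Y s i *\<^sub>R G i (\<gamma> s)) has_vector_derivative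
        (\<Sum>i<m. Y s i *\<^sub>R G' i + (if i = j then 1 else 0) *\<^sub>R G i (\<gamma> s))) (at s within T)"
      by (intro has_vector_derivative_sum has_vector_derivative_scaleR Yd that) auto
    moreover have "(\<Sum>i<m. (if i = j then 1 else 0) *\<^sub>R G i (\<gamma> s)) = G j (\<gamma> s)"
      using j by (simp add: if_distrib[of "\<lambda>c. c *\<^sub>R _"] sum.delta cong: if_cong)
    ultimately show ?thesis by (simp add: sum.distrib)
  qed
  have s2: "((\<lambda>s. \<Sum>i<m. \<Sum>k<m. (Y s i * Y s k) *\<^sub>R G i k (\<gamma> s)) has_vector_derivative
      (\<Sum>i<m. \<Sum>k<m. (Y s i * Y s k) *\<^sub>R G' i k) + (\<Sum>i<m. Y s i *\<^sub>R (G j i (\<gamma> s) + G i j (\<gamma> s)))) (at s within T)"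
    if "\<And>i k. i < m \<Longrightarrow> k < m \<Longrightarrow> ((\<lambda>s. G i k (\<gamma> s)) has_vector_derivative G' i k) (at s within T)" for G :: "nat \<Rightarrow> nat \<Rightarrow> 'e \<Rightarrow> 'e" and G'
  proof -
    have "((\<lambda>s. \<Sum>i<m. \<Sum>k<m. (Y s i * Y s k) *\<^sub>R G i k (\<gamma> s)) has_vector_derivative
        (\<Sum>i<m. \<Sum>k<m. (Y s i * Y s k) *\<^sub>R G' i k + ((if i = j then Y s k else 0) + (if k = j then Y s i else 0)) *\<^sub>R G i k (\<gamma> s))) (at s within T)"
      by (intro has_vector_derivative_sum has_vector_derivative_scaleR YYd that) auto
    moreover have "(\<Sum>i<m. \<Sum>k<m. (if i = j then Y s k else 0) *\<^sub>R G i k (\<gamma> s)) = (\<Sum>k<m. Y s k *\<^sub>R G j k (\<gamma> s))"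
      using j by (subst sum.swap) (simp add: if_distrib[of "\<lambda>c. c *\<^sub>R _"] sum.delta cong: if_cong)
    moreover have "(\<Sum>i<m. \<Sum>k<m. (if k = j then Y s i else 0) *\<^sub>R G i k (\<gamma> s)) = (\<Sum>i<m. Y s i *\<^sub>R G i j (\<gamma> s))"
      using j by (simp add: if_distrib[of "\<lambda>c. c *\<^sub>R _"] sum.delta cong: if_cong)
    ultimately show ?thesis by (simp add: sum.distrib scaleR_add_left scaleR_add_right)
  qed
  have half: "((\<lambda>s. (1/2) *\<^sub>R g s) has_vector_derivative (1/2) *\<^sub>R g') (at s within T)"
    if "(g has_vector_derivative g') (at s within T)" for g :: "real \<Rightarrow> 'e" and g'
    using bounded_linear.has_vector_derivative[OF bounded_linear_scaleR_right that] .
  have "((\<lambda>s. theta (Y s) (\<gamma> s)) has_vector_derivative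
      F j (\<gamma> s) - ((\<Sum>i<m. Y s i *\<^sub>R FF i j (\<gamma> s)) + F j (\<gamma> s))
      + (1/2) *\<^sub>R ((\<Sum>i<m. \<Sum>k<m. (Y s i * Y s k) *\<^sub>R FFF i k j (\<gamma> s)) + (\<Sum>i<m. Y s i *\<^sub>R (FF j i (\<gamma> s) + FF i j (\<gamma> s))))) (at s within T)"
    unfolding theta_def by (intro has_vector_derivative_add has_vector_derivative_diff half \<gamma> s1 s2 dF dFF)
  then show "((\<lambda>s. theta (Y s) (\<gamma> s)) has_vector_derivative theta1 j (Y s) (\<gamma> s)) (at s within T)"
  proof (rule has_vector_derivative_eq_rhs)
    have "(\<Sum>i<m. Y s i *\<^sub>R FF i j (\<gamma> s)) = (1/2) *\<^sub>R (\<Sum>i<m. Y s i *\<^sub>R FF i j (\<gamma> s)) + (1/2) *\<^sub>R (\<Sum>i<m. Y s i *\<^sub>R FF i j (\<gamma> s))"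
      by (simp flip: scaleR_add_left)
    then show "F j (\<gamma> s) - ((\<Sum>i<m. Y s i *\<^sub>R FF i j (\<gamma> s)) + F j (\<gamma> s))
      + (1/2) *\<^sub>R ((\<Sum>i<m. \<Sum>k<m. (Y s i * Y s k) *\<^sub>R FFF i k j (\<gamma> s)) + (\<Sum>i<m. Y s i *\<^sub>R (FF j i (\<gamma> s) + FF i j (\<gamma> s)))) = theta1 j (Y s) (\<gamma> s)"
      unfolding theta1_def by (simp add: scaleR_add_right scaleR_diff_right sum.distrib sum_subtractf algebra_simps)
  qed
  have "((\<lambda>s. theta1 j (Y s) (\<gamma> s)) has_vector_derivative
      (1/2) *\<^sub>R ((\<Sum>i<m. Y s i *\<^sub>R (FFF j i j (\<gamma> s) - FFF i j j (\<gamma> s))) + (FF j j (\<gamma> s) - FF j j (\<gamma> s)))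
      + (1/2) *\<^sub>R ((\<Sum>i<m. \<Sum>k<m. (Y s i * Y s k) *\<^sub>R FFFF i k j (\<gamma> s)) + (\<Sum>i<m. Y s i *\<^sub>R (FFF j i j (\<gamma> s) + FFF i j j (\<gamma> s))))) (at s within T)"
    unfolding theta1_def
    by (intro has_vector_derivative_add half s2 dFFF s1[of "\<lambda>i x. FF j i x - FF i j x"]
        has_vector_derivative_diff dFF j)
  then show "((\<lambda>s. theta1 j (Y s) (\<gamma> s)) has_vector_derivative theta2 j (Y s) (\<gamma> s)) (at s within T)"
    by (simp add: theta2_def)
qed

end

context degenerate_elliptic
begin

lemma ysum_nonneg: "0 \<le> ysum y"
  unfolding ysum_def by (intro sum_nonneg) auto

lemma closed_max_set: "cball p r \<subseteq> V \<Longrightarrow> closed (max_set \<inter> cball p r)"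
proof -
  assume V: "cball p r \<subseteq> V"
  have "closed (cball p r \<inter> u -` {0})"
    using continuous_on_subset[OF smooth_onD(3)[OF smooth_u] V] by (intro continuous_closed_preimage) auto
  moreover have "max_set \<inter> cball p r = cball p r \<inter> u -` {0}" using V by (auto simp: max_set_def)
  ultimately show ?thesis by simp
qed

lemma uniform_bounds:
  assumes V: "cball p r \<subseteq> V"
  obtains K where "K \<ge> 1"
    "\<And>i x. i < m \<Longrightarrow> x \<in> cball p r \<Longrightarrow> norm (F i x) \<le> K"
    "\<And>i x y. i < m \<Longrightarrow> x \<in> cball p r \<Longrightarrow> y \<in> cball p r \<Longrightarrow> norm (F i x - F i y) \<le> K * norm (x - y)"
    "\<And>i x v. i < m \<Longrightarrow> x \<in> cball p r \<Longrightarrow> norm (fder (F i) x v) \<le> K * norm v"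
    "\<And>i x y. i < m \<Longrightarrow> x \<in> cball p r \<Longrightarrow> y \<in> cball p r \<Longrightarrow> norm (F i y - F i x - fder (F i) x (y - x)) \<le> K * (norm (y - x))\<^sup>2"
    "\<And>i k x. i < m \<Longrightarrow> k < m \<Longrightarrow> x \<in> cball p r \<Longrightarrow> norm (FF i k x) \<le> K"
    "\<And>i k x v. i < m \<Longrightarrow> k < m \<Longrightarrow> x \<in> cball p r \<Longrightarrow> norm (fder (FF i k) x v) \<le> K * norm v"
    "\<And>i k j x. i < m \<Longrightarrow> k < m \<Longrightarrow> j < m \<Longrightarrow> x \<in> cball p r \<Longrightarrow> norm (FFF i k j x) \<le> K"
    "\<And>i k j x. i < m \<Longrightarrow> k < m \<Longrightarrow> j < m \<Longrightarrow> x \<in> cball p r \<Longrightarrow> norm (FFFF i k j x) \<le> K"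
    "\<And>x. x \<in> cball p r \<Longrightarrow> norm (F0 x) \<le> K"
proof -
  let ?B = "cball p r"
  define lb where "lb K g \<longleftrightarrow> (\<forall>x\<in>?B. norm (g x) \<le> K) \<and> (\<forall>x\<in>?B. \<forall>v. norm (fder g x v) \<le> K * norm v) \<and>
    (\<forall>x\<in>?B. \<forall>y\<in>?B. norm (g x - g y) \<le> K * norm (x - y)) \<and>
    (\<forall>x\<in>?B. \<forall>y\<in>?B. norm (g y - g x - fder g x (y - x)) \<le> K * (norm (y - x))\<^sup>2)" for K :: real and g :: "'e \<Rightarrow> 'e"
  have mono: "lb K' g" if "lb K g" "K \<le> K'" for K K' g
    using that order_trans[OF _ mult_right_mono[OF that(2) norm_ge_zero]]
      order_trans[OF _ mult_right_mono[OF that(2) zero_le_power2]] order_trans[OF _ that(2)]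
    unfolding lb_def by blast
  have ex: "\<exists>K. lb K g" if g: "smooth_on V g" for g
  proof -
    obtain K where K: "K \<ge> 0" "\<And>x. x \<in> ?B \<Longrightarrow> norm (g x) \<le> K"
      "\<And>x v. x \<in> ?B \<Longrightarrow> norm (fder g x v) \<le> K * norm v"
      "\<And>x y. x \<in> ?B \<Longrightarrow> y \<in> ?B \<Longrightarrow> norm (g x - g y) \<le> K * norm (x - y)"
      using smooth_on_lipschitz[OF g V] by blast
    obtain C where C: "C \<ge> 0" "\<And>x y. x \<in> ?B \<Longrightarrow> y \<in> ?B \<Longrightarrow> norm (g y - g x - fder g x (y - x)) \<le> C * (norm (y - x))\<^sup>2"
      using smooth_on_taylor[OF g V] by blast
    have m1: "K * norm v \<le> max K C * norm v" for v :: 'e by (intro mult_right_mono) auto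
    have m2: "C * (norm v)\<^sup>2 \<le> max K C * (norm v)\<^sup>2" for v :: 'e by (intro mult_right_mono) auto
    show ?thesis
      by (rule exI[of _ "max K C"], unfold lb_def, intro conjI ballI allI)
        (use K(2) in fastforce, use order_trans[OF K(3) m1] in blast,
          use order_trans[OF K(4) m1] in blast, use order_trans[OF C(2) m2] in blast)
  qed
  have m1: "\<exists>K. \<forall>i<m. lb K (G i)" if "\<And>i. i < m \<Longrightarrow> smooth_on V (G i)" for G
  proof (rule common_bound)
    show "\<exists>K. lb K (G i)" if "i < m" for i using ex \<open>\<And>i. i < m \<Longrightarrow> smooth_on V (G i)\<close> that by simp
  qed (rule mono)
  have m2: "\<exists>K. \<forall>i<m. \<forall>k<m. lb K (G i k)" if G: "\<And>i k. i < m \<Longrightarrow> k < m \<Longrightarrow> smooth_on V (G i k)" for G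
  proof (rule common_bound)
    show "\<exists>K. \<forall>k<m. lb K (G i k)" if "i < m" for i using m1[of "G i"] G[OF that] by simp
    show "\<forall>k<m. lb K' (G i k)" if "\<forall>k<m. lb K (G i k)" "K \<le> K'" for i K K'
      using mono[OF _ that(2)] that(1) by simp
  qed
  have m3: "\<exists>K. \<forall>i<m. \<forall>k<m. \<forall>j<m. lb K (G i k j)"
    if G: "\<And>i k j. i < m \<Longrightarrow> k < m \<Longrightarrow> j < m \<Longrightarrow> smooth_on V (G i k j)" for G
  proof (rule common_bound)
    show "\<exists>K. \<forall>k<m. \<forall>j<m. lb K (G i k j)" if "i < m" for i using m2[of "G i"] G[OF that] by simp
    show "\<forall>k<m. \<forall>j<m. lb K' (G i k j)" if "\<forall>k<m. \<forall>j<m. lb K (G i k j)" "K \<le> K'" for i K K'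
      using mono[OF _ that(2)] that(1) by simp
  qed
  obtain K1 where K1: "\<forall>i<m. lb K1 (F i)" using m1[of F, OF smooth_F] by blast
  obtain K2 where K2: "\<forall>i<m. \<forall>k<m. lb K2 (FF i k)" using m2[of FF, OF smooth_FF] by blast
  obtain K3 where K3: "\<forall>i<m. \<forall>k<m. \<forall>j<m. lb K3 (FFF i k j)" using m3[of FFF, OF smooth_FFF] by blast
  obtain K4 where K4: "\<forall>i<m. \<forall>k<m. \<forall>j<m. lb K4 (FFFF i k j)" using m3[of FFFF, OF smooth_FFFF] by blast
  obtain K5 where K5: "lb K5 F0" using ex[OF smooth_F0] by blast
  define K where "K = Max {1, K1, K2, K3, K4, K5}"
  have le: "1 \<le> K" "K1 \<le> K" "K2 \<le> K" "K3 \<le> K" "K4 \<le> K" "K5 \<le> K" unfolding K_def by auto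
  have 1: "lb K (F i)" if "i < m" for i using K1 that mono le by blast
  have 2: "lb K (FF i k)" if "i < m" "k < m" for i k using K2 that mono le by blast
  have 3: "lb K (FFF i k j)" if "i < m" "k < m" "j < m" for i k j using K3 that mono le by blast
  have 4: "lb K (FFFF i k j)" if "i < m" "k < m" "j < m" for i k j using K4 that mono le by blast
  have 5: "lb K F0" using K5 mono le by blast
  have lbD: "x \<in> ?B \<Longrightarrow> norm (g x) \<le> K" "x \<in> ?B \<Longrightarrow> norm (fder g x v) \<le> K * norm v"
    "x \<in> ?B \<Longrightarrow> y \<in> ?B \<Longrightarrow> norm (g x - g y) \<le> K * norm (x - y)"
    "x \<in> ?B \<Longrightarrow> y \<in> ?B \<Longrightarrow> norm (g y - g x - fder g x (y - x)) \<le> K * (norm (y - x))\<^sup>2"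
    if "lb K g" for g x y v
    using that unfolding lb_def by blast+
  show ?thesis
    by (rule that[OF le(1) lbD(1)[OF 1] lbD(3)[OF 1] lbD(2)[OF 1] lbD(4)[OF 1] lbD(1)[OF 2] lbD(2)[OF 2]
          lbD(1)[OF 3] lbD(1)[OF 4] lbD(1)[OF 5]])
qed

text \<open>The quadratic curve from \<open>x\<close> to \<open>theta y x\<close> satisfies the
  equation of the flow of \<open>- Y\<close> up to a term cubic in \<open>ysum y\<close>, and
  \<open>Y\<close>, a constant combination of the \<open>F i\<close>, is orthogonal to the exterior
  normals. \<open>approximate_invariance\<close> turns the error \<open>5 * K ^ 3 * s ^ 3\<close>
  into a distance. The cubic order matters: a penalty quadratic in \<open>y\<close> can absorb
  it.\<close>

lemma theta_near_max_set:
  assumes r: "r > 0" "cball p r \<subseteq> V" and K: "K \<ge> 1"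
    and F: "\<And>i x. i < m \<Longrightarrow> x \<in> cball p r \<Longrightarrow> norm (F i x) \<le> K"
    and lip: "\<And>i x y. i < m \<Longrightarrow> x \<in> cball p r \<Longrightarrow> y \<in> cball p r \<Longrightarrow> norm (F i x - F i y) \<le> K * norm (x - y)"
    and fd: "\<And>i x v. i < m \<Longrightarrow> x \<in> cball p r \<Longrightarrow> norm (fder (F i) x v) \<le> K * norm v"
    and tay: "\<And>i x y. i < m \<Longrightarrow> x \<in> cball p r \<Longrightarrow> y \<in> cball p r \<Longrightarrow> norm (F i y - F i x - fder (F i) x (y - x)) \<le> K * (norm (y - x))\<^sup>2"
    and FF: "\<And>i k x. i < m \<Longrightarrow> k < m \<Longrightarrow> x \<in> cball p r \<Longrightarrow> norm (FF i k x) \<le> K"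
    and x: "x \<in> max_set" "x \<in> cball p (r / 8)" and s: "ysum y * K \<le> 1/4" "2 * (ysum y * K) \<le> r / 8" "ysum y \<le> 1"
  shows "infdist (theta y x) (max_set \<inter> cball p r) \<le> 15 * K ^ 3 * ysum y ^ 3"
proof -
  define s where "s = ysum y"
  have s0: "s \<ge> 0" unfolding s_def by (rule ysum_nonneg)
  have xr: "x \<in> cball p r" using x r by auto
  have xV: "x \<in> V" using xr r by auto
  define Y where "Y z = (\<Sum>i<m. y i *\<^sub>R F i z)" for z
  define Q where "Q = (\<Sum>i<m. \<Sum>k<m. (y i * y k) *\<^sub>R FF i k x)"
  define DY where "DY v = (\<Sum>i<m. y i *\<^sub>R fder (F i) x v)" for v
  have DY_lin: "DY (a + b) = DY a + DY b" "DY (c *\<^sub>R a) = c *\<^sub>R DY a" for a b c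
    unfolding DY_def using fder_linear_arg[OF smooth_onD(4)[OF smooth_F xV]]
    by (simp_all add: scaleR_add_right sum.distrib scaleR_sum_right mult.commute)
  \<comment> \<open>The acceleration of an integral curve of \<open>Y\<close> is the derivative of
    \<open>Y\<close> along itself. Through this identity the terms linear and quadratic in
    \<open>y\<close> cancel in the error.\<close>
  have DYY: "DY (Y x) = Q"
  proof -
    have "fder (F i) x (Y x) = (\<Sum>k<m. y k *\<^sub>R FF i k x)" if "i < m" for i
      unfolding Y_def FF_def using fder_linear_arg(2)[OF smooth_onD(4)[OF smooth_F[OF that] xV]]
      by (simp add: fder_sum_arg[OF smooth_onD(4)[OF smooth_F[OF that] xV]])
    then show ?thesis unfolding DY_def Q_def by (simp add: scaleR_sum_right)
  qed
  have Yn: "norm (Y z) \<le> s * K" if "z \<in> cball p r" for z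
    unfolding Y_def s_def ysum_def using F[OF _ that] by (rule norm_weighted_sum_le)
  have DYn: "norm (DY v) \<le> s * (K * norm v)" for v
    unfolding DY_def s_def ysum_def using fd[OF _ xr] by (rule norm_weighted_sum_le)
  have Qn: "norm Q \<le> s\<^sup>2 * K"
    unfolding Q_def s_def ysum_def using FF[OF _ _ xr] by (rule norm_weighted_double_sum_le)
  have ss: "s\<^sup>2 \<le> s" using s0 s(3) mult_left_mono[of s 1 s] by (simp add: power2_eq_square s_def)
  have sK: "s\<^sup>2 * K \<le> s * K" using ss K by (intro mult_right_mono) auto
  define \<beta> where "\<beta> t = x - t *\<^sub>R Y x + (t\<^sup>2 / 2) *\<^sub>R Q" for t :: real
  define \<beta>' where "\<beta>' t = - Y x + t *\<^sub>R Q" for t :: real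
  have \<beta>n: "norm (\<beta> t - x) \<le> 2 * (s * K)" if "t \<in> {0..1}" for t
  proof -
    have "norm (\<beta> t - x) \<le> norm (t *\<^sub>R Y x) + norm ((t\<^sup>2 / 2) *\<^sub>R Q)"
    proof -
      have "\<beta> t - x = (t\<^sup>2 / 2) *\<^sub>R Q - t *\<^sub>R Y x" by (simp add: \<beta>_def)
      then show ?thesis using norm_triangle_ineq4[of "(t\<^sup>2 / 2) *\<^sub>R Q" "t *\<^sub>R Y x"] by simp
    qed
    moreover have "norm (t *\<^sub>R Y x) \<le> 1 * (s * K)"
      using that mult_mono[of t 1 "norm (Y x)" "s * K"] Yn[OF xr] by simp
    moreover have "norm ((t\<^sup>2 / 2) *\<^sub>R Q) \<le> 1 * (s * K)"
    proof -
      have "t\<^sup>2 \<le> 1" using that by (simp add: power_le_one)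
      then have "(t\<^sup>2/2) * norm Q \<le> 1 * norm Q" by (intro mult_right_mono) auto
      then show ?thesis using Qn sK by simp
    qed
    ultimately show ?thesis by simp
  qed
  have \<beta>8: "\<beta> t \<in> cball p (r / 4)" if "t \<in> {0..1}" for t
  proof -
    have "dist x (\<beta> t) \<le> r / 8" using \<beta>n[OF that] s(2) by (simp add: dist_norm norm_minus_commute s_def)
    then show ?thesis using x(2) dist_triangle[of p "\<beta> t" x] by simp
  qed
  have err: "norm (\<beta>' t - - Y (\<beta> t)) \<le> 5 * K ^ 3 * s ^ 3" if t: "t \<in> {0..1}" for t
  proof -
    let ?z = "\<beta> t"
    have z: "?z \<in> cball p r" using \<beta>8[OF t] r by auto
    have zx: "?z - x = - (t *\<^sub>R Y x) + (t\<^sup>2 / 2) *\<^sub>R Q" by (simp add: \<beta>_def)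
    have "DY (?z - x) = - (t *\<^sub>R Q) + (t\<^sup>2 / 2) *\<^sub>R DY Q"
      unfolding zx using DY_lin(2)[of "-t" "Y x"] by (simp only: DY_lin DYY scaleR_minus_left)
    then have "\<beta>' t - - Y ?z = (\<Sum>i<m. y i *\<^sub>R (F i ?z - F i x - fder (F i) x (?z - x))) + (t\<^sup>2 / 2) *\<^sub>R DY Q"
      unfolding \<beta>'_def Y_def DY_def by (simp add: sum_subtractf sum.distrib scaleR_diff_right algebra_simps)
    also have "norm \<dots> \<le> s * (K * (norm (?z - x))\<^sup>2) + norm ((t\<^sup>2 / 2) *\<^sub>R DY Q)"
      unfolding s_def ysum_def by (rule order_trans[OF norm_triangle_ineq add_right_mono])
        (rule norm_weighted_sum_le, rule tay[OF _ xr z])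
    also have "s * (K * (norm (?z - x))\<^sup>2) \<le> s * (K * (2 * (s * K))\<^sup>2)"
      using \<beta>n[OF t] s0 K by (intro mult_left_mono power_mono) auto
    also have "norm ((t\<^sup>2 / 2) *\<^sub>R DY Q) \<le> 1 * (s * (K * (s\<^sup>2 * K)))"
    proof -
      have "t\<^sup>2 \<le> 1" using t by (simp add: power_le_one)
      then have "(t\<^sup>2/2) * norm (DY Q) \<le> 1 * norm (DY Q)" by (intro mult_right_mono) auto
      also have "\<dots> \<le> s * (K * norm Q)" using DYn[of Q] by simp
      also have "\<dots> \<le> s * (K * (s\<^sup>2 * K))" using Qn s0 K by (intro mult_left_mono) auto
      finally show ?thesis by simp
    qed
    also have "s * (K * (2 * (s * K))\<^sup>2) + 1 * (s * (K * (s\<^sup>2 * K))) = 4 * K ^ 3 * s ^ 3 + K ^ 2 * s ^ 3"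
      by (simp add: power2_eq_square power3_eq_cube algebra_simps)
    also have "\<dots> \<le> 5 * K ^ 3 * s ^ 3"
    proof -
      have "K ^ 2 \<le> K ^ 3" using K by (intro power_increasing) auto
      then have "K ^ 2 * s ^ 3 \<le> K ^ 3 * s ^ 3" using s0 by (intro mult_right_mono) auto
      then show ?thesis by simp
    qed
    finally show ?thesis by linarith
  qed
  have "infdist (\<beta> 1) (max_set \<inter> cball p r) \<le> 3 * 1 * (5 * K ^ 3 * s ^ 3)"
  proof (rule approximate_invariance[where V="\<lambda>z. - Y z" and \<beta>'="\<beta>'" and K="s * K" and q=p])
    show "closed (max_set \<inter> cball p r)" by (rule closed_max_set[OF r(2)])
    show "norm (- Y a - - Y b) \<le> s * K * norm (a - b)" if "a \<in> cball p r" "b \<in> cball p r" for a b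
    proof -
      have "Y a - Y b = (\<Sum>i<m. y i *\<^sub>R (F i a - F i b))" by (simp add: Y_def sum_subtractf scaleR_diff_right)
      then have "norm (Y a - Y b) \<le> s * (K * norm (a - b))"
        unfolding s_def ysum_def using norm_weighted_sum_le[of m "\<lambda>i. F i a - F i b"] lip[OF _ that] by simp
      moreover have "norm (- Y a - - Y b) = norm (Y a - Y b)" 
        using norm_minus_commute[of "Y a" "Y b"] by (simp add: algebra_simps)
      ultimately show ?thesis by (simp add: mult.assoc)
    qed
    show "- Y q \<bullet> \<nu> \<le> 0" if "exterior_normal max_set q \<nu>" for q \<nu>
      unfolding Y_def using tangent_to_max_set[OF that] by (simp add: inner_sum_left)
    show "(\<beta> has_vector_derivative \<beta>' t) (at t within {0..1})" if "t \<in> {0..1}" for t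
    proof -
      have "((\<lambda>t. t\<^sup>2 / 2) has_real_derivative t) (at t within {0..1})" by (auto intro!: derivative_eq_intros)
      then show ?thesis unfolding \<beta>_def[abs_def] \<beta>'_def
        by (auto intro!: derivative_eq_intros simp: has_real_derivative_iff_has_vector_derivative)
    qed
    show "norm (\<beta>' t - - Y (\<beta> t)) \<le> 5 * K ^ 3 * s ^ 3" if "t \<in> {0..1}" for t using err[OF that] .
    show "\<beta> t \<in> cball p (r / 4)" if "t \<in> {0..1}" for t using \<beta>8[OF that] .
    show "\<beta> 0 \<in> max_set" using x by (simp add: \<beta>_def)
    show "s * K * 1 \<le> 1/4" using s(1) by (simp add: s_def)
  qed (use r s0 K in auto)
  moreover have "\<beta> 1 = theta y x" by (simp add: \<beta>_def theta_def Y_def Q_def)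
  ultimately show ?thesis by (simp add: s_def)
qed

lemma continuous_on_field_fst:
  assumes "smooth_on V G" "cball p r \<subseteq> V"
  shows "continuous_on (cball p r \<times> Y) (\<lambda>z. G (fst z))"
  by (rule continuous_on_compose2[OF smooth_onD(3)[OF assms(1)]]) (use assms(2) in \<open>auto intro!: continuous_intros\<close>)

lemma continuous_on_theta:
  assumes "cball p r \<subseteq> V"
  shows "continuous_on (cball p r \<times> Y) (\<lambda>z. theta (snd z) (fst z))"
proof -
  have c: "continuous_on (cball p r \<times> Y) (\<lambda>z. snd z i)" for i
    using continuous_on_compose2[OF continuous_on_product_coordinates[of i], of "cball p r \<times> Y" snd]
    by (simp add: continuous_on_snd)
  show ?thesis unfolding theta_def
    by (intro continuous_intros continuous_on_field_fst[OF _ assms] smooth_F smooth_FF c) auto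
qed

text \<open>Doubling of variables: \<open>u x + \<epsilon> (h (theta y x) - \<eta> |y|\<^sup>2)\<close> is maximised over \<open>x\<close> and \<open>y\<close>, and the
  second derivative test is applied along the curves on which \<open>x\<close> follows \<open>F\<^sub>j\<close> while \<open>y\<^sub>j\<close> grows with
  unit speed. Along them \<open>theta y x\<close> is nearly constant, so that the second order part of the
  operator contributes almost nothing and the sign of the drift decides.\<close>

lemma drift_inward:
  assumes nrm: "exterior_normal max_set p \<nu>"
  shows "F0 p \<bullet> \<nu> \<le> 0"
proof (rule ccontr)
  define \<kappa> where "\<kappa> = F0 p \<bullet> \<nu>"
  assume "\<not> ?thesis"
  then have \<kappa>: "\<kappa> > 0" by (simp add: \<kappa>_def)
  have V: "open V" using smooth_onD(1)[OF smooth_u] .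
  have p: "p \<in> max_set" "p \<in> V" using nrm by (auto simp: exterior_normal_iff max_set_def)
  obtain r where r: "r > 0" "cball p r \<subseteq> V" using V p open_contains_cball by blast
  obtain K where K: "K \<ge> 1"
    and bF: "\<And>i x. i < m \<Longrightarrow> x \<in> cball p r \<Longrightarrow> norm (F i x) \<le> K"
    and lF: "\<And>i x y. i < m \<Longrightarrow> x \<in> cball p r \<Longrightarrow> y \<in> cball p r \<Longrightarrow> norm (F i x - F i y) \<le> K * norm (x - y)"
    and dF: "\<And>i x v. i < m \<Longrightarrow> x \<in> cball p r \<Longrightarrow> norm (fder (F i) x v) \<le> K * norm v"
    and tF: "\<And>i x y. i < m \<Longrightarrow> x \<in> cball p r \<Longrightarrow> y \<in> cball p r \<Longrightarrow> norm (F i y - F i x - fder (F i) x (y - x)) \<le> K * (norm (y - x))\<^sup>2"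
    and bFF: "\<And>i k x. i < m \<Longrightarrow> k < m \<Longrightarrow> x \<in> cball p r \<Longrightarrow> norm (FF i k x) \<le> K"
    and dFF: "\<And>i k x v. i < m \<Longrightarrow> k < m \<Longrightarrow> x \<in> cball p r \<Longrightarrow> norm (fder (FF i k) x v) \<le> K * norm v"
    and bFFF: "\<And>i k j x. i < m \<Longrightarrow> k < m \<Longrightarrow> j < m \<Longrightarrow> x \<in> cball p r \<Longrightarrow> norm (FFF i k j x) \<le> K"
    and bFFFF: "\<And>i k j x. i < m \<Longrightarrow> k < m \<Longrightarrow> j < m \<Longrightarrow> x \<in> cball p r \<Longrightarrow> norm (FFFF i k j x) \<le> K"
    and bF0: "\<And>x. x \<in> cball p r \<Longrightarrow> norm (F0 x) \<le> K"
    using uniform_bounds[OF r(2)] by blast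
  define N where "N = norm \<nu>"
  \<comment> \<open>The penalty contributes \<open>2 * \<eta>\<close> to the second derivative in
    each of the \<open>m\<close> directions; this choice keeps the total below an eighth of the
    drift \<open>\<kappa>\<close>.\<close>
  define \<eta> where "\<eta> = \<kappa> / (16 * (real m + 1))"
  have \<eta>: "\<eta> > 0" "real m * (2 * \<eta>) \<le> \<kappa> / 8" using \<kappa> by (auto simp: \<eta>_def field_simps)
  define C2 where "C2 = (N + 2 * r) * (15 * K ^ 3)"
  define C3 where "C3 = 8 * K\<^sup>2 + 3 * K * (N + 2 * r)"
  \<comment> \<open>Requirements on the size of \<open>y\<close>. The first three are those of
    \<open>theta_near_max_set\<close>, the fourth lets half of the penalty absorb the cubic error,
    the fifth bounds the second derivatives along the curves, and the sixth the error in the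
    derivative along \<open>F0\<close>.\<close>
  have "\<forall>\<^sub>F s in at_right 0. K * s \<le> 1/4 \<and> 2 * K * s \<le> r / 8 \<and> 1 * s \<le> 1 \<and> C2 * real m * s \<le> \<eta> / 2
      \<and> real m * C3 * s \<le> \<kappa> / 8 \<and> (2 * N * K\<^sup>2 + 12 * K\<^sup>2) * s \<le> \<kappa> / 8 \<and> 0 < s"
    using \<kappa> \<eta> r by (intro eventually_conj eventually_small eventually_at_right_less) auto
  then obtain s1 where s1: "K * s1 \<le> 1/4" "2 * K * s1 \<le> r / 8" "s1 \<le> 1" "C2 * real m * s1 \<le> \<eta> / 2"
      "real m * C3 * s1 \<le> \<kappa> / 8" "(2 * N * K\<^sup>2 + 12 * K\<^sup>2) * s1 \<le> \<kappa> / 8" "0 < s1"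
    using eventually_happens'[OF trivial_limit_at_right_real] by auto
  define \<sigma> where "\<sigma> = s1 / (real m + 1)"
  have \<sigma>: "\<sigma> > 0" using s1 by (simp add: \<sigma>_def)
  have ys: "ysum y \<le> s1" if "\<And>i. i < m \<Longrightarrow> \<bar>y i\<bar> \<le> \<sigma>" for y
  proof -
    have "ysum y \<le> (\<Sum>i<m. \<sigma>)" unfolding ysum_def using that by (intro sum_mono) auto
    also have "\<dots> = real m * \<sigma>" by simp
    also have "\<dots> \<le> (real m + 1) * \<sigma>" using \<sigma> by (intro mult_right_mono) auto
    also have "\<dots> = s1" by (simp add: \<sigma>_def)
    finally show ?thesis .
  qed
  have "isCont (\<lambda>x. F0 x \<bullet> \<nu>) p"
    using smooth_onD(3)[OF smooth_F0] V p by (auto simp: continuous_on_eq_continuous_at intro!: continuous_intros)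
  then obtain d where d: "d > 0" "\<And>x. dist x p < d \<Longrightarrow> dist (F0 x \<bullet> \<nu>) (F0 p \<bullet> \<nu>) < \<kappa> / 8"
    using \<kappa> unfolding continuous_at_eps_delta by (metis zero_less_divide_iff zero_less_numeral)
  define \<rho> where "\<rho> = Min {r / 8, d / 2, \<kappa> / (48 * K)}"
  have \<rho>: "\<rho> > 0" "\<rho> \<le> r / 8" "\<rho> < d" "6 * K * \<rho> \<le> \<kappa> / 8"
  proof -
    show "\<rho> > 0" "\<rho> \<le> r / 8" "\<rho> < d" using r d \<kappa> K by (auto simp: \<rho>_def)
    have "\<rho> \<le> \<kappa> / (48 * K)" by (simp add: \<rho>_def)
    then show "6 * K * \<rho> \<le> \<kappa> / 8" using K by (simp add: field_simps)
  qed
  have \<rho>r: "cball p \<rho> \<subseteq> cball p (r/8)" "cball p \<rho> \<subseteq> cball p r" "cball p \<rho> \<subseteq> V" using \<rho> r by auto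
  define h where "h = bump p \<nu>"
  define Q where "Q y = (\<Sum>i<m. (y i)\<^sup>2)" for y :: "nat \<Rightarrow> real"
  define Y where "Y = {y :: nat \<Rightarrow> real. (\<forall>i<m. \<bar>y i\<bar> \<le> \<sigma>) \<and> (\<forall>i\<ge>m. y i = 0)}"
  define H where "H z = h (theta (snd z) (fst z)) - \<eta> * Q (snd z)" for z
  define KK where "KK = cball p \<rho> \<times> Y"
  \<comment> \<open>The sphere and the faces of the box: a contact point off \<open>BB\<close>
    leaves room to move \<open>x\<close> and each \<open>y j\<close> in both directions.\<close>
  define BB where "BB = (sphere p \<rho> \<times> Y) \<union> (\<Union>i<m. cball p \<rho> \<times> (Y \<inter> {y. \<bar>y i\<bar> = \<sigma>}))"
  have Yc: "compact Y" unfolding Y_def by (rule compact_coordinate_box)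
  have coord: "continuous_on S (\<lambda>y. y i)" for S :: "(nat \<Rightarrow> real) set" and i
    by (rule continuous_on_subset[OF continuous_on_product_coordinates[of i]]) simp
  have BBc: "compact BB"
  proof -
    have "closed {y :: nat \<Rightarrow> real. \<bar>y i\<bar> = \<sigma>}" for i
      by (intro closed_Collect_eq continuous_intros coord)
    then have "compact (Y \<inter> {y. \<bar>y i\<bar> = \<sigma>})" for i using Yc by blast
    then show ?thesis unfolding BB_def using Yc
      by (intro compact_Un compact_UN compact_Times) auto
  qed
  have ysY: "ysum y \<le> s1" "ysum y * K \<le> 1/4" "2 * (ysum y * K) \<le> r / 8" "ysum y \<le> 1" if "y \<in> Y" for y
  proof -
    show s: "ysum y \<le> s1" using that by (intro ys) (auto simp: Y_def)
    have "ysum y * K \<le> s1 * K" using s K by (intro mult_right_mono) auto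
    then show "ysum y * K \<le> 1/4" "2 * (ysum y * K) \<le> r / 8" "ysum y \<le> 1" using s1 s by (auto simp: mult.commute)
  qed
  have th: "norm (theta y x - x) \<le> 2 * K * ysum y" if "x \<in> cball p r" "y \<in> Y" for x y
  proof -
    have "theta y x - x = (1/2) *\<^sub>R (\<Sum>i<m. \<Sum>k<m. (y i * y k) *\<^sub>R FF i k x) - (\<Sum>i<m. y i *\<^sub>R F i x)"
      by (simp add: theta_def)
    then have "norm (theta y x - x) \<le> (1/2) * norm (\<Sum>i<m. \<Sum>k<m. (y i * y k) *\<^sub>R FF i k x) + norm (\<Sum>i<m. y i *\<^sub>R F i x)"
      using norm_triangle_ineq4[of "(1/2) *\<^sub>R (\<Sum>i<m. \<Sum>k<m. (y i * y k) *\<^sub>R FF i k x)" "\<Sum>i<m. y i *\<^sub>R F i x"] by simp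
    also have "\<dots> \<le> (1/2) * ((ysum y)\<^sup>2 * K) + ysum y * K"
      unfolding ysum_def using norm_weighted_double_sum_le[of m "\<lambda>i k. FF i k x" K y] bFF[OF _ _ that(1)]
        norm_weighted_sum_le[of m "\<lambda>i. F i x" K y] bF[OF _ that(1)] by (intro add_mono mult_left_mono) auto
    also have "\<dots> \<le> (1/2) * (ysum y * K) + ysum y * K"
    proof -
      have "(ysum y)\<^sup>2 \<le> ysum y"
        using mult_left_mono[OF ysY(4)[OF that(2)] ysum_nonneg] by (simp add: power2_eq_square)
      then show ?thesis using K by (intro add_right_mono mult_left_mono mult_right_mono) auto
    qed
    also have "\<dots> \<le> 2 * K * ysum y" using ysum_nonneg[of y] K by simp
    finally show ?thesis .
  qed
  have thr: "theta y x \<in> cball p r" if "x \<in> cball p \<rho>" "y \<in> Y" for x y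
  proof -
    have "norm (theta y x - x) \<le> r / 8" using th[of x y] that \<rho>r ysY(3)[OF that(2)] by (auto simp: mult_ac)
    then show ?thesis using that(1) \<rho>(2) r(1) dist_triangle[of p "theta y x" x] by (auto simp: dist_norm norm_minus_commute)
  qed
  have Qs: "(ysum y)\<^sup>2 \<le> real m * Q y" for y
    using sum_squared_le_sum_of_squares[of "\<lambda>i. \<bar>y i\<bar>" "{..<m}"] by (simp add: ysum_def Q_def mult.commute)
  have Q0: "Q y \<ge> 0" for y unfolding Q_def by (intro sum_nonneg) auto
  \<comment> \<open>The point \<open>theta y x\<close> is within a cubic distance of
    \<open>max_set\<close>, where \<open>h\<close> is nonpositive, and \<open>h\<close> has the
    Lipschitz constant \<open>N + 2 * r\<close> on the ball. By \<open>Qs\<close> the cubic error is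
    at most half of the penalty.\<close>
  have Hneg: "H (x, y) \<le> - (\<eta> / 2) * Q y" if x: "x \<in> max_set" "x \<in> cball p \<rho>" and y: "y \<in> Y" for x y
  proof -
    let ?C = "max_set \<inter> cball p r" and ?s = "ysum y" and ?t = "theta y x"
    have cl: "closed ?C" "?C \<noteq> {}" using closed_max_set[OF r(2)] x \<rho>r by auto
    obtain z where z: "z \<in> ?C" "infdist ?t ?C = dist ?t z"
      using infdist_attains_inf[OF cl] by blast
    have "dist ?t z \<le> 15 * K ^ 3 * ?s ^ 3"
      unfolding z(2)[symmetric] using x \<rho>r ysY[OF y]
      by (intro theta_near_max_set[OF r K bF lF dF tF bFF]) auto
    moreover have "h ?t - h z \<le> (N + 2 * r) * dist ?t z"
    proof -
      let ?a = "?t - p" and ?b = "z - p"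
      have ab: "norm ?a \<le> r" "norm ?b \<le> r"
        using thr[OF x(2) y] z(1) by (auto simp: dist_norm norm_minus_commute)
      have "h ?t - h z = \<nu> \<bullet> (?t - z) - (?a + ?b) \<bullet> (?t - z)"
        unfolding h_def bump_def by (simp add: inner_diff_left inner_diff_right inner_add_left inner_commute algebra_simps)
      also have "\<dots> \<le> norm \<nu> * norm (?t - z) + norm (?a + ?b) * norm (?t - z)"
        using norm_cauchy_schwarz[of \<nu> "?t - z"] norm_cauchy_schwarz[of "- (?a + ?b)" "?t - z"]
        unfolding norm_minus_cancel inner_minus_left by linarith
      also have "\<dots> \<le> N * norm (?t - z) + (2 * r) * norm (?t - z)"
        using ab norm_triangle_ineq[of ?a ?b] by (intro add_mono mult_right_mono) (auto simp: N_def)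
      finally show ?thesis by (simp add: dist_norm algebra_simps)
    qed
    moreover have "h z \<le> 0"
      using order_trans[OF bump_max_set[OF nrm, of z], of 0] z(1) unfolding h_def by simp
    moreover have "(N + 2 * r) * dist ?t z \<le> (N + 2 * r) * (15 * K ^ 3 * ?s ^ 3)"
      using calculation(1) r by (intro mult_left_mono) (auto simp: N_def)
    ultimately have "h ?t \<le> C2 * ?s ^ 3" by (simp add: C2_def mult_ac)
    also have "\<dots> = C2 * ?s * ?s\<^sup>2" by (simp add: power2_eq_square power3_eq_cube)
    also have "\<dots> \<le> C2 * ?s * (real m * Q y)"
      using Qs ysum_nonneg r K by (intro mult_left_mono mult_nonneg_nonneg) (auto simp: C2_def N_def)
    also have "\<dots> = C2 * real m * ?s * Q y" by simp
    also have "\<dots> \<le> C2 * real m * s1 * Q y"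
      using ysY(1)[OF y] Q0 r K by (intro mult_right_mono mult_left_mono) (auto simp: C2_def N_def)
    also have "\<dots> \<le> (\<eta> / 2) * Q y" using s1 Q0 by (intro mult_right_mono) auto
    finally show ?thesis by (simp add: H_def algebra_simps)
  qed
  \<comment> \<open>Hence \<open>H\<close> can be nonnegative over \<open>max_set\<close> only at
    (p, 0), which is not on \<open>BB\<close>. This is the strictness that
    \<open>contact_point\<close> asks for.\<close>
  have Hz: "x = p \<and> y = (\<lambda>i. 0)" if x: "x \<in> max_set" "x \<in> cball p \<rho>" and y: "y \<in> Y" and "0 \<le> H (x, y)" for x y
  proof -
    have "(\<eta> / 2) * Q y \<le> 0" using Hneg[OF x y] that(4) by simp
    then have "Q y = 0" using Q0[of y] \<eta>(1) by (simp add: mult_le_0_iff)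
    then have "\<forall>i<m. y i = 0" unfolding Q_def by (subst (asm) sum_nonneg_eq_0_iff) auto
    then have y0: "y = (\<lambda>i. 0)" using y unfolding Y_def fun_eq_iff by (metis (mono_tags, lifting) mem_Collect_eq not_less)
    then have "H (x, y) = h x" by (simp add: H_def theta_def Q_def)
    then have "(norm (x - p))\<^sup>2 \<le> 0" using that(4) bump_max_set[OF nrm x(1)] unfolding h_def by linarith
    then show ?thesis using y0 by simp
  qed
  obtain \<epsilon> z where e: "\<epsilon> > 0" and zz: "z \<in> KK - BB"
    and max: "\<And>w. w \<in> KK \<Longrightarrow> u (fst w) + \<epsilon> * H w \<le> u (fst z) + \<epsilon> * H z"
  proof (rule contact_point[of KK BB "\<lambda>w. u (fst w)" H "(p, \<lambda>i. 0)"])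
    show "compact KK" unfolding KK_def using Yc by (intro compact_Times) auto
    show "compact BB" by (rule BBc)
    show BK: "BB \<subseteq> KK" by (auto simp: BB_def KK_def)
    show "continuous_on KK (\<lambda>w. u (fst w))"
      unfolding KK_def by (rule continuous_on_compose2[OF smooth_onD(3)[OF smooth_u]]) (use \<rho>r in \<open>auto intro!: continuous_intros\<close>)
    have c: "continuous_on KK (\<lambda>z. snd z i)" for i
      using continuous_on_compose2[OF coord[of UNIV i], of KK snd] by (simp add: continuous_on_snd)
    have "continuous_on KK (\<lambda>z. h (theta (snd z) (fst z)))"
      unfolding KK_def h_def
      by (rule continuous_on_compose2[OF smooth_onD(3)[OF smooth_bump[OF open_UNIV]] continuous_on_theta[OF \<rho>r(3)]]) simp
    then show "continuous_on KK H"
      unfolding H_def Q_def by (intro continuous_intros c)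
    show "(p, \<lambda>i. 0) \<in> KK" using \<rho>(1) \<sigma> by (simp add: KK_def Y_def)
    show "u (fst (p, \<lambda>i. 0)) = 0" using p by (simp add: max_set_def)
    show "H (p, \<lambda>i. 0) = 0" by (simp add: H_def theta_def Q_def h_def bump_def)
    fix w assume w: "w \<in> BB"
    then have wK: "fst w \<in> cball p \<rho>" "snd w \<in> Y" using BK by (auto simp: KK_def)
    then have wV: "fst w \<in> V" using \<rho>r by auto
    show "u (fst w) \<le> 0" by (rule nonpos[OF wV])
    assume Hw: "0 \<le> H w"
    show "u (fst w) < 0"
    proof (rule ccontr)
      assume "\<not> u (fst w) < 0"
      then have "fst w \<in> max_set" using wV nonpos[OF wV] by (simp add: max_set_def)
      from Hz[OF this wK] Hw have "fst w = p" "snd w = (\<lambda>i. 0)" by auto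
      then show False using w \<rho>(1) \<sigma> by (auto simp: BB_def)
    qed
  qed blast
  obtain x y where z: "z = (x, y)" by (cases z)
  have x: "x \<in> cball p \<rho>" "dist p x < \<rho>" and y: "y \<in> Y" and yj: "\<And>j. j < m \<Longrightarrow> \<bar>y j\<bar> < \<sigma>"
    using zz by (auto simp: z KK_def BB_def Y_def less_le)
  have xr: "x \<in> cball p r" "x \<in> V" using x(1) \<rho>r(2,3) by blast+
  define s where "s = ysum y"
  have s: "0 \<le> s" "s \<le> s1" "s \<le> 1" using ysum_nonneg ysY[OF y] by (auto simp: s_def)
  have s2: "s\<^sup>2 \<le> s" using mult_left_mono[OF s(3,1)] by (simp add: power2_eq_square)
  define t where "t = theta y x"
  have tp: "norm (t - p) \<le> r" using thr[OF x(1) y] by (simp add: t_def dist_norm norm_minus_commute)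
  have tp2: "norm (t - p) \<le> \<rho> + 2 * K * s"
    using th[OF xr(1) y] x(2) norm_triangle_ineq[of "t - x" "x - p"] by (simp add: t_def s_def dist_norm norm_minus_commute)
  define \<delta>0 where "\<delta>0 = \<rho> - dist p x"
  have \<delta>0: "\<delta>0 > 0" using x(2) by (simp add: \<delta>0_def)
  have near: "w \<in> cball p \<rho>" if "w \<in> cball x \<delta>0" for w
    using that dist_triangle[of p w x] by (simp add: \<delta>0_def)
  have hd: "(h has_derivative (\<lambda>v. (\<nu> - 2 *\<^sub>R (w - p)) \<bullet> v)) (at w)" for w
  proof -
    have "fder (bump p \<nu>) w = (\<lambda>v. (\<nu> - 2 *\<^sub>R (w - p)) \<bullet> v)" by (rule ext) (rule fder_bump)
    then show ?thesis using smooth_onD(5)[OF smooth_bump[OF open_UNIV, of p \<nu>], of w] unfolding h_def by simp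
  qed
  have hc: "((\<lambda>s. h (c s)) has_vector_derivative (\<nu> - 2 *\<^sub>R (c s - p)) \<bullet> c') (at s within T)"
    if "(c has_vector_derivative c') (at s within T)" for c :: "real \<Rightarrow> 'e" and c' s T
    using vector_derivative_diff_chain_within[OF that has_derivative_at_withinI[OF hd]] by (simp add: o_def)
  \<comment> \<open>Only the penalty gives a term without the factor \<open>s\<close>. The
    derivatives of \<open>theta\<close> along the curve enter through \<open>c1\<close> and
    \<open>c2\<close>, both of order \<open>s\<close>.\<close>
  have second: "fder (\<lambda>y. fder u y (F j y)) x (F j x) \<le> \<epsilon> * (2 * \<eta> + C3 * s)" if j: "j < m" for j
  proof -
    obtain \<delta> \<gamma> where g: "\<delta> > 0" "\<gamma> 0 = x" "\<And>s. s \<in> {-\<delta>..\<delta>} \<Longrightarrow> \<gamma> s \<in> V \<and> \<gamma> s \<in> cball x \<delta>0"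
      "\<And>s. s \<in> {-\<delta>..\<delta>} \<Longrightarrow> (\<gamma> has_vector_derivative F j (\<gamma> s)) (at s within {-\<delta>..\<delta>})"
      using integral_curve[OF smooth_F[OF j] xr(2) \<delta>0] by metis
    define d where "d = min \<delta> (\<sigma> - \<bar>y j\<bar>)"
    have d: "d > 0" "d \<le> \<delta>" "d \<le> \<sigma> - \<bar>y j\<bar>" using g(1) yj[OF j] by (auto simp: d_def)
    let ?I = "{-d..d}"
    have I: "a \<in> {-\<delta>..\<delta>}" if "a \<in> ?I" for a using that d by auto
    have \<gamma>: "(\<gamma> has_vector_derivative F j (\<gamma> a)) (at a within ?I)" if "a \<in> ?I" for a
      by (rule has_vector_derivative_within_subset[OF g(4)[OF I[OF that]]]) (use d in auto)
    have \<gamma>V: "\<gamma> a \<in> V" "\<gamma> a \<in> cball p \<rho>" if "a \<in> ?I" for a using g(3)[OF I[OF that]] near by blast+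
    define y' where "y' a = y(j := y j + a)" for a
    have y0: "y' 0 = y" by (simp add: y'_def)
    have y'Y: "y' a \<in> Y" if "a \<in> ?I" for a
      using y that d j by (auto simp: Y_def y'_def abs_if split: if_splits)
    define c where "c a = theta (y' a) (\<gamma> a)" for a
    define c1 where "c1 a = theta1 j (y' a) (\<gamma> a)" for a
    define c2 where "c2 = theta2 j y x"
    have 0: "0 \<in> ?I" using d by simp
    have cd: "(c has_vector_derivative c1 a) (at a within ?I)" if "a \<in> ?I" for a
      unfolding c_def c1_def y'_def by (rule theta_along_curve[OF j \<gamma>[OF that] \<gamma>V(1)[OF that]])
    have c1d: "(c1 has_vector_derivative c2) (at 0 within ?I)"
      using theta1_along_curve[OF j \<gamma>[OF 0] \<gamma>V(1)[OF 0], of y] unfolding c1_def[abs_def] c2_def y'_def by (simp add: g(2))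
    have Qd: "((\<lambda>a. Q (y' a)) has_real_derivative 2 * (y j + a)) (at a within T)" for a T
    proof -
      have "((\<lambda>a. Q (y' a)) has_real_derivative (\<Sum>i<m. if i = j then 2 * (y j + a) else 0)) (at a within T)"
        unfolding Q_def y'_def by (intro DERIV_sum) (auto intro!: derivative_eq_intros)
      then show ?thesis using j by simp
    qed
    define G where "G a = u (\<gamma> a) + \<epsilon> * (h (c a) - \<eta> * Q (y' a))" for a
    define G1 where "G1 a = fder u (\<gamma> a) (F j (\<gamma> a)) + \<epsilon> * ((\<nu> - 2 *\<^sub>R (c a - p)) \<bullet> c1 a - \<eta> * (2 * (y j + a)))" for a
    define G2 where "G2 = fder (\<lambda>y. fder u y (F j y)) x (F j x)
      + \<epsilon> * ((\<nu> - 2 *\<^sub>R (t - p)) \<bullet> c2 + (- 2 *\<^sub>R c1 0) \<bullet> c1 0 - \<eta> * 2)"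
    have Gd: "(G has_real_derivative G1 a) (at a within ?I)" if "a \<in> ?I" for a
    proof -
      have 1: "((\<lambda>a. u (\<gamma> a)) has_real_derivative fder u (\<gamma> a) (F j (\<gamma> a))) (at a within ?I)"
        using derivative_along_curve[where \<gamma>=\<gamma>, OF smooth_u \<gamma>V(1)[OF that] \<gamma>[OF that]] by (simp add: has_real_derivative_iff_has_vector_derivative)
      have 2: "((\<lambda>a. h (c a)) has_real_derivative (\<nu> - 2 *\<^sub>R (c a - p)) \<bullet> c1 a) (at a within ?I)"
        using hc[OF cd[OF that]] by (simp add: has_real_derivative_iff_has_vector_derivative)
      show ?thesis unfolding G_def G1_def by (intro DERIV_add DERIV_cmult DERIV_diff 1 2 Qd)
    qed
    have G1d: "(G1 has_real_derivative G2) (at 0 within ?I)"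
    proof -
      have 1: "((\<lambda>a. fder u (\<gamma> a) (F j (\<gamma> a))) has_real_derivative fder (\<lambda>y. fder u y (F j y)) x (F j x)) (at 0 within ?I)"
        using derivative_along_curve[where \<gamma>=\<gamma>, OF smooth_on_fder_field[OF smooth_u smooth_F[OF j]] \<gamma>V(1)[OF 0] \<gamma>[OF 0]] g(2)
        by (simp add: has_real_derivative_iff_has_vector_derivative)
      have 2: "((\<lambda>a. \<nu> - 2 *\<^sub>R (c a - p)) has_vector_derivative - 2 *\<^sub>R c1 0) (at 0 within ?I)"
        using cd[OF 0] by (auto intro!: derivative_eq_intros)
      have 3: "((\<lambda>a. (\<nu> - 2 *\<^sub>R (c a - p)) \<bullet> c1 a) has_real_derivative (\<nu> - 2 *\<^sub>R (t - p)) \<bullet> c2 + (- 2 *\<^sub>R c1 0) \<bullet> c1 0) (at 0 within ?I)"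
        using bounded_bilinear.has_vector_derivative[OF bounded_bilinear_inner 2 c1d]
        by (simp add: has_real_derivative_iff_has_vector_derivative c_def y0 g(2) t_def)
      have 4: "((\<lambda>a. \<eta> * (2 * (y j + a))) has_real_derivative \<eta> * 2) (at 0 within ?I)"
        by (auto intro!: derivative_eq_intros)
      show ?thesis unfolding G1_def G2_def by (intro DERIV_add DERIV_cmult DERIV_diff 1 3 4)
    qed
    have Gmax: "G a \<le> G 0" if "a \<in> ?I" for a
      using max[of "(\<gamma> a, y' a)"] \<gamma>V(2)[OF that] y'Y[OF that]
      by (simp add: KK_def G_def H_def z c_def y0 g(2))
    have "G2 \<le> 0" by (rule second_derivative_test(2)[OF d(1) Gd G1d Gmax])
    then have "fder (\<lambda>y. fder u y (F j y)) x (F j x) \<le> \<epsilon> * (2 * \<eta> + (2 * (c1 0 \<bullet> c1 0) - (\<nu> - 2 *\<^sub>R (t - p)) \<bullet> c2))"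
      unfolding G2_def by (simp add: algebra_simps)
    also have "\<dots> \<le> \<epsilon> * (2 * \<eta> + C3 * s)"
    proof -
      have n1: "norm (c1 0) \<le> 2 * K * s"
      proof -
        have "norm (c1 0) \<le> (1/2) * norm (\<Sum>i<m. y i *\<^sub>R (FF j i x - FF i j x)) + (1/2) * norm (\<Sum>i<m. \<Sum>k<m. (y i * y k) *\<^sub>R FFF i k j x)"
          unfolding c1_def y0 g(2) theta1_def by (rule order_trans[OF norm_triangle_ineq]) simp
        also have "\<dots> \<le> (1/2) * (s * (2 * K)) + (1/2) * (s\<^sup>2 * K)"
        proof (intro add_mono mult_left_mono)
          show "norm (\<Sum>i<m. y i *\<^sub>R (FF j i x - FF i j x)) \<le> s * (2 * K)" unfolding s_def ysum_def
          proof (rule norm_weighted_sum_le)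
            fix i assume i: "i < m"
            show "norm (FF j i x - FF i j x) \<le> 2 * K"
              using norm_triangle_ineq4[of "FF j i x" "FF i j x"] bFF[OF i j xr(1)] bFF[OF j i xr(1)] by linarith
          qed
          show "norm (\<Sum>i<m. \<Sum>k<m. (y i * y k) *\<^sub>R FFF i k j x) \<le> s\<^sup>2 * K"
            unfolding s_def ysum_def by (rule norm_weighted_double_sum_le) (rule bFFF[OF _ _ j xr(1)])
        qed auto
        also have "\<dots> \<le> 2 * K * s" using mult_right_mono[OF s2, of K] K s(1) by (simp add: algebra_simps)
        finally show ?thesis .
      qed
      have n2: "norm c2 \<le> 3 * K * s"
      proof -
        have "norm c2 \<le> (1/2) * norm (\<Sum>i<m. y i *\<^sub>R (FFF j i j x - FFF i j j x))
            + (1/2) * (norm (\<Sum>i<m. \<Sum>k<m. (y i * y k) *\<^sub>R FFFF i k j x) + norm (\<Sum>i<m. y i *\<^sub>R (FFF j i j x + FFF i j j x)))"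
          unfolding c2_def theta2_def
          by (rule order_trans[OF norm_triangle_ineq])
            (simp only: norm_scaleR, intro add_mono mult_mono norm_triangle_ineq, auto)
        also have "\<dots> \<le> (1/2) * (s * (2 * K)) + (1/2) * (s\<^sup>2 * K + s * (2 * K))"
        proof (intro add_mono mult_left_mono)
          show "norm (\<Sum>i<m. y i *\<^sub>R (FFF j i j x - FFF i j j x)) \<le> s * (2 * K)" unfolding s_def ysum_def
          proof (rule norm_weighted_sum_le)
            fix i assume i: "i < m"
            show "norm (FFF j i j x - FFF i j j x) \<le> 2 * K"
              using norm_triangle_ineq4[of "FFF j i j x" "FFF i j j x"] bFFF[OF i j j xr(1)] bFFF[OF j i j xr(1)] by linarith
          qed
          show "norm (\<Sum>i<m. y i *\<^sub>R (FFF j i j x + FFF i j j x)) \<le> s * (2 * K)" unfolding s_def ysum_def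
          proof (rule norm_weighted_sum_le)
            fix i assume i: "i < m"
            show "norm (FFF j i j x + FFF i j j x) \<le> 2 * K"
              using norm_triangle_ineq[of "FFF j i j x" "FFF i j j x"] bFFF[OF i j j xr(1)] bFFF[OF j i j xr(1)] by linarith
          qed
          show "norm (\<Sum>i<m. \<Sum>k<m. (y i * y k) *\<^sub>R FFFF i k j x) \<le> s\<^sup>2 * K"
            unfolding s_def ysum_def by (rule norm_weighted_double_sum_le) (rule bFFFF[OF _ _ j xr(1)])
        qed auto
        also have "\<dots> \<le> 3 * K * s" using mult_right_mono[OF s2, of K] K s(1) by (simp add: algebra_simps)
        finally show ?thesis .
      qed
      have "c1 0 \<bullet> c1 0 = (norm (c1 0))\<^sup>2" by (simp add: power2_norm_eq_inner)
      also have "\<dots> \<le> (2 * K * s)\<^sup>2" using n1 by (intro power_mono) auto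
      also have "\<dots> = 4 * K\<^sup>2 * s\<^sup>2" by (simp add: power2_eq_square)
      also have "\<dots> \<le> 4 * K\<^sup>2 * s" using s2 by (intro mult_left_mono) auto
      finally have a: "2 * (c1 0 \<bullet> c1 0) \<le> 8 * K\<^sup>2 * s" by linarith
      have "- ((\<nu> - 2 *\<^sub>R (t - p)) \<bullet> c2) \<le> norm (\<nu> - 2 *\<^sub>R (t - p)) * norm c2"
        using Cauchy_Schwarz_ineq2[of "\<nu> - 2 *\<^sub>R (t - p)" c2] by linarith
      also have "\<dots> \<le> (N + 2 * r) * (3 * K * s)"
      proof (rule mult_mono[OF _ n2])
        show "norm (\<nu> - 2 *\<^sub>R (t - p)) \<le> N + 2 * r"
          using norm_triangle_ineq4[of \<nu> "2 *\<^sub>R (t - p)"] tp by (simp add: N_def)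
      qed (use r in \<open>auto simp: N_def\<close>)
      finally have b: "- ((\<nu> - 2 *\<^sub>R (t - p)) \<bullet> c2) \<le> 3 * K * (N + 2 * r) * s" by (simp add: mult_ac)
      have "C3 * s = 8 * K\<^sup>2 * s + 3 * K * (N + 2 * r) * s" by (simp add: C3_def algebra_simps)
      then have "2 * \<eta> + (2 * (c1 0 \<bullet> c1 0) - (\<nu> - 2 *\<^sub>R (t - p)) \<bullet> c2) \<le> 2 * \<eta> + C3 * s"
        using a b by linarith
      then show ?thesis using e by (intro mult_left_mono) auto
    qed
    finally show ?thesis .
  qed
  \<comment> \<open>The deviation of the derivative of \<open>theta y\<close> along
    \<open>F0\<close> from \<open>F0 x\<close> itself; it is small together with
    \<open>y\<close>.\<close>
  define E where "E = - (\<Sum>i<m. y i *\<^sub>R fder (F i) x (F0 x)) + (1/2) *\<^sub>R (\<Sum>i<m. \<Sum>k<m. (y i * y k) *\<^sub>R fder (FF i k) x (F0 x))"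
  have En: "norm E \<le> 2 * K * K * s"
  proof -
    have "norm E \<le> norm (\<Sum>i<m. y i *\<^sub>R fder (F i) x (F0 x)) + (1/2) * norm (\<Sum>i<m. \<Sum>k<m. (y i * y k) *\<^sub>R fder (FF i k) x (F0 x))"
      unfolding E_def by (rule order_trans[OF norm_triangle_ineq]) simp
    also have "\<dots> \<le> s * (K * K) + (1/2) * (s\<^sup>2 * (K * K))"
    proof (intro add_mono mult_left_mono)
      have KF: "K * norm (F0 x) \<le> K * K" using bF0[OF xr(1)] K by (intro mult_left_mono) auto
      show "norm (\<Sum>i<m. y i *\<^sub>R fder (F i) x (F0 x)) \<le> s * (K * K)"
        unfolding s_def ysum_def by (rule norm_weighted_sum_le) (rule order_trans[OF dF[OF _ xr(1)] KF])
      show "norm (\<Sum>i<m. \<Sum>k<m. (y i * y k) *\<^sub>R fder (FF i k) x (F0 x)) \<le> s\<^sup>2 * (K * K)"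
        unfolding s_def ysum_def by (rule norm_weighted_double_sum_le) (rule order_trans[OF dFF[OF _ _ xr(1)] KF])
    qed auto
    also have "\<dots> \<le> 2 * K * K * s" using mult_right_mono[OF s2, of "K * K"] K s(1) by (simp add: algebra_simps)
    finally show ?thesis .
  qed
  \<comment> \<open>Here \<open>y\<close> is held fixed and only \<open>x\<close> varies, so the
    maximum is critical in the direction \<open>F0 x\<close>.\<close>
  have first: "fder u x (F0 x) = - \<epsilon> * ((\<nu> - 2 *\<^sub>R (t - p)) \<bullet> (F0 x + E))"
  proof -
    have sth: "smooth_on V (theta y)" unfolding theta_def
      by (intro smooth_on_add smooth_on_diff smooth_on_id smooth_on_sum smooth_on_scaleR smooth_on_const V smooth_F smooth_FF) auto
    have sht: "smooth_on V (\<lambda>w. h (theta y w))"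
      unfolding h_def using smooth_on_compose[OF smooth_bump[OF open_UNIV] sth] by auto
    define w where "w x = u x + \<epsilon> * (h (theta y x) - \<eta> * Q y)" for x
    have sw: "smooth_on V w" unfolding w_def
      by (intro smooth_on_add smooth_u smooth_on_mult smooth_on_const V smooth_on_diff sht)
    have "fder w x (F0 x) = 0"
    proof (rule interior_max_derivatives(1)[OF sw smooth_F0 xr(2) \<delta>0])
      fix w' assume "w' \<in> cball x \<delta>0"
      then show "w w' \<le> w x" using max[of "(w', y)"] near y by (simp add: KK_def w_def z H_def)
    qed
    moreover have "fder w x (F0 x) = fder u x (F0 x) + \<epsilon> * fder (\<lambda>w. h (theta y w)) x (F0 x)"
      unfolding w_def
      by (simp add: fder_add fder_diff fder_linear[OF bounded_linear_mult_right] smooth_onD(4)[OF smooth_u xr(2)] smooth_onD(4)[OF sht xr(2)])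
    moreover have "fder (\<lambda>w. h (theta y w)) x (F0 x) = (\<nu> - 2 *\<^sub>R (t - p)) \<bullet> fder (theta y) x (F0 x)"
      using fder_eq[OF has_derivative_compose[OF smooth_onD(5)[OF sth xr(2)] hd]] by (simp add: t_def)
    moreover have "fder (theta y) x (F0 x) = F0 x + E"
    proof -
      have "(theta y has_derivative (\<lambda>v. v - (\<Sum>i<m. y i *\<^sub>R fder (F i) x v) + (1/2) *\<^sub>R (\<Sum>i<m. \<Sum>k<m. (y i * y k) *\<^sub>R fder (FF i k) x v))) (at x)"
        unfolding theta_def
        by (intro has_derivative_add has_derivative_diff has_derivative_ident has_derivative_sum has_derivative_scaleR_right
            smooth_onD(5)[OF smooth_F xr(2)] smooth_onD(5)[OF smooth_FF xr(2)]) auto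
      from fder_eq[OF this] show ?thesis by (simp add: E_def)
    qed
    ultimately show ?thesis by simp
  qed
  \<comment> \<open>An eighth of \<open>\<kappa>\<close> is lost to each of three causes: the
    variation of \<open>F0\<close> near \<open>p\<close>, the terms with the factor
    \<open>s\<close>, and the radius \<open>\<rho>\<close>.\<close>
  have low: "\<kappa> / 2 \<le> (\<nu> - 2 *\<^sub>R (t - p)) \<bullet> (F0 x + E)"
  proof -
    have "\<bar>F0 x \<bullet> \<nu> - \<kappa>\<bar> < \<kappa> / 8" using d(2)[of x] x(2) \<rho>(3) 
      by (simp add: dist_commute[of p x] dist_real_def \<kappa>_def)
    then have a: "F0 x \<bullet> \<nu> > \<kappa> - \<kappa> / 8" by linarith
    have b: "\<nu> \<bullet> E \<ge> - (2 * N * K * (K * s))"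
    proof -
      have "- (\<nu> \<bullet> E) \<le> N * norm E" using Cauchy_Schwarz_ineq2[of \<nu> E] by (simp add: N_def)
      also have "\<dots> \<le> N * (2 * K * K * s)" using En by (intro mult_left_mono) (auto simp: N_def)
      finally show ?thesis by (simp add: mult_ac)
    qed
    have "norm (F0 x + E) \<le> K + 2 * K * (K * s)"
      using norm_triangle_ineq[of "F0 x" E] bF0[OF xr(1)] En by (simp add: mult_ac)
    also have "\<dots> \<le> 3 * K"
    proof -
      have "K * s \<le> K * s1" using s K by (intro mult_left_mono) auto
      then have "K * s \<le> 1" using s1 by linarith
      then have "2 * K * (K * s) \<le> 2 * K * 1" using K by (intro mult_left_mono) auto
      then show ?thesis by simp
    qed
    finally have c: "norm (F0 x + E) \<le> 3 * K" .
    have "2 * ((t - p) \<bullet> (F0 x + E)) \<le> 2 * (norm (t - p) * norm (F0 x + E))"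
      using norm_cauchy_schwarz[of "t - p" "F0 x + E"] by simp
    also have "\<dots> \<le> 2 * ((\<rho> + 2 * K * s) * (3 * K))"
      using tp2 c by (intro mult_left_mono mult_mono) (auto intro: order_trans[OF norm_ge_zero])
    also have "\<dots> = 6 * K * \<rho> + 12 * K\<^sup>2 * s" by (simp add: power2_eq_square algebra_simps)
    finally have f: "2 * ((t - p) \<bullet> (F0 x + E)) \<le> 6 * K * \<rho> + 12 * K\<^sup>2 * s" .
    have "2 * N * K * (K * s) + 12 * K\<^sup>2 * s = (2 * N * K\<^sup>2 + 12 * K\<^sup>2) * s" by (simp add: power2_eq_square algebra_simps)
    also have "\<dots> \<le> (2 * N * K\<^sup>2 + 12 * K\<^sup>2) * s1" using s by (intro mult_left_mono) (auto simp: N_def)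
    finally have "2 * N * K * (K * s) + 12 * K\<^sup>2 * s \<le> \<kappa> / 8" using s1(6) by linarith
    moreover have "(\<nu> - 2 *\<^sub>R (t - p)) \<bullet> (F0 x + E) = F0 x \<bullet> \<nu> + \<nu> \<bullet> E - 2 * ((t - p) \<bullet> (F0 x + E))"
      by (simp add: inner_diff_left inner_add_right inner_commute[of "F0 x" \<nu>] algebra_simps)
    moreover have "\<kappa> / 2 \<le> a' + b' - f'"
      if "x1 + x2 \<le> \<kappa> / 8" "\<kappa> - \<kappa> / 8 < a'" "- x1 \<le> b'" "f' \<le> x3 + x2" "x3 \<le> \<kappa> / 8" for a' b' f' x1 x2 x3
      using that \<kappa> by linarith
    ultimately show ?thesis using a b f \<rho>(4) by presburger
  qed
  \<comment> \<open>The squares contribute at most a quarter of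
    \<open>\<epsilon> * \<kappa>\<close>, while the drift contributes at most minus one half of it,
    so the equation cannot hold at \<open>x\<close>.\<close>
  have "(\<Sum>j<m. fder (\<lambda>y. fder u y (F j y)) x (F j x)) \<le> (\<Sum>j<m. \<epsilon> * (2 * \<eta> + C3 * s))"
    using second by (intro sum_mono) auto
  also have "\<dots> = \<epsilon> * (real m * (2 * \<eta>) + real m * C3 * s)" by (simp add: algebra_simps)
  also have "\<dots> \<le> \<epsilon> * (\<kappa> / 8 + \<kappa> / 8)"
  proof -
    have "real m * C3 * s \<le> real m * C3 * s1"
      using s K r by (intro mult_left_mono) (auto simp: C3_def N_def)
    then show ?thesis using \<eta>(2) s1(5) e by (intro mult_left_mono) auto
  qed
  finally have "(\<Sum>j<m. fder (\<lambda>y. fder u y (F j y)) x (F j x)) \<le> \<epsilon> * (\<kappa> / 4)" by simp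
  moreover have "fder u x (F0 x) \<le> - (\<epsilon> * (\<kappa> / 2))"
    unfolding first using mult_left_mono[OF low, of \<epsilon>] e by simp
  ultimately have "(\<Sum>j<m. fder (\<lambda>y. fder u y (F j y)) x (F j x)) + fder u x (F0 x) \<le> \<epsilon> * (\<kappa> / 4) - \<epsilon> * (\<kappa> / 2)"
    by simp
  also have "\<dots> < 0" using e \<kappa> by (simp add: field_simps)
  finally show False using equation[OF xr(2)] by simp
qed

end

section \<open>Weak derivatives of the indicator function of the maximum set\<close>

definition divg :: "('e::euclidean_space \<Rightarrow> 'e) \<Rightarrow> 'e \<Rightarrow> real" where
  "divg N x = (\<Sum>b\<in>Basis. fder N x b \<bullet> b)"

section \<open>Divergence theorem for fields with compact support\<close>

lemma integrable_compact_support: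
  fixes g :: "'e::euclidean_space \<Rightarrow> real"
  assumes "continuous_on UNIV g" "compact K" "\<And>x. x \<notin> K \<Longrightarrow> g x = 0"
  shows "integrable lborel g"
proof -
  have "integrable lborel (\<lambda>x. indicator K x *\<^sub>R g x)"
    using borel_integrable_compact[OF assms(2) continuous_on_subset[OF assms(1)]] by simp
  moreover have "(\<lambda>x. indicator K x *\<^sub>R g x) = g" using assms(3) by (auto simp: indicator_def fun_eq_iff)
  ultimately show ?thesis by simp
qed

text \<open>The values of \<open>g\<close> matter only on \<open>V\<close>: a point outside
  \<open>V\<close> has the neighbourhood \<open>- K\<close>, on which the product is identically
  zero.\<close>

lemma Ck_on_cutoff:
  fixes \<phi> :: "'e::euclidean_space \<Rightarrow> real"
  assumes \<phi>: "Ck_on k UNIV \<phi>" "\<And>x. x \<notin> K \<Longrightarrow> \<phi> x = 0" and K: "compact K" "K \<subseteq> V" and V: "open V" and g: "Ck_on k V g"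
  shows "Ck_on k UNIV (\<lambda>x. \<phi> x *\<^sub>R g x)"
proof (rule Ck_on_local)
  fix x :: 'e
  show "\<exists>N. open N \<and> x \<in> N \<and> Ck_on k N (\<lambda>x. \<phi> x *\<^sub>R g x)"
  proof (cases "x \<in> V")
    case True
    have "Ck_on k V (\<lambda>x. \<phi> x *\<^sub>R g x)"
      using Ck_on_bilinear[OF bounded_bilinear_scaleR V Ck_on_subset[OF \<phi>(1)] g] by simp
    then show ?thesis using V True by blast
  next
    case False
    have "open (- K)" using compact_imp_closed[OF K(1)] by (simp add: open_Compl)
    moreover from this have "Ck_on k (- K) (\<lambda>x. \<phi> x *\<^sub>R g x)"
      by (rule Ck_on_cong[OF _ _ Ck_on_const[of k _ 0]]) (use \<phi>(2) in auto)
    ultimately show ?thesis using False K(2) by blast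
  qed
qed

lemma fder_outside_support:
  assumes "compact K" "\<And>x. x \<notin> K \<Longrightarrow> g x = 0" "x \<notin> K"
  shows "fder g x v = 0"
proof -
  have "open (- K)" using compact_imp_closed[OF assms(1)] by (simp add: open_Compl)
  from fder_cong[OF this, of x g "\<lambda>x. 0"] show ?thesis using assms(2,3) by simp
qed

lemma lborel_integral_translate:
  fixes g :: "'e::euclidean_space \<Rightarrow> real"
  assumes "g \<in> borel_measurable borel"
  shows "(\<integral>x. g (c + x) \<partial>lborel) = (\<integral>x. g x \<partial>lborel)"
proof -
  have "(\<integral>x. g x \<partial>lborel) = (\<integral>x. g x \<partial>distr lborel borel ((+) c))" by (simp add: lborel_distr_plus)
  also have "\<dots> = (\<integral>x. g (c + x) \<partial>lborel)" using assms by (subst integral_distr) auto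
  finally show ?thesis by simp
qed

text \<open>By translation invariance every difference quotient has integral zero, and dominated
  convergence passes to the limit; iterated integration is avoided.\<close>

lemma integral_fder_compact_support:
  fixes g :: "'e::euclidean_space \<Rightarrow> real"
  assumes g: "Ck_on (Suc 0) UNIV g" and K: "compact K" "\<And>x. x \<notin> K \<Longrightarrow> g x = 0"
  shows "integrable lborel (\<lambda>x. fder g x b)" "(\<integral>x. fder g x b \<partial>lborel) = 0"
proof -
  have gd: "g differentiable at x" for x using g by simp
  have gc: "continuous_on UNIV g" using Ck_on_imp_continuous_on[OF g] .
  have dc: "continuous_on UNIV (\<lambda>x. fder g x b)" using g by simp
  have d0: "fder g x b = 0" if "x \<notin> K" for x by (rule fder_outside_support[OF K that])
  show "integrable lborel (\<lambda>x. fder g x b)" by (rule integrable_compact_support[OF dc K(1) d0])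
  obtain B where B: "B \<ge> 0" "\<And>x. \<bar>fder g x b\<bar> \<le> B"
  proof -
    have "compact ((\<lambda>x. fder g x b) ` K)" using dc K by (intro compact_continuous_image continuous_on_subset[OF dc]) auto
    from compact_imp_bounded[OF this] obtain B where B: "B > 0" "\<forall>x\<in>K. \<bar>fder g x b\<bar> \<le> B"
      unfolding bounded_pos by auto
    show ?thesis
    proof (rule that[of B])
      show "\<bar>fder g x b\<bar> \<le> B" for x using B d0[of x] by (cases "x \<in> K") auto
    qed (use B in simp)
  qed
  obtain R where R: "R > 0" "K \<subseteq> cball 0 R" 
    using compact_imp_bounded[OF K(1)] unfolding bounded_pos by (auto simp: subset_iff)
  \<comment> \<open>Contains the supports of all difference quotients, because the steps are at most
    1.\<close>
  let ?K = "cball (0::'e) (R + norm b)"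
  define h where "h n x = (g (x + (1 / real (Suc n)) *\<^sub>R b) - g x) / (1 / real (Suc n))" for n x
  have gi: "integrable lborel g" by (rule integrable_compact_support[OF gc K])
  have gm: "g \<in> borel_measurable borel" using gc by (rule borel_measurable_continuous_onI)
  have gti: "integrable lborel (\<lambda>x. g (c + x))" for c
    using gi integrable_distr_eq[of "(+) c" lborel borel g] gm by (simp add: lborel_distr_plus)
  have hint: "(\<integral>x. h n x \<partial>lborel) = 0" for n
  proof -
    let ?c = "(1 / real (Suc n)) *\<^sub>R b"
    have "(\<integral>x. h n x \<partial>lborel) = (\<integral>x. g (?c + x) - g x \<partial>lborel) / (1 / real (Suc n))"
      unfolding h_def by (simp only: add.commute integral_divide_zero)
    also have "(\<integral>x. g (?c + x) - g x \<partial>lborel) = 0"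
      using lborel_integral_translate[OF gm, of ?c] by (simp add: Bochner_Integration.integral_diff gti gi)
    finally show ?thesis by simp
  qed
  have lim: "(\<lambda>n. h n x) \<longlonglongrightarrow> fder g x b" for x
  proof -
    have "((\<lambda>s. g (x + s *\<^sub>R b)) has_real_derivative fder g x b) (at 0)"
      using line_derivative[of g x 0 b UNIV] gd by (simp add: has_real_derivative_iff_has_vector_derivative)
    then have "((\<lambda>s. (g (x + s *\<^sub>R b) - g x) / s) \<longlongrightarrow> fder g x b) (at 0)"
      by (simp add: DERIV_def)
    moreover have "filterlim (\<lambda>n. 1 / real (Suc n)) (at 0) sequentially"
      unfolding filterlim_at using LIMSEQ_inverse_real_of_nat by (auto simp: inverse_eq_divide)
    ultimately show ?thesis unfolding h_def by (rule filterlim_compose)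
  qed
  have bnd: "norm (h n x) \<le> B * indicator ?K x" for n x
  proof (cases "x \<in> ?K")
    case True
    let ?s = "1 / real (Suc n)"
    have s: "?s > 0" by simp
    obtain z where "g (x + ?s *\<^sub>R b) - g (x + 0 *\<^sub>R b) = (?s - 0) * fder g (x + z *\<^sub>R b) b"
      using MVT2[OF s, of "\<lambda>s. g (x + s *\<^sub>R b)" "\<lambda>s. fder g (x + s *\<^sub>R b) b"] line_derivative[of g x _ b UNIV] gd
      by (auto simp: has_real_derivative_iff_has_vector_derivative)
    then have "h n x = fder g (x + z *\<^sub>R b) b" unfolding h_def using s by (simp del: of_nat_Suc)
    then show ?thesis using B True by simp
  next
    case False
    have "norm ((1 / real (Suc n)) *\<^sub>R b) \<le> norm b"
      using mult_right_mono[of "1 / real (Suc n)" 1 "norm b"] by simp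
    then have "x + (1 / real (Suc n)) *\<^sub>R b \<notin> cball 0 R" "x \<notin> cball 0 R"
      using False norm_triangle_ineq4[of "x + (1 / real (Suc n)) *\<^sub>R b" "(1 / real (Suc n)) *\<^sub>R b"] norm_ge_zero[of b]
      unfolding mem_cball_0 add_diff_cancel_right' by linarith+
    then have "g (x + (1 / real (Suc n)) *\<^sub>R b) = 0" "g x = 0" using K(2) R(2) by blast+
    then show ?thesis using False by (simp add: h_def)
  qed
  have hm: "h n \<in> borel_measurable lborel" for n
  proof -
    have "continuous_on UNIV (h n)" unfolding h_def
      by (intro continuous_intros continuous_on_compose2[OF gc]) auto
    then show ?thesis using borel_measurable_continuous_onI by simp
  qed
  have "(\<lambda>n. \<integral>x. h n x \<partial>lborel) \<longlonglongrightarrow> (\<integral>x. fder g x b \<partial>lborel)"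
  proof (rule integral_dominated_convergence[where w="\<lambda>x. B * indicator ?K x"])
    show "(\<lambda>x. fder g x b) \<in> borel_measurable lborel" using borel_measurable_continuous_onI[OF dc] by simp
    show "h n \<in> borel_measurable lborel" for n by (rule hm)
    have "integrable lborel (indicator ?K :: 'e \<Rightarrow> real)"
      using emeasure_lborel_cball_finite by (intro integrable_real_indicator) auto
    then show "integrable lborel (\<lambda>x. B * indicator ?K x)" by (intro integrable_mult_right)
    show "AE x in lborel. (\<lambda>n. h n x) \<longlonglongrightarrow> fder g x b" using lim by simp
    show "AE x in lborel. norm (h n x) \<le> B * indicator ?K x" for n using bnd by simp
  qed
  then show "(\<integral>x. fder g x b \<partial>lborel) = 0" unfolding hint LIMSEQ_const_iff by simp
qed

lemma
  fixes N :: "'e::euclidean_space \<Rightarrow> 'e"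
  assumes N: "Ck_on (Suc 0) UNIV N" and K: "compact K" "\<And>x. x \<notin> K \<Longrightarrow> N x = 0"
  shows integral_divg: "(\<integral>x. divg N x \<partial>lborel) = 0"
    and continuous_on_divg: "continuous_on UNIV (divg N)"
    and divg_outside: "x \<notin> K \<Longrightarrow> divg N x = 0"
    and integrable_divg: "integrable lborel (divg N)"
proof -
  have nb: "Ck_on (Suc 0) UNIV (\<lambda>x. N x \<bullet> b)" for b
    by (rule Ck_on_linear[OF bounded_linear_inner_left open_UNIV N])
  have fb: "fder (\<lambda>x. N x \<bullet> b) x v = fder N x v \<bullet> b" for x b v
  proof -
    have "N differentiable at x" using N by simp
    then show ?thesis by (rule fder_linear[OF bounded_linear_inner_left])
  qed
  have i: "integrable lborel (\<lambda>x. fder N x b \<bullet> b)" "(\<integral>x. fder N x b \<bullet> b \<partial>lborel) = 0" for b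
    using integral_fder_compact_support[OF nb K(1), of b b] K(2) by (simp_all add: fb)
  show "(\<integral>x. divg N x \<partial>lborel) = 0" unfolding divg_def using i by (simp add: Bochner_Integration.integral_sum)
  show "continuous_on UNIV (divg N)" unfolding divg_def using N by (auto intro!: continuous_intros)
  show "x \<notin> K \<Longrightarrow> divg N x = 0" unfolding divg_def using fder_outside_support[OF K] by simp
  show "integrable lborel (divg N)" unfolding divg_def using i by (intro Bochner_Integration.integrable_sum)
qed

lemma divg_scaleR:
  assumes "g differentiable at x" "N differentiable at x"
  shows "divg (\<lambda>x. g x *\<^sub>R N x) x = g x * divg N x + fder g x (N x)"
proof -
  have "divg (\<lambda>x. g x *\<^sub>R N x) x = (\<Sum>b\<in>Basis. g x * (fder N x b \<bullet> b) + (N x \<bullet> b) * fder g x b)"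
    unfolding divg_def by (simp add: fder_scaleR[OF assms] inner_add_left mult.commute)
  also have "\<dots> = g x * divg N x + (\<Sum>b\<in>Basis. (N x \<bullet> b) * fder g x b)"
    by (simp add: sum.distrib sum_distrib_left divg_def)
  also have "(\<Sum>b\<in>Basis. (N x \<bullet> b) * fder g x b) = fder g x (N x)"
    using fder_expand[OF assms(1), of "N x"] by simp
  finally show ?thesis .
qed

text \<open>The function \<open>- Ln (1 + \<epsilon> - f)\<close> is annihilated by \<open>X + \<i> Y\<close>; its real part is close to
  \<open>ln (1/\<epsilon>)\<close> on \<open>{f = 1}\<close> and bounded elsewhere, while its imaginary part is bounded by \<open>\<pi>/2\<close>
  everywhere. Dividing by \<open>ln (1/\<epsilon>)\<close> shows that \<open>X\<close> annihilates the indicator function of \<open>{f = 1}\<close>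
  in the sense of distributions.\<close>

lemma weak_derivative_indicator:
  fixes f :: "'e::euclidean_space \<Rightarrow> complex"
  assumes f: "smooth_on V f" and f1: "\<And>x. x \<in> V \<Longrightarrow> cmod (f x) \<le> 1"
    and X: "smooth_on V X" and Y: "smooth_on V Y"
    and CR: "\<And>x. x \<in> V \<Longrightarrow> fder f x (X x) + \<i> * fder f x (Y x) = 0"
    and \<phi>: "Ck_on (Suc 0) UNIV \<phi>" and K: "compact K" "K \<subseteq> V" "\<And>x. x \<notin> K \<Longrightarrow> \<phi> x = 0"
  shows "(\<integral>x. indicator {x \<in> V. f x = 1} x * divg (\<lambda>x. \<phi> x *\<^sub>R X x) x \<partial>lborel) = 0"
    "integrable lborel (\<lambda>x. indicator {x \<in> V. f x = 1} x * divg (\<lambda>x. \<phi> x *\<^sub>R X x) x)"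
proof -
  have V: "open V" using smooth_onD(1)[OF f] .
  define NX where "NX x = \<phi> x *\<^sub>R X x" for x
  define NY where "NY x = \<phi> x *\<^sub>R Y x" for x
  have CN: "Ck_on (Suc 0) UNIV NX" "Ck_on (Suc 0) UNIV NY"
    unfolding NX_def NY_def by (intro Ck_on_cutoff[OF \<phi> K(3,1,2) V] smooth_onD(2)[OF X] smooth_onD(2)[OF Y]; simp)+
  have N0: "NX x = 0" "NY x = 0" if "x \<notin> K" for x using K(3)[OF that] by (simp_all add: NX_def NY_def)
  \<comment> \<open>Since |f| is at most 1, the shift by \<open>\<epsilon>\<close> puts the argument
    of \<open>Ln\<close> into the open right half plane, away from the branch cut.\<close>
  define L where "L \<epsilon> x = - Ln (1 + complex_of_real \<epsilon> - f x)" for \<epsilon> x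
  have Rep: "Re (1 + complex_of_real \<epsilon> - f x) \<ge> \<epsilon>" if "x \<in> V" for \<epsilon> x
    using f1[OF that] complex_Re_le_cmod[of "f x"] by simp
  have Ld: "(L \<epsilon> has_derivative (\<lambda>v. fder f x v / (1 + complex_of_real \<epsilon> - f x))) (at x)"
    if "\<epsilon> > 0" "x \<in> V" for \<epsilon> x
  proof -
    let ?w = "1 + complex_of_real \<epsilon> - f x"
    have nr: "?w \<notin> \<real>\<^sub>\<le>\<^sub>0" using Rep[OF that(2), of \<epsilon>] that(1) by (auto simp: complex_nonpos_Reals_iff)
    have "((\<lambda>x. 1 + complex_of_real \<epsilon> - f x) has_derivative (\<lambda>v. - fder f x v)) (at x)"
      using has_derivative_diff[OF has_derivative_const smooth_onD(5)[OF f that(2)]] by simp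
    moreover have "(Ln has_derivative (\<lambda>v. v * inverse ?w)) (at ?w)"
      using has_field_derivative_Ln[OF nr] by (simp add: has_field_derivative_def mult.commute[of _ "inverse ?w"])
    ultimately have "((\<lambda>x. Ln (1 + complex_of_real \<epsilon> - f x)) has_derivative (\<lambda>v. - fder f x v * inverse ?w)) (at x)"
      using has_derivative_compose by fastforce
    from has_derivative_minus[OF this] show ?thesis unfolding L_def by (simp add: divide_inverse)
  qed
  have CL: "Ck_on (Suc 0) V (L \<epsilon>)" if "\<epsilon> > 0" for \<epsilon>
  proof -
    have "continuous_on V (\<lambda>x. fder (L \<epsilon>) x v)" for v
    proof -
      have "continuous_on V (\<lambda>x. fder f x v / (1 + complex_of_real \<epsilon> - f x))"
      proof (intro continuous_intros smooth_onD(3)[OF smooth_on_fder[OF f]] smooth_onD(3)[OF f] ballI)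
        fix x assume "x \<in> V"
        then have "Re (1 + complex_of_real \<epsilon> - f x) > 0" using Rep[of x \<epsilon>] that by linarith
        then show "1 + complex_of_real \<epsilon> - f x \<noteq> 0" by (metis less_irrefl zero_complex.simps(1))
      qed
      then show ?thesis by (rule continuous_on_eq) (simp add: fder_eq[OF Ld[OF that]])
    qed
    then show ?thesis using differentiableI[OF Ld[OF that]] by simp
  qed
  define a where "a \<epsilon> x = Re (L \<epsilon> x)" for \<epsilon> x
  define b where "b \<epsilon> x = Im (L \<epsilon> x)" for \<epsilon> x
  have Ca: "Ck_on (Suc 0) V (a \<epsilon>)" "Ck_on (Suc 0) V (b \<epsilon>)" if "\<epsilon> > 0" for \<epsilon>
    unfolding a_def b_def by (intro Ck_on_linear[OF _ V CL[OF that]] bounded_linear_Re bounded_linear_Im)+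
  have ab: "fder (a \<epsilon>) x (X x) = fder (b \<epsilon>) x (Y x)" if "\<epsilon> > 0" "x \<in> V" for \<epsilon> x
  proof -
    have "L \<epsilon> differentiable at x" using differentiableI[OF Ld[OF that]] .
    then have "fder (a \<epsilon>) x (X x) = Re (fder f x (X x) / (1 + complex_of_real \<epsilon> - f x))"
      "fder (b \<epsilon>) x (Y x) = Im (fder f x (Y x) / (1 + complex_of_real \<epsilon> - f x))"
      unfolding a_def b_def by (simp_all add: fder_linear[OF bounded_linear_Re] fder_linear[OF bounded_linear_Im] fder_eq[OF Ld[OF that]])
    moreover have "fder f x (X x) = - (\<i> * fder f x (Y x))" using CR[OF that(2)] by (simp add: add_eq_0_iff2)
    ultimately show ?thesis
      by (metis Im_i_times Re_i_times minus_complex.simps(1) mult_minus_left times_divide_eq_right uminus_complex.simps(1) minus_minus)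
  qed
  have parts: "(\<integral>x. g x * divg (\<lambda>x. \<phi> x *\<^sub>R Z x) x \<partial>lborel) = - (\<integral>x. \<phi> x * fder g x (Z x) \<partial>lborel)"
    and gint: "integrable lborel (\<lambda>x. g x * divg (\<lambda>x. \<phi> x *\<^sub>R Z x) x)"
    if g: "Ck_on (Suc 0) V g" and Z: "smooth_on V Z" for g Z
  proof -
    define N where "N x = \<phi> x *\<^sub>R Z x" for x
    have CNZ: "Ck_on (Suc 0) UNIV N" unfolding N_def by (rule Ck_on_cutoff[OF \<phi> K(3,1,2) V smooth_onD(2)[OF Z]])
    have N0: "N x = 0" if "x \<notin> K" for x using K(3)[OF that] by (simp add: N_def)
    have cd: "continuous_on UNIV (divg N)" and d0: "\<And>x. x \<notin> K \<Longrightarrow> divg N x = 0"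
      using continuous_on_divg[OF CNZ K(1) N0] divg_outside[OF CNZ K(1) N0] by auto
    have "Ck_on 0 UNIV (\<lambda>x. divg N x *\<^sub>R g x)"
      using cd by (intro Ck_on_cutoff[OF _ d0 K(1,2) V Ck_on_Suc_imp[OF g]]) simp_all
    then have c1: "continuous_on UNIV (\<lambda>x. g x * divg N x)" by (simp add: mult.commute)
    have i1: "integrable lborel (\<lambda>x. g x * divg N x)"
      by (rule integrable_compact_support[OF c1 K(1)]) (simp add: d0)
    have cgZ: "continuous_on V (\<lambda>x. fder g x (Z x))"
    proof -
      have "continuous_on V (\<lambda>x. \<Sum>b\<in>Basis. (Z x \<bullet> b) *\<^sub>R fder g x b)"
        using g smooth_onD(3)[OF Z] by (intro continuous_intros) auto
      then show ?thesis by (rule continuous_on_eq) (use g fder_expand[symmetric] in fastforce)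
    qed
    have "Ck_on 0 UNIV (\<lambda>x. \<phi> x *\<^sub>R fder g x (Z x))"
      using cgZ by (intro Ck_on_cutoff[OF Ck_on_Suc_imp[OF \<phi>] K(3,1,2) V]) simp_all
    then have i2: "integrable lborel (\<lambda>x. \<phi> x * fder g x (Z x))"
      by (intro integrable_compact_support[OF _ K(1)]) (simp_all add: K(3))
    have CgN: "Ck_on (Suc 0) UNIV (\<lambda>x. \<phi> x *\<^sub>R (g x *\<^sub>R Z x))"
      by (rule Ck_on_cutoff[OF \<phi> K(3,1,2) V Ck_on_bilinear[OF bounded_bilinear_scaleR V g smooth_onD(2)[OF Z]]])
    have dd: "divg (\<lambda>x. \<phi> x *\<^sub>R (g x *\<^sub>R Z x)) x = g x * divg N x + \<phi> x * fder g x (Z x)" for x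
    proof (cases "x \<in> V")
      case True
      have e: "(\<lambda>x. \<phi> x *\<^sub>R (g x *\<^sub>R Z x)) = (\<lambda>x. g x *\<^sub>R N x)" by (simp add: N_def mult.commute fun_eq_iff)
      have "g differentiable at x" "N differentiable at x" using g True CNZ by auto
      from divg_scaleR[OF this] have "divg (\<lambda>x. g x *\<^sub>R N x) x = g x * divg N x + fder g x (N x)" .
      moreover have "fder g x (N x) = \<phi> x * fder g x (Z x)"
        unfolding N_def using fder_linear_arg(2)[OF \<open>g differentiable at x\<close>] by simp
      ultimately show ?thesis unfolding e by simp
    next
      case False
      then have "x \<notin> K" using K by blast
      then show ?thesis using divg_outside[OF CgN K(1)] K(3) d0 by simp
    qed
    have "(\<integral>x. g x * divg N x + \<phi> x * fder g x (Z x) \<partial>lborel) = 0"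
      using integral_divg[OF CgN K(1)] K(3) unfolding dd by simp
    then show "(\<integral>x. g x * divg (\<lambda>x. \<phi> x *\<^sub>R Z x) x \<partial>lborel) = - (\<integral>x. \<phi> x * fder g x (Z x) \<partial>lborel)"
      unfolding N_def[symmetric] using i1 i2 by simp
    show "integrable lborel (\<lambda>x. g x * divg (\<lambda>x. \<phi> x *\<^sub>R Z x) x)" using i1 unfolding N_def .
  qed
  \<comment> \<open>The derivative is moved from the test field onto the real part of the logarithm,
    exchanged for the derivative of the imaginary part along \<open>Y\<close>, and moved back onto
    the test field of \<open>Y\<close>.\<close>
  have swap: "(\<integral>x. a \<epsilon> x * divg NX x \<partial>lborel) = (\<integral>x. b \<epsilon> x * divg NY x \<partial>lborel)" if "\<epsilon> > 0" for \<epsilon>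
  proof -
    have "\<phi> x * fder (a \<epsilon>) x (X x) = \<phi> x * fder (b \<epsilon>) x (Y x)" for x
      using ab[OF that, of x] K by (cases "x \<in> V") auto
    then have e: "(\<lambda>x. \<phi> x * fder (a \<epsilon>) x (X x)) = (\<lambda>x. \<phi> x * fder (b \<epsilon>) x (Y x))" by (rule ext)
    show ?thesis
      using parts[OF Ca(1)[OF that] X] parts[OF Ca(2)[OF that] Y] unfolding NX_def NY_def e by simp
  qed
  define C where "C = (\<integral>x. pi / 2 * \<bar>divg NY x\<bar> \<partial>lborel)"
  have iY: "integrable lborel (divg NY)" and iX: "integrable lborel (divg NX)"
    using integrable_divg[OF CN(2) K(1) N0(2)] integrable_divg[OF CN(1) K(1) N0(1)] by auto
  have bC: "\<bar>\<integral>x. b \<epsilon> x * divg NY x \<partial>lborel\<bar> \<le> C" if "\<epsilon> > 0" for \<epsilon>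
  proof -
    have "norm (\<integral>x. b \<epsilon> x * divg NY x \<partial>lborel) \<le> C" unfolding C_def
    proof (rule Bochner_Integration.integral_norm_bound_integral)
      show "integrable lborel (\<lambda>x. b \<epsilon> x * divg NY x)" using gint[OF Ca(2)[OF that] Y] unfolding NY_def .
      show "integrable lborel (\<lambda>x. pi / 2 * \<bar>divg NY x\<bar>)" using iY by (intro integrable_mult_right integrable_abs)
      fix x :: 'e
      show "norm (b \<epsilon> x * divg NY x) \<le> pi / 2 * \<bar>divg NY x\<bar>"
      proof (cases "x \<in> V")
        case True
        let ?w = "1 + complex_of_real \<epsilon> - f x"
        have "Re ?w > 0" using Rep[OF True, of \<epsilon>] that by linarith
        then have "\<bar>Im (Ln ?w)\<bar> < pi / 2" using Re_Ln_pos_lt_imp Re_Ln_pos_lt by (metis complex_eq_iff less_irrefl zero_complex.simps(1))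
        then have "\<bar>b \<epsilon> x\<bar> \<le> pi / 2" by (simp add: b_def L_def)
        then show ?thesis using mult_right_mono[of "\<bar>b \<epsilon> x\<bar>" "pi / 2" "\<bar>divg NY x\<bar>"] by (simp add: abs_mult)
      next
        case False
        then have "divg NY x = 0" using K(2) by (intro divg_outside[OF CN(2) K(1) N0(2)]) auto
        then show ?thesis by simp
      qed
    qed
    then show ?thesis by simp
  qed
  let ?S = "{x \<in> V. f x = 1}"
  have KS: "closed (K \<inter> ?S)"
  proof -
    have "closed (K \<inter> f -` {1})"
      using continuous_on_subset[OF smooth_onD(3)[OF f] K(2)] compact_imp_closed[OF K(1)] by (intro continuous_closed_preimage) auto
    moreover have "K \<inter> ?S = K \<inter> f -` {1}" using K by auto
    ultimately show ?thesis by simp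
  qed
  have ind: "indicator ?S x * divg NX x = indicator (K \<inter> ?S) x * divg NX x" for x
    using divg_outside[OF CN(1) K(1) N0(1), of x] by (auto simp: indicator_def)
  have Sm: "(\<lambda>x. indicator ?S x * divg NX x) \<in> borel_measurable lborel"
    unfolding ind using borel_measurable_continuous_onI[OF continuous_on_divg[OF CN(1) K(1) N0(1)]] KS
    by (auto intro!: borel_measurable_times borel_measurable_indicator borel_closed)
  \<comment> \<open>With \<epsilon> = 1 / (n + 3) the modulus of 1 + \<epsilon> - f lies between
    \<epsilon> and 3, so its logarithm is at most ln (n + 3) in absolute value. Hence the quotients
    are dominated by \<open>\<bar>divg NX x\<bar>\<close>.\<close>
  define q where "q n x = a (1 / real (n + 3)) x * divg NX x / ln (real (n + 3))" for n x
  have conv: "(\<lambda>n. \<integral>x. q n x \<partial>lborel) \<longlonglongrightarrow> (\<integral>x. indicator ?S x * divg NX x \<partial>lborel)"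
    and sint: "integrable lborel (\<lambda>x. indicator ?S x * divg NX x)"
  proof -
    have qm: "q n \<in> borel_measurable lborel" for n
      unfolding q_def using gint[OF Ca(1)[of "1 / real (n+3)"] X] unfolding NX_def
      by (auto intro!: borel_measurable_divide dest: borel_measurable_integrable)
    have lnp: "ln (real (n + 3)) \<ge> ln 3" "ln 3 > (0::real)" "ln (real (n + 3)) > 0" for n :: nat by auto
    have ln_inf: "filterlim (\<lambda>n. ln (real (n + 3))) at_top sequentially"
      by (rule filterlim_compose[OF ln_at_top filterlim_compose[OF filterlim_real_sequentially filterlim_add_const_nat_at_top]])
    have lim: "(\<lambda>n. q n x) \<longlonglongrightarrow> indicator ?S x * divg NX x" for x
    proof (cases "x \<in> K")
      case False
      then show ?thesis using divg_outside[OF CN(1) K(1) N0(1)] by (simp add: q_def)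
    next
      case True
      then have xV: "x \<in> V" using K by blast
      show ?thesis
      proof (cases "f x = 1")
        case True
        have "q n x = divg NX x" for n
        proof -
          have "a (1 / real (n+3)) x = - ln (1 / real (n+3))"
            unfolding a_def L_def True by (simp add: Ln_of_real del: of_nat_add flip: of_real_divide)
          also have "\<dots> = ln (real (n + 3))" by (simp add: ln_div)
          finally show ?thesis using lnp(3)[of n] by (simp add: q_def)
        qed
        then show ?thesis using True xV by (simp add: indicator_def)
      next
        case False
        have "(\<lambda>n. 1 / real (n + 3)) \<longlonglongrightarrow> 0"
          using LIMSEQ_ignore_initial_segment[OF lim_1_over_n, of 3] by simp
        then have "(\<lambda>n. 1 + complex_of_real (1 / real (n+3)) - f x) \<longlonglongrightarrow> 1 + complex_of_real 0 - f x"
          by (intro tendsto_intros)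
        from tendsto_minus[OF tendsto_ln[OF tendsto_norm[OF this]]] False
        have "(\<lambda>n. - ln (cmod (1 + complex_of_real (1 / real (n+3)) - f x))) \<longlonglongrightarrow> - ln (cmod (1 - f x))"
          by simp
        moreover have "- ln (cmod (1 + complex_of_real (1 / real (n+3)) - f x)) = a (1 / real (n+3)) x" for n
        proof -
          have "Re (1 + complex_of_real (1 / real (n+3)) - f x) > 0"
            using Rep[OF xV, of "1 / real (n+3)"] by (smt (verit) divide_pos_pos of_nat_0_less_iff add_gr_0 zero_less_numeral)
          then have "1 + complex_of_real (1 / real (n+3)) - f x \<noteq> 0" by (metis less_irrefl zero_complex.simps(1))
          then show ?thesis by (simp add: a_def L_def Re_Ln del: of_nat_add)
        qed
        ultimately have "(\<lambda>n. a (1 / real (n+3)) x) \<longlonglongrightarrow> - ln (cmod (1 - f x))" by simp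
        then have "(\<lambda>n. a (1 / real (n+3)) x * divg NX x / ln (real (n + 3))) \<longlonglongrightarrow> 0"
          by (intro real_tendsto_divide_at_top[OF tendsto_mult[OF _ tendsto_const] ln_inf])
        then show ?thesis using False by (simp add: q_def indicator_def)
      qed
    qed
    have bnd: "norm (q n x) \<le> \<bar>divg NX x\<bar>" for n x
    proof (cases "x \<in> V")
      case False
      then have "x \<notin> K" using K by blast
      then show ?thesis using divg_outside[OF CN(1) K(1) N0(1)] by (simp add: q_def)
    next
      case True
      let ?w = "1 + complex_of_real (1 / real (n+3)) - f x"
      have e: "1 / real (n + 3) > 0" "1 / real (n + 3) \<le> 1" by auto
      have lo: "1 / real (n+3) \<le> cmod ?w" using Rep[OF True, of "1 / real (n+3)"] complex_Re_le_cmod[of ?w] by linarith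
      have "cmod ?w \<le> cmod (1 + complex_of_real (1 / real (n+3))) + cmod (f x)" by (rule norm_triangle_ineq4)
      also have "cmod (1 + complex_of_real (1 / real (n+3))) \<le> 1 + 1 / real (n+3)"
        using norm_triangle_ineq[of 1 "complex_of_real (1 / real (n+3))"] e by (simp del: of_nat_add of_real_divide)
      finally have hi: "cmod ?w \<le> 3" using f1[OF True] e by linarith
      have wn: "?w \<noteq> 0" "cmod ?w > 0" using lo e by (auto simp del: of_nat_add)
      have "\<bar>ln (cmod ?w)\<bar> \<le> ln (real (n+3))"
      proof -
        have "ln (cmod ?w) \<le> ln 3" using hi wn by simp
        moreover have "ln (1 / real (n+3)) \<le> ln (cmod ?w)" using lo e by (intro ln_mono) auto
        moreover have "ln (1 / real (n+3)) = - ln (real (n+3))" by (simp add: ln_div)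
        ultimately show ?thesis using lnp(1)[of n] lnp(2) by linarith
      qed
      moreover have "\<bar>a (1 / real (n+3)) x\<bar> = \<bar>ln (cmod ?w)\<bar>" using wn by (simp add: a_def L_def Re_Ln)
      ultimately have "\<bar>a (1 / real (n+3)) x\<bar> * \<bar>divg NX x\<bar> \<le> ln (real (n+3)) * \<bar>divg NX x\<bar>"
        by (intro mult_right_mono) auto
      then show ?thesis using lnp(3)[of n] by (simp add: q_def abs_mult pos_divide_le_eq mult.commute)
    qed
    have iw: "integrable lborel (\<lambda>x. \<bar>divg NX x\<bar>)" using iX by (rule integrable_abs)
    show "(\<lambda>n. \<integral>x. q n x \<partial>lborel) \<longlonglongrightarrow> (\<integral>x. indicator ?S x * divg NX x \<partial>lborel)"
      by (rule integral_dominated_convergence[where s=q and w="\<lambda>x. \<bar>divg NX x\<bar>"]) (use Sm qm iw lim bnd in auto)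
    show "integrable lborel (\<lambda>x. indicator ?S x * divg NX x)"
      by (rule integrable_dominated_convergence[where s=q and w="\<lambda>x. \<bar>divg NX x\<bar>"]) (use Sm qm iw lim bnd in auto)
  qed
  have "(\<lambda>n. \<integral>x. q n x \<partial>lborel) \<longlonglongrightarrow> 0"
  proof (rule Lim_null_comparison)
    show "\<forall>\<^sub>F n in sequentially. norm (\<integral>x. q n x \<partial>lborel) \<le> C / ln (real (n + 3))"
    proof (rule always_eventually, rule allI)
      fix n
      have "(\<integral>x. q n x \<partial>lborel) = (\<integral>x. a (1 / real (n+3)) x * divg NX x \<partial>lborel) / ln (real (n+3))"
        unfolding q_def by (rule integral_divide_zero)
      also have "\<dots> = (\<integral>x. b (1 / real (n+3)) x * divg NY x \<partial>lborel) / ln (real (n+3))" by (simp add: swap)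
      finally show "norm (\<integral>x. q n x \<partial>lborel) \<le> C / ln (real (n + 3))"
        using bC[of "1 / real (n+3)"] by (simp add: divide_right_mono)
    qed
    have ln_inf: "filterlim (\<lambda>n. ln (real (n + 3))) at_top sequentially"
      by (rule filterlim_compose[OF ln_at_top filterlim_compose[OF filterlim_real_sequentially filterlim_add_const_nat_at_top]])
    show "(\<lambda>n. C / ln (real (n + 3))) \<longlonglongrightarrow> 0"
      by (rule real_tendsto_divide_at_top[OF tendsto_const ln_inf])
  qed
  then show "(\<integral>x. indicator ?S x * divg (\<lambda>x. \<phi> x *\<^sub>R X x) x \<partial>lborel) = 0"
    using LIMSEQ_unique[OF conv] unfolding NX_def by simp
  show "integrable lborel (\<lambda>x. indicator ?S x * divg (\<lambda>x. \<phi> x *\<^sub>R X x) x)" using sint unfolding NX_def .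
qed

text \<open>Class C^1 is all that \<open>weak_derivative_indicator\<close> asks of a test function,
  and the support is governed by the sign of \<open>h\<close>, so no smooth cutoff function has to
  be constructed.\<close>

lemma C1_square_of_positive_part:
  fixes h :: "'e::euclidean_space \<Rightarrow> real"
  assumes h: "smooth_on UNIV h"
  shows "Ck_on (Suc 0) UNIV (\<lambda>x. (max 0 (h x))\<^sup>2)"
    "fder (\<lambda>x. (max 0 (h x))\<^sup>2) x v = 2 * max 0 (h x) * fder h x v"
proof -
  have q: "((\<lambda>t. (max 0 t)\<^sup>2) has_real_derivative 2 * max 0 t) (at t)" for t :: real
  proof -
    consider "t > 0" | "t < 0" | "t = 0" by linarith
    then show ?thesis
    proof cases
      case 1
      have "((\<lambda>t. t\<^sup>2) has_real_derivative 2 * max 0 t) (at t)" using 1 by (auto intro!: derivative_eq_intros)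
      then show ?thesis
        by (rule has_field_derivative_transform_within_open[of _ _ _ "{0<..}"]) (use 1 in auto)
    next
      case 2
      have "((\<lambda>t. 0) has_real_derivative 2 * max 0 t) (at t)" using 2 by (auto intro!: derivative_eq_intros)
      then show ?thesis
        by (rule has_field_derivative_transform_within_open[of _ _ _ "{..<0}"]) (use 2 in auto)
    next
      case 3
      have "((\<lambda>s::real. (max 0 s)\<^sup>2 / s) \<longlongrightarrow> 0) (at 0)"
      proof (rule Lim_null_comparison)
        have "norm ((max 0 s)\<^sup>2 / s) \<le> \<bar>s\<bar>" for s :: real
          by (cases "s > 0") (auto simp: max_def power2_eq_square)
        then show "\<forall>\<^sub>F s::real in at 0. norm ((max 0 s)\<^sup>2 / s) \<le> \<bar>s\<bar>" by (simp add: always_eventually)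
        show "((\<lambda>s::real. \<bar>s\<bar>) \<longlongrightarrow> 0) (at 0)" by (intro tendsto_rabs_zero tendsto_ident_at)
      qed
      then show ?thesis using 3 by (simp add: DERIV_def)
    qed
  qed
  have d: "((\<lambda>x. (max 0 (h x))\<^sup>2) has_derivative (\<lambda>v. 2 * max 0 (h x) * fder h x v)) (at x)" for x
    using has_derivative_compose[OF smooth_onD(5)[OF h] q[of "h x", unfolded has_field_derivative_def]] by simp
  show f: "fder (\<lambda>x. (max 0 (h x))\<^sup>2) x v = 2 * max 0 (h x) * fder h x v" for x v
    using fder_eq[OF d] by simp
  have "continuous_on UNIV (\<lambda>x. 2 * max 0 (h x) * fder h x v)" for v
    by (intro continuous_intros smooth_onD(3)[OF h] smooth_onD(3)[OF smooth_on_fder[OF h]])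
  then show "Ck_on (Suc 0) UNIV (\<lambda>x. (max 0 (h x))\<^sup>2)"
    using differentiableI[OF d] by (simp add: f)
qed

text \<open>The test function is supported near \<open>p\<close> in a ball slightly larger than an exterior ball
  at \<open>p\<close>; outside of the exterior ball \<open>divg (\<phi> X)\<close> is positive.\<close>

lemma tangent_to_complement_of_interior:
  fixes f :: "'e::euclidean_space \<Rightarrow> complex"
  assumes G: "open G" "V \<subseteq> G" and f: "smooth_on V f" and f1: "\<And>x. x \<in> V \<Longrightarrow> cmod (f x) \<le> 1"
    and X: "smooth_on V X" and Y: "smooth_on V Y"
    and CR: "\<And>x. x \<in> V \<Longrightarrow> fder f x (X x) + \<i> * fder f x (Y x) = 0"
    and p: "p \<in> V" and nrm: "exterior_normal (G - interior {x \<in> G. f x = 1}) p \<nu>"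
  shows "X p \<bullet> \<nu> \<le> 0"
proof (rule ccontr)
  let ?S = "{x \<in> G. f x = 1}" and ?C = "G - interior {x \<in> G. f x = 1}"
  assume "\<not> ?thesis"
  then have pos: "X p \<bullet> \<nu> > 0" by simp
  have V: "open V" using smooth_onD(1)[OF f] .
  obtain r where r: "r > 0" "cball p r \<subseteq> V" using V p open_contains_cball by blast
  have \<nu>0: "norm \<nu> > 0" using pos by auto
  \<comment> \<open>A shorter normal has a smaller exterior ball, here one contained in the ball of
    radius \<open>r\<close> about \<open>p\<close>.\<close>
  define c where "c = min 1 (r / (2 * norm \<nu>))"
  have c: "0 < c" "c \<le> 1" "c * norm \<nu> \<le> r / 2"
    using r \<nu>0 by (auto simp: c_def min_def field_simps)
  define \<mu> where "\<mu> = c *\<^sub>R \<nu>"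
  have \<mu>: "norm \<mu> \<le> r / 2" using c by (simp add: \<mu>_def)
  have ext: "exterior_normal ?C p \<mu>" unfolding \<mu>_def using exterior_normal_scaleR[OF nrm] c by simp
  define \<kappa> where "\<kappa> = X p \<bullet> \<mu>"
  have \<kappa>: "\<kappa> > 0" using pos c by (simp add: \<kappa>_def \<mu>_def)
  define g where "g x = 2 * ((\<mu> - 2 *\<^sub>R (x - p)) \<bullet> X x)" for x
  have "isCont g p" unfolding g_def
    using smooth_onD(3)[OF X] V p by (auto simp: continuous_on_eq_continuous_at intro!: continuous_intros)
  moreover have "g p = 2 * \<kappa>" by (simp add: g_def \<kappa>_def inner_commute)
  ultimately obtain d where d: "d > 0" "\<And>x. dist x p < d \<Longrightarrow> dist (g x) (2 * \<kappa>) < \<kappa>"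
    using \<kappa> unfolding continuous_at_eps_delta by metis
  have "continuous_on (cball p r) (divg X)"
    unfolding divg_def
    by (intro continuous_intros continuous_on_subset[OF smooth_onD(3)[OF smooth_on_fder[OF X]] r(2)])
  then have "compact (divg X ` cball p r)" by (intro compact_continuous_image) auto
  from compact_imp_bounded[OF this] obtain D where D: "D > 0" "\<And>x. x \<in> cball p r \<Longrightarrow> \<bar>divg X x\<bar> \<le> D"
    unfolding bounded_pos by auto
  \<comment> \<open>Outside the exterior ball \<open>h x > 0\<close> forces |x - p|^2 < 2 \<delta>.
    The entry with \<open>d\<close> therefore confines such points to where \<open>g\<close> is
    close to \<open>2 * \<kappa>\<close>, and the entry with \<open>D\<close> makes the term with
    the divergence of \<open>X\<close> smaller than \<open>\<kappa>\<close>. The entries with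
    \<open>r\<close> keep the support of the test function in the ball.\<close>
  define \<delta> where "\<delta> = Min {r\<^sup>2 / 4, d\<^sup>2 / 4, \<kappa> / (2 * D), r\<^sup>2 / 2}"
  have \<delta>: "\<delta> > 0" "\<delta> \<le> r\<^sup>2 / 4" "2 * \<delta> < d\<^sup>2" "\<delta> * D < \<kappa>"
  proof -
    show "\<delta> > 0" "\<delta> \<le> r\<^sup>2 / 4" using r d \<kappa> D by (auto simp: \<delta>_def)
    have "\<delta> \<le> d\<^sup>2 / 4" by (simp add: \<delta>_def)
    then show "2 * \<delta> < d\<^sup>2" using zero_less_power[OF d(1), of 2] by linarith
    have "\<delta> \<le> \<kappa> / (2 * D)" by (simp add: \<delta>_def)
    then show "\<delta> * D < \<kappa>" using D \<kappa> by (simp add: field_simps)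
  qed
  define h where "h x = \<delta> + \<mu> \<bullet> (x - p) - (x - p) \<bullet> (x - p)" for x
  have sh: "smooth_on UNIV h" unfolding h_def
    by (intro smooth_on_diff smooth_on_add smooth_on_inner smooth_on_const smooth_on_id) auto
  have hder: "fder h x v = (\<mu> - 2 *\<^sub>R (x - p)) \<bullet> v" for x v
  proof -
    have "(h has_derivative (\<lambda>v. (\<mu> - 2 *\<^sub>R (x - p)) \<bullet> v)) (at x)"
      unfolding h_def
      by (auto intro!: derivative_eq_intros simp: fun_eq_iff inner_diff_left inner_diff_right inner_commute algebra_simps)
    from fder_eq[OF this] show ?thesis by simp
  qed
  have hsup: "h x < 0" if "x \<notin> cball p r" for x
  proof -
    let ?n = "norm (x - p)"
    have n: "?n > r" using that by (simp add: dist_norm norm_minus_commute)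
    have "\<mu> \<bullet> (x - p) \<le> norm \<mu> * ?n" by (rule norm_cauchy_schwarz)
    also have "\<dots> \<le> r / 2 * ?n" using \<mu> by (intro mult_right_mono) auto
    finally have a: "\<mu> \<bullet> (x - p) \<le> r / 2 * ?n" .
    have "r * (r / 2) < ?n * (?n - r / 2)" using n r(1) by (intro mult_strict_mono) auto
    then have "r\<^sup>2 / 2 < ?n\<^sup>2 - r / 2 * ?n" by (simp add: power2_eq_square algebra_simps)
    moreover have "\<delta> \<le> r\<^sup>2 / 2" by (simp add: \<delta>_def)
    moreover have "(x - p) \<bullet> (x - p) = ?n\<^sup>2" by (simp add: power2_norm_eq_inner)
    ultimately show ?thesis using a unfolding h_def by linarith
  qed
  define \<phi> where "\<phi> x = (max 0 (h x))\<^sup>2" for x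
  have \<phi>C: "Ck_on (Suc 0) UNIV \<phi>" unfolding \<phi>_def by (rule C1_square_of_positive_part(1)[OF sh])
  have \<phi>0: "\<phi> x = 0" if "x \<notin> cball p r" for x using hsup[OF that] by (simp add: \<phi>_def)
  have K: "compact (cball p r)" by simp
  define q where "q = divg (\<lambda>x. \<phi> x *\<^sub>R X x)"
  let ?SV = "{x \<in> V. f x = 1}"
  have CN: "Ck_on (Suc 0) UNIV (\<lambda>x. \<phi> x *\<^sub>R X x)"
    by (rule Ck_on_cutoff[OF \<phi>C \<phi>0 K r(2) V smooth_onD(2)[OF X]])
  have N0: "\<phi> x *\<^sub>R X x = 0" if "x \<notin> cball p r" for x using \<phi>0[OF that] by simp
  have i1: "(\<integral>x. q x \<partial>lborel) = 0" "integrable lborel q"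
    unfolding q_def using integral_divg[OF CN K N0] integrable_divg[OF CN K N0] by auto
  have i2: "(\<integral>x. indicator ?SV x * q x \<partial>lborel) = 0" "integrable lborel (\<lambda>x. indicator ?SV x * q x)"
    unfolding q_def using weak_derivative_indicator[OF f f1 X Y CR \<phi>C K r(2) \<phi>0] by auto
  have qV: "q x = max 0 (h x) * (g x + max 0 (h x) * divg X x)" if "x \<in> V" for x
  proof -
    have "q x = \<phi> x * divg X x + fder \<phi> x (X x)"
      unfolding q_def using \<phi>C smooth_onD(4)[OF X that] by (intro divg_scaleR) auto
    also have "fder \<phi> x (X x) = max 0 (h x) * g x"
      unfolding \<phi>_def C1_square_of_positive_part(2)[OF sh] hder g_def by simp
    finally show ?thesis by (simp add: \<phi>_def power2_eq_square algebra_simps)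
  qed
  have out: "q x > 0" if "x \<in> V" "x \<notin> ?SV" "h x > 0" for x
  proof -
    have "x \<in> ?C" using that G(2) interior_subset[of ?S] by auto
    then have "2 * (\<mu> \<bullet> (x - p)) \<le> (norm (x - p))\<^sup>2" using ext by (simp add: exterior_normal_iff)
    moreover have "(x - p) \<bullet> (x - p) = (norm (x - p))\<^sup>2" by (simp add: power2_norm_eq_inner)
    ultimately have hx: "h x \<le> \<delta> - (norm (x - p))\<^sup>2 / 2" unfolding h_def by linarith
    then have "(norm (x - p))\<^sup>2 < d\<^sup>2" using that(3) \<delta>(3) by linarith
    then have "dist x p < d" using d(1) by (simp add: dist_norm power_less_imp_less_base)
    then have "g x > \<kappa>" using d(2)[of x] by (simp add: dist_real_def abs_if split: if_splits)
    moreover have "h x * divg X x \<ge> - (\<delta> * D)"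
    proof -
      have xr: "x \<in> cball p r" using hsup[of x] that(3) by force
      have "h x \<le> \<delta>" using hx zero_le_power2[of "norm (x - p)"] by linarith
      then have "h x * \<bar>divg X x\<bar> \<le> \<delta> * D" using D(2)[OF xr] that(3) \<delta> by (intro mult_mono) auto
      moreover have "- (h x * divg X x) \<le> h x * \<bar>divg X x\<bar>"
        using that(3) mult_left_mono[of "- divg X x" "\<bar>divg X x\<bar>" "h x"] by simp
      ultimately show ?thesis by linarith
    qed
    ultimately have "g x + h x * divg X x > 0" using \<delta>(4) by linarith
    then show ?thesis using qV[OF that(1)] that(3) by simp
  qed
  \<comment> \<open>The integral of \<open>q\<close> vanishes by the divergence theorem, that over
    the maximum set by the weak equation. As \<open>q\<close> is nonnegative off the maximum set, it
    vanishes there almost everywhere. But it is positive on the open set \<open>T\<close>, which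
    must be empty, and so \<open>p\<close> is interior to the maximum set.\<close>
  define w where "w x = q x - indicator ?SV x * q x" for x
  have w0: "w x \<ge> 0" for x
  proof (cases "x \<in> V \<and> x \<notin> ?SV \<and> h x > 0")
    case True
    then show ?thesis using out[of x] by (simp add: w_def indicator_def)
  next
    case False
    have "q x = 0 \<or> x \<in> ?SV"
    proof (cases "x \<in> V")
      case True
      then show ?thesis using False qV[OF True] by auto
    next
      case False
      then have "x \<notin> cball p r" using r(2) by blast
      then show ?thesis unfolding q_def using divg_outside[OF CN K N0] by blast
    qed
    then show ?thesis by (auto simp: w_def)
  qed
  have "integrable lborel w" unfolding w_def[abs_def] using i1 i2 by (intro Bochner_Integration.integrable_diff)
  moreover have "(\<integral>x. w x \<partial>lborel) = 0" unfolding w_def using i1 i2 by simp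
  ultimately have ae: "AE x in lborel. w x = 0"
    using integral_nonneg_eq_0_iff_AE[of lborel w] w0 by simp
  define T where "T = {x \<in> V. f x \<noteq> 1 \<and> h x > 0}"
  have "open T"
  proof -
    have "open (V \<inter> f -` (- {1}))" using smooth_onD(3)[OF f] V by (intro continuous_open_preimage) auto
    moreover have "open (UNIV \<inter> h -` {0<..})" using smooth_onD(3)[OF sh] by (intro continuous_open_preimage) auto
    moreover have "T = (V \<inter> f -` (- {1})) \<inter> (UNIV \<inter> h -` {0<..})" by (auto simp: T_def)
    ultimately show ?thesis by (simp add: open_Int)
  qed
  moreover have "negligible T"
  proof -
    have "AE x in lborel. x \<notin> T"
      using ae by eventually_elim (use out in \<open>force simp: T_def w_def indicator_def\<close>)
    then have "T \<in> null_sets lborel" using \<open>open T\<close> by (subst AE_iff_null_sets) auto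
    then show ?thesis using negligible_iff_null_sets null_sets_completionI by blast
  qed
  ultimately have "T = {}" using open_not_negligible by blast
  moreover have "open {x \<in> V. h x > 0}"
  proof -
    have "open (UNIV \<inter> h -` {0<..})" using smooth_onD(3)[OF sh] by (intro continuous_open_preimage) auto
    moreover have "{x \<in> V. h x > 0} = V \<inter> (UNIV \<inter> h -` {0<..})" by auto
    ultimately show ?thesis using V by (simp add: open_Int)
  qed
  moreover have "p \<in> {x \<in> V. h x > 0}" using p \<delta> by (simp add: h_def)
  moreover have "{x \<in> V. h x > 0} \<subseteq> ?S" using \<open>T = {}\<close> G(2) by (auto simp: T_def)
  ultimately have "p \<in> interior ?S" by (meson interiorI)
  then show False using nrm by (simp add: exterior_normal_iff)
qed

section \<open>Forward invariant sets of bracket generating families\<close>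

text \<open>Formulated for all integral curves in a small ball instead of a chosen flow, with ball
  and time span depending on the point alone. In this form it passes to intersections, and it refers
  to positive times only, which is what is known for the drift.\<close>

definition forward_invariant :: "'e::euclidean_space set \<Rightarrow> 'e set \<Rightarrow> ('e \<Rightarrow> 'e) \<Rightarrow> bool" where
  "forward_invariant S V X \<longleftrightarrow> (\<forall>q\<in>S \<inter> V. \<exists>\<rho>>0. \<exists>T0>0. \<forall>\<beta> T. 0 < T \<and> T \<le> T0 \<and> \<beta> 0 \<in> S \<and>
     (\<forall>t\<in>{0..T}. \<beta> t \<in> cball q \<rho> \<and> (\<beta> has_vector_derivative X (\<beta> t)) (at t within {0..T})) \<longrightarrow> \<beta> T \<in> S)"

lemma forward_invariant_Int:
  assumes "forward_invariant S V X" "forward_invariant S' V X"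
  shows "forward_invariant (S \<inter> S') V X"
  unfolding forward_invariant_def
proof
  fix q assume q: "q \<in> (S \<inter> S') \<inter> V"
  obtain \<rho>1 T1 where i1: "\<rho>1 > 0" "T1 > 0" "\<And>\<beta> T. 0 < T \<and> T \<le> T1 \<and> \<beta> 0 \<in> S \<and>
     (\<forall>t\<in>{0..T}. \<beta> t \<in> cball q \<rho>1 \<and> (\<beta> has_vector_derivative X (\<beta> t)) (at t within {0..T})) \<Longrightarrow> \<beta> T \<in> S"
    using assms(1) q unfolding forward_invariant_def by blast
  obtain \<rho>2 T2 where i2: "\<rho>2 > 0" "T2 > 0" "\<And>\<beta> T. 0 < T \<and> T \<le> T2 \<and> \<beta> 0 \<in> S' \<and>
     (\<forall>t\<in>{0..T}. \<beta> t \<in> cball q \<rho>2 \<and> (\<beta> has_vector_derivative X (\<beta> t)) (at t within {0..T})) \<Longrightarrow> \<beta> T \<in> S'"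
    using assms(2) q unfolding forward_invariant_def by blast
  have "\<beta> T \<in> S \<inter> S'"
    if "0 < T \<and> T \<le> min T1 T2 \<and> \<beta> 0 \<in> S \<inter> S' \<and>
     (\<forall>t\<in>{0..T}. \<beta> t \<in> cball q (min \<rho>1 \<rho>2) \<and> (\<beta> has_vector_derivative X (\<beta> t)) (at t within {0..T}))" for \<beta> T
    using i1(3)[of T \<beta>] i2(3)[of T \<beta>] that by auto
  moreover have "min \<rho>1 \<rho>2 > 0" "min T1 T2 > 0" using i1 i2 by auto
  ultimately show "\<exists>\<rho>>0. \<exists>T0>0. \<forall>\<beta> T. 0 < T \<and> T \<le> T0 \<and> \<beta> 0 \<in> S \<inter> S' \<and>
     (\<forall>t\<in>{0..T}. \<beta> t \<in> cball q \<rho> \<and> (\<beta> has_vector_derivative X (\<beta> t)) (at t within {0..T})) \<longrightarrow> \<beta> T \<in> S \<inter> S'"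
    by blast
qed

text \<open>From normals to semiflows: near each point the set is closed and the field is Lipschitz,
  so \<open>invariance\<close> applies in a small ball for short times.\<close>

lemma forward_invariant_normals:
  assumes X: "smooth_on V X" and cl: "\<And>q. q \<in> V \<Longrightarrow> \<exists>R>0. closed (S \<inter> cball q R)"
    and nrm: "\<And>p \<nu>. p \<in> V \<Longrightarrow> exterior_normal S p \<nu> \<Longrightarrow> X p \<bullet> \<nu> \<le> 0"
  shows "forward_invariant S V X"
  unfolding forward_invariant_def
proof
  fix q assume q: "q \<in> S \<inter> V"
  obtain R1 where R1: "R1 > 0" "closed (S \<inter> cball q R1)" using cl q by blast
  obtain R2 where R2: "R2 > 0" "cball q R2 \<subseteq> V"
    using smooth_onD(1)[OF X] q open_contains_cball by blast
  define R where "R = min R1 R2"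
  have R: "R > 0" "cball q R \<subseteq> V" using R1 R2 by (auto simp: R_def)
  have "S \<inter> cball q R = (S \<inter> cball q R1) \<inter> cball q R" by (auto simp: R_def)
  then have cR: "closed (S \<inter> cball q R)" using R1(2) by (metis closed_Int closed_cball)
  obtain K where K: "K \<ge> 0" "\<And>x y. x \<in> cball q R \<Longrightarrow> y \<in> cball q R \<Longrightarrow> norm (X x - X y) \<le> K * norm (x - y)"
    using smooth_on_lipschitz[OF X R(2)] by metis
  define T0 where "T0 = 1 / (4 * (K + 1))"
  have T0: "T0 > 0" "(K + 1) * T0 = 1/4" using K(1) by (auto simp: T0_def)
  show "\<exists>\<rho>>0. \<exists>T0>0. \<forall>\<beta> T. 0 < T \<and> T \<le> T0 \<and> \<beta> 0 \<in> S \<and>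
     (\<forall>t\<in>{0..T}. \<beta> t \<in> cball q \<rho> \<and> (\<beta> has_vector_derivative X (\<beta> t)) (at t within {0..T})) \<longrightarrow> \<beta> T \<in> S"
  proof (rule exI[of _ "R/4"], intro conjI, use R in simp, rule exI[of _ T0], intro conjI allI impI)
    fix \<beta> :: "real \<Rightarrow> 'a" and T
    assume b: "0 < T \<and> T \<le> T0 \<and> \<beta> 0 \<in> S \<and>
      (\<forall>t\<in>{0..T}. \<beta> t \<in> cball q (R/4) \<and> (\<beta> has_vector_derivative X (\<beta> t)) (at t within {0..T}))"
    have "K * T \<le> (K + 1) * T0" using b K(1) by (intro mult_mono) auto
    then have KT: "K * T \<le> 1/4" using T0 by simp
    have nrm': "X p \<bullet> \<nu> \<le> 0" if "p \<in> ball q R" "exterior_normal S p \<nu>" for p \<nu>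
      using nrm[OF _ that(2)] that(1) R(2) ball_subset_cball by blast
    show "\<beta> T \<in> S"
      by (rule invariance[OF cR R(1) K(2) K(1) KT _ nrm', where \<beta>=\<beta>]) (use b in auto)
  qed (rule T0)
qed

text \<open>The Euclidean counterpart of \<open>lie_distribution\<close>, rule by rule, so that an
  induction over the latter transfers to lifted fields.\<close>

inductive_set lie_fields :: "('e::euclidean_space set \<times> ('e \<Rightarrow> 'e)) set \<Rightarrow> ('e set \<times> ('e \<Rightarrow> 'e)) set"
  for \<G> :: "('e::euclidean_space set \<times> ('e \<Rightarrow> 'e)) set" where
  gen: "(V, X) \<in> \<G> \<Longrightarrow> (V, X) \<in> lie_fields \<G>"
| zero: "open V \<Longrightarrow> (V, \<lambda>x. 0) \<in> lie_fields \<G>"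
| add: "(V, X) \<in> lie_fields \<G> \<Longrightarrow> (V, Y) \<in> lie_fields \<G> \<Longrightarrow> (V, \<lambda>x. X x + Y x) \<in> lie_fields \<G>"
| scale: "(V, X) \<in> lie_fields \<G> \<Longrightarrow> smooth_on V (g :: 'e \<Rightarrow> real) \<Longrightarrow> (V, \<lambda>x. g x *\<^sub>R X x) \<in> lie_fields \<G>"
| bracket: "(V, X) \<in> lie_fields \<G> \<Longrightarrow> (V, Y) \<in> lie_fields \<G> \<Longrightarrow> (V, brk X Y) \<in> lie_fields \<G>"
| local: "open V \<Longrightarrow> (\<And>x. x \<in> V \<Longrightarrow> \<exists>W X'. x \<in> W \<and> (W, X') \<in> lie_fields \<G> \<and> (\<forall>y\<in>V \<inter> W. X y = X' y)) \<Longrightarrow>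
    (V, X) \<in> lie_fields \<G>"

lemma smooth_on_eq_local:
  assumes "smooth_on W X'" "open V" "\<And>y. y \<in> V \<inter> W \<Longrightarrow> X y = X' y"
  shows "smooth_on (V \<inter> W) X"
proof -
  have "smooth_on (V \<inter> W) X'"
    using assms(1,2) smooth_onD(1)[OF assms(1)] by (intro smooth_on_subset[OF assms(1)]) auto
  then show ?thesis by (rule smooth_on_cong) (use assms(3) in simp)
qed

text \<open>The maps \<open>\<psi>\<close> arise from a constant map by composition with the flows of the generators;
  only continuity near \<open>x\<^sub>0\<close> and differentiability at \<open>x\<^sub>0\<close> are retained.\<close>

definition reach :: "'e::euclidean_space set \<Rightarrow> ('e \<Rightarrow> 'e) \<Rightarrow> 'e \<Rightarrow> ('e \<Rightarrow> 'e) \<Rightarrow> bool" where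
  "reach S \<psi> x0 A \<longleftrightarrow> (\<exists>r>0. continuous_on (ball x0 r) \<psi> \<and> \<psi> ` ball x0 r \<subseteq> S) \<and> (\<psi> has_derivative A) (at x0)"

section \<open>Joint regularity of flows that stay in an invariant set\<close>

lemma reach_flow:
  fixes X :: "'e::euclidean_space \<Rightarrow> 'e"
  assumes X: "smooth_on V X" and inv: "forward_invariant S V X" and W: "open W" "q \<in> W" and q: "q \<in> S" "q \<in> V"
  obtains R \<delta> \<delta>' \<phi> A where "local_flow V X q R \<delta> \<phi> A" "cball q (2 * R) \<subseteq> W" "0 < \<delta>'" "\<delta>' < \<delta>"
    "\<And>x t. x \<in> S \<Longrightarrow> x \<in> cball q R \<Longrightarrow> t \<in> {0..\<delta>'} \<Longrightarrow> \<phi> x t \<in> S"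
proof -
  obtain \<rho> T0 where i: "\<rho> > 0" "T0 > 0" "\<And>\<beta> T. 0 < T \<and> T \<le> T0 \<and> \<beta> 0 \<in> S \<and>
     (\<forall>t\<in>{0..T}. \<beta> t \<in> cball q \<rho> \<and> (\<beta> has_vector_derivative X (\<beta> t)) (at t within {0..T})) \<Longrightarrow> \<beta> T \<in> S"
    using inv q unfolding forward_invariant_def by blast
  obtain w where w: "w > 0" "cball q w \<subseteq> W" using W open_contains_cball by blast
  define e where "e = min \<rho> w / 2"
  have e: "e > 0" using i w by (simp add: e_def)
  obtain R \<delta> \<phi> A where R: "R \<le> e" and fl: "local_flow V X q R \<delta> \<phi> A"
    using local_flow_exists[OF X q(2) e] .
  note f = local_flowD[OF fl]
  define \<delta>' where "\<delta>' = min (\<delta>/2) T0"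
  have d: "0 < \<delta>'" "\<delta>' < \<delta>" "\<delta>' \<le> T0" using f(2) i by (auto simp: \<delta>'_def)
  have R2: "2 * R \<le> \<rho>" "2 * R \<le> w" using R by (auto simp: e_def)
  show ?thesis
  proof (rule that[OF fl _ d(1,2)])
    show "cball q (2 * R) \<subseteq> W" using w R2 by (meson order_trans subset_cball)
    fix x t assume x: "x \<in> S" "x \<in> cball q R" and t: "t \<in> {0..\<delta>'}"
    show "\<phi> x t \<in> S"
    proof (cases "t = 0")
      case True
      then show ?thesis using f(4)[OF x(2)] x by simp
    next
      case False
      show ?thesis
      proof (rule i(3), intro conjI ballI)
        show "0 < t" "t \<le> T0" using False t d by auto
        show "\<phi> x 0 \<in> S" using f(4)[OF x(2)] x by simp
        fix s assume s: "s \<in> {0..t}"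
        then have s': "s \<in> {-\<delta>..\<delta>}" using t d by auto
        show "\<phi> x s \<in> cball q \<rho>" using f(5)[OF x(2) s'] R2 by auto
        show "(\<phi> x has_vector_derivative X (\<phi> x s)) (at s within {0..t})"
          by (rule has_vector_derivative_within_subset[OF f(6)[OF x(2) s']]) (use t d in auto)
      qed
    qed
  qed
qed

lemma flow_continuous:
  assumes X: "smooth_on V X" and fl: "local_flow V X q R \<delta> \<phi> A"
  shows "continuous_on (cball q R \<times> {-\<delta>..\<delta>}) (\<lambda>(x, t). \<phi> x t)"
proof -
  note f = local_flowD[OF fl]
  obtain M where M: "M \<ge> 0" "\<And>x. x \<in> cball q (2 * R) \<Longrightarrow> norm (X x) \<le> M"
    using smooth_on_lipschitz[OF X f(3)] by metis
  have lip: "dist (\<phi> x t) (\<phi> y s) \<le> (M + 2) * dist (x, t) (y, s)"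
    if "x \<in> cball q R" "y \<in> cball q R" "t \<in> {-\<delta>..\<delta>}" "s \<in> {-\<delta>..\<delta>}" for x y t s
  proof -
    have "dist (\<phi> x t) (\<phi> y s) \<le> dist (\<phi> x t) (\<phi> y t) + dist (\<phi> y t) (\<phi> y s)" by (rule dist_triangle)
    also have "dist (\<phi> x t) (\<phi> y t) \<le> 2 * dist x y" using f(7) that by (simp add: dist_norm)
    also have "dist (\<phi> y t) (\<phi> y s) \<le> M * \<bar>t - s\<bar>"
      unfolding dist_norm using that f(5,6) M by (intro vector_derivative_bound[of \<delta> "\<phi> y" "\<lambda>t. X (\<phi> y t)"]) auto
    also have "2 * dist x y + M * \<bar>t - s\<bar> \<le> 2 * dist (x, t) (y, s) + M * dist (x, t) (y, s)"
      using dist_fst_le[of "(x,t)" "(y,s)"] dist_snd_le[of "(x,t)" "(y,s)"] M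
      by (intro add_mono mult_left_mono) (auto simp: dist_real_def)
    finally show ?thesis by (simp add: algebra_simps)
  qed
  have "(M + 2)-lipschitz_on (cball q R \<times> {-\<delta>..\<delta>}) (\<lambda>(x, t). \<phi> x t)"
    by (rule lipschitz_onI) (use lip M in auto)
  then show ?thesis by (rule lipschitz_on_continuous_on)
qed

text \<open>The differential in space is known at \<open>q\<close> only, but a total derivative
  requires continuity of just one of the two partial derivatives. Here that is the time derivative,
  the field along the flow.\<close>

lemma flow_has_derivative:
  assumes X: "smooth_on V X" and fl: "local_flow V X q R \<delta> \<phi> A" and t: "0 < t" "t < \<delta>"
  shows "((\<lambda>(x, t). \<phi> x t) has_derivative (\<lambda>(h, s). A t h + s *\<^sub>R X (\<phi> q t))) (at (q, t))"
proof -
  note f = local_flowD[OF fl]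
  let ?B = "ball q R" and ?I = "{-\<delta>..\<delta>}"
  have tI: "t \<in> ?I" and qB: "q \<in> ?B" "q \<in> cball q R" using t f(1) by auto
  have "((\<lambda>(x, t). \<phi> x t) has_derivative (\<lambda>(tx, ty). A t tx + blinfun_scaleR_left (X (\<phi> q t)) ty)) (at (q, t) within ?B \<times> ?I)"
  proof (rule has_derivative_partialsI[where fy="\<lambda>x t. blinfun_scaleR_left (X (\<phi> x t))"])
    show "((\<lambda>x. \<phi> x t) has_derivative blinfun_apply (A t)) (at q within ?B)"
      using f(8)[OF tI] by (rule has_derivative_at_withinI)
    fix x s assume "x \<in> ?B" "s \<in> ?I"
    then show "(\<phi> x has_derivative blinfun_apply (blinfun_scaleR_left (X (\<phi> x s)))) (at s within ?I)"
      using f(6)[of x s] by (simp add: has_vector_derivative_def)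
  next
    have "continuous_on (cball q R \<times> ?I) (\<lambda>z. X ((\<lambda>(x, t). \<phi> x t) z))"
      by (rule continuous_on_compose2[OF smooth_onD(3)[OF X] flow_continuous[OF X fl]]) (use f(5,3) in auto)
    then have "continuous_on (cball q R \<times> ?I) (\<lambda>z. blinfun_scaleR_left (X ((\<lambda>(x, t). \<phi> x t) z)))"
      by (rule bounded_linear.continuous_on[OF bounded_linear_blinfun_scaleR_left])
    then have "continuous_on (?B \<times> ?I) (\<lambda>(x, t). blinfun_scaleR_left (X (\<phi> x t)))"
      by (rule continuous_on_subset[THEN continuous_on_eq]) auto
    then show "continuous (at (q, t) within ?B \<times> ?I) (\<lambda>(x, t). blinfun_scaleR_left (X (\<phi> x t)))"
      using qB tI unfolding continuous_on_eq_continuous_within by blast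
  qed (use tI in auto)
  moreover have "at (q, t) within ?B \<times> ?I = at (q, t)"
    by (rule at_within_interior) (use t qB in \<open>auto simp: interior_Times\<close>)
  ultimately show ?thesis by simp
qed

lemma flow_injective:
  assumes fl: "local_flow V X q R \<delta> \<phi> A" and t: "t \<in> {-\<delta>..\<delta>}"
  shows "inj (blinfun_apply (A t))"
proof -
  note f = local_flowD[OF fl]
  have "v = 0" if "A t v = 0" for v
  proof -
    have "norm v \<le> \<bar>t\<bar> / (2 * \<delta>) * norm v" using f(11)[OF t, of v] that by simp
    also have "\<dots> \<le> 1/2 * norm v" using t f(2) by (intro mult_right_mono) (auto simp: field_simps)
    finally show ?thesis by simp
  qed
  then show ?thesis using linear_injective_0[of "blinfun_apply (A t)"] blinfun.bounded_linear_right bounded_linear.linear by blast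
qed

text \<open>Krener's argument. Instantiated with the largest rank \<open>k\<close> that occurs: at a
  map of rank \<open>k\<close> every generator is tangent to the image, since flowing along it would
  otherwise raise the rank.\<close>

locale krener =
  fixes \<G> :: "('e::euclidean_space set \<times> ('e \<Rightarrow> 'e)) set" and S :: "'e set" and k :: nat
  assumes smooth_gens: "\<And>V X. (V, X) \<in> \<G> \<Longrightarrow> smooth_on V X"
    and invariant: "\<And>V X. (V, X) \<in> \<G> \<Longrightarrow> forward_invariant S V X"
    and max_rank: "\<And>\<psi> x0 A. reach S \<psi> x0 A \<Longrightarrow> dim (range A) \<le> k"
begin

definition tangent :: "'e set \<Rightarrow> ('e \<Rightarrow> 'e) \<Rightarrow> bool" where
  "tangent V Y \<longleftrightarrow> (\<forall>\<psi> x0 A. reach S \<psi> x0 A \<longrightarrow> dim (range A) = k \<longrightarrow> \<psi> x0 \<in> V \<longrightarrow> Y (\<psi> x0) \<in> range A)"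

lemma reachD:
  assumes "reach S \<psi> x0 A"
  shows "linear A" "\<psi> x0 \<in> S" "subspace (range A)" "isCont \<psi> x0"
proof -
  show l: "linear A" using assms unfolding reach_def using has_derivative_linear by blast
  show "\<psi> x0 \<in> S" using assms unfolding reach_def by (auto simp: image_subset_iff)
  show "subspace (range A)" using l by (simp add: linear_subspace_image)
  show "isCont \<psi> x0" using assms unfolding reach_def using has_derivative_continuous by blast
qed

lemma tangent_generator:
  assumes gen: "(V, X) \<in> \<G>"
  shows "tangent V X"
  unfolding tangent_def
proof (intro allI impI, rule ccontr)
  fix \<psi> x0 A assume rA: "reach S \<psi> x0 A" and rank: "dim (range A) = k" and qV: "\<psi> x0 \<in> V" and not: "X (\<psi> x0) \<notin> range A"
  define q where "q = \<psi> x0"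
  have X: "smooth_on V X" by (rule smooth_gens[OF gen])
  note A = reachD[OF rA]
  have qS: "q \<in> S" using A(2) by (simp add: q_def)
  obtain R \<delta> \<delta>' \<phi> B where fl: "local_flow V X q R \<delta> \<phi> B" and d: "0 < \<delta>'" "\<delta>' < \<delta>"
    and inS: "\<And>x t. x \<in> S \<Longrightarrow> x \<in> cball q R \<Longrightarrow> t \<in> {0..\<delta>'} \<Longrightarrow> \<phi> x t \<in> S"
    using reach_flow[OF X invariant[OF gen] open_UNIV UNIV_I qS, of thesis] qV by (auto simp: q_def)
  note f = local_flowD[OF fl]
  \<comment> \<open>Source and target have equal dimension, so the missed vector yields a kernel
    vector \<open>v0\<close>. The parameter in its direction is free to serve as a time.\<close>
  have "\<not> inj A" using linear_injective_imp_surjective[OF A(1)] not by auto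
  then obtain v0 where v0: "v0 \<noteq> 0" "A v0 = 0" using linear_injective_0[OF A(1)] by blast
  define v where "v = v0 /\<^sub>R norm v0"
  have v: "A v = 0" "v \<bullet> v = 1"
    using v0 linear_scale[OF A(1)] by (auto simp: v_def dot_square_norm power2_eq_square)
  \<comment> \<open>The base time is positive: only forward times are known to stay in
    \<open>S\<close>, while differentiability concerns a full neighbourhood of the base
    time.\<close>
  define \<tau> where "\<tau> = \<delta>' / 2"
  have \<tau>: "0 < \<tau>" "\<tau> < \<delta>" "\<tau> < \<delta>'" "\<tau> \<in> {-\<delta>..\<delta>}" using d by (auto simp: \<tau>_def)
  define P where "P h = h - (v \<bullet> h) *\<^sub>R v" for h
  \<comment> \<open>The component along \<open>v\<close> is removed from the argument of
    \<open>\<psi>\<close>, where it has no first order effect, and is used as flow time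
    instead.\<close>
  define c where "c x = (\<psi> (x0 + P (x - x0)), \<tau> + v \<bullet> (x - x0))" for x
  define \<Psi> where "\<Psi> x = \<phi> (fst (c x)) (snd (c x))" for x
  have c0: "c x0 = (q, \<tau>)" by (simp add: c_def P_def q_def)
  have Pd: "((\<lambda>x. x0 + P (x - x0)) has_derivative P) (at x)" for x
    unfolding P_def by (auto intro!: derivative_eq_intros simp: algebra_simps)
  have AP: "A (P h) = A h" for h
    unfolding P_def using A(1) v(1) by (simp add: linear_diff linear_scale)
  have cd: "(c has_derivative (\<lambda>h. (A h, v \<bullet> h))) (at x0)"
    unfolding c_def
  proof (rule has_derivative_Pair)
    have "(\<psi> has_derivative A) (at (x0 + P (x0 - x0)))" using rA by (simp add: reach_def P_def)
    from has_derivative_compose[OF Pd this] show "((\<lambda>x. \<psi> (x0 + P (x - x0))) has_derivative A) (at x0)"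
      by (simp add: AP)
    show "((\<lambda>x. \<tau> + v \<bullet> (x - x0)) has_derivative (\<lambda>h. v \<bullet> h)) (at x0)" by (auto intro!: derivative_eq_intros)
  qed
  define D where "D h = B \<tau> (A h) + (v \<bullet> h) *\<^sub>R X (\<phi> q \<tau>)" for h
  have Dd: "(\<Psi> has_derivative D) (at x0)"
  proof -
    have "((\<lambda>x. (\<lambda>(x, t). \<phi> x t) (c x)) has_derivative (\<lambda>h. (\<lambda>(h, s). B \<tau> h + s *\<^sub>R X (\<phi> q \<tau>)) (A h, v \<bullet> h))) (at x0)"
      by (rule has_derivative_compose[OF cd]) (simp add: c0 flow_has_derivative[OF X fl \<tau>(1,2)])
    then show ?thesis by (simp add: \<Psi>_def[abs_def] D_def[abs_def] split_beta)
  qed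
  have "reach S \<Psi> x0 D" unfolding reach_def
  proof (intro conjI Dd)
    obtain r where r: "r > 0" "continuous_on (ball x0 r) \<psi>" "\<psi> ` ball x0 r \<subseteq> S"
      using rA unfolding reach_def by blast
    have Pn: "norm (P h) \<le> 2 * norm h" for h
    proof -
      have nv: "norm v = 1" using v(2) by (simp add: norm_eq_1)
      have "norm (P h) \<le> norm h + \<bar>v \<bullet> h\<bar> * norm v" unfolding P_def using norm_triangle_ineq4[of h "(v \<bullet> h) *\<^sub>R v"] by simp
      also have "\<bar>v \<bullet> h\<bar> \<le> norm h" using Cauchy_Schwarz_ineq2[of v h] nv by simp
      finally show ?thesis using nv by simp
    qed
    have m1: "x0 + P (x - x0) \<in> ball x0 r" if "x \<in> ball x0 (r/2)" for x
      using Pn[of "x - x0"] that by (simp add: dist_norm norm_minus_commute)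
    have cc: "continuous_on (ball x0 (r/2)) c"
      unfolding c_def
      by (intro continuous_intros continuous_on_compose2[OF r(2)]
          continuous_at_imp_continuous_on ballI has_derivative_continuous[OF Pd]) (use m1 in auto)
    have U: "open (ball q R \<times> {0<..<\<delta>'})" by (intro open_Times) auto
    have "open (ball x0 (r/2) \<inter> c -` (ball q R \<times> {0<..<\<delta>'}))"
      by (rule continuous_open_preimage[OF cc open_ball U])
    moreover have "x0 \<in> ball x0 (r/2) \<inter> c -` (ball q R \<times> {0<..<\<delta>'})" using c0 \<tau> f(1) r(1) by simp
    ultimately obtain r' where r': "r' > 0" "ball x0 r' \<subseteq> ball x0 (r/2) \<inter> c -` (ball q R \<times> {0<..<\<delta>'})"
      using open_contains_ball by blast
    show "\<exists>r>0. continuous_on (ball x0 r) \<Psi> \<and> \<Psi> ` ball x0 r \<subseteq> S"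
    proof (intro exI[of _ r'] conjI)
      have "continuous_on (ball x0 r') (\<lambda>x. (\<lambda>(x, t). \<phi> x t) (c x))"
      proof (rule continuous_on_compose2[OF flow_continuous[OF X fl] continuous_on_subset[OF cc]])
        show "c ` ball x0 r' \<subseteq> cball q R \<times> {-\<delta>..\<delta>}" using r'(2) d by fastforce
      qed (use r'(2) in auto)
      then show "continuous_on (ball x0 r') \<Psi>" by (simp add: \<Psi>_def[abs_def] split_beta)
      show "\<Psi> ` ball x0 r' \<subseteq> S"
      proof
        fix z assume "z \<in> \<Psi> ` ball x0 r'"
        then obtain x where x: "x \<in> ball x0 r'" "z = \<Psi> x" by blast
        then have x2: "x \<in> ball x0 (r/2)" "c x \<in> ball q R \<times> {0<..<\<delta>'}" using r'(2) by auto
        have "fst (c x) \<in> S" using r(3) m1[OF x2(1)] by (auto simp: c_def)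
        then show "z \<in> S" unfolding x(2) \<Psi>_def using x2(2) by (intro inS) (auto simp: mem_Times_iff)
      qed
    qed (use r' in simp)
  qed
  then have "dim (range D) \<le> k" by (rule max_rank)
  moreover have "dim (range D) \<ge> Suc k"
  proof -
    \<comment> \<open>The flow carries \<open>X\<close> to itself, so \<open>B \<tau>\<close>
      factors out of \<open>D\<close>. It is injective; hence \<open>D\<close> has the rank of
      \<open>M\<close>, whose range contains \<open>range A\<close> and the new vector
      \<open>X q\<close>.\<close>
    define M where "M h = A h + (v \<bullet> h) *\<^sub>R X q" for h
    have "D h = B \<tau> (M h)" for h
      by (simp add: D_def M_def blinfun.add_right blinfun.scaleR_right f(12)[OF \<tau>(4), symmetric])
    then have "range D = blinfun_apply (B \<tau>) ` range M" by auto
    moreover have linB: "linear (blinfun_apply (B \<tau>))" by (simp add: blinfun.bounded_linear_right bounded_linear.linear)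
    moreover have "inj_on (blinfun_apply (B \<tau>)) (span (range M))"
      using flow_injective[OF fl \<tau>(4)] by (meson inj_on_subset subset_UNIV)
    ultimately have "dim (range D) = dim (range M)" by (simp add: dim_image_eq)
    moreover have "insert (X q) (range A) \<subseteq> range M"
    proof -
      have "M v = X q" by (simp add: M_def v)
      moreover have "M (P h) = A h" for h
      proof -
        have "v \<bullet> P h = 0" by (simp add: P_def inner_diff_right v)
        then show ?thesis by (simp add: M_def AP)
      qed
      ultimately show ?thesis by (metis insert_subset image_subsetI rangeI)
    qed
    moreover have "dim (insert (X q) (range A)) = Suc k"
      using not rank A(3) by (simp add: dim_insert span_eq_iff[THEN iffD2] q_def)
    ultimately show ?thesis using dim_subset by metis
  qed
  ultimately show False by simp
qed

text \<open>Following \<open>\<psi>\<close> by the flow of \<open>X\<close> gives another map of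
  maximal rank, to whose image \<open>Y\<close> is tangent. Pulled back by the differentials
  \<open>B t\<close>, the values of \<open>Y\<close> along the orbit lie in the fixed space
  \<open>range A\<close>. So does their derivative at time 0, the bracket, because subspaces are
  closed.\<close>

lemma tangent_bracket:
  assumes gen: "(V, X) \<in> \<G>" and Y: "smooth_on V' Y" "tangent V' Y"
  shows "tangent (V \<inter> V') (brk X Y)"
  unfolding tangent_def
proof (intro allI impI)
  fix \<psi> x0 A assume rA: "reach S \<psi> x0 A" and rank: "dim (range A) = k" and q: "\<psi> x0 \<in> V \<inter> V'"
  define q where "q = \<psi> x0"
  have X: "smooth_on V X" by (rule smooth_gens[OF gen])
  note A = reachD[OF rA]
  have qS: "q \<in> S" "q \<in> V" "q \<in> V'" using A(2) q by (auto simp: q_def)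
  obtain R \<delta> \<delta>' \<phi> B where fl: "local_flow V X q R \<delta> \<phi> B" and RV: "cball q (2 * R) \<subseteq> V'" and d: "0 < \<delta>'" "\<delta>' < \<delta>"
    and inS: "\<And>x t. x \<in> S \<Longrightarrow> x \<in> cball q R \<Longrightarrow> t \<in> {0..\<delta>'} \<Longrightarrow> \<phi> x t \<in> S"
    by (rule reach_flow[OF X invariant[OF gen] smooth_onD(1)[OF Y(1)] qS(3,1,2)], rule that)
  note f = local_flowD[OF fl]
  have qR: "q \<in> cball q R" using f(1) by simp
  obtain r where r: "r > 0" "continuous_on (ball x0 r) \<psi>" "\<psi> ` ball x0 r \<subseteq> S"
    using rA unfolding reach_def by blast
  obtain r' where r': "r' > 0" "ball x0 r' \<subseteq> ball x0 r \<inter> \<psi> -` ball q R"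
  proof -
    have "open (ball x0 r \<inter> \<psi> -` ball q R)" by (rule continuous_open_preimage[OF r(2) open_ball open_ball])
    moreover have "x0 \<in> ball x0 r \<inter> \<psi> -` ball q R" using r(1) f(1) by (simp add: q_def)
    ultimately show ?thesis using that open_contains_ball by blast
  qed
  have lB: "linear (blinfun_apply (B t))" for t by (simp add: blinfun.bounded_linear_right bounded_linear.linear)
  have "\<exists>w. w \<in> range A \<and> B t w = Y (\<phi> q t)" if t: "t \<in> {0..\<delta>'}" for t
  proof -
    have tI: "t \<in> {-\<delta>..\<delta>}" using t d by auto
    have "reach S (\<lambda>x. \<phi> (\<psi> x) t) x0 (\<lambda>h. B t (A h))"
      unfolding reach_def
    proof (intro conjI exI[of _ r'])
      have "continuous_on (ball x0 r') (\<lambda>x. (\<lambda>(x, t). \<phi> x t) (\<psi> x, t))"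
        by (rule continuous_on_compose2[OF flow_continuous[OF X fl]])
          (use r' tI in \<open>auto intro!: continuous_intros continuous_on_subset[OF r(2)] simp: less_imp_le subset_iff\<close>)
      then show "continuous_on (ball x0 r') (\<lambda>x. \<phi> (\<psi> x) t)" by simp
      show "(\<lambda>x. \<phi> (\<psi> x) t) ` ball x0 r' \<subseteq> S"
        using r'(2) r(3) inS[OF _ _ t] by (fastforce simp: image_subset_iff subset_iff)
      have "((\<lambda>x. \<phi> x t) has_derivative blinfun_apply (B t)) (at (\<psi> x0))" using f(8)[OF tI] by (simp add: q_def)
      then show "((\<lambda>x. \<phi> (\<psi> x) t) has_derivative (\<lambda>h. B t (A h))) (at x0)"
        using has_derivative_compose rA unfolding reach_def by blast
    qed (use r' in simp)
    moreover have "dim (range (\<lambda>h. B t (A h))) = k"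
    proof -
      have "range (\<lambda>h. B t (A h)) = blinfun_apply (B t) ` range A" by auto
      moreover have "inj_on (blinfun_apply (B t)) (span (range A))"
        using flow_injective[OF fl tI] by (meson inj_on_subset subset_UNIV)
      ultimately show ?thesis using rank lB by (simp add: dim_image_eq)
    qed
    moreover have "\<phi> (\<psi> x0) t \<in> V'" using f(5)[OF qR tI] RV by (auto simp: q_def)
    ultimately have "Y (\<phi> (\<psi> x0) t) \<in> range (\<lambda>h. B t (A h))"
      using Y(2) unfolding tangent_def by blast
    then show ?thesis by (auto simp: q_def)
  qed
  then obtain w where w: "\<And>t. t \<in> {0..\<delta>'} \<Longrightarrow> w t \<in> range A \<and> B t (w t) = Y (\<phi> q t)" by metis
  have w0: "w 0 \<in> range A" "B 0 (w 0) = Y (\<phi> q 0)" using w[of 0] d by auto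
  have "w 0 = Y q" using w0(2) by (simp add: f(9) f(4)[OF qR])
  with w0(1) have Yq: "Y q \<in> range A" by metis
  \<comment> \<open>In place of inverting \<open>B t\<close>, the image of the constant vector
    \<open>Y q\<close> is subtracted: \<open>D t\<close> is the image of \<open>w t - Y q\<close>
    under \<open>B t\<close>, which is close to the identity.\<close>
  define D where "D t = Y (\<phi> q t) - B t (Y q)" for t
  have Dd: "(D has_vector_derivative brk X Y q) (at 0 within {-\<delta>..\<delta>})"
  proof -
    have 0: "0 \<in> {-\<delta>..\<delta>}" using f(2) by simp
    have "((\<lambda>t. Y (\<phi> q t)) has_vector_derivative fder Y (\<phi> q 0) (X (\<phi> q 0))) (at 0 within {-\<delta>..\<delta>})"
      by (rule derivative_along_curve[OF Y(1) _ f(6)[OF qR 0]]) (simp add: f(4)[OF qR] qS)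
    from has_vector_derivative_diff[OF this f(10)[of "Y q"]]
    show ?thesis by (simp add: D_def[abs_def] brk_def f(4)[OF qR])
  qed
  have "brk X Y q \<in> closure (range A)"
    unfolding closure_approachable
  proof (intro allI impI)
    fix e0 :: real assume e0: "e0 > 0"
    define b where "b = brk X Y q"
    define e where "e = e0 / 3"
    have e: "e > 0" using e0 by (simp add: e_def)
    obtain d1 where d1: "d1 > 0" "\<And>t. t \<in> {-\<delta>..\<delta>} \<Longrightarrow> norm (t - 0) < d1 \<Longrightarrow> norm (D t - D 0 - (t - 0) *\<^sub>R b) \<le> e * norm (t - 0)"
      using Dd e unfolding has_vector_derivative_def has_derivative_within_alt b_def by blast
    have D0: "D 0 = 0" by (simp add: D_def f(9) f(4)[OF qR])
    have eb: "e + norm b > 0" using e by (simp add: add_pos_nonneg)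
    \<comment> \<open>The last entry bounds the distortion caused by \<open>B t\<close>, which is of
      relative order t / \<delta>, by \<open>e * t\<close>.\<close>
    define t where "t = Min {\<delta>', d1 / 2, e * \<delta> / (e + norm b)}"
    have t: "0 < t" "t \<le> \<delta>'" "t < d1"
    proof -
      show "0 < t" "t \<le> \<delta>'" using d(1) d1(1) e eb f(2) by (auto simp: t_def)
      have "t \<le> d1 / 2" unfolding t_def by (rule Min_le) auto
      then show "t < d1" using d1(1) by simp
    qed
    have "t \<le> e * \<delta> / (e + norm b)" unfolding t_def by (rule Min_le) auto
    then have t4: "t * (e + norm b) \<le> e * \<delta>" using eb by (simp add: pos_le_divide_eq)
    have tI: "t \<in> {-\<delta>..\<delta>}" "t \<in> {0..\<delta>'}" using t d by auto
    define z where "z = w t - Y q"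
    have zA: "z \<in> range A" unfolding z_def using w[OF tI(2)] Yq A(3) by (simp add: subspace_diff)
    have Bz: "B t z = D t" using w[OF tI(2)] by (simp add: z_def D_def blinfun.diff_right)
    have Dt: "norm (D t - t *\<^sub>R b) \<le> e * t" using d1(2)[OF tI(1)] t D0 by simp
    have zB: "norm (D t - z) \<le> t / (2 * \<delta>) * norm z" using f(11)[OF tI(1), of z] t by (simp add: Bz)
    have "t / (2 * \<delta>) * norm z \<le> 1/2 * norm z"
      using t d f(2) by (intro mult_right_mono) (auto simp: field_simps)
    then have "norm z \<le> 2 * norm (D t)"
      using zB norm_triangle_ineq2[of z "D t"] norm_minus_commute[of z "D t"] by linarith
    also have "norm (D t) \<le> (e + norm b) * t"
      using Dt norm_triangle_ineq2[of "D t" "t *\<^sub>R b"] t by (simp add: algebra_simps)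
    finally have zn: "norm z \<le> 2 * ((e + norm b) * t)" by simp
    have "t / (2 * \<delta>) * norm z \<le> t / (2 * \<delta>) * (2 * ((e + norm b) * t))"
      using zn t f(2) by (intro mult_left_mono) auto
    also have "\<dots> = (t * (e + norm b)) / \<delta> * t" using f(2) by (simp add: field_simps)
    also have "\<dots> \<le> e * t"
      using t4 t f(2) by (intro mult_right_mono) (auto simp: pos_divide_le_eq)
    finally have "norm (z - t *\<^sub>R b) \<le> 2 * (e * t)"
      using zB Dt norm_triangle_ineq[of "z - D t" "D t - t *\<^sub>R b"] norm_minus_commute[of z "D t"] by simp
    moreover have "z - t *\<^sub>R b = t *\<^sub>R (z /\<^sub>R t - b)" using t by (simp add: scaleR_diff_right)
    ultimately have "t * norm (z /\<^sub>R t - b) \<le> t * (2 * e)" using t by (simp add: mult_ac)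
    then have "norm (z /\<^sub>R t - b) \<le> 2 * e" using t by simp
    then have "dist (z /\<^sub>R t) b < e0" using e0 by (simp add: dist_norm e_def)
    moreover have "z /\<^sub>R t \<in> range A" using zA A(3) by (simp add: subspace_scale)
    ultimately show "\<exists>y\<in>range A. dist y (brk X Y q) < e0" unfolding b_def by blast
  qed
  then show "brk X Y (\<psi> x0) \<in> range A"
    using closed_subspace[OF A(3)] by (simp add: q_def closure_closed)
qed

text \<open>Tangency alone does not carry the induction, as \<open>tangent_bracket\<close> only
  treats brackets with generators. Requiring in addition that brackets with all tangent fields are
  tangent reduces the bracket rule to the Jacobi identity.\<close>

definition lie_tangent :: "'e set \<Rightarrow> ('e \<Rightarrow> 'e) \<Rightarrow> bool" where
  "lie_tangent V X \<longleftrightarrow> smooth_on V X \<and> tangent V X \<and>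
     (\<forall>V' Y. smooth_on V' Y \<longrightarrow> tangent V' Y \<longrightarrow> tangent (V \<inter> V') (brk X Y))"

lemma tangent_combination:
  assumes "tangent V X" "tangent V Y" "\<And>x. x \<in> V \<Longrightarrow> Z x = a x *\<^sub>R X x + b x *\<^sub>R Y x"
  shows "tangent V Z"
  unfolding tangent_def
proof (intro allI impI)
  fix \<psi> x0 A assume r: "reach S \<psi> x0 A" "dim (range A) = k" "\<psi> x0 \<in> V"
  then have "X (\<psi> x0) \<in> range A" "Y (\<psi> x0) \<in> range A" using assms unfolding tangent_def by blast+
  then show "Z (\<psi> x0) \<in> range A"
    using assms(3)[OF r(3)] reachD(3)[OF r(1)] by (simp add: subspace_add subspace_scale)
qed

lemma lie_tangent_lie_fields:
  assumes "(V, X) \<in> lie_fields \<G>"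
  shows "lie_tangent V X"
  using assms
proof induction
  case (gen V X)
  then show ?case unfolding lie_tangent_def using smooth_gens tangent_generator tangent_bracket by blast
next
  case (zero V)
  have t0: "tangent W (\<lambda>x. 0)" for W
    unfolding tangent_def using reachD(3) subspace_0 by blast
  have "tangent (V \<inter> V') (brk (\<lambda>x. 0) Y)" if Y: "smooth_on V' Y" for V' Y
    by (rule tangent_combination[OF t0 t0, of _ _ "\<lambda>x. 0" "\<lambda>x. 0"])
      (simp add: brk_def fder_linear_arg[OF smooth_onD(4)[OF Y]])
  then show ?case unfolding lie_tangent_def using smooth_on_const[OF zero] t0 by blast
next
  case (add V X X')
  note h = add.IH[unfolded lie_tangent_def]
  have "tangent (V \<inter> V') (brk (\<lambda>x. X x + X' x) Y)" if Y: "smooth_on V' Y" "tangent V' Y" for V' Y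
  proof (rule tangent_combination[of _ "brk X Y" "brk X' Y" _ "\<lambda>x. 1" "\<lambda>x. 1"])
    show "tangent (V \<inter> V') (brk X Y)" "tangent (V \<inter> V') (brk X' Y)" using h Y by blast+
    fix x assume x: "x \<in> V \<inter> V'"
    then have "X differentiable at x" "X' differentiable at x" "Y differentiable at x"
      using h Y smooth_onD(4) by blast+
    then show "brk (\<lambda>x. X x + X' x) Y x = 1 *\<^sub>R brk X Y x + 1 *\<^sub>R brk X' Y x"
      by (simp add: brk_def fder_add fder_linear_arg)
  qed
  moreover have "tangent V (\<lambda>x. X x + X' x)"
    by (rule tangent_combination[of _ X X' _ "\<lambda>x. 1" "\<lambda>x. 1"]) (use h in auto)
  ultimately show ?case unfolding lie_tangent_def using h smooth_on_add by blast
next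
  case (scale V X g)
  note h = scale.IH[unfolded lie_tangent_def]
  have "tangent (V \<inter> V') (brk (\<lambda>x. g x *\<^sub>R X x) Y)" if Y: "smooth_on V' Y" "tangent V' Y" for V' Y
  proof (rule tangent_combination[of _ "brk X Y" X _ g "\<lambda>x. - fder g x (Y x)"])
    show "tangent (V \<inter> V') (brk X Y)" using h Y by blast
    show "tangent (V \<inter> V') X" using h unfolding tangent_def by blast
    fix x assume x: "x \<in> V \<inter> V'"
    then have "X differentiable at x" "g differentiable at x" "Y differentiable at x"
      using h Y smooth_onD(4) scale(2) by blast+
    then show "brk (\<lambda>x. g x *\<^sub>R X x) Y x = g x *\<^sub>R brk X Y x + (- fder g x (Y x)) *\<^sub>R X x"
      by (simp add: brk_def fder_scaleR fder_linear_arg algebra_simps)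
  qed
  moreover have "tangent V (\<lambda>x. g x *\<^sub>R X x)"
    by (rule tangent_combination[of _ X X _ g "\<lambda>x. 0"]) (use h in auto)
  ultimately show ?case unfolding lie_tangent_def using h smooth_on_scaleR[OF scale(2)] by blast
next
  case (bracket V X X')
  note h = bracket.IH[unfolded lie_tangent_def]
  have s: "smooth_on V X" "smooth_on V X'" using h by blast+
  have "tangent (V \<inter> V') (brk (brk X X') Y)" if Y: "smooth_on V' Y" "tangent V' Y" for V' Y
  proof -
    have o: "open (V \<inter> V')" using smooth_onD(1)[OF s(1)] smooth_onD(1)[OF Y(1)] by blast
    have sI: "smooth_on (V \<inter> V') X" "smooth_on (V \<inter> V') X'" "smooth_on (V \<inter> V') Y"
      using smooth_on_subset[OF s(1) o] smooth_on_subset[OF s(2) o] smooth_on_subset[OF Y(1) o] by blast+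
    have t1: "tangent (V \<inter> V') (brk X Y)" "tangent (V \<inter> V') (brk X' Y)" using h Y by blast+
    have sb: "smooth_on (V \<inter> V') (brk X Y)" "smooth_on (V \<inter> V') (brk X' Y)" using sI smooth_on_brk by blast+
    have "tangent (V \<inter> (V \<inter> V')) (brk X (brk X' Y))" "tangent (V \<inter> (V \<inter> V')) (brk X' (brk X Y))"
      using h t1 sb by blast+
    then have t2: "tangent (V \<inter> V') (brk X (brk X' Y))" "tangent (V \<inter> V') (brk X' (brk X Y))"
      by (simp_all add: Int_absorb1 Int_left_absorb)
    show ?thesis
      by (rule tangent_combination[OF t2, of _ "\<lambda>x. 1" "\<lambda>x. - 1"]) (simp add: brk_jacobi[OF sI])
  qed
  moreover have "tangent V (brk X X')"
    using h by (metis Int_absorb)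
  ultimately show ?case unfolding lie_tangent_def using s smooth_on_brk by blast
next
  case (local V X)
  have loc: "\<exists>W X'. x \<in> W \<and> lie_tangent W X' \<and> (\<forall>y\<in>V \<inter> W. X y = X' y)" if "x \<in> V" for x
    using local(2)[OF that] by blast
  have sm: "smooth_on V X"
  proof (rule smooth_on_local[OF local(1)])
    fix x assume x: "x \<in> V"
    then obtain W X' where "x \<in> W" "smooth_on W X'" "\<forall>y\<in>V \<inter> W. X y = X' y"
      using loc unfolding lie_tangent_def by blast
    then have "x \<in> V \<inter> W \<and> smooth_on (V \<inter> W) X"
      using x smooth_on_eq_local[OF \<open>smooth_on W X'\<close> local(1), of X] by simp
    then show "\<exists>N. x \<in> N \<and> smooth_on N X" by (rule exI)
  qed
  moreover have "tangent V X"
    unfolding tangent_def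
  proof (intro allI impI)
    fix \<psi> x0 A assume r: "reach S \<psi> x0 A" "dim (range A) = k" "\<psi> x0 \<in> V"
    then obtain W X' where "\<psi> x0 \<in> W" "lie_tangent W X'" "X (\<psi> x0) = X' (\<psi> x0)" using loc by blast
    then show "X (\<psi> x0) \<in> range A" using r unfolding lie_tangent_def tangent_def by metis
  qed
  moreover have "tangent (V \<inter> V') (brk X Y)" if Y: "smooth_on V' Y" "tangent V' Y" for V' Y
    unfolding tangent_def
  proof (intro allI impI)
    fix \<psi> x0 A assume r: "reach S \<psi> x0 A" "dim (range A) = k" "\<psi> x0 \<in> V \<inter> V'"
    then obtain W X' where W: "\<psi> x0 \<in> W" "lie_tangent W X'" "\<forall>y\<in>V \<inter> W. X y = X' y" using loc by blast
    have "open (V \<inter> W)" using local(1) W(2) smooth_onD(1) unfolding lie_tangent_def by blast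
    then have "brk X Y (\<psi> x0) = brk X' Y (\<psi> x0)"
      using W r by (intro brk_cong[of "V \<inter> W"]) auto
    moreover have "tangent (W \<inter> V') (brk X' Y)" using W(2) Y unfolding lie_tangent_def by blast
    ultimately show "brk X Y (\<psi> x0) \<in> range A" using r W(1) unfolding tangent_def by auto
  qed
  ultimately show ?case unfolding lie_tangent_def by blast
qed

text \<open>At maximal rank all fields are tangent to the image, so \<open>A\<close> is onto.
  Continuity near \<open>x0\<close> and differentiability at \<open>x0\<close> with a right inverse
  suffice for the open mapping theorem used here.\<close>

lemma interior_nonempty:
  assumes r: "reach S \<psi> x0 A" and rank: "dim (range A) = k"
    and full: "\<And>q v. q \<in> S \<Longrightarrow> \<exists>V X. (V, X) \<in> lie_fields \<G> \<and> q \<in> V \<and> X q = v"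
  shows "interior S \<noteq> {}"
proof -
  note A = reachD[OF r]
  have "v \<in> range A" for v
  proof -
    obtain V X where "(V, X) \<in> lie_fields \<G>" "\<psi> x0 \<in> V" "X (\<psi> x0) = v" using full[OF A(2)] by blast
    then show ?thesis using lie_tangent_lie_fields[of V X] r rank unfolding lie_tangent_def tangent_def by blast
  qed
  then have "surj A" by blast
  then obtain g where g: "linear g" "A \<circ> g = id" using linear_surjective_right_inverse[OF A(1)] by blast
  obtain e where e: "e > 0" "continuous_on (ball x0 e) \<psi>" "\<psi> ` ball x0 e \<subseteq> S" and d: "(\<psi> has_derivative A) (at x0)"
    using r unfolding reach_def by blast
  have "\<psi> x0 \<in> interior (\<psi> ` ball x0 e)"
    using sussmann_open_mapping[OF open_ball e(2) _ d linear_conv_bounded_linear[THEN iffD1, OF g(1)] g(2), of "ball x0 e"]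
      e(1) by (simp add: interior_open)
  then show ?thesis using interior_mono[OF e(3)] by blast
qed

end

lemma lie_full_interior_nonempty:
  fixes S :: "'e::euclidean_space set"
  assumes gens: "\<And>V X. (V, X) \<in> \<G> \<Longrightarrow> smooth_on V X"
    and inv: "\<And>V X. (V, X) \<in> \<G> \<Longrightarrow> forward_invariant S V X"
    and ne: "S \<noteq> {}"
    and full: "\<And>q v. q \<in> S \<Longrightarrow> \<exists>V X. (V, X) \<in> lie_fields \<G> \<and> q \<in> V \<and> X q = v"
  shows "interior S \<noteq> {}"
proof -
  define P where "P k \<longleftrightarrow> (\<exists>\<psi> x0 A. reach S \<psi> x0 A \<and> dim (range A) = k)" for k
  obtain q where q: "q \<in> S" using ne by blast
  \<comment> \<open>A constant map starts the construction; the ranks that occur are bounded by the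
    dimension, so a largest one exists.\<close>
  have "reach S (\<lambda>x. q) 0 (\<lambda>h. 0)" unfolding reach_def using q by (auto intro!: exI[of _ 1])
  then have P0: "P (dim (range (\<lambda>h::'e. 0::'e)))" unfolding P_def by blast
  have bd: "k \<le> DIM('e)" if "P k" for k using that dim_subset_UNIV unfolding P_def by auto
  define k where "k = (GREATEST k. P k)"
  have k1: "P k" unfolding k_def by (rule GreatestI_nat[of P, OF P0 bd])
  have k2: "l \<le> k" if "P l" for l unfolding k_def by (rule Greatest_le_nat[of P, OF that bd])
  interpret krener \<G> S k
  proof
    show "dim (range A) \<le> k" if "reach S \<psi> x0 A" for \<psi> x0 A
      using k2[of "dim (range A)"] that unfolding P_def by blast
  qed (use gens inv in auto)
  from k1[unfolded P_def] obtain \<psi> x0 A where "reach S \<psi> x0 A" "dim (range A) = k" by blast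
  from interior_nonempty[OF this full] show ?thesis by blast
qed

section \<open>The maximum set in Euclidean space\<close>

definition cr_system :: "('e::euclidean_space \<Rightarrow> complex) \<Rightarrow> 'e set \<Rightarrow> 'e set \<Rightarrow> nat \<Rightarrow>
    (nat \<Rightarrow> 'e \<Rightarrow> 'e) \<Rightarrow> (nat \<Rightarrow> 'e \<Rightarrow> 'e) \<Rightarrow> ('e \<Rightarrow> 'e) \<Rightarrow> bool" where
  "cr_system f G V r X Y X0 \<longleftrightarrow> open V \<and> V \<subseteq> G \<and> (\<forall>j<r. smooth_on V (X j) \<and> smooth_on V (Y j)) \<and> smooth_on V X0 \<and>
     (\<forall>x\<in>V. \<forall>j<r. fder f x (X j x) + \<i> * fder f x (Y j x) = 0) \<and>
     (\<forall>x\<in>V. (\<Sum>j<r. fder (\<lambda>y. fder f y (X j y)) x (X j x) + fder (\<lambda>y. fder f y (Y j y)) x (Y j x)) = fder f x (X0 x))"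

text \<open>The sign of the drift matters: these are the fields whose forward semiflows preserve the
  sets in question. The module that they generate contains \<open>X0\<close> as well.\<close>

definition cr_generators :: "('e::euclidean_space \<Rightarrow> complex) \<Rightarrow> 'e set \<Rightarrow> ('e set \<times> ('e \<Rightarrow> 'e)) set" where
  "cr_generators f G = {(V, Z). \<exists>r X Y X0. cr_system f G V r X Y X0 \<and>
     ((\<exists>j<r. Z = X j) \<or> (\<exists>j<r. Z = Y j) \<or> Z = (\<lambda>x. - X0 x))}"

lemma sum_lessThan_add: "(\<Sum>j<r + s. g j) = (\<Sum>j<r. g j) + (\<Sum>j<s. g (r + j))" for g :: "nat \<Rightarrow> 'a::comm_monoid_add"
  by (induction s) (auto simp: add.assoc)

lemma exterior_normal_subset: "exterior_normal S p \<nu> \<Longrightarrow> T \<subseteq> S \<Longrightarrow> p \<in> T \<Longrightarrow> exterior_normal T p \<nu>"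
  unfolding exterior_normal_def by blast

context
  fixes f :: "'e::euclidean_space \<Rightarrow> complex" and G V :: "'e set" and r X Y X0
  assumes f: "smooth_on G f" and f1: "\<And>x. x \<in> G \<Longrightarrow> cmod (f x) \<le> 1" and sys: "cr_system f G V r X Y X0"
begin

lemma cr_systemD:
  shows "open V" "V \<subseteq> G" "smooth_on V f" "j < r \<Longrightarrow> smooth_on V (X j)" "j < r \<Longrightarrow> smooth_on V (Y j)" "smooth_on V X0"
    "x \<in> V \<Longrightarrow> j < r \<Longrightarrow> fder f x (X j x) + \<i> * fder f x (Y j x) = 0"
    "x \<in> V \<Longrightarrow> (\<Sum>j<r. fder (\<lambda>y. fder f y (X j y)) x (X j x) + fder (\<lambda>y. fder f y (Y j y)) x (Y j x)) = fder f x (X0 x)"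
proof -
  show "open V" "V \<subseteq> G" using sys unfolding cr_system_def by blast+
  then show "smooth_on V f" using smooth_on_subset[OF f] by blast
qed (use sys in \<open>simp_all add: cr_system_def\<close>)

lemma cr_system_exterior_normal:
  assumes p: "p \<in> V" and nrm: "exterior_normal {x \<in> G. f x = 1} p \<nu>"
  shows "j < r \<Longrightarrow> X j p \<bullet> \<nu> = 0" "j < r \<Longrightarrow> Y j p \<bullet> \<nu> = 0" "- X0 p \<bullet> \<nu> \<le> 0"
proof -
  note s = cr_systemD
  define F where "F j = (if j < r then X j else Y (j - r))" for j
  define u where "u x = Re (f x) - 1" for x
  have su: "smooth_on V u" unfolding u_def
    by (intro smooth_on_diff smooth_on_linear[OF bounded_linear_Re s(3)] smooth_on_const s(1))
  have ud: "fder u x v = Re (fder f x v)" if "x \<in> V" for x v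
    unfolding u_def using smooth_onD(4)[OF s(3) that] smooth_onD(4)[OF smooth_on_linear[OF bounded_linear_Re s(3)] that]
    by (simp add: fder_diff fder_linear[OF bounded_linear_Re])
  have ud2: "fder (\<lambda>y. fder u y (Z y)) x (Z x) = Re (fder (\<lambda>y. fder f y (Z y)) x (Z x))"
    if x: "x \<in> V" and Z: "smooth_on V Z" for x Z
  proof -
    have "fder (\<lambda>y. fder u y (Z y)) x = fder (\<lambda>y. Re (fder f y (Z y))) x"
      by (rule fder_cong[OF s(1) x]) (rule ud)
    then show ?thesis
      using smooth_onD(4)[OF smooth_on_fder_field[OF s(3) Z] x] by (simp add: fder_linear[OF bounded_linear_Re])
  qed
  have sF: "smooth_on V (F j)" if "j < r + r" for j using that s(4,5) by (auto simp: F_def)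
  interpret degenerate_elliptic V u "r + r" F "\<lambda>x. - X0 x"
  proof
    show "u x \<le> 0" if "x \<in> V" for x
      using f1[of x] s(2) that complex_Re_le_cmod[of "f x"] by (auto simp: u_def)
    fix x assume x: "x \<in> V"
    have "(\<Sum>j<r + r. fder (\<lambda>y. fder u y (F j y)) x (F j x)) =
        Re (\<Sum>j<r. fder (\<lambda>y. fder f y (X j y)) x (X j x) + fder (\<lambda>y. fder f y (Y j y)) x (Y j x))"
      unfolding sum_lessThan_add by (simp add: F_def ud2[OF x] s(4,5) sum.distrib)
    also have "\<dots> = fder u x (X0 x)" by (simp add: s(8)[OF x] ud[OF x])
    finally show "(\<Sum>j<r + r. fder (\<lambda>y. fder u y (F j y)) x (F j x)) + fder u x (- X0 x) = 0"
      by (simp add: fder_linear_arg[OF smooth_onD(4)[OF su x]])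
  qed (auto intro: su sF smooth_on_minus s(6))
  \<comment> \<open>Under |f| \<le> 1 the real part equals 1 only where f = 1, so passing to the
    real part does not enlarge the set.\<close>
  have ms: "max_set = {x \<in> V. f x = 1}"
  proof -
    have "u x = 0 \<longleftrightarrow> f x = 1" if "x \<in> V" for x
    proof
      assume "u x = 0"
      then have r1: "Re (f x) = 1" by (simp add: u_def)
      have "(cmod (f x))\<^sup>2 \<le> 1" using f1[of x] s(2) that by (simp add: power_le_one subset_iff)
      then have "Im (f x) = 0" using r1 by (simp add: cmod_power2)
      then show "f x = 1" using r1 by (simp add: complex_eq_iff)
    qed (simp add: u_def)
    then show ?thesis by (auto simp: max_set_def)
  qed
  have "exterior_normal max_set p \<nu>"
    unfolding ms using exterior_normal_subset[OF nrm] p s(2) nrm by (auto simp: exterior_normal_iff)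
  note e = this
  show "j < r \<Longrightarrow> X j p \<bullet> \<nu> = 0" using tangent_to_max_set[OF e, of j] by (simp add: F_def)
  show "j < r \<Longrightarrow> Y j p \<bullet> \<nu> = 0" using tangent_to_max_set[OF e, of "r + j"] by (simp add: F_def)
  show "- X0 p \<bullet> \<nu> \<le> 0" using drift_inward[OF e] .
qed

text \<open>The conjugate of the drift \<open>X\<^sub>0\<close> is \<open>\<Sum>\<^sub>j [X\<^sub>j, Y\<^sub>j]\<close>.\<close>

lemma cr_system_drift_conjugate:
  assumes x: "x \<in> V"
  shows "fder f x (X0 x) + \<i> * fder f x (\<Sum>j<r. brk (X j) (Y j) x) = 0"
proof -
  note s = cr_systemD
  have df: "f differentiable at x" using smooth_onD(4)[OF s(3) x] .
  have "fder f x (brk (X j) (Y j) x) = \<i> * (fder (\<lambda>y. fder f y (X j y)) x (X j x) + fder (\<lambda>y. fder f y (Y j y)) x (Y j x))"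
    if j: "j < r" for j
  proof -
    have YX: "fder f y (Y j y) = \<i> * fder f y (X j y)" "fder f y (X j y) = - \<i> * fder f y (Y j y)" if "y \<in> V" for y
    proof -
      show 1: "fder f y (X j y) = - \<i> * fder f y (Y j y)" using s(7)[OF that j] by (simp add: add_eq_0_iff2)
      show "fder f y (Y j y) = \<i> * fder f y (X j y)" unfolding 1 by (simp flip: mult.assoc)
    qed
    have dX: "(\<lambda>y. fder f y (X j y)) differentiable at x" "(\<lambda>y. fder f y (Y j y)) differentiable at x"
      using smooth_onD(4)[OF smooth_on_fder_field[OF s(3) s(4)[OF j]] x] smooth_onD(4)[OF smooth_on_fder_field[OF s(3) s(5)[OF j]] x] .
    have 1: "fder (\<lambda>y. fder f y (Y j y)) x = fder (\<lambda>y. \<i> * fder f y (X j y)) x"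
      by (rule fder_cong[OF s(1) x]) (rule YX(1))
    have 2: "fder (\<lambda>y. fder f y (X j y)) x = fder (\<lambda>y. - \<i> * fder f y (Y j y)) x"
      by (rule fder_cong[OF s(1) x]) (rule YX(2))
    have "fder f x (brk (X j) (Y j) x) = fder (\<lambda>y. fder f y (Y j y)) x (X j x) - fder (\<lambda>y. fder f y (X j y)) x (Y j x)"
      by (rule fder_brk[OF s(3) s(4)[OF j] s(5)[OF j] x])
    also have "fder (\<lambda>y. fder f y (Y j y)) x (X j x) = \<i> * fder (\<lambda>y. fder f y (X j y)) x (X j x)"
      unfolding 1 by (rule fder_linear[OF bounded_linear_mult_right dX(1)])
    also have "fder (\<lambda>y. fder f y (X j y)) x (Y j x) = - \<i> * fder (\<lambda>y. fder f y (Y j y)) x (Y j x)"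
      unfolding 2 by (rule fder_linear[OF bounded_linear_mult_right dX(2)])
    finally show ?thesis by (simp add: algebra_simps)
  qed
  then have "fder f x (\<Sum>j<r. brk (X j) (Y j) x) = \<i> * fder f x (X0 x)"
    by (simp add: fder_sum_arg[OF df] flip: s(8)[OF x] sum_distrib_left)
  then show ?thesis by (simp flip: mult.assoc)
qed

text \<open>Each field is paired with a conjugate field: \<open>X j\<close> with \<open>Y j\<close>,
  \<open>Y j\<close> with \<open>- X j\<close>, and \<open>- X0\<close> with minus the sum of the
  brackets. Thus the drift is treated exactly like the other fields.\<close>

lemma cr_system_complement_normal:
  assumes p: "p \<in> V" and nrm: "exterior_normal (G - interior {x \<in> G. f x = 1}) p \<nu>"
  shows "j < r \<Longrightarrow> X j p \<bullet> \<nu> \<le> 0" "j < r \<Longrightarrow> Y j p \<bullet> \<nu> \<le> 0" "- X0 p \<bullet> \<nu> \<le> 0"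
proof -
  note s = cr_systemD
  have f1V: "cmod (f x) \<le> 1" if "x \<in> V" for x using f1 that s(2) by blast
  have t: "Z p \<bullet> \<nu> \<le> 0"
    if "smooth_on V Z" "smooth_on V W" "\<And>x. x \<in> V \<Longrightarrow> fder f x (Z x) + \<i> * fder f x (W x) = 0" for Z W
    by (rule tangent_to_complement_of_interior[OF smooth_onD(1)[OF f] s(2,3) f1V that p nrm])
  show "X j p \<bullet> \<nu> \<le> 0" if "j < r"
    using t[OF s(4)[OF that] s(5)[OF that] s(7)[OF _ that]] .
  show "Y j p \<bullet> \<nu> \<le> 0" if "j < r"
  proof (rule t[OF s(5)[OF that] smooth_on_minus[OF s(4)[OF that]]])
    fix x assume x: "x \<in> V"
    have "fder f x (X j x) = - \<i> * fder f x (Y j x)" using s(7)[OF x that] by (simp add: add_eq_0_iff2)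
    then show "fder f x (Y j x) + \<i> * fder f x (- X j x) = 0"
      by (simp add: fder_linear_arg[OF smooth_onD(4)[OF s(3) x]] flip: mult.assoc)
  qed
  show "- X0 p \<bullet> \<nu> \<le> 0"
  proof (rule t[OF smooth_on_minus[OF s(6)] smooth_on_minus])
    show "smooth_on V (\<lambda>x. \<Sum>j<r. brk (X j) (Y j) x)"
      by (intro smooth_on_sum s(1) smooth_on_brk s(4,5)) auto
    fix x assume x: "x \<in> V"
    show "fder f x (- X0 x) + \<i> * fder f x (- (\<Sum>j<r. brk (X j) (Y j) x)) = 0"
      using cr_system_drift_conjugate[OF x]
      by (simp add: fder_linear_arg[OF smooth_onD(4)[OF s(3) x]] add_eq_0_iff)
  qed
qed

end

theorem maximum_set_open:
  fixes f :: "'e::euclidean_space \<Rightarrow> complex"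
  assumes f: "smooth_on G f" and f1: "\<And>x. x \<in> G \<Longrightarrow> cmod (f x) \<le> 1"
    and full: "\<And>x v. x \<in> G \<Longrightarrow> \<exists>V a. (V, a) \<in> lie_fields (cr_generators f G) \<and> x \<in> V \<and> a x = v"
  shows "open {x \<in> G. f x = 1}"
proof (rule ccontr)
  let ?S = "{x \<in> G. f x = 1}" and ?C = "G - interior {x \<in> G. f x = 1}"
  assume "\<not> open ?S"
  have "\<not> ?S \<subseteq> interior ?S"
  proof
    assume "?S \<subseteq> interior ?S"
    then have "interior ?S = ?S" by (rule subset_antisym[OF interior_subset])
    then show False using \<open>\<not> open ?S\<close> open_interior[of ?S] by simp
  qed
  then have ne: "?S \<inter> ?C \<noteq> {}" by blast
  have G: "open G" using smooth_onD(1)[OF f] .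
  have smooth: "smooth_on V Z" if "(V, Z) \<in> cr_generators f G" for V Z
    using that cr_systemD(4-6)[OF f f1] smooth_on_minus unfolding cr_generators_def by blast
  have VG: "V \<subseteq> G" if "(V, Z) \<in> cr_generators f G" for V Z
    using that cr_systemD(2)[OF f f1] unfolding cr_generators_def by blast
  have ball: "\<exists>R>0. cball q R \<subseteq> G" if "q \<in> G" for q using G that open_contains_cball by blast
  have clS: "\<exists>R>0. closed (?S \<inter> cball q R)" if "q \<in> G" for q
  proof -
    obtain R where R: "R > 0" "cball q R \<subseteq> G" using ball[OF \<open>q \<in> G\<close>] by blast
    have "closed (cball q R \<inter> f -` {1})"
      using continuous_on_subset[OF smooth_onD(3)[OF f] R(2)] by (intro continuous_closed_preimage) auto
    moreover have "?S \<inter> cball q R = cball q R \<inter> f -` {1}" using R(2) by auto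
    ultimately show ?thesis using R(1) by auto
  qed
  have clC: "\<exists>R>0. closed (?C \<inter> cball q R)" if "q \<in> G" for q
  proof -
    obtain R where R: "R > 0" "cball q R \<subseteq> G" using ball[OF \<open>q \<in> G\<close>] by blast
    have "closed (cball q R - interior ?S)" by (intro closed_Diff) auto
    moreover have "?C \<inter> cball q R = cball q R - interior ?S" using R(2) by auto
    ultimately show ?thesis using R(1) by auto
  qed
  have inv: "forward_invariant (?S \<inter> ?C) V Z" if gen: "(V, Z) \<in> cr_generators f G" for V Z
  proof -
    obtain r X Y X0 where sys: "cr_system f G V r X Y X0"
      and Z: "(\<exists>j<r. Z = X j) \<or> (\<exists>j<r. Z = Y j) \<or> Z = (\<lambda>x. - X0 x)"
      using gen unfolding cr_generators_def by blast
    have "Z p \<bullet> \<nu> \<le> 0" if "p \<in> V" "exterior_normal ?S p \<nu>" for p \<nu>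
      using cr_system_exterior_normal[OF f f1 sys that] Z by auto
    then have "forward_invariant ?S V Z"
      using clS VG[OF gen] by (intro forward_invariant_normals[OF smooth[OF gen]]) auto
    moreover have "Z p \<bullet> \<nu> \<le> 0" if "p \<in> V" "exterior_normal ?C p \<nu>" for p \<nu>
      using cr_system_complement_normal[OF f f1 sys that] Z by auto
    then have "forward_invariant ?C V Z"
      using clC VG[OF gen] by (intro forward_invariant_normals[OF smooth[OF gen]]) auto
    ultimately show ?thesis by (rule forward_invariant_Int)
  qed
  have "interior (?S \<inter> ?C) \<noteq> {}"
    by (rule lie_full_interior_nonempty[OF smooth inv ne full]) auto
  moreover have "interior (?S \<inter> ?C) \<subseteq> interior ?S" "interior (?S \<inter> ?C) \<subseteq> ?C"
    by (intro interior_mono) (use interior_subset[of "?S \<inter> ?C"] in auto)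
  ultimately show False by blast
qed

section \<open>Vector fields on manifolds\<close>

lemma sum_fun_apply: "(\<Sum>j\<in>S. g j) x = (\<Sum>j\<in>S. g j x :: 'b::comm_monoid_add)"
  by (induction S rule: infinite_finite_induct) auto

locale smooth_manifold =
  fixes A :: "('m::topological_space, 'e::euclidean_space) chart set"
  assumes atlas: "smooth_atlas A"
begin

lemma chartD:
  assumes "(U, \<phi>) \<in> A"
  shows "open U" "open (\<phi> ` U)" "inj_on \<phi> U" "homeomorphism U (\<phi> ` U) \<phi> (inv_into U \<phi>)"
proof -
  have "\<forall>(U, \<phi>)\<in>A. open U \<and> open (\<phi> ` U) \<and> inj_on \<phi> U \<and> homeomorphism U (\<phi> ` U) \<phi> (inv_into U \<phi>)"
    using atlas unfolding smooth_atlas_def by (elim conjE)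
  from bspec[OF this assms] show "open U" "open (\<phi> ` U)" "inj_on \<phi> U" "homeomorphism U (\<phi> ` U) \<phi> (inv_into U \<phi>)"
    by simp_all
qed

lemma chart_at: obtains U \<phi> where "(U, \<phi>) \<in> A" "p \<in> U"
proof -
  have "(\<Union>(U, \<phi>)\<in>A. U) = UNIV" using atlas unfolding smooth_atlas_def by (elim conjE)
  then have "p \<in> (\<Union>(U, \<phi>)\<in>A. U)" by simp
  then show ?thesis using that by auto
qed

lemma open_chart_image:
  assumes c: "(U, \<phi>) \<in> A" and W: "open W"
  shows "open (\<phi> ` (W \<inter> U))"
proof -
  have "openin (top_of_set (\<phi> ` U)) (\<phi> ` (W \<inter> U))"
    using homeomorphism_imp_open_map[OF chartD(4)[OF c]] W by (simp add: openin_open_Int Int_commute)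
  then show ?thesis using chartD(2)[OF c] openin_open_eq by blast
qed

lemma inv_chart [simp]: "(U, \<phi>) \<in> A \<Longrightarrow> x \<in> U \<Longrightarrow> inv_into U \<phi> (\<phi> x) = x"
  using chartD(3) inv_into_f_f by metis

lemma smooth_funI:
  assumes "open W" "\<And>U \<phi>. (U, \<phi>) \<in> A \<Longrightarrow> smooth_on (\<phi> ` (W \<inter> U)) (g \<circ> inv_into U \<phi>)"
  shows "smooth_fun A W g"
  using assms unfolding smooth_fun_def by auto

lemma smooth_funD:
  assumes "smooth_fun A W g"
  shows "open W" "(U, \<phi>) \<in> A \<Longrightarrow> smooth_on (\<phi> ` (W \<inter> U)) (\<lambda>x. g (inv_into U \<phi> x))"
  using assms unfolding smooth_fun_def by (auto simp: o_def)

section \<open>Smooth functions on the manifold and their germs\<close>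

lemma smooth_fun_cong:
  assumes g: "smooth_fun A W g" and eq: "\<And>x. x \<in> W \<Longrightarrow> g x = h x"
  shows "smooth_fun A W h"
proof (rule smooth_funI[OF smooth_funD(1)[OF g]])
  fix U \<phi> assume c: "(U, \<phi>) \<in> A"
  show "smooth_on (\<phi> ` (W \<inter> U)) (h \<circ> inv_into U \<phi>)"
    by (rule smooth_on_cong[OF smooth_funD(2)[OF g c]]) (use eq c in auto)
qed

lemma smooth_fun_subset: "smooth_fun A W g \<Longrightarrow> open W' \<Longrightarrow> W' \<subseteq> W \<Longrightarrow> smooth_fun A W' g"
  by (rule smooth_funI, assumption, unfold o_def,
      rule smooth_on_subset[OF smooth_funD(2)]) (auto intro: open_chart_image)

lemma smooth_fun_local:
  assumes W: "open W" and loc: "\<And>p. p \<in> W \<Longrightarrow> \<exists>N. p \<in> N \<and> smooth_fun A N g"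
  shows "smooth_fun A W g"
proof (rule smooth_funI[OF W], rule smooth_on_local)
  fix U \<phi> assume c: "(U, \<phi>) \<in> A"
  show "open (\<phi> ` (W \<inter> U))" by (rule open_chart_image[OF c W])
  fix x assume "x \<in> \<phi> ` (W \<inter> U)"
  then obtain p where p: "p \<in> W" "p \<in> U" "x = \<phi> p" by blast
  then obtain N where N: "p \<in> N" "smooth_fun A N g" using loc by blast
  have "x \<in> \<phi> ` (N \<inter> U) \<and> smooth_on (\<phi> ` (N \<inter> U)) (g \<circ> inv_into U \<phi>)"
    using N p smooth_funD(2)[OF N(2) c] by (auto simp: o_def)
  then show "\<exists>N. x \<in> N \<and> smooth_on N (g \<circ> inv_into U \<phi>)" by (rule exI)
qed

lemma smooth_fun_const: "open W \<Longrightarrow> smooth_fun A W (\<lambda>x. c)"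
  by (rule smooth_funI) (auto simp: o_def intro!: smooth_on_const open_chart_image)

lemma smooth_fun_bilinear:
  "bounded_bilinear h \<Longrightarrow> smooth_fun A W f \<Longrightarrow> smooth_fun A W g \<Longrightarrow> smooth_fun A W (\<lambda>x. h (f x) (g x))"
  by (rule smooth_funI, erule smooth_funD(1), unfold o_def, rule smooth_on_bilinear) (auto intro: smooth_funD)

lemma smooth_fun_add: "smooth_fun A W f \<Longrightarrow> smooth_fun A W g \<Longrightarrow> smooth_fun A W (\<lambda>x. f x + g x)"
  by (rule smooth_funI, erule smooth_funD(1), unfold o_def, rule smooth_on_add) (auto intro: smooth_funD)

lemma smooth_fun_linear: "bounded_linear h \<Longrightarrow> smooth_fun A W f \<Longrightarrow> smooth_fun A W (\<lambda>x. h (f x))"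
  by (rule smooth_funI, erule smooth_funD(1), unfold o_def, rule smooth_on_linear) (auto intro: smooth_funD)

lemmas smooth_fun_mult = smooth_fun_bilinear[OF bounded_bilinear_mult]
  and smooth_fun_cmult = smooth_fun_linear[OF bounded_linear_mult_right]
  and smooth_fun_cnj = smooth_fun_linear[OF bounded_linear_cnj]
  and smooth_fun_minus = smooth_fun_linear[OF bounded_linear_minus[OF bounded_linear_ident]]

lemma smooth_fun_diff: "smooth_fun A W f \<Longrightarrow> smooth_fun A W g \<Longrightarrow> smooth_fun A W (\<lambda>x. f x - g x)"
  using smooth_fun_add[OF _ smooth_fun_minus] by fastforce

lemma smooth_nearI: "smooth_fun A W f \<Longrightarrow> p \<in> W \<Longrightarrow> smooth_near A p f"
  unfolding smooth_near_def by blast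

lemma smooth_near_common:
  assumes "smooth_near A p f" "smooth_near A p g"
  obtains W where "p \<in> W" "smooth_fun A W f" "smooth_fun A W g"
proof -
  obtain W W' where w: "p \<in> W" "smooth_fun A W f" "p \<in> W'" "smooth_fun A W' g"
    using assms unfolding smooth_near_def by blast
  have "open (W \<inter> W')" using smooth_funD(1) w by blast
  then have "smooth_fun A (W \<inter> W') f" "smooth_fun A (W \<inter> W') g"
    using smooth_fun_subset[OF w(2), of "W \<inter> W'"] smooth_fun_subset[OF w(4), of "W \<inter> W'"] by simp_all
  then show ?thesis using that[of "W \<inter> W'"] w by simp
qed

lemma smooth_near_add: "smooth_near A p f \<Longrightarrow> smooth_near A p g \<Longrightarrow> smooth_near A p (\<lambda>x. f x + g x)"
  by (erule smooth_near_common, assumption) (rule smooth_nearI[OF smooth_fun_add])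

lemma smooth_near_mult: "smooth_near A p f \<Longrightarrow> smooth_near A p g \<Longrightarrow> smooth_near A p (\<lambda>x. f x * g x)"
  by (erule smooth_near_common, assumption) (rule smooth_nearI[OF smooth_fun_mult])

lemma smooth_near_cmult: "smooth_near A p f \<Longrightarrow> smooth_near A p (\<lambda>x. c * f x)"
  unfolding smooth_near_def using smooth_fun_cmult by blast

lemma smooth_near_cnj: "smooth_near A p (\<lambda>x. cnj (f x)) \<longleftrightarrow> smooth_near A p f"
proof
  assume "smooth_near A p (\<lambda>x. cnj (f x))"
  then have "smooth_near A p (\<lambda>x. cnj (cnj (f x)))" unfolding smooth_near_def using smooth_fun_cnj by blast
  then show "smooth_near A p f" by simp
next
  assume "smooth_near A p f"
  then show "smooth_near A p (\<lambda>x. cnj (f x))" unfolding smooth_near_def using smooth_fun_cnj by blast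
qed

section \<open>Complex tangent vectors as derivations\<close>

lemma ctangentD:
  assumes "X \<in> ctangent A p"
  shows "smooth_near A p f \<Longrightarrow> smooth_near A p g \<Longrightarrow> X (\<lambda>x. f x + g x) = X f + X g"
    "smooth_near A p f \<Longrightarrow> smooth_near A p g \<Longrightarrow> X (\<lambda>x. f x * g x) = f p * X g + g p * X f"
    "smooth_near A p f \<Longrightarrow> X (\<lambda>x. c * f x) = c * X f"
    "\<not> smooth_near A p f \<Longrightarrow> X f = 0"
  using assms unfolding ctangent_def by blast+

text \<open>The indicator function of \<open>W\<close> is smooth near \<open>p\<close> and equals
  its own square, so the Leibniz rule forces \<open>X\<close> to annihilate it. Multiplication by it
  therefore leaves the value of \<open>X\<close> unchanged and makes \<open>f\<close> and
  \<open>g\<close> equal.\<close>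

lemma ctangent_locality:
  assumes X: "X \<in> ctangent A p" and f: "smooth_near A p f" and W: "open W" "p \<in> W"
    and eq: "\<And>x. x \<in> W \<Longrightarrow> f x = g x"
  shows "X f = X g"
proof -
  define \<kappa> :: "'m \<Rightarrow> complex" where "\<kappa> x = (if x \<in> W then 1 else 0)" for x
  have s: "smooth_near A p \<kappa>"
    by (rule smooth_nearI[OF smooth_fun_cong[OF smooth_fun_const[OF W(1), of 1]] W(2)]) (simp add: \<kappa>_def)
  have g: "smooth_near A p g"
  proof -
    obtain W' where w: "p \<in> W'" "smooth_fun A W' f" using f unfolding smooth_near_def by blast
    have "smooth_fun A (W' \<inter> W) f" using smooth_fun_subset[OF w(2)] smooth_funD(1)[OF w(2)] W by auto
    then have "smooth_fun A (W' \<inter> W) g" by (rule smooth_fun_cong) (use eq in auto)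
    then show ?thesis by (rule smooth_nearI) (use w W in auto)
  qed
  have "X (\<lambda>x. \<kappa> x * \<kappa> x) = \<kappa> p * X \<kappa> + \<kappa> p * X \<kappa>" by (rule ctangentD(2)[OF X s s])
  moreover have "(\<lambda>x. \<kappa> x * \<kappa> x) = \<kappa>" by (auto simp: \<kappa>_def)
  ultimately have X0: "X \<kappa> = 0" using W(2) by (simp add: \<kappa>_def)
  have "X (\<lambda>x. \<kappa> x * h x) = X h" if "smooth_near A p h" for h
    using ctangentD(2)[OF X s that] X0 W(2) by (simp add: \<kappa>_def)
  moreover have "(\<lambda>x. \<kappa> x * f x) = (\<lambda>x. \<kappa> x * g x)" using eq by (auto simp: \<kappa>_def)
  ultimately show ?thesis using f g by metis
qed

lemma ctangent_zero: "0 \<in> ctangent A p"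
  unfolding ctangent_def by simp

lemma ctangent_add: "X \<in> ctangent A p \<Longrightarrow> Y \<in> ctangent A p \<Longrightarrow> X + Y \<in> ctangent A p"
  unfolding ctangent_def by (auto simp: algebra_simps)

lemma ctangent_scaleC: "X \<in> ctangent A p \<Longrightarrow> c *\<^sub>C X \<in> ctangent A p"
  unfolding ctangent_def by (auto simp: scaleC_fun_def algebra_simps)

lemma scaleR_eq_scaleC: "c *\<^sub>R (X :: 'm cvec) = complex_of_real c *\<^sub>C X"
  by (simp add: scaleR_fun_def scaleC_fun_def fun_eq_iff scaleR_conv_of_real)

lemma ctangent_conj:
  assumes X: "X \<in> ctangent A p"
  shows "conj_vec X \<in> ctangent A p"
  unfolding ctangent_def conj_vec_def
  using ctangentD[OF X] by (auto simp: smooth_near_cnj)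

lemma ctangent_Re: "X \<in> ctangent A p \<Longrightarrow> Re_vec X \<in> ctangent A p"
  unfolding Re_vec_def by (intro ctangent_scaleC ctangent_add ctangent_conj)

lemma Im_vec_alt: "Im_vec X = (1/(2*\<i>)) *\<^sub>C (X + (-1) *\<^sub>C conj_vec X)"
  by (simp add: Im_vec_def scaleC_fun_def fun_eq_iff)

lemma ctangent_Im: "X \<in> ctangent A p \<Longrightarrow> Im_vec X \<in> ctangent A p"
  unfolding Im_vec_alt by (intro ctangent_scaleC ctangent_add ctangent_conj)

section \<open>Smooth complex vector fields and their brackets\<close>

lemma smooth_cfieldD:
  assumes "smooth_cfield A U X"
  shows "open U" "p \<in> U \<Longrightarrow> X p \<in> ctangent A p" "W \<subseteq> U \<Longrightarrow> smooth_fun A W f \<Longrightarrow> smooth_fun A W (\<lambda>p. X p f)"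
  using assms unfolding smooth_cfield_def by blast+

lemma smooth_cfieldI:
  assumes "open U" "\<And>p. p \<in> U \<Longrightarrow> X p \<in> ctangent A p"
    "\<And>W f. W \<subseteq> U \<Longrightarrow> smooth_fun A W f \<Longrightarrow> smooth_fun A W (\<lambda>p. X p f)"
  shows "smooth_cfield A U X"
  using assms unfolding smooth_cfield_def by blast

lemma smooth_cfield_subset: "smooth_cfield A U X \<Longrightarrow> open V \<Longrightarrow> V \<subseteq> U \<Longrightarrow> smooth_cfield A V X"
  unfolding smooth_cfield_def by (meson order_trans subsetD)

lemma smooth_cfield_add:
  assumes "smooth_cfield A U X" "smooth_cfield A U Y"
  shows "smooth_cfield A U (\<lambda>p. X p + Y p)"
proof (rule smooth_cfieldI)
  show "smooth_fun A W (\<lambda>p. (X p + Y p) f)" if "W \<subseteq> U" "smooth_fun A W f" for W f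
    using smooth_fun_add[OF smooth_cfieldD(3)[OF assms(1) that] smooth_cfieldD(3)[OF assms(2) that]] by simp
qed (use assms in \<open>auto intro: ctangent_add smooth_cfieldD\<close>)

lemma smooth_cfield_scaleC:
  assumes "smooth_cfield A U X"
  shows "smooth_cfield A U (\<lambda>p. c *\<^sub>C X p)"
proof (rule smooth_cfieldI)
  show "smooth_fun A W (\<lambda>p. (c *\<^sub>C X p) f)" if "W \<subseteq> U" "smooth_fun A W f" for W f
    using smooth_fun_cmult[OF smooth_cfieldD(3)[OF assms that], of c] by (simp add: scaleC_fun_def)
qed (use assms in \<open>auto intro: ctangent_scaleC smooth_cfieldD\<close>)

lemma smooth_cfield_conj:
  assumes "smooth_cfield A U X"
  shows "smooth_cfield A U (\<lambda>p. conj_vec (X p))"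
proof (rule smooth_cfieldI)
  show "smooth_fun A W (\<lambda>p. conj_vec (X p) f)" if "W \<subseteq> U" "smooth_fun A W f" for W f
    unfolding conj_vec_def by (rule smooth_fun_cnj[OF smooth_cfieldD(3)[OF assms that(1) smooth_fun_cnj[OF that(2)]]])
qed (use assms in \<open>auto intro: ctangent_conj smooth_cfieldD\<close>)

lemma smooth_cfield_Re: "smooth_cfield A U X \<Longrightarrow> smooth_cfield A U (\<lambda>p. Re_vec (X p))"
  unfolding Re_vec_def by (intro smooth_cfield_scaleC smooth_cfield_add smooth_cfield_conj)

lemma smooth_cfield_Im: "smooth_cfield A U X \<Longrightarrow> smooth_cfield A U (\<lambda>p. Im_vec (X p))"
  unfolding Im_vec_alt by (intro smooth_cfield_scaleC smooth_cfield_add smooth_cfield_conj)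

lemma smooth_cfield_zero: "open U \<Longrightarrow> smooth_cfield A U (\<lambda>p. 0)"
proof (rule smooth_cfieldI)
  show "smooth_fun A W (\<lambda>p. (0::'m cvec) f)" if "smooth_fun A W f" for W f
    using smooth_fun_const[OF smooth_funD(1)[OF that], of "0::complex"] by simp
qed (auto intro: ctangent_zero)

lemma smooth_cfield_scaleR:
  fixes g :: "'m \<Rightarrow> real"
  assumes X: "smooth_cfield A U X" and g: "smooth_fun A U g"
  shows "smooth_cfield A U (\<lambda>p. g p *\<^sub>R X p)"
proof (rule smooth_cfieldI)
  show "smooth_fun A W (\<lambda>p. (g p *\<^sub>R X p) f)" if "W \<subseteq> U" "smooth_fun A W f" for W f
    using smooth_fun_bilinear[OF bounded_bilinear_scaleR smooth_fun_subset[OF g smooth_funD(1)[OF that(2)] that(1)]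
        smooth_cfieldD(3)[OF X that]] by (simp add: scaleR_fun_def)
  show "g p *\<^sub>R X p \<in> ctangent A p" if "p \<in> U" for p
    unfolding scaleR_eq_scaleC using that X by (intro ctangent_scaleC smooth_cfieldD)
qed (use X in \<open>auto intro: smooth_cfieldD\<close>)

lemma smooth_cfield_local:
  assumes U: "open U" and loc: "\<And>p. p \<in> U \<Longrightarrow> \<exists>V X'. p \<in> V \<and> smooth_cfield A V X' \<and> (\<forall>q\<in>U \<inter> V. X q = X' q)"
  shows "smooth_cfield A U X"
proof (rule smooth_cfieldI[OF U])
  show "X p \<in> ctangent A p" if p: "p \<in> U" for p
  proof -
    obtain V X' where "p \<in> V" "smooth_cfield A V X'" "X p = X' p" using loc[OF p] p by auto
    then show ?thesis using smooth_cfieldD(2) by metis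
  qed
  fix W f assume W: "W \<subseteq> U" "smooth_fun A W (f :: 'm \<Rightarrow> complex)"
  show "smooth_fun A W (\<lambda>p. X p f)"
  proof (rule smooth_fun_local[OF smooth_funD(1)[OF W(2)]])
    fix p assume p: "p \<in> W"
    then obtain V X' where V: "p \<in> V" "smooth_cfield A V X'" "\<forall>q\<in>U \<inter> V. X q = X' q" using loc W by blast
    have "smooth_fun A (W \<inter> V) f"
      using smooth_fun_subset[OF W(2), of "W \<inter> V"] smooth_funD(1)[OF W(2)] smooth_cfieldD(1)[OF V(2)] by blast
    then have "smooth_fun A (W \<inter> V) (\<lambda>p. X' p f)" by (intro smooth_cfieldD(3)[OF V(2)]) auto
    then have "smooth_fun A (W \<inter> V) (\<lambda>p. X p f)" by (rule smooth_fun_cong) (use V(3) W(1) in auto)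
    then show "\<exists>N. p \<in> N \<and> smooth_fun A N (\<lambda>p. X p f)" using p V(1) by blast
  qed
qed

lemma smooth_near_field:
  assumes X: "smooth_cfield A U X" and p: "p \<in> U" and f: "smooth_near A p f"
  shows "smooth_near A p (\<lambda>q. X q f)"
proof -
  obtain W where w: "p \<in> W" "smooth_fun A W f" using f unfolding smooth_near_def by blast
  have "smooth_fun A (W \<inter> U) f"
    using smooth_fun_subset[OF w(2), of "W \<inter> U"] smooth_funD(1)[OF w(2)] smooth_cfieldD(1)[OF X] by blast
  from smooth_cfieldD(3)[OF X Int_lower2 this] show ?thesis by (rule smooth_nearI) (use w p in auto)
qed

lemma lie_bracket_ctangent:
  assumes X: "smooth_cfield A U X" and Y: "smooth_cfield A U Y" and p: "p \<in> U"
  shows "lie_bracket A X Y p \<in> ctangent A p"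
proof -
  note tX = smooth_cfieldD(2)[OF X] and tY = smooth_cfieldD(2)[OF Y]
  have U: "open U" using smooth_cfieldD(1)[OF X] .
  \<comment> \<open>The iterated derivatives are expanded once for an arbitrary ordered pair and
    used in both orders; the products of first derivatives cancel in the commutator.\<close>
  have gen: "X p (\<lambda>q. Y q (\<lambda>x. f x + g x)) = X p (\<lambda>q. Y q f) + X p (\<lambda>q. Y q g)"
      "X p (\<lambda>q. Y q (\<lambda>x. f x * g x)) = f p * X p (\<lambda>q. Y q g) + Y p g * X p f + (g p * X p (\<lambda>q. Y q f) + Y p f * X p g)"
      "X p (\<lambda>q. Y q (\<lambda>x. c * f x)) = c * X p (\<lambda>q. Y q f)"
    if X: "smooth_cfield A U X" and Y: "smooth_cfield A U Y" and f: "smooth_near A p f" and g: "smooth_near A p g" for X Y f g c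
  proof -
    note tX = smooth_cfieldD(2)[OF X] and tY = smooth_cfieldD(2)[OF Y]
    obtain W where W: "p \<in> W" "smooth_fun A W f" "smooth_fun A W g" using smooth_near_common[OF f g] .
    have N: "open (W \<inter> U)" "p \<in> W \<inter> U" using W p U smooth_funD(1)[OF W(2)] by auto
    have n: "smooth_near A q f" "smooth_near A q g" if "q \<in> W \<inter> U" for q using smooth_nearI W that by blast+
    have sY: "smooth_near A p (\<lambda>q. Y q h)" if "smooth_near A p h" for h using smooth_near_field[OF Y p that] .
    have "X p (\<lambda>q. Y q (\<lambda>x. f x + g x)) = X p (\<lambda>q. Y q f + Y q g)"
      by (rule ctangent_locality[OF tX[OF p] _ N]) (use sY smooth_near_add f g ctangentD(1)[OF tY n] in auto)
    then show "X p (\<lambda>q. Y q (\<lambda>x. f x + g x)) = X p (\<lambda>q. Y q f) + X p (\<lambda>q. Y q g)"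
      using ctangentD(1)[OF tX[OF p] sY[OF f] sY[OF g]] by simp
    have "X p (\<lambda>q. Y q (\<lambda>x. f x * g x)) = X p (\<lambda>q. f q * Y q g + g q * Y q f)"
      by (rule ctangent_locality[OF tX[OF p] _ N]) (use sY smooth_near_mult f g ctangentD(2)[OF tY n] in auto)
    also have "\<dots> = X p (\<lambda>q. f q * Y q g) + X p (\<lambda>q. g q * Y q f)"
      by (intro ctangentD(1)[OF tX[OF p]] smooth_near_mult sY f g)
    finally show "X p (\<lambda>q. Y q (\<lambda>x. f x * g x)) = f p * X p (\<lambda>q. Y q g) + Y p g * X p f + (g p * X p (\<lambda>q. Y q f) + Y p f * X p g)"
      using ctangentD(2)[OF tX[OF p] f sY[OF g]] ctangentD(2)[OF tX[OF p] g sY[OF f]] by simp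
    have "X p (\<lambda>q. Y q (\<lambda>x. c * f x)) = X p (\<lambda>q. c * Y q f)"
      by (rule ctangent_locality[OF tX[OF p] _ N]) (use sY smooth_near_cmult f ctangentD(3)[OF tY n(1)] in auto)
    then show "X p (\<lambda>q. Y q (\<lambda>x. c * f x)) = c * X p (\<lambda>q. Y q f)"
      using ctangentD(3)[OF tX[OF p] sY[OF f]] by simp
  qed
  show ?thesis
    unfolding ctangent_def lie_bracket_def mem_Collect_eq
    using smooth_near_add smooth_near_mult smooth_near_cmult
    by (auto simp: gen[OF X Y] gen[OF Y X] algebra_simps)
qed

lemma smooth_cfield_lie_bracket:
  assumes X: "smooth_cfield A U X" and Y: "smooth_cfield A U Y"
  shows "smooth_cfield A U (lie_bracket A X Y)"
proof (rule smooth_cfieldI)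
  fix W f assume W: "W \<subseteq> U" "smooth_fun A W (f :: 'm \<Rightarrow> complex)"
  have "smooth_fun A W (\<lambda>p. X p (\<lambda>q. Y q f) - Y p (\<lambda>q. X q f))"
    by (intro smooth_fun_diff smooth_cfieldD(3)[OF X W(1)] smooth_cfieldD(3)[OF Y W(1)] W)
  then show "smooth_fun A W (\<lambda>p. lie_bracket A X Y p f)"
    by (rule smooth_fun_cong) (use W smooth_nearI in \<open>auto simp: lie_bracket_def\<close>)
qed (use X Y in \<open>auto intro: smooth_cfieldD lie_bracket_ctangent\<close>)

lemma lie_distribution_smooth:
  assumes "\<And>U X. (U, X) \<in> S \<Longrightarrow> smooth_cfield A U X" "(U, X) \<in> lie_distribution A S"
  shows "smooth_cfield A U X"
  using assms(2)
proof induction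
  case (local U X)
  then show ?case by (intro smooth_cfield_local) blast+
qed (erule assms(1) smooth_cfield_zero smooth_cfield_add smooth_cfield_scaleR smooth_cfield_lie_bracket; assumption)+

lemma smooth_fun_coordinate:
  assumes c: "(U, \<phi>) \<in> A"
  shows "smooth_fun A U (\<lambda>q. complex_of_real (\<phi> q \<bullet> b))"
proof (rule smooth_funI[OF chartD(1)[OF c]])
  fix V \<psi> assume c': "(V, \<psi>) \<in> A"
  have "smooth_on (\<psi> ` (V \<inter> U)) (\<phi> \<circ> inv_into V \<psi>)" using atlas c c' unfolding smooth_atlas_def by blast
  then show "smooth_on (\<psi> ` (U \<inter> V)) ((\<lambda>q. complex_of_real (\<phi> q \<bullet> b)) \<circ> inv_into V \<psi>)"
    unfolding o_def by (subst Int_commute)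
      (rule smooth_on_linear[OF bounded_linear_of_real smooth_on_linear[OF bounded_linear_inner_left]])
qed

text \<open>For \<open>Z = X + \<i> Y\<close> with \<open>Z f = 0\<close> one has \<open>(X\<^sup>2 + Y\<^sup>2) f = 1/2 Z (conj Z f) = 1/2 [Z, conj Z] f\<close>.\<close>

lemma cr_second_order:
  fixes Z :: "nat \<Rightarrow> 'm cfield" and r :: nat
  assumes Z: "\<And>j. j < r \<Longrightarrow> smooth_cfield A V (Z j)" and p: "p \<in> V"
    and f: "smooth_fun A V f" and Zf: "\<And>j q. j < r \<Longrightarrow> q \<in> V \<Longrightarrow> Z j q f = 0" and Lf: "L0 p f = 0"
    and levi: "(\<Sum>j<r. lie_bracket A (Z j) (\<lambda>x. conj_vec (Z j x)) p) = conj_vec (L0 p) - L0 p"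
  shows "(\<Sum>j<r. Re_vec (Z j p) (\<lambda>q. Re_vec (Z j q) f) + Im_vec (Z j p) (\<lambda>q. Im_vec (Z j q) f)) = Re_vec (L0 p) f"
proof -
  have fp: "smooth_near A p f" using smooth_nearI[OF f p] .
  have V: "open V" using smooth_funD(1)[OF f] .
  have "Re_vec (Z j p) (\<lambda>q. Re_vec (Z j q) f) + Im_vec (Z j p) (\<lambda>q. Im_vec (Z j q) f)
      = (1/2) * lie_bracket A (Z j) (\<lambda>x. conj_vec (Z j x)) p f" if j: "j < r" for j
  proof -
    \<comment> \<open>As \<open>Z j\<close> annihilates f, the real part of \<open>Z j\<close> maps
      f to g / 2 and the imaginary part maps it to (\<i> / 2) g; applied once more they combine to
      one half of \<open>Z j\<close> applied to g.\<close>
    define g where "g q = conj_vec (Z j q) f" for q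
    have tZ: "Z j p \<in> ctangent A p" using smooth_cfieldD(2)[OF Z[OF j] p] .
    have sg: "smooth_near A p g" unfolding g_def by (rule smooth_near_field[OF smooth_cfield_conj[OF Z[OF j]] p fp])
    have re: "Re_vec (Z j p) (\<lambda>q. Re_vec (Z j q) f) = Re_vec (Z j p) (\<lambda>q. (1/2) * g q)"
      by (rule ctangent_locality[OF ctangent_Re[OF tZ] smooth_near_field[OF smooth_cfield_Re[OF Z[OF j]] p fp] V p])
        (simp add: Re_vec_def g_def scaleC_fun_def Zf[OF j])
    have im: "Im_vec (Z j p) (\<lambda>q. Im_vec (Z j q) f) = Im_vec (Z j p) (\<lambda>q. (\<i>/2) * g q)"
      by (rule ctangent_locality[OF ctangent_Im[OF tZ] smooth_near_field[OF smooth_cfield_Im[OF Z[OF j]] p fp] V p])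
        (simp add: Im_vec_def g_def scaleC_fun_def Zf[OF j] field_simps)
    have "Re_vec (Z j p) (\<lambda>q. (1/2) * g q) = (1/2) * Re_vec (Z j p) g" by (rule ctangentD(3)[OF ctangent_Re[OF tZ] sg])
    moreover have "Im_vec (Z j p) (\<lambda>q. (\<i>/2) * g q) = (\<i>/2) * Im_vec (Z j p) g" by (rule ctangentD(3)[OF ctangent_Im[OF tZ] sg])
    ultimately have "Re_vec (Z j p) (\<lambda>q. Re_vec (Z j q) f) + Im_vec (Z j p) (\<lambda>q. Im_vec (Z j q) f) = (1/2) * Z j p g"
      unfolding re im by (simp add: Re_vec_def Im_vec_def scaleC_fun_def distrib_left right_diff_distrib)
    moreover have "conj_vec (Z j p) (\<lambda>q. Z j q f) = conj_vec (Z j p) (\<lambda>q. 0 * f q)"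
      by (rule ctangent_locality[OF ctangent_conj[OF tZ] smooth_near_field[OF Z[OF j] p fp] V p]) (simp add: Zf[OF j])
    then have "conj_vec (Z j p) (\<lambda>q. Z j q f) = 0" using ctangentD(3)[OF ctangent_conj[OF tZ] fp, of 0] by simp
    ultimately show ?thesis using fp by (simp add: lie_bracket_def g_def[abs_def])
  qed
  then have "(\<Sum>j<r. Re_vec (Z j p) (\<lambda>q. Re_vec (Z j q) f) + Im_vec (Z j p) (\<lambda>q. Im_vec (Z j q) f))
      = (1/2) * (\<Sum>j<r. lie_bracket A (Z j) (\<lambda>x. conj_vec (Z j x)) p) f"
    unfolding sum_fun_apply sum_distrib_left by (intro sum.cong) auto
  also have "\<dots> = (1/2) * conj_vec (L0 p) f" unfolding levi by (simp add: Lf)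
  also have "\<dots> = Re_vec (L0 p) f" by (simp add: Re_vec_def scaleC_fun_def Lf)
  finally show ?thesis .
qed

end

section \<open>Lifts to a parametrisation of a leaf\<close>

lemma lie_fields_cong:
  assumes "open V" "(V, X) \<in> lie_fields \<G>" "\<And>x. x \<in> V \<Longrightarrow> Y x = X x"
  shows "(V, Y) \<in> lie_fields \<G>"
  using assms(1)
proof (rule lie_fields.local)
  fix x assume "x \<in> V"
  then show "\<exists>W X'. x \<in> W \<and> (W, X') \<in> lie_fields \<G> \<and> (\<forall>y\<in>V \<inter> W. Y y = X' y)"
    using assms by (intro exI[of _ V] exI[of _ X]) auto
qed

lemma smooth_on_Pair:
  assumes "smooth_on S f" "smooth_on S g"
  shows "smooth_on S (\<lambda>x. (f x, g x))"
proof -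
  have "bounded_linear (\<lambda>v. (v, 0))" "bounded_linear (\<lambda>v. (0, v))"
    by (intro bounded_linear_Pair bounded_linear_ident bounded_linear_zero)+
  from smooth_on_add[OF smooth_on_linear[OF this(1) assms(1)] smooth_on_linear[OF this(2) assms(2)]]
  show ?thesis by simp
qed

context smooth_manifold begin

section \<open>Pullback along a smooth map into the manifold\<close>

lemma smooth_map_intoD:
  assumes "smooth_map_into A G \<psi>"
  shows "open G" "continuous_on G \<psi>" "(U, \<phi>) \<in> A \<Longrightarrow> smooth_on (G \<inter> \<psi> -` U) (\<phi> \<circ> \<psi>)"
proof -
  have a: "\<forall>(U, \<phi>)\<in>A. smooth_on (G \<inter> \<psi> -` U) (\<phi> \<circ> \<psi>)" and b: "open G" "continuous_on G \<psi>"
    using assms unfolding smooth_map_into_def by simp_all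
  show "open G" "continuous_on G \<psi>" using b .
  show "smooth_on (G \<inter> \<psi> -` U) (\<phi> \<circ> \<psi>)" if "(U, \<phi>) \<in> A" using bspec[OF a that] by simp
qed

lemma smooth_on_pullback:
  assumes h: "smooth_map_into A G \<psi>" and g: "smooth_fun A W g"
  shows "smooth_on (G \<inter> \<psi> -` W) (\<lambda>x. g (\<psi> x))"
proof (rule smooth_on_local)
  have G: "open G" "continuous_on G \<psi>" using smooth_map_intoD[OF h] by blast+
  have o: "open (G \<inter> \<psi> -` U)" if "open U" for U
    using continuous_on_open_vimage[OF G(1), of \<psi>] G(2) that by (simp add: Int_commute)
  have W: "open W" using smooth_funD(1)[OF g] .
  show "open (G \<inter> \<psi> -` W)" by (rule o[OF W])
  fix x assume x: "x \<in> G \<inter> \<psi> -` W"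
  obtain U \<phi> where c: "(U, \<phi>) \<in> A" "\<psi> x \<in> U" using chart_at .
  have s: "smooth_on (G \<inter> \<psi> -` U) (\<lambda>y. \<phi> (\<psi> y))"
    using smooth_map_intoD(3)[OF h c(1)] by (simp add: o_def)
  have "smooth_on (G \<inter> \<psi> -` (W \<inter> U)) (\<lambda>y. g (inv_into U \<phi> (\<phi> (\<psi> y))))"
  proof (rule smooth_on_compose[OF smooth_funD(2)[OF g c(1)]])
    show "smooth_on (G \<inter> \<psi> -` (W \<inter> U)) (\<lambda>y. \<phi> (\<psi> y))"
      by (rule smooth_on_subset[OF s o]) (use W chartD(1)[OF c(1)] in auto)
  qed auto
  then have "smooth_on (G \<inter> \<psi> -` (W \<inter> U)) (\<lambda>y. g (\<psi> y))"
    by (rule smooth_on_cong) (use c(1) in simp)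
  moreover have "x \<in> G \<inter> \<psi> -` (W \<inter> U)" using x c(2) by simp
  ultimately show "\<exists>N. x \<in> N \<and> smooth_on N (\<lambda>x. g (\<psi> x))" by (intro exI conjI)
qed

lemma smooth_map_preimage_open: "smooth_map_into A G \<psi> \<Longrightarrow> open U \<Longrightarrow> open (G \<inter> \<psi> -` U)"
  using smooth_onD(1)[OF smooth_on_pullback[OF _ smooth_fun_const]] .

lemma pushforward_eq_fder:
  assumes h: "smooth_map_into A G \<psi>" and x: "x \<in> G" and g: "smooth_near A (\<psi> x) g"
  shows "(\<lambda>y. g (\<psi> y)) differentiable at x" "pushforward A \<psi> x v g = fder (\<lambda>y. g (\<psi> y)) x v"
proof -
  obtain W where W: "\<psi> x \<in> W" "smooth_fun A W g" using g unfolding smooth_near_def by blast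
  show d: "(\<lambda>y. g (\<psi> y)) differentiable at x"
    using smooth_onD(4)[OF smooth_on_pullback[OF h W(2)]] x W(1) by simp
  have "((\<lambda>s. g (\<psi> (x + s *\<^sub>R v))) has_vector_derivative fder (\<lambda>y. g (\<psi> y)) x v) (at 0)"
    using line_derivative[of "\<lambda>y. g (\<psi> y)" x 0 v UNIV] d by simp
  from vector_derivative_at[OF this] show "pushforward A \<psi> x v g = fder (\<lambda>y. g (\<psi> y)) x v"
    unfolding pushforward_def using g by simp
qed

end

text \<open>One parametrisation as in \<open>connected_integral_manifold\<close>, with the fibres
  kept abstract as \<open>F\<close>.\<close>

locale leaf_chart = smooth_manifold A for A :: "('m::topological_space, 'e::euclidean_space) chart set" +
  fixes E G :: "'e set" and \<psi> :: "'e \<Rightarrow> 'm" and F :: "'m \<Rightarrow> 'm cvec set"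
  assumes E: "subspace E" and psi: "smooth_map_into A G \<psi>"
    and psi_inj: "\<And>x. x \<in> G \<inter> E \<Longrightarrow> inj_on (pushforward A \<psi> x) E"
    and psi_range: "\<And>x. x \<in> G \<inter> E \<Longrightarrow> pushforward A \<psi> x ` E = F (\<psi> x)"
begin

text \<open>Some linear projection onto \<open>E\<close>; its kernel provides the transversal
  directions.\<close>

definition proj :: "'e \<Rightarrow> 'e" where
  "proj = (SOME h. range h \<subseteq> E \<and> linear h \<and> (\<forall>v\<in>E. h v = v))"

lemma proj: "linear proj" "proj v \<in> E" "v \<in> E \<Longrightarrow> proj v = v"
proof -
  have "\<exists>h. range h \<subseteq> E \<and> linear h \<and> (\<forall>v\<in>E. h (id v) = v)"
    by (rule linear_exists_left_inverse_on[OF linear_id E]) simp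
  then have "range proj \<subseteq> E \<and> linear proj \<and> (\<forall>v\<in>E. proj v = v)"
    unfolding proj_def id_def by (rule someI_ex)
  then show "linear proj" "proj v \<in> E" "v \<in> E \<Longrightarrow> proj v = v" by auto
qed

lemma proj_proj [simp]: "proj (proj v) = proj v"
  by (simp add: proj)

lemma bounded_linear_proj: "bounded_linear proj"
  using proj(1) by (simp add: linear_conv_bounded_linear)

definition G' where "G' = proj -` G"
definition \<psi>' where "\<psi>' = \<psi> \<circ> proj"

lemma proj_G': "x \<in> G' \<Longrightarrow> proj x \<in> G \<inter> E"
  by (simp add: G'_def proj)

lemma psi': "smooth_map_into A G' \<psi>'"
proof -
  have G: "open G" "continuous_on G \<psi>" using smooth_map_intoD[OF psi] by blast+
  have cont: "continuous_on S proj" for S using bounded_linear_proj by (rule linear_continuous_on)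
  have o: "open (proj -` S)" if "open S" for S using open_vimage[OF that cont] .
  have "smooth_on (G' \<inter> \<psi>' -` U) (\<phi> \<circ> \<psi>')" if c: "(U, \<phi>) \<in> A" for U \<phi>
  proof -
    have s: "smooth_on (G \<inter> \<psi> -` U) (\<phi> \<circ> \<psi>)" using smooth_map_intoD(3)[OF psi c] .
    have eq: "G' \<inter> \<psi>' -` U = proj -` (G \<inter> \<psi> -` U)" by (auto simp: G'_def \<psi>'_def)
    have "smooth_on (proj -` (G \<inter> \<psi> -` U)) (\<lambda>x. (\<phi> \<circ> \<psi>) (proj x))"
      by (rule smooth_on_compose[OF s smooth_on_linear[OF bounded_linear_proj smooth_on_id]])
        (rule o[OF smooth_onD(1)[OF s]], blast)
    then show ?thesis unfolding eq by (simp add: \<psi>'_def o_def)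
  qed
  moreover have "open G'" unfolding G'_def using o[OF G(1)] .
  moreover have "continuous_on G' \<psi>'" unfolding \<psi>'_def G'_def
    by (intro continuous_on_compose cont continuous_on_subset[OF G(2)]) auto
  ultimately show ?thesis unfolding smooth_map_into_def by blast
qed

definition pre where "pre U = G' \<inter> \<psi>' -` U"

lemma open_pre: "open U \<Longrightarrow> open (pre U)"
  unfolding pre_def by (rule smooth_map_preimage_open[OF psi'])

lemma smooth_pre: "smooth_fun A W g \<Longrightarrow> smooth_on (pre W) (\<lambda>x. g (\<psi>' x))"
  unfolding pre_def by (rule smooth_on_pullback[OF psi'])

lemma fder_psi':
  assumes x: "x \<in> G'" and g: "smooth_near A (\<psi>' x) g"
  shows "(\<lambda>y. g (\<psi>' y)) differentiable at x"
    "fder (\<lambda>y. g (\<psi>' y)) x v = pushforward A \<psi> (proj x) (proj v) g"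
proof -
  have x': "proj x \<in> G" using proj_G'[OF x] by blast
  have g': "smooth_near A (\<psi> (proj x)) g" using g by (simp add: \<psi>'_def)
  note p = pushforward_eq_fder[OF psi x' g']
  have "((\<lambda>y. g (\<psi>' y)) has_derivative (\<lambda>v. fder (\<lambda>y. g (\<psi> y)) (proj x) (proj v))) (at x)"
    using has_derivative_compose[OF bounded_linear_imp_has_derivative[OF bounded_linear_proj] fder_works[OF p(1)]]
    by (simp add: \<psi>'_def)
  then show "(\<lambda>y. g (\<psi>' y)) differentiable at x"
    "fder (\<lambda>y. g (\<psi>' y)) x v = pushforward A \<psi> (proj x) (proj v) g"
    using p(2) by (auto simp: fder_eq differentiableI)
qed

text \<open>The immersion property at \<open>proj x\<close>, expressed through the action on
  functions. Uniqueness and smoothness of lifts both rest on it.\<close>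

lemma psi'_inj:
  assumes x: "x \<in> G'" and v: "proj v = v" "proj w = w"
    and eq: "\<And>g. smooth_near A (\<psi>' x) g \<Longrightarrow> fder (\<lambda>y. g (\<psi>' y)) x v = fder (\<lambda>y. g (\<psi>' y)) x w"
  shows "v = w"
proof -
  have "pushforward A \<psi> (proj x) v g = pushforward A \<psi> (proj x) w g" for g
  proof (cases "smooth_near A (\<psi>' x) g")
    case True
    then show ?thesis using eq[OF True] fder_psi'(2)[OF x True] v by simp
  next
    case False
    then show ?thesis by (simp add: pushforward_def \<psi>'_def)
  qed
  then have e: "pushforward A \<psi> (proj x) v = pushforward A \<psi> (proj x) w" by (rule ext)
  show ?thesis
    by (rule inj_onD[OF psi_inj[OF proj_G'[OF x]] e]) (metis proj(2) v(1), metis proj(2) v(2))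
qed

text \<open>The second clause says that \<open>a\<close> is related to \<open>X\<close> by
  \<open>\<psi>'\<close>. It leaves the part of \<open>a\<close> in the kernel of
  \<open>proj\<close> undetermined; requiring values in \<open>E\<close> makes the lift
  unique.\<close>

definition lift where
  "lift U X a \<longleftrightarrow> (\<forall>x\<in>pre U. proj (a x) = a x \<and>
     (\<forall>g. smooth_near A (\<psi>' x) g \<longrightarrow> fder (\<lambda>y. g (\<psi>' y)) x (a x) = X (\<psi>' x) g))"

lemma liftD:
  assumes "lift U X a" "x \<in> pre U"
  shows "proj (a x) = a x" "smooth_near A (\<psi>' x) g \<Longrightarrow> fder (\<lambda>y. g (\<psi>' y)) x (a x) = X (\<psi>' x) g"
  using assms unfolding lift_def by blast+

lemma liftI:
  assumes "\<And>x. x \<in> pre U \<Longrightarrow> proj (a x) = a x"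
    "\<And>x g. x \<in> pre U \<Longrightarrow> smooth_near A (\<psi>' x) g \<Longrightarrow> fder (\<lambda>y. g (\<psi>' y)) x (a x) = X (\<psi>' x) g"
  shows "lift U X a"
  using assms unfolding lift_def by blast

lemma pre_G': "x \<in> pre U \<Longrightarrow> x \<in> G'"
  by (simp add: pre_def)

lemma pre_Int: "pre (U \<inter> V) = pre U \<inter> pre V"
  by (auto simp: pre_def)

lemma lift_unique:
  assumes a: "lift U X a" and b: "lift V Y b" and x: "x \<in> pre U" "x \<in> pre V"
    and eq: "X (\<psi>' x) = Y (\<psi>' x)"
  shows "a x = b x"
  by (rule psi'_inj[OF pre_G'[OF x(1)] liftD(1)[OF a x(1)] liftD(1)[OF b x(2)]])
    (simp add: liftD(2)[OF a x(1)] liftD(2)[OF b x(2)] eq)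

lemma lift_exists:
  assumes F: "\<And>p. p \<in> U \<Longrightarrow> X p \<in> F p"
  obtains a where "lift U X a"
proof -
  have "\<exists>v\<in>E. pushforward A \<psi> (proj x) v = X (\<psi>' x)" if x: "x \<in> pre U" for x
  proof -
    have "X (\<psi>' x) \<in> F (\<psi> (proj x))" using F[of "\<psi>' x"] x by (simp add: pre_def \<psi>'_def)
    then show ?thesis unfolding psi_range[OF proj_G'[OF pre_G'[OF x]], symmetric] by force
  qed
  then obtain a where a: "\<And>x. x \<in> pre U \<Longrightarrow> a x \<in> E \<and> pushforward A \<psi> (proj x) (a x) = X (\<psi>' x)" by metis
  have "lift U X a"
    by (rule liftI) (use a proj(3) in \<open>auto simp: fder_psi' pre_G'\<close>)
  then show ?thesis by (rule that)
qed

lemma lift_smooth: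
  assumes X: "smooth_cfield A U X" and a: "lift U X a"
  shows "smooth_on (pre U) a"
proof (rule smooth_on_local)
  have U: "open U" using smooth_cfieldD(1)[OF X] .
  show "open (pre U)" using open_pre[OF U] .
  fix x0 assume x0: "x0 \<in> pre U"
  obtain C \<phi> where c: "(C, \<phi>) \<in> A" "\<psi>' x0 \<in> C" using chart_at .
  note C = chartD(1)[OF c(1)]
  define \<Phi> where "\<Phi> x = \<phi> (\<psi>' x)" for x
  let ?N = "pre (U \<inter> C)"
  have N: "open ?N" using open_pre U C by blast
  have s\<Phi>: "smooth_on (pre C) \<Phi>"
    using smooth_map_intoD(3)[OF psi' c(1)] unfolding pre_def \<Phi>_def[abs_def] o_def .
  have dP: "\<Phi> differentiable at x" if "x \<in> ?N" for x
    using smooth_onD(4)[OF s\<Phi>] that by (simp add: pre_Int)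
  \<comment> \<open>In a chart the lift solves an overdetermined linear system: the differential of
    the coordinates sends \<open>a x\<close> to the components of \<open>X\<close>, and the
    transversal part vanishes. The system is injective because \<open>\<psi>\<close> is an immersion
    along \<open>E\<close>.\<close>
  define B where "B x v = (fder \<Phi> x v, v - proj v)" for x v
  have "smooth_on ?N a"
  proof (rule smooth_on_linear_solve[where B = B and c = "\<lambda>x. (fder \<Phi> x (a x), 0)"])
    show "open ?N" using N .
    have sN: "smooth_on ?N \<Phi>" using smooth_on_subset[OF s\<Phi> N] by (simp add: pre_Int)
    show "smooth_on ?N (\<lambda>x. B x b)" for b
      unfolding B_def by (intro smooth_on_Pair smooth_on_fder[OF sN] smooth_on_const[OF N])
    show linB: "linear (B x)" if x: "x \<in> ?N" for x
    proof -
      have "linear (fder \<Phi> x)" using linear_frechet_derivative[OF dP[OF x]] .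
      then show ?thesis unfolding B_def using linear_compose_sub[OF linear_id proj(1)]
        by (intro linearI) (auto simp: linear_add linear_scale proj(1) algebra_simps)
    qed
    have chain: "fder (\<lambda>y. g (\<psi>' y)) x v = fder (\<lambda>z. g (inv_into C \<phi> z)) (\<Phi> x) (fder \<Phi> x v)"
      if x: "x \<in> ?N" and g: "smooth_near A (\<psi>' x) g" for x v g
    proof -
      obtain W where W: "\<psi>' x \<in> W" "smooth_fun A W g" using g unfolding smooth_near_def by blast
      have xC: "\<psi>' x \<in> C" using x by (simp add: pre_def)
      have d: "(\<lambda>z. g (inv_into C \<phi> z)) differentiable at (\<Phi> x)"
        using smooth_onD(4)[OF smooth_funD(2)[OF W(2) c(1)], of "\<Phi> x"] W(1) xC by (simp add: \<Phi>_def)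
      have "fder (\<lambda>y. g (\<psi>' y)) x = fder (\<lambda>y. g (inv_into C \<phi> (\<Phi> y))) x"
        by (rule fder_cong[OF N x]) (use c(1) in \<open>simp add: \<Phi>_def pre_def\<close>)
      also have "\<dots> = (\<lambda>v. fder (\<lambda>z. g (inv_into C \<phi> z)) (\<Phi> x) (fder \<Phi> x v))"
        by (rule fder_eq[OF has_derivative_compose[OF fder_works[OF dP[OF x]] fder_works[OF d]]])
      finally show ?thesis by simp
    qed
    show "inj (B x)" if x: "x \<in> ?N" for x
      unfolding linear_injective_0[OF linB[OF x]]
    proof (intro allI impI)
      fix v assume "B x v = 0"
      then have v: "fder \<Phi> x v = 0" "proj v = v" by (simp_all add: B_def zero_prod_def)
      have "linear (fder \<Phi> x)" using linear_frechet_derivative[OF dP[OF x]] .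
      then have z: "fder \<Phi> x 0 = 0" by (rule linear_0)
      show "v = 0"
        by (rule psi'_inj[OF pre_G'[OF x] v(2) linear_0[OF proj(1)]]) (simp add: chain[OF x] v(1) z)
    qed
    have "smooth_on ?N (\<lambda>x. fder \<Phi> x (a x))"
    proof (rule smooth_on_componentwise[OF N])
      fix b :: 'e
      define g where "g q = complex_of_real (\<phi> q \<bullet> b)" for q
      have g: "smooth_fun A C g" unfolding g_def by (rule smooth_fun_coordinate[OF c(1)])
      have gU: "smooth_fun A (U \<inter> C) g" using smooth_fun_subset[OF g open_Int[OF U C]] by simp
      have "smooth_on ?N (\<lambda>x. Re (X (\<psi>' x) g))"
        by (rule smooth_on_linear[OF bounded_linear_Re smooth_pre[OF smooth_cfieldD(3)[OF X _ gU]]]) simp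
      moreover have "Re (X (\<psi>' x) g) = fder \<Phi> x (a x) \<bullet> b" if x: "x \<in> ?N" for x
      proof -
        have xU: "x \<in> pre U" using x by (simp add: pre_Int)
        have n: "smooth_near A (\<psi>' x) g" using smooth_nearI[OF g] x by (simp add: pre_def)
        have d: "(\<lambda>y. \<Phi> y \<bullet> b) differentiable at x" using dP[OF x] by simp
        have "X (\<psi>' x) g = fder (\<lambda>y. complex_of_real (\<Phi> y \<bullet> b)) x (a x)"
          using liftD(2)[OF a xU n] by (simp add: g_def \<Phi>_def)
        also have "\<dots> = complex_of_real (fder \<Phi> x (a x) \<bullet> b)"
          using fder_linear[OF bounded_linear_of_real d] fder_linear[OF bounded_linear_inner_left dP[OF x]] by simp
        finally show ?thesis by simp
      qed
      ultimately show "smooth_on ?N (\<lambda>x. fder \<Phi> x (a x) \<bullet> b)" by (rule smooth_on_cong) simp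
    qed
    then show "smooth_on ?N (\<lambda>x. (fder \<Phi> x (a x), 0::'e))"
      by (rule smooth_on_Pair[OF _ smooth_on_const[OF N]])
    show "B x (a x) = (fder \<Phi> x (a x), 0)" if x: "x \<in> ?N" for x
      using liftD(1)[OF a, of x] x by (simp add: B_def pre_Int)
  qed
  moreover have "x0 \<in> ?N" using x0 c(2) by (simp add: pre_def)
  ultimately show "\<exists>N. x0 \<in> N \<and> smooth_on N a" by blast
qed

lemma lift_second_order:
  assumes a: "lift U X a" and Y: "smooth_cfield A U Y" and b: "lift U Y b"
    and x: "x \<in> pre U" and g: "smooth_near A (\<psi>' x) g"
  shows "fder (\<lambda>y. fder (\<lambda>z. g (\<psi>' z)) y (b y)) x (a x) = X (\<psi>' x) (\<lambda>q. Y q g)"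
proof -
  obtain W where W: "\<psi>' x \<in> W" "smooth_fun A W g" using g unfolding smooth_near_def by blast
  have p: "\<psi>' x \<in> U" using x by (simp add: pre_def)
  have "fder (\<lambda>y. fder (\<lambda>z. g (\<psi>' z)) y (b y)) x = fder (\<lambda>y. Y (\<psi>' y) g) x"
  proof (rule fder_cong)
    show "open (pre (U \<inter> W))" using open_pre smooth_cfieldD(1)[OF Y] smooth_funD(1)[OF W(2)] by blast
    show "x \<in> pre (U \<inter> W)" using x W(1) by (simp add: pre_def)
    fix y assume "y \<in> pre (U \<inter> W)"
    then have "y \<in> pre U" "\<psi>' y \<in> W" by (auto simp: pre_def)
    then show "fder (\<lambda>z. g (\<psi>' z)) y (b y) = Y (\<psi>' y) g"
      using liftD(2)[OF b] smooth_nearI[OF W(2)] by blast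
  qed
  then show ?thesis using liftD(2)[OF a x smooth_near_field[OF Y p g]] by simp
qed

text \<open>Related fields have related brackets, and derivatives of fields with values in
  \<open>E\<close> again have values in \<open>E\<close>.\<close>

lemma lift_bracket:
  assumes X: "smooth_cfield A U X" and a: "lift U X a" and Y: "smooth_cfield A U Y" and b: "lift U Y b"
  shows "lift U (lie_bracket A X Y) (brk a b)"
proof (rule liftI)
  note sa = lift_smooth[OF X a] and sb = lift_smooth[OF Y b]
  have U: "open (pre U)" using open_pre smooth_cfieldD(1)[OF X] by blast
  fix x assume x: "x \<in> pre U"
  have pf: "proj (fder c x v) = fder c x v" if c: "smooth_on (pre U) c" and eq: "\<And>y. y \<in> pre U \<Longrightarrow> proj (c y) = c y" for c v
  proof -
    have "fder c x = fder (\<lambda>y. proj (c y)) x" by (rule fder_cong[OF U x]) (simp add: eq)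
    then show ?thesis using fder_linear[OF bounded_linear_proj smooth_onD(4)[OF c x], of v] by simp
  qed
  show "proj (brk a b x) = brk a b x"
    unfolding brk_def linear_diff[OF proj(1)] using pf[OF sa liftD(1)[OF a]] pf[OF sb liftD(1)[OF b]] by simp
  fix g assume g: "smooth_near A (\<psi>' x) g"
  obtain W where W: "\<psi>' x \<in> W" "smooth_fun A W g" using g unfolding smooth_near_def by blast
  have N: "open (pre (U \<inter> W))" "x \<in> pre (U \<inter> W)" "pre (U \<inter> W) \<subseteq> pre U" "pre (U \<inter> W) \<subseteq> pre W"
    using open_pre[OF open_Int[OF smooth_cfieldD(1)[OF X] smooth_funD(1)[OF W(2)]]] x W(1)
    by (auto simp: pre_Int) (simp add: pre_def)
  have "fder (\<lambda>y. g (\<psi>' y)) x (brk a b x) = fder (\<lambda>y. fder (\<lambda>y. g (\<psi>' y)) y (b y)) x (a x) - fder (\<lambda>y. fder (\<lambda>y. g (\<psi>' y)) y (a y)) x (b x)"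
    by (rule fder_brk[OF smooth_on_subset[OF smooth_pre[OF W(2)] N(1,4)] smooth_on_subset[OF sa N(1,3)] smooth_on_subset[OF sb N(1,3)] N(2)])
  then show "fder (\<lambda>y. g (\<psi>' y)) x (brk a b x) = lie_bracket A X Y (\<psi>' x) g"
    unfolding lift_second_order[OF a Y b x g] lift_second_order[OF b X a x g] by (simp add: lie_bracket_def g)
qed

text \<open>Members of the distribution take values in the fibres \<open>F\<close>, so each of them
  has a lift, and it is unique. Thus every rule of \<open>lie_distribution\<close> is matched by the
  corresponding rule of \<open>lie_fields\<close>, for whichever lift is given.\<close>

lemma lie_distribution_lift:
  assumes sub: "\<And>U X p. (U, X) \<in> lie_distribution A S \<Longrightarrow> p \<in> U \<Longrightarrow> X p \<in> F p"
    and gens: "\<And>U X. (U, X) \<in> S \<Longrightarrow> smooth_cfield A U X"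
    and lifts: "\<And>U X a. (U, X) \<in> S \<Longrightarrow> lift U X a \<Longrightarrow> (pre U, a) \<in> lie_fields \<G>"
    and UX: "(U, X) \<in> lie_distribution A S" and a: "lift U X a"
  shows "(pre U, a) \<in> lie_fields \<G>"
  using UX a
proof (induction arbitrary: a)
  case (gen U X)
  then show ?case using lifts by blast
next
  case (zero U)
  have l: "lift U (\<lambda>p. 0) (\<lambda>x. 0)"
    by (rule liftI) (use linear_0[OF proj(1)] in \<open>auto simp: fder_linear_arg fder_psi'(1) pre_G'\<close>)
  show ?case
    by (rule lie_fields_cong[OF open_pre[OF zero(1)] lie_fields.zero[OF open_pre[OF zero(1)]]])
      (rule lift_unique[OF zero(2) l], auto)
next
  case (add U X Y)
  obtain b where b: "lift U X b" using lift_exists sub[OF add(1)] by blast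
  obtain c where c: "lift U Y c" using lift_exists sub[OF add(2)] by blast
  have U: "open U" using smooth_cfieldD(1)[OF lie_distribution_smooth[OF gens add(1)]] by blast
  have l: "lift U (\<lambda>p. X p + Y p) (\<lambda>x. b x + c x)"
    by (rule liftI) (use b c in \<open>auto simp: linear_add[OF proj(1)] fder_linear_arg fder_psi'(1) pre_G' liftD\<close>)
  show ?case
    by (rule lie_fields_cong[OF open_pre[OF U] lie_fields.add[OF add.IH(1)[OF b] add.IH(2)[OF c]]])
      (rule lift_unique[OF add.prems l], auto)
next
  case (scale U X g)
  obtain b where b: "lift U X b" using lift_exists sub[OF scale(1)] by blast
  have U: "open U" using smooth_cfieldD(1)[OF lie_distribution_smooth[OF gens scale(1)]] by blast
  have l: "lift U (\<lambda>p. g p *\<^sub>R X p) (\<lambda>x. g (\<psi>' x) *\<^sub>R b x)"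
    by (rule liftI) (use b in \<open>auto simp: linear_scale[OF proj(1)] fder_linear_arg fder_psi'(1) pre_G' liftD scaleR_fun_def\<close>)
  show ?case
    by (rule lie_fields_cong[OF open_pre[OF U] lie_fields.scale[OF scale.IH[OF b] smooth_pre[OF scale(2)]]])
      (rule lift_unique[OF scale.prems l], auto)
next
  case (bracket U X Y)
  obtain b where b: "lift U X b" using lift_exists sub[OF bracket(1)] by blast
  obtain c where c: "lift U Y c" using lift_exists sub[OF bracket(2)] by blast
  have sX: "smooth_cfield A U X" using lie_distribution_smooth[OF gens bracket(1)] by blast
  have sY: "smooth_cfield A U Y" using lie_distribution_smooth[OF gens bracket(2)] by blast
  show ?case
    by (rule lie_fields_cong[OF open_pre[OF smooth_cfieldD(1)[OF sX]] lie_fields.bracket[OF bracket.IH(1)[OF b] bracket.IH(2)[OF c]]])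
      (rule lift_unique[OF bracket.prems lift_bracket[OF sX b sY c]], auto)
next
  case (local U X)
  show ?case
  proof (rule lie_fields.local[OF open_pre[OF local(1)]])
    fix x assume x: "x \<in> pre U"
    then have "\<psi>' x \<in> U" by (simp add: pre_def)
    then obtain V X' where V: "\<psi>' x \<in> V" "(V, X') \<in> lie_distribution A S"
        "\<And>a. lift V X' a \<Longrightarrow> (pre V, a) \<in> lie_fields \<G>" "\<forall>q\<in>U \<inter> V. X q = X' q"
      using local(2) by blast
    obtain b where b: "lift V X' b" using lift_exists sub[OF V(2)] by blast
    have "a y = b y" if "y \<in> pre U \<inter> pre V" for y
      by (rule lift_unique[OF local.prems b]) (use that V(4) in \<open>auto simp: pre_def\<close>)
    moreover have "x \<in> pre V" using x V(1) by (simp add: pre_def)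
    ultimately show "\<exists>W X'. x \<in> W \<and> (W, X') \<in> lie_fields \<G> \<and> (\<forall>y\<in>pre U \<inter> W. a y = X' y)"
      using V(3)[OF b] by blast
  qed
qed

end

section \<open>Propagation along leaves\<close>

context smooth_manifold begin

lemma CR_sections_smooth: "Z \<in> CR_sections A T V \<Longrightarrow> smooth_cfield A V Z"
  by (simp add: CR_sections_def)

text \<open>\<open>CR_functions\<close> tests sections over subsets of \<open>\<Omega>\<close>; a
  section over another open set is first restricted to the intersection.\<close>

lemma CR_functionsD:
  assumes f: "f \<in> CR_functions A T \<Omega>" and Z: "Z \<in> CR_sections A T V" and p: "p \<in> V" "p \<in> \<Omega>"
  shows "Z p f = 0"
proof -
  have \<Omega>: "open \<Omega>" using f smooth_funD(1) unfolding CR_functions_def by blast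
  have "open (V \<inter> \<Omega>)" using \<Omega> smooth_cfieldD(1)[OF CR_sections_smooth[OF Z]] by (rule open_Int[rotated])
  then have "Z \<in> CR_sections A T (V \<inter> \<Omega>)"
    using smooth_cfield_subset[OF CR_sections_smooth[OF Z]] Z unfolding CR_sections_def by simp
  then have "\<forall>p\<in>V \<inter> \<Omega>. Z p f = 0" using f unfolding CR_functions_def by blast
  then show ?thesis using p by blast
qed

lemma CR_functions_smooth: "f \<in> CR_functions A T \<Omega> \<Longrightarrow> smooth_fun A \<Omega> f"
  by (simp add: CR_functions_def)

lemma CR_functions_scale:
  assumes f: "f \<in> CR_functions A T \<Omega>"
  shows "(\<lambda>p. c * f p) \<in> CR_functions A T \<Omega>"
proof -
  have "Z p (\<lambda>p. c * f p) = 0" if "U \<subseteq> \<Omega>" "Z \<in> CR_sections A T U" "p \<in> U" for U Z p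
  proof -
    have "p \<in> \<Omega>" using that by blast
    then show ?thesis
      using ctangentD(3)[OF smooth_cfieldD(2)[OF CR_sections_smooth[OF that(2)] that(3)] smooth_nearI[OF CR_functions_smooth[OF f]]]
        CR_functionsD[OF f that(2,3)] by simp
  qed
  then show ?thesis using smooth_fun_cmult[OF CR_functions_smooth[OF f]] unfolding CR_functions_def by simp
qed

end

section \<open>The maximum set in a parametrisation of the leaf\<close>

context leaf_chart begin

context
  fixes T :: "'m \<Rightarrow> 'm cvec set" and \<Omega> f
  assumes f: "f \<in> CR_functions A T \<Omega>" and \<Omega>: "\<psi> ` (G \<inter> E) \<subseteq> \<Omega>"
begin

lemma psi'_\<Omega>: "x \<in> G' \<Longrightarrow> \<psi>' x \<in> \<Omega>"
  using proj_G' \<Omega> by (auto simp: \<psi>'_def)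

lemma f_near: "x \<in> G' \<Longrightarrow> smooth_near A (\<psi>' x) f"
  using smooth_nearI[OF CR_functions_smooth[OF f]] psi'_\<Omega> .

lemma pre_\<Omega>: "pre \<Omega> = G'"
  using psi'_\<Omega> by (auto simp: pre_def)

lemma smooth_f': "smooth_on G' (\<lambda>x. f (\<psi>' x))"
  using smooth_pre[OF CR_functions_smooth[OF f]] by (simp add: pre_\<Omega>)

lemma cr_system_lift:
  assumes Z: "\<And>j. j < r \<Longrightarrow> Z j \<in> CR_sections A T V" and L0: "L0 \<in> CR_sections A T V"
    and levi: "\<And>q. q \<in> V \<Longrightarrow> (\<Sum>j<r. lie_bracket A (Z j) (\<lambda>x. conj_vec (Z j x)) q) = conj_vec (L0 q) - L0 q"
    and X: "\<And>j. j < r \<Longrightarrow> lift V (\<lambda>q. Re_vec (Z j q)) (X j)"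
    and Y: "\<And>j. j < r \<Longrightarrow> lift V (\<lambda>q. Im_vec (Z j q)) (Y j)"
    and X0: "lift V (\<lambda>q. Re_vec (L0 q)) X0"
  shows "cr_system (\<lambda>x. f (\<psi>' x)) G' (pre V) r X Y X0"
  unfolding cr_system_def
proof (intro conjI allI impI ballI)
  have sL: "smooth_cfield A V L0" using CR_sections_smooth[OF L0] .
  have sZ: "smooth_cfield A V (Z j)" if "j < r" for j using CR_sections_smooth[OF Z[OF that]] .
  have V: "open V" using smooth_cfieldD(1)[OF sL] .
  show "open (pre V)" using open_pre[OF V] .
  show "pre V \<subseteq> G'" using pre_G' by blast
  show "smooth_on (pre V) (X j)" "smooth_on (pre V) (Y j)" if "j < r" for j
    using lift_smooth[OF smooth_cfield_Re[OF sZ[OF that]] X[OF that]]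
      lift_smooth[OF smooth_cfield_Im[OF sZ[OF that]] Y[OF that]] .
  show "smooth_on (pre V) X0" using lift_smooth[OF smooth_cfield_Re[OF sL] X0] .
  fix x assume x: "x \<in> pre V"
  note n = f_near[OF pre_G'[OF x]]
  have p: "\<psi>' x \<in> V" "\<psi>' x \<in> \<Omega>" using x psi'_\<Omega> by (auto simp: pre_def)
  show "fder (\<lambda>x. f (\<psi>' x)) x (X j x) + \<i> * fder (\<lambda>x. f (\<psi>' x)) x (Y j x) = 0" if j: "j < r" for j
  proof -
    have "Re_vec (Z j (\<psi>' x)) f + \<i> * Im_vec (Z j (\<psi>' x)) f = Z j (\<psi>' x) f"
      by (simp add: Re_vec_def Im_vec_def scaleC_fun_def field_simps)
    then show ?thesis
      using CR_functionsD[OF f Z[OF j] p] liftD(2)[OF X[OF j] x n] liftD(2)[OF Y[OF j] x n] by simp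
  qed
  have \<Omega>o: "open \<Omega>" using smooth_funD(1)[OF CR_functions_smooth[OF f]] .
  have "(\<Sum>j<r. Re_vec (Z j (\<psi>' x)) (\<lambda>q. Re_vec (Z j q) f) + Im_vec (Z j (\<psi>' x)) (\<lambda>q. Im_vec (Z j q) f)) = Re_vec (L0 (\<psi>' x)) f"
  proof (rule cr_second_order[where V = "V \<inter> \<Omega>"])
    show "smooth_cfield A (V \<inter> \<Omega>) (Z j)" if "j < r" for j
      using smooth_cfield_subset[OF sZ[OF that] open_Int[OF V \<Omega>o]] by simp
    show "\<psi>' x \<in> V \<inter> \<Omega>" using p by simp
    show "smooth_fun A (V \<inter> \<Omega>) f"
      using smooth_fun_subset[OF CR_functions_smooth[OF f] open_Int[OF V \<Omega>o]] by simp
    show "Z j q f = 0" if "j < r" "q \<in> V \<inter> \<Omega>" for j q using CR_functionsD[OF f Z[OF that(1)]] that(2) by simp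
    show "L0 (\<psi>' x) f = 0" using CR_functionsD[OF f L0 p] .
  qed (rule levi[OF p(1)])
  moreover have "fder (\<lambda>y. fder (\<lambda>x. f (\<psi>' x)) y (X j y)) x (X j x) = Re_vec (Z j (\<psi>' x)) (\<lambda>q. Re_vec (Z j q) f)"
    "fder (\<lambda>y. fder (\<lambda>x. f (\<psi>' x)) y (Y j y)) x (Y j x) = Im_vec (Z j (\<psi>' x)) (\<lambda>q. Im_vec (Z j q) f)" if "j < r" for j
    using lift_second_order[OF X[OF that] smooth_cfield_Re[OF sZ[OF that]] X[OF that] x n]
      lift_second_order[OF Y[OF that] smooth_cfield_Im[OF sZ[OF that]] Y[OF that] x n] .
  ultimately show "(\<Sum>j<r. fder (\<lambda>y. fder (\<lambda>x. f (\<psi>' x)) y (X j y)) x (X j x) + fder (\<lambda>y. fder (\<lambda>x. f (\<psi>' x)) y (Y j y)) x (Y j x))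
      = fder (\<lambda>x. f (\<psi>' x)) x (X0 x)"
    using liftD(2)[OF X0 x n] by simp
qed

lemma V2_lift:
  assumes F: "F = fibre (V2 A T)" and UX: "(U, X) \<in> V2 A T" and a: "lift U X a"
  shows "(pre U, a) \<in> lie_fields (cr_generators (\<lambda>x. f (\<psi>' x)) G')" "open U"
proof -
  let ?\<G> = "cr_generators (\<lambda>x. f (\<psi>' x)) G'"
  \<comment> \<open>\<open>V2\<close> is generated in two stages, the inner one for a single
    \<open>\<tau>\<close>. Naming the inner generators allows \<open>lie_distribution_lift\<close>
    to be applied once for each stage.\<close>
  define gens where "gens U \<tau> = {(V, Y). \<exists>r Z L0.
     V \<subseteq> U \<and> represents A T V r Z \<tau> \<and> L0 \<in> CR_sections A T V \<and>
     (\<forall>q\<in>V. (\<Sum>j<r. lie_bracket A (Z j) (\<lambda>x. conj_vec (Z j x)) q) = conj_vec (L0 q) - L0 q) \<and>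
     ((\<exists>j<r. Y = (\<lambda>q. Re_vec (Z j q))) \<or> (\<exists>j<r. Y = (\<lambda>q. Im_vec (Z j q))) \<or>
      Y = (\<lambda>q. Re_vec (L0 q)))}" for U \<tau>
  have V2_of: "V2_of A T U \<tau> = lie_distribution A (gens U \<tau>)" for U \<tau>
    unfolding V2_of_def gens_def ..
  have memF: "X p \<in> F p" if "(U, X) \<in> V2 A T" "p \<in> U" for U X p
    using that unfolding F fibre_def by blast
  have gensV2: "(V, Y) \<in> V2 A T" if "\<tau> \<in> ker_levi_sections A T U" "(V, Y) \<in> V2_of A T U \<tau>" for U \<tau> V Y
    using that unfolding V2_def by (blast intro: lie_distribution.gen)
  have gens_smooth: "smooth_cfield A V Y" if g: "(V, Y) \<in> gens U \<tau>" for U \<tau> V Y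
  proof -
    obtain r Z L0 where rep: "represents A T V r Z \<tau>" and L0: "L0 \<in> CR_sections A T V"
      and Y: "(\<exists>j<r. Y = (\<lambda>q. Re_vec (Z j q))) \<or> (\<exists>j<r. Y = (\<lambda>q. Im_vec (Z j q))) \<or> Y = (\<lambda>q. Re_vec (L0 q))"
      using g unfolding gens_def by blast
    have Z: "\<And>j. j < r \<Longrightarrow> Z j \<in> CR_sections A T V" "L0 \<in> CR_sections A T V"
      using rep L0 unfolding represents_def by blast+
    show ?thesis
      using Y smooth_cfield_Re[OF CR_sections_smooth[OF Z(1)]] smooth_cfield_Im[OF CR_sections_smooth[OF Z(1)]]
        smooth_cfield_Re[OF CR_sections_smooth[OF Z(2)]] by blast
  qed
  have gens_lift: "(pre V, a) \<in> lie_fields ?\<G>"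
    if \<tau>: "\<tau> \<in> ker_levi_sections A T U" and g: "(V, Y) \<in> gens U \<tau>" and a: "lift V Y a" for U \<tau> V Y a
  proof -
    obtain r Z L0 where VU: "V \<subseteq> U" and rep: "represents A T V r Z \<tau>" and L0: "L0 \<in> CR_sections A T V"
      and levi: "\<forall>q\<in>V. (\<Sum>j<r. lie_bracket A (Z j) (\<lambda>x. conj_vec (Z j x)) q) = conj_vec (L0 q) - L0 q"
      and Y: "(\<exists>j<r. Y = (\<lambda>q. Re_vec (Z j q))) \<or> (\<exists>j<r. Y = (\<lambda>q. Im_vec (Z j q))) \<or> Y = (\<lambda>q. Re_vec (L0 q))"
      using g unfolding gens_def by blast
    have Z: "\<And>j. j < r \<Longrightarrow> Z j \<in> CR_sections A T V" using rep unfolding represents_def by blast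
    have V: "open (pre V)" using open_pre[OF smooth_cfieldD(1)[OF CR_sections_smooth[OF L0]]] .
    \<comment> \<open>The generators belong to \<open>V2\<close>, so their values lie in the fibres
      and they can be lifted; all of them are needed at once to form a
      \<open>cr_system\<close>.\<close>
    have memgen: "(V, W) \<in> V2 A T"
      if "(\<exists>j<r. W = (\<lambda>q. Re_vec (Z j q))) \<or> (\<exists>j<r. W = (\<lambda>q. Im_vec (Z j q))) \<or> W = (\<lambda>q. Re_vec (L0 q))" for W
    proof (rule gensV2[OF \<tau>])
      have "(V, W) \<in> gens U \<tau>"
        unfolding gens_def mem_Collect_eq prod.case
        by (rule exI[of _ r], rule exI[of _ Z], rule exI[of _ L0]) (intro conjI VU rep L0 levi that)
      then show "(V, W) \<in> V2_of A T U \<tau>" unfolding V2_of by (rule lie_distribution.gen)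
    qed
    have "\<exists>b. lift V (\<lambda>q. Re_vec (Z j q)) b" if "j < r" for j
    proof -
      have "(V, \<lambda>q. Re_vec (Z j q)) \<in> V2 A T" by (rule memgen) (use that in blast)
      from memF[OF this] show ?thesis by (rule lift_exists) blast+
    qed
    then obtain X1 where X1: "\<And>j. j < r \<Longrightarrow> lift V (\<lambda>q. Re_vec (Z j q)) (X1 j)" by metis
    have "\<exists>b. lift V (\<lambda>q. Im_vec (Z j q)) b" if "j < r" for j
    proof -
      have "(V, \<lambda>q. Im_vec (Z j q)) \<in> V2 A T" by (rule memgen) (use that in blast)
      from memF[OF this] show ?thesis by (rule lift_exists) blast+
    qed
    then obtain Y1 where Y1: "\<And>j. j < r \<Longrightarrow> lift V (\<lambda>q. Im_vec (Z j q)) (Y1 j)" by metis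
    have "(V, \<lambda>q. Re_vec (L0 q)) \<in> V2 A T" by (rule memgen) blast
    from memF[OF this] obtain X0 where X0: "lift V (\<lambda>q. Re_vec (L0 q)) X0" by (rule lift_exists) blast+
    have sys: "cr_system (\<lambda>x. f (\<psi>' x)) G' (pre V) r X1 Y1 X0"
      by (rule cr_system_lift[OF Z L0 _ X1 Y1 X0]) (use levi in blast)+
    have mem: "(pre V, W) \<in> lie_fields ?\<G>" if "(\<exists>j<r. W = X1 j) \<or> (\<exists>j<r. W = Y1 j) \<or> W = (\<lambda>x. - X0 x)" for W
    proof (rule lie_fields.gen)
      show "(pre V, W) \<in> ?\<G>" unfolding cr_generators_def mem_Collect_eq prod.case
        by (rule exI[of _ r], rule exI[of _ X1], rule exI[of _ Y1], rule exI[of _ X0]) (intro conjI sys that)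
    qed
    have un: "(pre V, a) \<in> lie_fields ?\<G>" if b: "lift V Y b" "(pre V, b) \<in> lie_fields ?\<G>" for b
      by (rule lie_fields_cong[OF V b(2)]) (rule lift_unique[OF a b(1)], auto)
    from Y show ?thesis
    proof (elim disjE exE conjE)
      fix j assume j: "j < r" "Y = (\<lambda>q. Re_vec (Z j q))"
      show ?thesis by (rule un[of "X1 j"]) (use X1 j mem in blast)+
    next
      fix j assume j: "j < r" "Y = (\<lambda>q. Im_vec (Z j q))"
      show ?thesis by (rule un[of "Y1 j"]) (use Y1 j mem in blast)+
    next
      assume Y: "Y = (\<lambda>q. Re_vec (L0 q))"
      have "(pre V, \<lambda>x. - X0 x) \<in> lie_fields ?\<G>" by (rule mem) blast
      \<comment> \<open>The generators contain only \<open>- X0\<close>; the module structure gives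
        back \<open>X0\<close>.\<close>
      from lie_fields.scale[OF this smooth_on_const[OF V, of "-1"]]
      have "(pre V, X0) \<in> lie_fields ?\<G>" by simp
      then show ?thesis using un X0 Y by blast
    qed
  qed
  let ?S = "\<Union>U. \<Union>\<tau>\<in>ker_levi_sections A T U. V2_of A T U \<tau>"
  have inner: "smooth_cfield A V Y" "lift V Y a \<Longrightarrow> (pre V, a) \<in> lie_fields ?\<G>" if VY: "(V, Y) \<in> ?S" for V Y a
  proof -
    obtain U \<tau> where \<tau>: "\<tau> \<in> ker_levi_sections A T U" and Y: "(V, Y) \<in> lie_distribution A (gens U \<tau>)"
      using VY unfolding V2_of by blast
    show "smooth_cfield A V Y" by (rule lie_distribution_smooth[OF gens_smooth Y])
    show "(pre V, a) \<in> lie_fields ?\<G>" if "lift V Y a"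
    proof (rule lie_distribution_lift[OF _ gens_smooth gens_lift[OF \<tau>] Y that])
      show "X p \<in> F p" if "(U', X) \<in> lie_distribution A (gens U \<tau>)" "p \<in> U'" for U' X p
        using memF[OF gensV2[OF \<tau>] that(2)] that(1) unfolding V2_of by blast
    qed
  qed
  have UX': "(U, X) \<in> lie_distribution A ?S" using UX unfolding V2_def .
  show "open U" using smooth_cfieldD(1)[OF lie_distribution_smooth[OF inner(1) UX']] .
  show "(pre U, a) \<in> lie_fields ?\<G>"
    by (rule lie_distribution_lift[OF _ inner(1) inner(2) UX' a]) (use memF in \<open>unfold V2_def, blast\<close>)
qed

lemma leaf_chart_maximum_set_open:
  assumes F: "F = fibre (V2 A T)" and f1: "\<And>p. p \<in> \<Omega> \<Longrightarrow> cmod (f p) \<le> 1"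
  shows "open {x \<in> G'. f (\<psi>' x) = 1}"
proof (rule maximum_set_open[OF smooth_f'])
  show "cmod (f (\<psi>' x)) \<le> 1" if "x \<in> G'" for x using f1[OF psi'_\<Omega>[OF that]] .
  let ?\<G> = "cr_generators (\<lambda>x. f (\<psi>' x)) G'"
  fix x v assume x: "x \<in> G'"
  have "pushforward A \<psi> (proj x) (proj v) \<in> fibre (V2 A T) (\<psi>' x)"
    using psi_range[OF proj_G'[OF x]] proj(2)[of v] F by (auto simp: \<psi>'_def)
  then obtain U X where U: "(U, X) \<in> V2 A T" "\<psi>' x \<in> U" and X: "X (\<psi>' x) = pushforward A \<psi> (proj x) (proj v)"
    unfolding fibre_def by fastforce
  have "X p \<in> F p" if "p \<in> U" for p using U(1) that unfolding F fibre_def by blast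
  then obtain a where a: "lift U X a" by (rule lift_exists)
  note aG = V2_lift[OF F U(1) a]
  have xU: "x \<in> pre U" using x U(2) by (simp add: pre_def)
  have ax: "a x = proj v"
    by (rule psi'_inj[OF x liftD(1)[OF a xU]]) (simp_all add: liftD(2)[OF a xU] X fder_psi'(2)[OF x, of _ "proj v"])
  \<comment> \<open>The lifted fields only reach directions in \<open>E\<close>. The lifted function
    is constant along the transversal part \<open>w\<close>, so the constant field \<open>w\<close>
    with zero fields in the other places is a \<open>cr_system\<close> with \<open>r = 1\<close> and
    counts as a generator.\<close>
  define w where "w = v - proj v"
  have w: "proj w = 0" by (simp add: w_def linear_diff[OF proj(1)])
  have kill: "fder (\<lambda>x. f (\<psi>' x)) y w = 0" if y: "y \<in> G'" for y
    using fder_psi'(2)[OF y f_near[OF y], of w] fder_psi'(2)[OF y f_near[OF y], of 0]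
      fder_linear_arg(5)[OF fder_psi'(1)[OF y f_near[OF y]]] by (simp add: w linear_0[OF proj(1)])
  have oU: "open (pre U)" by (rule open_pre[OF aG(2)])
  have "cr_system (\<lambda>x. f (\<psi>' x)) G' (pre U) 1 (\<lambda>_ _. w) (\<lambda>_ _. 0) (\<lambda>_. 0)"
    unfolding cr_system_def
  proof (intro conjI allI impI ballI)
    fix y assume y: "y \<in> pre U"
    have z: "fder (\<lambda>x. f (\<psi>' x)) y 0 = 0"
      using fder_linear_arg(5)[OF fder_psi'(1)[OF pre_G'[OF y] f_near[OF pre_G'[OF y]]]] by simp
    then show "fder (\<lambda>x. f (\<psi>' x)) y w + \<i> * fder (\<lambda>x. f (\<psi>' x)) y 0 = 0"
      using kill[OF pre_G'[OF y]] by simp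
    have "fder (\<lambda>z. fder (\<lambda>x. f (\<psi>' x)) z w) y = fder (\<lambda>z. 0) y"
      by (rule fder_cong[OF oU y]) (rule kill[OF pre_G'])
    moreover have "fder (\<lambda>z. fder (\<lambda>x. f (\<psi>' x)) z 0) y = fder (\<lambda>z. 0) y"
      by (rule fder_cong[OF oU y])
        (use fder_linear_arg(5)[OF fder_psi'(1)[OF _ f_near]] pre_G' in blast)
    ultimately show "(\<Sum>j<1. fder (\<lambda>z. fder (\<lambda>x. f (\<psi>' x)) z w) y w + fder (\<lambda>z. fder (\<lambda>x. f (\<psi>' x)) z 0) y 0)
        = fder (\<lambda>x. f (\<psi>' x)) y 0" using z by (simp add: frechet_derivative_const)
  qed (use oU pre_G' in \<open>auto intro: smooth_on_const\<close>)
  then have "(pre U, \<lambda>_. w) \<in> lie_fields ?\<G>"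
    unfolding cr_generators_def
    by (intro lie_fields.gen CollectI case_prodI exI conjI) (assumption, rule disjI1, auto)
  from lie_fields.add[OF aG(1) this]
  show "\<exists>V b. (V, b) \<in> lie_fields ?\<G> \<and> x \<in> V \<and> b x = v"
    using xU ax by (intro exI[of _ "pre U"] exI[of _ "\<lambda>x. a x + w"]) (simp add: w_def)
qed

text \<open>The parameter domain \<open>G \<inter> E\<close> carries the topology of the leaf, so
  open sets of the model space are intersected with \<open>E\<close>, on which
  \<open>\<psi>'\<close> agrees with \<open>\<psi>\<close>.\<close>

lemma leaf_chart_openin:
  assumes F: "F = fibre (V2 A T)" and f1: "\<And>p. p \<in> \<Omega> \<Longrightarrow> cmod (f p) \<le> 1"
  shows "openin (top_of_set (G \<inter> E)) {x \<in> G \<inter> E. f (\<psi> x) = 1}"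
    "openin (top_of_set (G \<inter> E)) {x \<in> G \<inter> E. f (\<psi> x) \<noteq> 1}"
proof -
  have eq: "x \<in> G \<inter> E \<Longrightarrow> x \<in> G' \<and> \<psi>' x = \<psi> x" for x by (auto simp: G'_def \<psi>'_def proj)
  have "{x \<in> G \<inter> E. f (\<psi> x) = 1} = (G \<inter> E) \<inter> {x \<in> G'. f (\<psi>' x) = 1}" using eq by auto
  then show "openin (top_of_set (G \<inter> E)) {x \<in> G \<inter> E. f (\<psi> x) = 1}"
    using openin_open_Int[OF leaf_chart_maximum_set_open[OF F f1]] by simp
  have "open (G' \<inter> (\<lambda>x. f (\<psi>' x)) -` (- {1}))"
    by (rule continuous_open_preimage[OF smooth_onD(3)[OF smooth_f'] smooth_onD(1)[OF smooth_f']]) (simp add: open_Compl)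
  moreover have "{x \<in> G \<inter> E. f (\<psi> x) \<noteq> 1} = (G \<inter> E) \<inter> (G' \<inter> (\<lambda>x. f (\<psi>' x)) -` (- {1}))" using eq by auto
  ultimately show "openin (top_of_set (G \<inter> E)) {x \<in> G \<inter> E. f (\<psi> x) \<noteq> 1}"
    using openin_open_Int by simp
qed

end

end

context smooth_manifold begin

text \<open>Openness and connectedness refer to the topology of the leaf itself, in general finer
  than the one induced by the manifold; the parametrisations transport relatively open sets into
  it.\<close>

theorem maximum_propagates:
  assumes f: "f \<in> CR_functions A T \<Omega>" and f1: "\<And>p. p \<in> \<Omega> \<Longrightarrow> cmod (f p) \<le> 1"
    and L: "connected_integral_manifold A (V2 A T) L" "L \<subseteq> \<Omega>" and p0: "p0 \<in> L" "f p0 = 1" and p: "p \<in> L"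
  shows "f p = 1"
proof -
  obtain \<T> where T: "topspace \<T> = L" "connected_space \<T>"
    and ch: "\<forall>p\<in>L. \<exists>E G \<psi>. subspace E \<and> smooth_map_into A G \<psi> \<and> p \<in> \<psi> ` (G \<inter> E) \<and>
        openin \<T> (\<psi> ` (G \<inter> E)) \<and>
        homeomorphic_map (top_of_set (G \<inter> E)) (subtopology \<T> (\<psi> ` (G \<inter> E))) \<psi> \<and>
        (\<forall>x\<in>G \<inter> E. inj_on (pushforward A \<psi> x) E \<and>
           pushforward A \<psi> x ` E = fibre (V2 A T) (\<psi> x))"
    using L(1) unfolding connected_integral_manifold_def by auto
  \<comment> \<open>Stated for a general predicate, because the set where f = 1 and its complement
    are both to be shown open in the leaf.\<close>
  have key: "openin \<T> {q \<in> L. P (f q)}"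
    if hP: "\<And>E G \<psi>. leaf_chart A E G \<psi> (fibre (V2 A T)) \<Longrightarrow> \<psi> ` (G \<inter> E) \<subseteq> \<Omega> \<Longrightarrow>
      openin (top_of_set (G \<inter> E)) {x \<in> G \<inter> E. P (f (\<psi> x))}" for P
  proof (subst openin_subopen, intro ballI)
    fix q assume q: "q \<in> {q \<in> L. P (f q)}"
    then obtain E G \<psi> where E: "subspace E" and psi: "smooth_map_into A G \<psi>" and qi: "q \<in> \<psi> ` (G \<inter> E)"
      and op: "openin \<T> (\<psi> ` (G \<inter> E))"
      and hom: "homeomorphic_map (top_of_set (G \<inter> E)) (subtopology \<T> (\<psi> ` (G \<inter> E))) \<psi>"
      and imm: "\<forall>x\<in>G \<inter> E. inj_on (pushforward A \<psi> x) E \<and> pushforward A \<psi> x ` E = fibre (V2 A T) (\<psi> x)"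
      using ch by (elim CollectE conjE) (drule (1) bspec, elim exE conjE, blast)
    have lc: "leaf_chart A E G \<psi> (fibre (V2 A T))"
      by unfold_locales (use E psi imm in auto)
    have sub: "\<psi> ` (G \<inter> E) \<subseteq> L" using openin_subset[OF op] T(1) by simp
    let ?N = "\<psi> ` {x \<in> G \<inter> E. P (f (\<psi> x))}"
    have "openin (subtopology \<T> (\<psi> ` (G \<inter> E))) ?N"
      using homeomorphic_imp_open_map[OF hom] hP[OF lc order_trans[OF sub L(2)]] unfolding open_map_def by blast
    then have "openin \<T> ?N" using op by (rule openin_trans_full)
    moreover have "q \<in> ?N" "?N \<subseteq> {q \<in> L. P (f q)}" using q qi sub by auto
    ultimately show "\<exists>N. openin \<T> N \<and> q \<in> N \<and> N \<subseteq> {q \<in> L. P (f q)}" by blast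
  qed
  have o: "openin \<T> {q \<in> L. f q = 1}" "openin \<T> {q \<in> L. f q \<noteq> 1}"
    by (rule key, rule leaf_chart.leaf_chart_openin[OF _ f _ refl f1]; assumption)+
  have "topspace \<T> - {q \<in> L. f q = 1} = {q \<in> L. f q \<noteq> 1}" using T(1) by auto
  then have "closedin \<T> {q \<in> L. f q = 1}" using o unfolding closedin_def by (auto simp: T(1))
  then have "{q \<in> L. f q = 1} = {} \<or> {q \<in> L. f q = 1} = L"
    using T o(1) connected_space_clopen_in by blast
  then show ?thesis using p0 p by blast
qed

end

theorem theorem3p7:
  fixes A :: "('m::{t2_space, second_countable_topology}, 'e::euclidean_space) chart set"
    and n :: nat
    and T :: "'m \<Rightarrow> 'm cvec set"
    and \<Omega> :: "'m set"
    and f :: "'m \<Rightarrow> complex"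
    and p0 :: 'm
    and L :: "'m set"
  assumes "almost_CR_manifold A n T"
    and "open \<Omega>"
    and "constant_rank_on (V2 A T) \<Omega>"
    and "f \<in> CR_functions A T \<Omega>"
    and "p0 \<in> \<Omega>"
    and "\<forall>p\<in>\<Omega>. cmod (f p) \<le> cmod (f p0)"
    and "is_leaf A (V2 A T) \<Omega> p0 L"
  shows "f constant_on L"
proof -
  interpret smooth_manifold A
    by unfold_locales (use assms(1) in \<open>simp add: almost_CR_manifold_def\<close>)
  have L: "connected_integral_manifold A (V2 A T) L" "L \<subseteq> \<Omega>" "p0 \<in> L"
    using assms(7) unfolding is_leaf_def by blast+
  have "f p = f p0" if p: "p \<in> L" for p
  proof (cases "f p0 = 0")
    case True
    then show ?thesis using assms(6) L(2) p by fastforce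
  next
    case False
    \<comment> \<open>Dividing by the value at \<open>p0\<close> gives modulus at most 1 and the
      value 1 at \<open>p0\<close>. The quotient is again a CR function since the equations are
      complex linear.\<close>
    have "(1 / f p0) * f p = 1"
    proof (rule maximum_propagates[OF CR_functions_scale[OF assms(4)] _ L _ p])
      show "cmod (1 / f p0 * f q) \<le> 1" if "q \<in> \<Omega>" for q
        using assms(6) that False by (simp add: norm_mult norm_divide divide_simps)
      show "1 / f p0 * f p0 = 1" using False by simp
    qed
    then show ?thesis using False by (simp add: field_simps)
  qed
  then show ?thesis unfolding constant_on_def by blast
qed

end
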